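(* Let $\sigma>0$ be known and $\alpha\in(0,1)$. Let $\hat f_n$ be the estimate obtained from the monotone modulator: $\hat\xi=(\hat\xi_\phi,\hat\xi_{J_0},\dots,\hat\xi_{J_1})$ minimizes $\tilde S_n(\xi)$ subject to $1\ge\xi_\phi\ge\xi_{J_0}\ge\xi_{J_0+1}\ge\dots\ge\xi_{J_1}$, and the coefficients $\hat\mu_1,\dots,\hat\mu_n$ of $\hat f_n$ are $\hat\alpha_k=\hat\xi_\phi\tilde\alpha_k$ and $\hat\beta_{j,k}=\hat\xi_j\tilde\beta_{j,k}$. Let $$s_n^2=\hat\tau\frac{z_\alpha}{\sqrt n}+\tilde S_n(\hat\xi),$$ where $$\hat\tau^2=\frac{2\sigma^4}{n}\sum_{\ell=1}^n(2\hat\xi_\ell-1)^2+4\sigma^2\sum_{\ell=1}^n\Big(\tilde\mu_\ell^2-\frac{\sigma^2}{n}\Big)^2(1-\hat\xi_\ell)^2,$$ and $\hat\xi_\ell$ is the estimated shrinkage coefficient associated with $\mu_\ell$ (that is, $\hat\xi_\phi$ or the relevant $\hat\xi_j$). Let $$\mathcal D_n=\Big\{\mu^n:\sum_{\ell=1}^n(\mu_\ell-\hat\mu_\ell)^2\le s_n^2\Big\},\qquad \mathcal A_n=\Big\{\sum_{\ell=1}^n\mu_\ell\phi_\ell:\mu^n\in\mathcal D_n\Big\}.$$ Then, for any Besov body $\mathcal B$ with $\gamma>1/2$ and radius $c>0$, (i) $\displaystyle\lim_{n\to\infty}\sup_{\mu^n\in\mathcal B^n}\big|\mathsf P\{\mu^n\in\mathcal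 D_n\}-(1-\alpha)\big|=0$; (ii) $\displaystyle\lim_{n\to\infty}\sup_{\mu^n\in\mathcal B^n}\big|\mathsf P\{f_n\in\mathcal A_n\}-(1-\alpha)\big|=0$, where $f_n=\sum_{\ell=1}^n\mu_\ell\phi_\ell$; and (iii) for fixed $\eta,c>0$ and $\delta>0$, the set $\mathcal C_n=\{f\in\mathcal F_{\eta,c}:\inf_{g\in\mathcal A_n}\|f-g\|_2\le\delta/\sqrt n\}$ satisfies $$\liminf_{n\to\infty}\inf_{f\in\mathcal F_{\eta,c}}\mathsf P\{f\in\mathcal C_n\}\ge1-\alpha.$$
   Context: Wavelets. $\phi$ and $\psi$ are a father and mother wavelet generating the complete orthonormal set $\phi_{J_0,k}(x)=2^{J_0/2}\phi(2^{J_0}x-k)$, $0\le k<2^{J_0}$, and $\psi_{j,k}(x)=2^{j/2}\psi(2^jx-k)$, $j\ge J_0$, $0\le k<2^j$, of $L^2[0,1]$, with $J_0$ fixed. They are bounded, have compact support and have derivatives with finite $L^2$ norms. For $f\in L^2[0,1]$, $\alpha_k=\int f\phi_{J_0,k}$ and $\beta_{j,k}=\int f\psi_{j,k}$. The coefficients are also written as one sequence $\mu=(\mu_1,\mu_2,\dots)$ with corresponding basis functions $\phi_1,\phi_2,\dots$: $\alpha_k$ is $\mu_\ell$ with $\ell=k+1$, and $\beta_{j,k}$ is $\mu_\ell$ with $\ell=2^j+k+1$. The sample size is $n=2^{J_1+1}$ for an integer $J_1$, so that $\mu^n=(\mu_1,\dots,\mu_n)$ consists of the $\alpha_k$ and of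 the $\beta_{j,k}$ with $J_0\le j\le J_1$. Model. $Y_i=f(x_i)+\sigma\varepsilon_i$, $i=1,\dots,n$, where $f\in L^2[0,1]$, $x_i=i/n$ and the $\varepsilon_i$ are i.i.d. standard normal; $\mathsf P$ is the law of these data, and $\mu^n$ is the vector of the first $n$ wavelet coefficients of $f$. The empirical wavelet coefficients are $$\tilde\alpha_k=\sum_{i=1}^nY_i\int_{(i-1)/n}^{i/n}\phi_{J_0,k}(x)\,dx\approx\alpha_k+\frac{\sigma}{\sqrt n}Z_k,\qquad \tilde\beta_{j,k}=\sum_{i=1}^nY_i\int_{(i-1)/n}^{i/n}\psi_{j,k}(x)\,dx\approx\beta_{j,k}+\frac{\sigma}{\sqrt n}Z_{j,k},$$ with $Z_k,Z_{j,k}$ i.i.d. standard normal; in the single indexing they are written $\tilde\mu_1,\dots,\tilde\mu_n$. (Strictly speaking, $\mathcal D_n$ is a confidence set for the approximate wavelet coefficients $\bar\mu_\ell=\int\bar f_n\phi_\ell$, $\ell\le n$, where $\bar f_n$ equals $n\int_{(i-1)/n}^{i/n}f(t)\,dt$ on the $i$-th interval $[(i-1)/n,i/n]$; in (i) and (ii) these are denoted simply by $\mu_\ell$.) The estimator is $\hat f_n=\sum_{\ell=1}^n\hat\mu_\ell\phi_\ell$. Risk estimate (Stein's unbiased risk estimate) for modulators: $$\tilde S_n(\xi)=\sum_{k=0}^{2^{J_0}-1}\Big[\xi_\phi^2\frac{\sigma^2}{n}+(1-\xi_\phi)^2\Big(\tilde\alpha_k^2-\frac{\sigma^2}{n}\Big)\Big]+\sum_{j=J_0}^{J_1}\sum_{k=0}^{2^j-1}\Big[\xi_j^2\frac{\sigma^2}{n}+(1-\xi_j)^2\Big(\tilde\beta_{j,k}^2-\frac{\sigma^2}{n}\Big)\Big].$$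 Besov bodies. For $p,q\ge1$, $$\|\mu\|_{p,q}^\varsigma=\Big(\sum_{j=J_0}^\infty\Big(2^{j(\varsigma+1/2-1/p)}\Big(\sum_k|\beta_{j,k}|^p\Big)^{1/p}\Big)^q\Big)^{1/q},$$ and $\gamma=\varsigma$ if $p\ge2$, $\gamma=\varsigma+\frac12-\frac1p$ if $1\le p<2$. $\mathcal B_{p,q}^\varsigma(c)$ is the Besov space with radius $c$; when the wavelets are $r$-regular with $r>\varsigma$, the coefficients of its members satisfy $\|\mu\|_{p,q}^\varsigma\le c$. A Besov body $\mathcal B$ with $\gamma>1/2$ and radius $c$ is the body of coefficient sequences (of functions in $L^2[0,1]$) with $\|\mu\|_{p,q}^\varsigma\le c$, where $p,q\ge1$ and $\gamma>1/2$. $\mathcal B^n$ is the set of vectors $(\mu_1,\dots,\mu_n)$ for $\mu\in\mathcal B$. Finally $\mathcal F_{\eta,c}=\bigcup_{p,q\ge1}\bigcup_{\gamma\ge1/2+\eta}\mathcal B_{p,q}^{\varsigma(\gamma)}(c)$, where $\varsigma(\gamma)$ is the $\varsigma$ corresponding to $\gamma$ (and $p$). $z_\alpha$ is the upper-tail $\alpha$-quantile of the standard normal.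
   Formalization: f is taken as its left-continuous version on (0,1], since f(x_i) is undefined for L^2 classes; the wavelets may lack a derivative at finitely many points, since the stated dilates form a basis of L^2[0,1] only for Haar-type ψ. *)

theory Defs
  imports "HOL-Probability.Probability" "HOL-Library.Discrete_Functions"
begin

text \<open>Elements of $L^2[0,1]$ are represented by functions on the reals, of which only the
  restriction to the unit interval matters.\<close>

definition L2_unit :: "(real \<Rightarrow> real) set" where
  "L2_unit = {f. f \<in> borel_measurable (lebesgue_on {0..1}) \<and>
                 integrable (lebesgue_on {0..1}) (\<lambda>x. (f x)\<^sup>2)}"

definition L2_inner :: "(real \<Rightarrow> real) \<Rightarrow> (real \<Rightarrow> real) \<Rightarrow> real" where
  "L2_inner f g = (\<integral>x. f x * g x \<partial>lebesgue_on {0..1})"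

definition L2_norm :: "(real \<Rightarrow> real) \<Rightarrow> real" where
  "L2_norm f = sqrt (L2_inner f f)"

text \<open>Point values are not determined by an $L^2$ class, but the regression model samples
  $f$ at $x_i = i/n$. The sampled version of $f$ is the left-continuous one: the cell
  $[(i-1)/n, i/n]$ attached to $x_i$ lies to the left of $x_i$. Every continuous function is
  such a version, and for bounded, piecewise smooth wavelets the wavelet series of a member of a
  Besov ball with $\gamma > 1/2$ converges uniformly, so that each member has exactly one
  left-continuous version on $(0,1]$.\<close>

definition left_continuous_versions :: "(real \<Rightarrow> real) set" where
  "left_continuous_versions = {f. \<forall>x\<in>{0<..1}. continuous (at_left x) f}"

definition dilate :: "(real \<Rightarrow> real) \<Rightarrow> nat \<Rightarrow> nat \<Rightarrow> real \<Rightarrow> real" where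
  "dilate g j k x = 2 powr (real j / 2) * g (2 ^ j * x - real k)"

text \<open>Single indexing, starting at 1: $\phi_{J_0,k}$ has index $k+1$ for $k < 2^{J_0}$, and
  $\psi_{j,k}$ has index $2^j+k+1$ for $j \ge J_0$, $k < 2^j$.\<close>

definition basis_fun :: "(real \<Rightarrow> real) \<Rightarrow> (real \<Rightarrow> real) \<Rightarrow> nat \<Rightarrow> nat \<Rightarrow> real \<Rightarrow> real" where
  "basis_fun \<phi> \<psi> J0 l =
     (if l \<le> 2 ^ J0 then dilate \<phi> J0 (l - 1)
      else (let j = floor_log (l - 1) in dilate \<psi> j (l - 1 - 2 ^ j)))"

text \<open>Finitely many points without a derivative are allowed, so that the Haar system is
  included.\<close>

definition regular_wavelet :: "(real \<Rightarrow> real) \<Rightarrow> bool" where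
  "regular_wavelet g \<longleftrightarrow>
     bounded (range g) \<and>
     (\<exists>K. compact K \<and> (\<forall>x. x \<notin> K \<longrightarrow> g x = 0)) \<and>
     (\<exists>S. finite S \<and> (\<forall>x. x \<notin> S \<longrightarrow> g differentiable (at x))) \<and>
     integrable lebesgue (\<lambda>x. (deriv g x)\<^sup>2)"

definition wavelet_system :: "(real \<Rightarrow> real) \<Rightarrow> (real \<Rightarrow> real) \<Rightarrow> nat \<Rightarrow> bool" where
  "wavelet_system \<phi> \<psi> J0 \<longleftrightarrow>
     regular_wavelet \<phi> \<and> regular_wavelet \<psi> \<and>
     (\<forall>l\<ge>1. basis_fun \<phi> \<psi> J0 l \<in> L2_unit) \<and>
     (\<forall>l\<ge>1. \<forall>m\<ge>1. L2_inner (basis_fun \<phi> \<psi> J0 l) (basis_fun \<phi> \<psi> J0 m) = (if l = m then 1 else 0)) \<and>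
     (\<forall>f\<in>L2_unit. (\<forall>l\<ge>1. L2_inner f (basis_fun \<phi> \<psi> J0 l) = 0) \<longrightarrow>
        (AE x in lebesgue_on {0..1}. f x = 0))"

definition wavelet_coeff ::
    "(real \<Rightarrow> real) \<Rightarrow> (real \<Rightarrow> real) \<Rightarrow> nat \<Rightarrow> (real \<Rightarrow> real) \<Rightarrow> nat \<Rightarrow> real" where
  "wavelet_coeff \<phi> \<psi> J0 f l = L2_inner f (basis_fun \<phi> \<psi> J0 l)"

text \<open>The inner sum runs over $|\beta_{j,k}|^p$ with $\beta_{j,k} = \mu_{2^j+k+1}$; the
  coefficients of $\phi_{J_0,k}$ do not enter.\<close>

definition besov_level :: "real \<Rightarrow> real \<Rightarrow> (nat \<Rightarrow> real) \<Rightarrow> nat \<Rightarrow> real" where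
  "besov_level p s \<mu> j =
     2 powr (real j * (s + 1/2 - 1/p)) * (\<Sum>k<2 ^ j. \<bar>\<mu> (2 ^ j + k + 1)\<bar> powr p) powr (1/p)"

definition besov_norm :: "nat \<Rightarrow> real \<Rightarrow> real \<Rightarrow> real \<Rightarrow> (nat \<Rightarrow> real) \<Rightarrow> ereal" where
  "besov_norm J0 p q s \<mu> =
     (if summable (\<lambda>i. besov_level p s \<mu> (J0 + i) powr q)
      then ereal ((\<Sum>i. besov_level p s \<mu> (J0 + i) powr q) powr (1/q)) else \<infinity>)"

definition besov_gamma :: "real \<Rightarrow> real \<Rightarrow> real" where
  "besov_gamma p s = (if p \<ge> 2 then s else s + 1/2 - 1/p)"

text \<open>The functions whose coefficient sequences form the Besov body.\<close>

definition besov_ball ::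
    "(real \<Rightarrow> real) \<Rightarrow> (real \<Rightarrow> real) \<Rightarrow> nat \<Rightarrow> real \<Rightarrow> real \<Rightarrow> real \<Rightarrow> real \<Rightarrow> (real \<Rightarrow> real) set" where
  "besov_ball \<phi> \<psi> J0 p q s c =
     {f \<in> L2_unit. besov_norm J0 p q s (wavelet_coeff \<phi> \<psi> J0 f) \<le> ereal c}"

definition besov_union ::
    "(real \<Rightarrow> real) \<Rightarrow> (real \<Rightarrow> real) \<Rightarrow> nat \<Rightarrow> real \<Rightarrow> real \<Rightarrow> (real \<Rightarrow> real) set" where
  "besov_union \<phi> \<psi> J0 \<eta> c =
     (\<Union>p\<in>{1..}. \<Union>q\<in>{1..}. \<Union>s\<in>{s. besov_gamma p s \<ge> 1/2 + \<eta>}. besov_ball \<phi> \<psi> J0 p q s c)"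

definition sample_size :: "nat \<Rightarrow> nat" where
  "sample_size J1 = 2 ^ (J1 + 1)"

definition noise :: "nat \<Rightarrow> (nat \<Rightarrow> real) measure" where
  "noise J1 = PiM {1..sample_size J1} (\<lambda>_. std_normal_distribution)"

definition observations :: "real \<Rightarrow> nat \<Rightarrow> (real \<Rightarrow> real) \<Rightarrow> (nat \<Rightarrow> real) \<Rightarrow> nat \<Rightarrow> real" where
  "observations \<sigma> J1 f \<epsilon> =
     (\<lambda>i\<in>{1..sample_size J1}. f (real i / real (sample_size J1)) + \<sigma> * \<epsilon> i)"

definition cell :: "nat \<Rightarrow> nat \<Rightarrow> real set" where
  "cell n i = {(real i - 1) / real n .. real i / real n}"

definition empirical_coeff :: "nat \<Rightarrow> (nat \<Rightarrow> real) \<Rightarrow> (real \<Rightarrow> real) \<Rightarrow> real" where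
  "empirical_coeff J1 y g =
     (\<Sum>i=1..sample_size J1. y i * (LINT x:cell (sample_size J1) i|lebesgue. g x))"

text \<open>$\bar f_n$; a point $x$ of $(0,1]$ lies in the cell with index $\lceil nx \rceil$, and the
  choice at the end points of the cells is immaterial for $\bar\mu_\ell$.\<close>

definition cell_average :: "nat \<Rightarrow> (real \<Rightarrow> real) \<Rightarrow> real \<Rightarrow> real" where
  "cell_average n f x = real n * (LINT t:cell n (nat \<lceil>real n * x\<rceil>)|lebesgue. f t)"

definition approx_coeff ::
    "(real \<Rightarrow> real) \<Rightarrow> (real \<Rightarrow> real) \<Rightarrow> nat \<Rightarrow> nat \<Rightarrow> (real \<Rightarrow> real) \<Rightarrow> nat \<Rightarrow> real" where
  "approx_coeff \<phi> \<psi> J0 J1 f = wavelet_coeff \<phi> \<psi> J0 (cell_average (sample_size J1) f)"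

text \<open>A modulator is a pair of $\xi_\phi$ and $j \mapsto \xi_j$; only $J_0 \le j \le J_1$
  matters.\<close>

type_synonym modulator = "real \<times> (nat \<Rightarrow> real)"

definition sure ::
    "(real \<Rightarrow> real) \<Rightarrow> (real \<Rightarrow> real) \<Rightarrow> nat \<Rightarrow> real \<Rightarrow> nat \<Rightarrow> (nat \<Rightarrow> real) \<Rightarrow> modulator \<Rightarrow> real" where
  "sure \<phi> \<psi> J0 \<sigma> J1 y \<xi> = (let v = \<sigma>\<^sup>2 / real (sample_size J1) in
     (\<Sum>k<2 ^ J0. (fst \<xi>)\<^sup>2 * v +
        (1 - fst \<xi>)\<^sup>2 * ((empirical_coeff J1 y (dilate \<phi> J0 k))\<^sup>2 - v)) +
     (\<Sum>j=J0..J1. \<Sum>k<2 ^ j. (snd \<xi> j)\<^sup>2 * v +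
        (1 - snd \<xi> j)\<^sup>2 * ((empirical_coeff J1 y (dilate \<psi> j k))\<^sup>2 - v)))"

definition monotone_modulators :: "nat \<Rightarrow> nat \<Rightarrow> modulator set" where
  "monotone_modulators J0 J1 =
     {\<xi>. 1 \<ge> fst \<xi> \<and> fst \<xi> \<ge> snd \<xi> J0 \<and> (\<forall>j\<in>{J0..<J1}. snd \<xi> j \<ge> snd \<xi> (Suc j))}"

text \<open>A minimizer need not exist when all empirical coefficients of the finest level vanish. This
  has probability zero whatever $f$ is, since the law of the data is equivalent to Lebesgue
  measure; hence the estimator is only asked to minimize almost everywhere.\<close>

definition monotone_estimator ::
    "(real \<Rightarrow> real) \<Rightarrow> (real \<Rightarrow> real) \<Rightarrow> nat \<Rightarrow> real \<Rightarrow> nat \<Rightarrow> ((nat \<Rightarrow> real) \<Rightarrow> modulator) \<Rightarrow> bool" where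
  "monotone_estimator \<phi> \<psi> J0 \<sigma> J1 X \<longleftrightarrow>
     (\<lambda>y. fst (X y)) \<in> borel_measurable (PiM {1..sample_size J1} (\<lambda>_. borel)) \<and>
     (\<forall>j\<in>{J0..J1}. (\<lambda>y. snd (X y) j) \<in> borel_measurable (PiM {1..sample_size J1} (\<lambda>_. borel))) \<and>
     (AE y in PiM {1..sample_size J1} (\<lambda>_. lborel).
        X y \<in> monotone_modulators J0 J1 \<and>
        (\<forall>\<zeta>\<in>monotone_modulators J0 J1. sure \<phi> \<psi> J0 \<sigma> J1 y (X y) \<le> sure \<phi> \<psi> J0 \<sigma> J1 y \<zeta>))"

definition shrinkage :: "nat \<Rightarrow> modulator \<Rightarrow> nat \<Rightarrow> real" where
  "shrinkage J0 \<xi> l = (if l \<le> 2 ^ J0 then fst \<xi> else snd \<xi> (floor_log (l - 1)))"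

definition normal_upper_quantile :: "real \<Rightarrow> real" where
  "normal_upper_quantile \<alpha> = (THE z. measure std_normal_distribution {z<..} = \<alpha>)"

definition tau_hat ::
    "(real \<Rightarrow> real) \<Rightarrow> (real \<Rightarrow> real) \<Rightarrow> nat \<Rightarrow> real \<Rightarrow> nat \<Rightarrow> modulator \<Rightarrow> (nat \<Rightarrow> real) \<Rightarrow> real" where
  "tau_hat \<phi> \<psi> J0 \<sigma> J1 \<xi> y = (let n = sample_size J1 in
     sqrt (2 * \<sigma> ^ 4 / real n * (\<Sum>l=1..n. (2 * shrinkage J0 \<xi> l - 1)\<^sup>2) +
           4 * \<sigma>\<^sup>2 * (\<Sum>l=1..n. ((empirical_coeff J1 y (basis_fun \<phi> \<psi> J0 l))\<^sup>2 - \<sigma>\<^sup>2 / real n)\<^sup>2 *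
                                  (1 - shrinkage J0 \<xi> l)\<^sup>2)))"

text \<open>This is $s_n^2$, which may be negative.\<close>

definition radius_sq ::
    "(real \<Rightarrow> real) \<Rightarrow> (real \<Rightarrow> real) \<Rightarrow> nat \<Rightarrow> real \<Rightarrow> real \<Rightarrow> nat \<Rightarrow> modulator \<Rightarrow> (nat \<Rightarrow> real) \<Rightarrow> real" where
  "radius_sq \<phi> \<psi> J0 \<sigma> \<alpha> J1 \<xi> y =
     tau_hat \<phi> \<psi> J0 \<sigma> J1 \<xi> y * normal_upper_quantile \<alpha> / sqrt (real (sample_size J1)) +
     sure \<phi> \<psi> J0 \<sigma> J1 y \<xi>"

text \<open>Vectors $(m_1,\dots,m_n)$ are functions on the naturals; only their values on
  $\{1,\dots,n\}$ matter.\<close>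

definition conf_coeffs ::
    "(real \<Rightarrow> real) \<Rightarrow> (real \<Rightarrow> real) \<Rightarrow> nat \<Rightarrow> real \<Rightarrow> real \<Rightarrow> nat \<Rightarrow>
     ((nat \<Rightarrow> real) \<Rightarrow> modulator) \<Rightarrow> (nat \<Rightarrow> real) \<Rightarrow> (nat \<Rightarrow> real) set" where
  "conf_coeffs \<phi> \<psi> J0 \<sigma> \<alpha> J1 X y =
     {m. (\<Sum>l=1..sample_size J1.
            (m l - shrinkage J0 (X y) l * empirical_coeff J1 y (basis_fun \<phi> \<psi> J0 l))\<^sup>2)
         \<le> radius_sq \<phi> \<psi> J0 \<sigma> \<alpha> J1 (X y) y}"

definition expansion ::
    "(real \<Rightarrow> real) \<Rightarrow> (real \<Rightarrow> real) \<Rightarrow> nat \<Rightarrow> nat \<Rightarrow> (nat \<Rightarrow> real) \<Rightarrow> real \<Rightarrow> real" where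
  "expansion \<phi> \<psi> J0 J1 m x = (\<Sum>l=1..sample_size J1. m l * basis_fun \<phi> \<psi> J0 l x)"

text \<open>Equality of functions is equality in $L^2[0,1]$.\<close>

definition conf_funs ::
    "(real \<Rightarrow> real) \<Rightarrow> (real \<Rightarrow> real) \<Rightarrow> nat \<Rightarrow> real \<Rightarrow> real \<Rightarrow> nat \<Rightarrow>
     ((nat \<Rightarrow> real) \<Rightarrow> modulator) \<Rightarrow> (nat \<Rightarrow> real) \<Rightarrow> (real \<Rightarrow> real) set" where
  "conf_funs \<phi> \<psi> J0 \<sigma> \<alpha> J1 X y =
     {g \<in> L2_unit. \<exists>m\<in>conf_coeffs \<phi> \<psi> J0 \<sigma> \<alpha> J1 X y.
        AE x in lebesgue_on {0..1}. g x = expansion \<phi> \<psi> J0 J1 m x}"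

text \<open>The infimum is taken in the extended reals, so that it is infinite if there is no $g$.\<close>

definition enlarged_conf_funs ::
    "(real \<Rightarrow> real) \<Rightarrow> (real \<Rightarrow> real) \<Rightarrow> nat \<Rightarrow> real \<Rightarrow> real \<Rightarrow> real \<Rightarrow> real \<Rightarrow> real \<Rightarrow> nat \<Rightarrow>
     ((nat \<Rightarrow> real) \<Rightarrow> modulator) \<Rightarrow> (nat \<Rightarrow> real) \<Rightarrow> (real \<Rightarrow> real) set" where
  "enlarged_conf_funs \<phi> \<psi> J0 \<sigma> \<alpha> \<eta> c \<delta> J1 X y =
     {f \<in> besov_union \<phi> \<psi> J0 \<eta> c.
        (INF g\<in>conf_funs \<phi> \<psi> J0 \<sigma> \<alpha> J1 X y. ereal (L2_norm (\<lambda>x. f x - g x)))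
        \<le> ereal (\<delta> / sqrt (real (sample_size J1)))}"

end

theory Submission
  imports Defs
begin

text \<open>Bessel's inequality for the constant function forces $\int\psi = 0$, and the norms of the
  $\psi_{j,k}$ on the unit interval force $\psi$ to live on $[0,1]$. Hence the first $n$ basis
  functions span the step functions on the cells, the empirical coefficients are an exact rotation
  of the noise, and only the discretization bias $f(x_i) - \bar f_n(x_i)$, which is
  $O(n^{-1/2})$ in $\ell^2$ when $\gamma > 1/2$, separates the data from a Gaussian sequence model.

  In the sequence model put $v = \sigma^2/n$. The pivot $\sqrt n$ (loss minus risk estimate) at
  $\hat\xi$ equals $\frac{\sigma^2}{\sqrt n}\sum_\ell(2\hat\xi_\ell-1)(Z_\ell^2-1)
  - 2\sigma\sum_\ell(1-\hat\xi_\ell)\mu_\ell Z_\ell$. On the finest levels, which carry nearly all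
  indices, there is only noise and the isotonic minimizer is close to $0$; on a fixed coarse level
  $(1-\hat\xi)\sum\tilde\mu_\ell^2 = O(v)$, so that even unboundedly large coefficients do not
  contribute; in between the coefficients of the body are uniformly summable. Thus the pivot is
  $-\frac{\sigma^2}{\sqrt n}\sum_i(\varepsilon_i^2-1) + o(1)$ and $\hat\tau^2 = 2\sigma^4 + o(1)$,
  uniformly over the body, and the central limit theorem applies.\<close>

section \<open>Isotonic minimization of the risk estimate\<close>

text \<open>The minimizer depends on all the data, so moments of the pivot cannot be computed with
  it inside. The pivot and the variance estimate are therefore bounded, realization by realization,
  by majorants free of the modulator, and only these are integrated. One cutoff m governs the
  estimates. The m+1 finest blocks contain all indices but the fraction 1/2^(m+1), and four times
  this number bounds the modulator there; the blocks up to m are the coarse ones. For fixed m the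
  remaining errors vanish as n grows, apart from terms that are small for large m, so m is chosen
  first and n afterwards. Modulators have no lower bound 0, hence their smallness on the fine blocks
  needs an argument on each side. The discretization bias is of the same order as the noise of one
  coefficient and does not become small against it. It is harmless because its total squared size in
  noise units stays bounded, while the pivot is a normalized sum over n coordinates. The rotation
  preserves the sum of squares, so the limit law is read off from the original independent
  errors.\<close>

definition level_block :: "nat \<Rightarrow> nat \<Rightarrow> nat set" where
  "level_block J0 t = (if t = 0 then {1..2 ^ J0} else {2 ^ (J0 + t - 1) + 1..2 ^ (J0 + t)})"

lemma finite_level_block [simp, intro]: "finite (level_block J0 t)"
  by (simp add: level_block_def)

lemma card_level_block: "card (level_block J0 t) = (if t = 0 then 2 ^ J0 else 2 ^ (J0 + t - 1))"
proof (cases t)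
  case (Suc k)
  then show ?thesis by (simp add: level_block_def)
qed (simp add: level_block_def)

text \<open>The blocks tile the index set: block 0 carries the scaling coefficients and block t >= 1
  the wavelet level J0+t-1, so that R = J1+1-J0 exhausts n = 2^(J1+1). Blocks 0 and 1 have the same
  size.\<close>

lemma sum_level_blocks:
  fixes F :: "nat \<Rightarrow> 'a::comm_monoid_add"
  shows "(\<Sum>l=1..2 ^ (J0 + R). F l) = (\<Sum>t\<le>R. \<Sum>l\<in>level_block J0 t. F l)"
proof (induction R)
  case 0
  show ?case by (simp add: level_block_def)
next
  case (Suc R)
  have "{1..2 ^ (J0 + Suc R)} = {1..2 ^ (J0 + R)} \<union> level_block J0 (Suc R)"
    by (auto simp: level_block_def intro: order_trans[OF _ power_increasing])
  moreover have "{1..2 ^ (J0 + R)} \<inter> level_block J0 (Suc R) = {}"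
    by (auto simp: level_block_def)
  ultimately show ?case
    using Suc.IH by (simp add: sum.union_disjoint)
qed

lemma sum_card_level_block:
  "(\<Sum>t\<le>R. real (card (level_block J0 t))) = 2 ^ (J0 + R)"
  using sum_level_blocks[of "\<lambda>_. 1::real" J0 R] by simp

lemma sum_card_level_block_from:
  assumes "1 \<le> s" "s \<le> R"
  shows "(\<Sum>t=s..R. real (card (level_block J0 t))) = 2 ^ (J0 + R) - 2 ^ (J0 + s - 1)"
proof -
  obtain k where k: "s = Suc k" using assms(1) by (cases s) auto
  have "{..R} = {..k} \<union> {s..R}" using assms k by auto
  then have "(\<Sum>t\<le>R. real (card (level_block J0 t))) =
      (\<Sum>t\<le>k. real (card (level_block J0 t))) + (\<Sum>t=s..R. real (card (level_block J0 t)))"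
    by (simp add: sum.union_disjoint k)
  then show ?thesis by (simp add: sum_card_level_block k)
qed

section \<open>Isotonic modulators as chains over the blocks\<close>

definition monotone_chain :: "nat \<Rightarrow> (nat \<Rightarrow> real) \<Rightarrow> bool" where
  "monotone_chain R h \<longleftrightarrow> h 0 \<le> 1 \<and> (\<forall>t<R. h (Suc t) \<le> h t)"

text \<open>Stein's estimate summed within blocks: \<open>N t\<close> is the block size and
  \<open>A t\<close> the sum of the squared empirical coefficients. In one variable
  \<open>h t\<close> it is, up to a constant, \<open>A t\<close> times the squared distance to 1 -
  \<open>N t\<close> v / \<open>A t\<close>.\<close>

definition chain_risk :: "real \<Rightarrow> nat \<Rightarrow> (nat \<Rightarrow> real) \<Rightarrow> (nat \<Rightarrow> real) \<Rightarrow> (nat \<Rightarrow> real) \<Rightarrow> real" where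
  "chain_risk v R N A h = (\<Sum>t\<le>R. (h t)\<^sup>2 * (N t * v) + (1 - h t)\<^sup>2 * (A t - N t * v))"

definition chain_minimizer :: "real \<Rightarrow> nat \<Rightarrow> (nat \<Rightarrow> real) \<Rightarrow> (nat \<Rightarrow> real) \<Rightarrow> (nat \<Rightarrow> real) \<Rightarrow> bool" where
  "chain_minimizer v R N A h \<longleftrightarrow>
     monotone_chain R h \<and> (\<forall>g. monotone_chain R g \<longrightarrow> chain_risk v R N A h \<le> chain_risk v R N A g)"

lemma monotone_chain_antimono:
  assumes "monotone_chain R h" "s \<le> t" "t \<le> R"
  shows "h t \<le> h s"
  using assms(2,3)
proof (induction t rule: dec_induct)
  case (step t)
  then have "h (Suc t) \<le> h t" using assms(1) by (simp add: monotone_chain_def)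
  with step show ?case by simp
qed simp

lemma monotone_chain_le_one:
  assumes "monotone_chain R h" "t \<le> R"
  shows "h t \<le> 1"
  using monotone_chain_antimono[OF assms(1), of 0 t] assms by (simp add: monotone_chain_def)

text \<open>On each block the risk is a quadratic whose vertex is at most c by the last hypothesis,
  or an increasing linear function if \<open>A t\<close> = 0. Cutting \<open>h\<close> off at c from
  \<open>t0\<close> on keeps the chain monotone, and it would lower the risk strictly if
  \<open>h t0\<close> exceeded c.\<close>

lemma chain_minimizer_le:
  assumes min: "chain_minimizer v R N A h" and "t0 \<le> R"
    and A: "\<And>t. t0 \<le> t \<Longrightarrow> t \<le> R \<Longrightarrow> 0 \<le> A t"
    and N: "\<And>t. t0 \<le> t \<Longrightarrow> t \<le> R \<Longrightarrow> 0 < N t * v"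
    and le: "\<And>t. t0 \<le> t \<Longrightarrow> t \<le> R \<Longrightarrow> (1 - c) * A t \<le> N t * v"
  shows "h t0 \<le> c"
proof (rule ccontr)
  assume "\<not> h t0 \<le> c"
  then have c: "c < h t0" by simp
  have mono: "monotone_chain R h" using min by (simp add: chain_minimizer_def)
  define g where "g t = (if t0 \<le> t then min (h t) c else h t)" for t
  have "monotone_chain R g"
    unfolding monotone_chain_def
  proof (intro conjI allI impI)
    show "g 0 \<le> 1"
      using mono by (auto simp: g_def monotone_chain_def)
  next
    fix t assume "t < R"
    then have "h (Suc t) \<le> h t" using mono by (simp add: monotone_chain_def)
    then show "g (Suc t) \<le> g t" by (auto simp: g_def)
  qed
  then have le': "chain_risk v R N A h \<le> chain_risk v R N A g"
    using min by (simp add: chain_minimizer_def)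
  have strict: "c\<^sup>2 * (N t * v) + (1 - c)\<^sup>2 * (A t - N t * v)
      < (h t)\<^sup>2 * (N t * v) + (1 - h t)\<^sup>2 * (A t - N t * v)"
    if t: "t0 \<le> t" "t \<le> R" and h: "c < h t" for t
  proof -
    have "(h t)\<^sup>2 * (N t * v) + (1 - h t)\<^sup>2 * (A t - N t * v)
        - (c\<^sup>2 * (N t * v) + (1 - c)\<^sup>2 * (A t - N t * v))
        = (h t - c) * (A t * (h t - c) + 2 * (N t * v - (1 - c) * A t))"
      by (simp add: algebra_simps power2_eq_square)
    moreover have "0 < A t * (h t - c) + 2 * (N t * v - (1 - c) * A t)"
    proof (cases "A t = 0")
      case True
      then show ?thesis using N[OF t] by simp
    next
      case False
      then have "0 < A t * (h t - c)" using A[OF t] h by simp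
      then show ?thesis using le[OF t] by (intro add_pos_nonneg) auto
    qed
    ultimately show ?thesis using h by (smt (verit) mult_pos_pos)
  qed
  have "chain_risk v R N A g < chain_risk v R N A h"
    unfolding chain_risk_def
  proof (rule sum_strict_mono_ex1)
    show "\<forall>t\<in>{..R}. (g t)\<^sup>2 * (N t * v) + (1 - g t)\<^sup>2 * (A t - N t * v)
        \<le> (h t)\<^sup>2 * (N t * v) + (1 - h t)\<^sup>2 * (A t - N t * v)"
      using strict by (force simp: g_def min_def)
    show "\<exists>t\<in>{..R}. (g t)\<^sup>2 * (N t * v) + (1 - g t)\<^sup>2 * (A t - N t * v)
        < (h t)\<^sup>2 * (N t * v) + (1 - h t)\<^sup>2 * (A t - N t * v)"
      using strict[of t0] \<open>t0 \<le> R\<close> c by (intro bexI[of _ t0]) (auto simp: g_def)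
  qed simp
  with le' show False by simp
qed

text \<open>Raising the part up to $t$ of the block of constancy of $h$ that contains $t$ keeps the
  chain monotone, so the corresponding derivative of the risk is nonnegative.\<close>

lemma chain_minimizer_block:
  assumes min: "chain_minimizer v R N A h" and "t \<le> R"
    and N: "\<And>s. s \<le> R \<Longrightarrow> 0 \<le> N s * v"
  obtains a where "a \<le> t" "(1 - h t) * (\<Sum>s=a..t. A s) \<le> (\<Sum>s=a..t. N s) * v"
proof -
  have mono: "monotone_chain R h" using min by (simp add: chain_minimizer_def)
  define a where "a = (LEAST s. h s = h t)"
  have a: "h a = h t" "a \<le> t" unfolding a_def by (auto intro: LeastI Least_le)
  have below: "h s \<noteq> h t" if "s < a" for s
    using that not_less_Least unfolding a_def by blast
  have eq: "h s = h t" if "a \<le> s" "s \<le> t" for s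
    using monotone_chain_antimono[OF mono, of a s] monotone_chain_antimono[OF mono, of s t] a that
      \<open>t \<le> R\<close> by force
  define SA SN where "SA = (\<Sum>s=a..t. A s)" and "SN = (\<Sum>s=a..t. N s)"
  have "(1 - h t) * SA \<le> SN * v"
  proof (cases "a = 0 \<and> h t = 1")
    \<comment> \<open>At the ceiling 1 nothing can be raised, but then the left side is 0.\<close>
    case True
    then show ?thesis
      using \<open>t \<le> R\<close> N by (auto simp: SN_def sum_distrib_right intro!: sum_nonneg)
  next
    case False
    \<comment> \<open>The largest amount by which the segment can be raised before it meets the
      preceding value, or the ceiling if there is none.\<close>
    define e0 where "e0 = (if a = 0 then 1 - h t else h (a - 1) - h a)"
    have "e0 > 0"
    proof (cases "a = 0")
      case True
      then show ?thesis
        using False monotone_chain_le_one[OF mono \<open>t \<le> R\<close>] by (simp add: e0_def)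
    next
      case nz: False
      then have "h a \<le> h (a - 1)"
        using monotone_chain_antimono[OF mono, of "a - 1" a] a \<open>t \<le> R\<close> by simp
      moreover have "h (a - 1) \<noteq> h a" using below[of "a - 1"] nz a by simp
      ultimately show ?thesis using nz by (simp add: e0_def)
    qed
    \<comment> \<open>The risk is quadratic, so its increment is exactly e times this
      expression.\<close>
    have var: "0 \<le> e * SA + 2 * (SN * v - (1 - h t) * SA)" if e: "0 < e" "e \<le> e0" for e
    proof -
      define g where "g s = (if a \<le> s \<and> s \<le> t then h t + e else h s)" for s
      have "monotone_chain R g"
        unfolding monotone_chain_def
      proof (intro conjI allI impI)
        show "g 0 \<le> 1"
          using mono e by (auto simp: g_def e0_def monotone_chain_def)
      next
        fix s assume "s < R"
        then have hs: "h (Suc s) \<le> h s" using mono by (simp add: monotone_chain_def)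
        consider "Suc s = a" | "Suc s < a" | "a \<le> s" "Suc s \<le> t" | "a \<le> s" "s = t" | "t < s"
          using a(2) by linarith
        then show "g (Suc s) \<le> g s"
        proof cases
          case 1
          then have "a - 1 = s" by simp
          then show ?thesis using 1 e a by (auto simp: g_def e0_def)
        qed (use hs e in \<open>auto simp: g_def\<close>)
      qed
      then have "0 \<le> chain_risk v R N A g - chain_risk v R N A h"
        using min by (simp add: chain_minimizer_def)
      also have "chain_risk v R N A g - chain_risk v R N A h
          = (\<Sum>s\<le>R. if a \<le> s \<and> s \<le> t then e * (e * A s + 2 * (N s * v - (1 - h t) * A s)) else 0)"
        unfolding chain_risk_def sum_subtractf[symmetric]
      proof (rule sum.cong)
        fix s assume "s \<in> {..R}"
        show "(g s)\<^sup>2 * (N s * v) + (1 - g s)\<^sup>2 * (A s - N s * v)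
            - ((h s)\<^sup>2 * (N s * v) + (1 - h s)\<^sup>2 * (A s - N s * v))
            = (if a \<le> s \<and> s \<le> t then e * (e * A s + 2 * (N s * v - (1 - h t) * A s)) else 0)"
        proof (cases "a \<le> s \<and> s \<le> t")
          case True
          have "(x + e)\<^sup>2 * Q + (1 - (x + e))\<^sup>2 * (B - Q) - (x\<^sup>2 * Q + (1 - x)\<^sup>2 * (B - Q))
              = e * (e * B + 2 * (Q - (1 - x) * B))" for x Q B :: real
            by (simp add: algebra_simps power2_eq_square)
          moreover have "h s = h t" "g s = h t + e" using True eq[of s] by (auto simp: g_def)
          ultimately show ?thesis using True by (simp only:) simp
        qed (auto simp: g_def)
      qed simp
      also have "\<dots> = (\<Sum>s\<in>{a..t}. e * (e * A s + 2 * (N s * v - (1 - h t) * A s)))"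
        using \<open>t \<le> R\<close> by (intro sum.mono_neutral_cong_right) auto
      also have "\<dots> = e * (e * SA + 2 * (SN * v - (1 - h t) * SA))"
        by (simp add: SA_def SN_def sum_distrib_left sum_distrib_right sum.distrib sum_subtractf
            algebra_simps)
      finally show ?thesis using e by (simp add: zero_le_mult_iff)
    qed
    show ?thesis
    proof (rule ccontr)
      define X where "X = (1 - h t) * SA - SN * v"
      assume "\<not> ?thesis"
      then have X: "X > 0" by (simp add: X_def)
      \<comment> \<open>With this e the term \<open>e * SA\<close> is at most X and cannot offset
        the linear term -2X.\<close>
      define e where "e = min e0 (X / (\<bar>SA\<bar> + 1))"
      have "0 < e" using \<open>e0 > 0\<close> X by (simp add: e_def)
      have "e * SA \<le> e * (\<bar>SA\<bar> + 1)" using \<open>0 < e\<close> by (intro mult_left_mono) auto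
      also have "\<dots> \<le> X / (\<bar>SA\<bar> + 1) * (\<bar>SA\<bar> + 1)" by (intro mult_right_mono) (auto simp: e_def)
      also have "\<dots> = X" by simp
      finally show False using var[of e] \<open>0 < e\<close> X by (simp add: e_def X_def)
    qed
  qed
  then show thesis using that a by (simp add: SA_def SN_def)
qed

section \<open>Deterministic comparison of the pivot\<close>

lemma power4_add_le: "(a + b) ^ 4 \<le> 8 * (a ^ 4 + b ^ (4::nat) :: real)"
proof -
  have "(a + b)\<^sup>2 \<le> 2 * (a\<^sup>2 + b\<^sup>2)"
    using zero_le_power2[of "a - b"] by (simp add: power2_eq_square algebra_simps)
  then have "((a + b)\<^sup>2)\<^sup>2 \<le> (2 * (a\<^sup>2 + b\<^sup>2))\<^sup>2" by (intro power_mono) auto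
  also have "\<dots> \<le> 8 * (a ^ 4 + b ^ 4)"
    using zero_le_power2[of "a\<^sup>2 - b\<^sup>2"] by (simp add: power2_eq_square power4_eq_xxxx algebra_simps)
  finally show ?thesis by (simp add: power_mult[symmetric])
qed

lemma sum_power4_le: "(\<Sum>l\<in>B. (x l :: real) ^ 4) \<le> (\<Sum>l\<in>B. (x l)\<^sup>2)\<^sup>2"
proof (cases "finite B")
  case True
  then show ?thesis
  proof (induction B rule: finite_induct)
    case (insert a B)
    have "0 \<le> (x a)\<^sup>2 * (\<Sum>l\<in>B. (x l)\<^sup>2)" by (intro mult_nonneg_nonneg sum_nonneg) auto
    then have "(\<Sum>l\<in>B. (x l)\<^sup>2)\<^sup>2 + (x a) ^ 4 \<le> (\<Sum>l\<in>insert a B. (x l)\<^sup>2)\<^sup>2"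
      using insert.hyps by (simp add: power2_eq_square power4_eq_xxxx algebra_simps)
    then show ?case using insert by simp
  qed simp
qed simp

text \<open>Multiplication by the conjugate sqrt x + sqrt y, which is at least sqrt y. It turns an
  error of the variance estimate into a relative error of its square root.\<close>

lemma abs_sqrt_ratio_le:
  assumes "0 \<le> x" "0 < y"
  shows "\<bar>sqrt x / sqrt y - 1\<bar> \<le> \<bar>x - y\<bar> / y"
proof -
  have "\<bar>sqrt x - sqrt y\<bar> * sqrt y \<le> \<bar>sqrt x - sqrt y\<bar> * (sqrt x + sqrt y)"
    using assms by (intro mult_left_mono) auto
  also have "\<dots> = \<bar>(sqrt x - sqrt y) * (sqrt x + sqrt y)\<bar>"
    using assms by (simp add: abs_mult)
  also have "(sqrt x - sqrt y) * (sqrt x + sqrt y) = x - y"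
    using assms by (simp add: algebra_simps)
  finally have "\<bar>sqrt x - sqrt y\<bar> * sqrt y / y \<le> \<bar>x - y\<bar> / y"
    using assms by (intro divide_right_mono) auto
  moreover have "\<bar>sqrt x / sqrt y - 1\<bar> = \<bar>sqrt x - sqrt y\<bar> * sqrt y / y"
    using assms by (simp add: field_simps abs_if real_sqrt_divide)
  ultimately show ?thesis by simp
qed

text \<open>The first factor is the size of block R-m and also the number of all indices before that
  block: each is the fraction 1/2^(m+1) of the whole.\<close>

lemma power_two_split:
  assumes "m < R"
  shows "(2::real) ^ (J0 + R) = 2 ^ (J0 + (R - m) - 1) * 2 ^ (m + 1)"
proof -
  have "J0 + R = (J0 + (R - m) - 1) + (m + 1)" using assms by simp
  then show ?thesis by (metis power_add)
qed

section \<open>Block statistics and the majorants of the errors\<close>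

definition excess :: "nat \<Rightarrow> (nat \<Rightarrow> real) \<Rightarrow> nat \<Rightarrow> real" where
  "excess J0 w t = (\<Sum>l\<in>level_block J0 t. (w l)\<^sup>2 - 1)"

definition energy :: "nat \<Rightarrow> (nat \<Rightarrow> real) \<Rightarrow> nat \<Rightarrow> real" where
  "energy J0 w t = (\<Sum>l\<in>level_block J0 t. (w l)\<^sup>2)"

definition cross :: "nat \<Rightarrow> (nat \<Rightarrow> real) \<Rightarrow> (nat \<Rightarrow> real) \<Rightarrow> nat \<Rightarrow> real" where
  "cross J0 \<mu> w t = (\<Sum>l\<in>level_block J0 t. \<mu> l * w l)"

text \<open>Majorant of the distance of the pivot from its leading term. The weights bound the
  modulator: 1 on the coarser blocks and 4/2^(m+1) on the m+1 finest ones. In the cross term the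
  blocks up to m get a bound free of \<mu>, the others use 1 - h <= 2.\<close>

definition process_error :: "nat \<Rightarrow> nat \<Rightarrow> real \<Rightarrow> (nat \<Rightarrow> real) \<Rightarrow> (nat \<Rightarrow> real) \<Rightarrow> nat \<Rightarrow> real" where
  "process_error J0 R \<sigma> \<mu> w m =
     2 * \<sigma>\<^sup>2 / sqrt (2 ^ (J0 + R)) *
       (\<Sum>t\<le>R. (if t < R - m then 1 else 4 / 2 ^ (m + 1)) * \<bar>excess J0 w t\<bar>) +
     2 * \<sigma> * (\<Sum>t\<le>R. if t \<le> m
        then 2 * 2 ^ (J0 + t) * sqrt (\<sigma>\<^sup>2 / 2 ^ (J0 + R)) + 4 * sqrt (\<sigma>\<^sup>2 / 2 ^ (J0 + R)) * energy J0 w t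
        else 2 * \<bar>cross J0 \<mu> w t\<bar>)"

text \<open>Majorant of the distance of the squared scale estimate from 2 \<sigma>^4. The first
  summand belongs to the sum of (2h-1)^2, the bracket to the sum of fourth order, where the blocks
  up to m again get a bound free of \<mu>.\<close>

definition variance_error :: "nat \<Rightarrow> nat \<Rightarrow> real \<Rightarrow> (nat \<Rightarrow> real) \<Rightarrow> (nat \<Rightarrow> real) \<Rightarrow> nat \<Rightarrow> real" where
  "variance_error J0 R \<sigma> \<mu> w m =
     80 * \<sigma> ^ 4 / 2 ^ (m + 1) + 4 * \<sigma>\<^sup>2 *
       ((\<Sum>t\<le>m. 2 * (2 ^ (J0 + t) * (\<sigma>\<^sup>2 / 2 ^ (J0 + R)))\<^sup>2) + 8 * \<sigma> ^ 4 / 2 ^ (J0 + R) +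
        64 * (\<Sum>t\<in>{m<..R}. L2_set \<mu> (level_block J0 t) ^ 4) +
        64 * (\<sigma>\<^sup>2 / 2 ^ (J0 + R))\<^sup>2 * (\<Sum>t\<le>R. \<Sum>l\<in>level_block J0 t. (w l) ^ 4))"

text \<open>Both errors after division by the limiting standard deviation sqrt 2 \<sigma>^2 of the
  pivot. S is meant to be the centred sum of squares of the original errors; the discretization bias
  separates it from the total excess.\<close>

definition fit_error ::
    "nat \<Rightarrow> nat \<Rightarrow> real \<Rightarrow> (nat \<Rightarrow> real) \<Rightarrow> (nat \<Rightarrow> real) \<Rightarrow> nat \<Rightarrow> real \<Rightarrow> real \<Rightarrow> real" where
  "fit_error J0 R \<sigma> \<mu> w m z S =
     (\<sigma>\<^sup>2 / sqrt (2 ^ (J0 + R)) * \<bar>(\<Sum>t\<le>R. excess J0 w t) - S\<bar> + process_error J0 R \<sigma> \<mu> w m) / (sqrt 2 * \<sigma>\<^sup>2)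
     + \<bar>z\<bar> * variance_error J0 R \<sigma> \<mu> w m / (2 * \<sigma> ^ 4)"

text \<open>One fixed realization: everything here is deterministic, and \<open>w\<close> is noise
  plus bias in units of sqrt v. The block statistics are parameters with defining equations, so that
  an interpretation can supply their names.\<close>

locale sequence_fit =
  fixes J0 R :: nat and \<sigma> :: real and \<mu> w h :: "nat \<Rightarrow> real" and n v :: real
    and A N D C U W :: "nat \<Rightarrow> real"
  assumes sigma: "\<sigma> > 0"
    and n_def: "n = 2 ^ (J0 + R)" and v_def: "v = \<sigma>\<^sup>2 / n"
    and A_def: "\<And>t. A t = (\<Sum>l\<in>level_block J0 t. (\<mu> l + sqrt v * w l)\<^sup>2)"
    and N_def: "\<And>t. N t = real (card (level_block J0 t))"
    and D_def: "\<And>t. D t = (\<Sum>l\<in>level_block J0 t. (w l)\<^sup>2 - 1)"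
    and C_def: "\<And>t. C t = (\<Sum>l\<in>level_block J0 t. \<mu> l * w l)"
    and U_def: "\<And>t. U t = L2_set \<mu> (level_block J0 t)"
    and W_def: "\<And>t. W t = (\<Sum>l\<in>level_block J0 t. (w l)\<^sup>2)"
    and minimizer: "chain_minimizer v R N A h"
begin

lemma n_pos: "n > 0" and v_pos: "v > 0" and vn: "v * n = \<sigma>\<^sup>2"
  using sigma by (auto simp: n_def v_def)

lemma N_pos: "N t > 0" by (simp add: N_def card_level_block)

lemma A_nonneg: "A t \<ge> 0" by (simp add: A_def sum_nonneg)

lemma W_nonneg: "W t \<ge> 0" by (simp add: W_def sum_nonneg)

lemma U_nonneg: "U t \<ge> 0" by (simp add: U_def L2_set_nonneg)

lemma U_square: "(U t)\<^sup>2 = (\<Sum>l\<in>level_block J0 t. (\<mu> l)\<^sup>2)"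
  by (simp add: U_def L2_set_def sum_nonneg)

lemma sum_N: "(\<Sum>t\<le>R. N t) = n" by (simp add: N_def n_def sum_card_level_block)

lemma sum_N_le: "t \<le> R \<Longrightarrow> (\<Sum>s=a..t. N s) \<le> 2 ^ (J0 + t)"
  using sum_mono2[of "{..t}" "{a..t}" N] N_pos
  by (auto simp: N_def sum_card_level_block less_imp_le)

lemma D_eq: "D t = W t - N t" by (simp add: D_def W_def N_def sum_subtractf)

lemma A_eq: "A t = (U t)\<^sup>2 + 2 * sqrt v * C t + v * W t"
  using v_pos
  by (simp add: A_def U_square C_def W_def power2_sum power_mult_distrib sum.distrib
      sum_distrib_left mult_ac)

lemma C_le: "\<bar>C t\<bar> \<le> U t * sqrt (W t)"
proof -
  have "\<bar>C t\<bar> \<le> (\<Sum>l\<in>level_block J0 t. \<bar>\<mu> l\<bar> * \<bar>w l\<bar>)"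
    unfolding C_def abs_mult[symmetric] by (rule sum_abs)
  also have "\<dots> \<le> L2_set \<mu> (level_block J0 t) * L2_set w (level_block J0 t)"
    by (rule L2_set_mult_ineq)
  finally show ?thesis by (simp add: U_def W_def L2_set_def)
qed

lemma mono: "monotone_chain R h" using minimizer by (simp add: chain_minimizer_def)

text \<open>The segment from \<open>chain_minimizer_block\<close> ends at t. Its energies are
  nonnegative, so their sum dominates \<open>A t\<close>, and it has at most 2^(J0+t) indices. For a
  fixed block the bound is O(v) however large \<mu> is.\<close>

lemma shrink_bound:
  assumes "t \<le> R"
  shows "(1 - h t) * A t \<le> 2 ^ (J0 + t) * v"
proof -
  obtain a where a: "a \<le> t" "(1 - h t) * (\<Sum>s=a..t. A s) \<le> (\<Sum>s=a..t. N s) * v"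
    using chain_minimizer_block[OF minimizer assms] N_pos v_pos
    by (metis less_imp_le mult_nonneg_nonneg)
  have "A t \<le> (\<Sum>s=a..t. A s)" using a A_nonneg by (intro member_le_sum) auto
  then have "(1 - h t) * A t \<le> (1 - h t) * (\<Sum>s=a..t. A s)"
    using monotone_chain_le_one[OF mono assms] by (intro mult_left_mono) auto
  also note a(2)
  also have "(\<Sum>s=a..t. N s) * v \<le> 2 ^ (J0 + t) * v"
    using v_pos sum_N_le[OF assms] by (intro mult_right_mono) auto
  finally show ?thesis .
qed

text \<open>Two regimes. If the signal \<open>U t\<close> is at least twice the noise norm sqrt (v
  \<open>W t\<close>), then \<open>A t\<close> >= \<open>U t\<close>^2 / 4 and sqrt v
  |\<open>C t\<close>| <= \<open>U t\<close>^2 / 2, so \<open>shrink_bound\<close> applies.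
  Otherwise the signal is itself of the size of the noise and Cauchy-Schwarz suffices. Either way
  \<mu> drops out.\<close>

lemma cross_bound:
  assumes "t \<le> R" "h t \<ge> - 1"
  shows "(1 - h t) * \<bar>C t\<bar> \<le> 2 * 2 ^ (J0 + t) * sqrt v + 4 * sqrt v * W t"
proof (cases "2 * sqrt (v * W t) \<le> U t")
  case True
  have h1: "h t \<le> 1" by (rule monotone_chain_le_one[OF mono assms(1)])
  have "U t \<le> L2_set (\<lambda>l. \<mu> l + sqrt v * w l) (level_block J0 t) + L2_set (\<lambda>l. - sqrt v * w l) (level_block J0 t)"
    using L2_set_triangle_ineq[of "\<lambda>l. \<mu> l + sqrt v * w l" "\<lambda>l. - sqrt v * w l" "level_block J0 t"]
    by (simp add: U_def)
  also have "L2_set (\<lambda>l. - sqrt v * w l) (level_block J0 t) = sqrt (v * W t)"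
    using v_pos by (simp add: L2_set_def W_def power_mult_distrib sum_distrib_left)
  also have "L2_set (\<lambda>l. \<mu> l + sqrt v * w l) (level_block J0 t) = sqrt (A t)"
    by (simp add: L2_set_def A_def)
  finally have "U t / 2 \<le> sqrt (A t)" using True by simp
  then have "(U t / 2)\<^sup>2 \<le> (sqrt (A t))\<^sup>2" using U_nonneg by (intro power_mono) auto
  then have UA: "(U t)\<^sup>2 \<le> 4 * A t" using A_nonneg by (simp add: power_divide)
  have "sqrt v * ((1 - h t) * \<bar>C t\<bar>) \<le> (1 - h t) * (sqrt v * (U t * sqrt (W t)))"
    using mult_left_mono[OF C_le[of t], of "sqrt v * (1 - h t)"] h1 v_pos
    by (simp add: mult_ac)
  also have "\<dots> = (1 - h t) * (U t * sqrt (v * W t))" by (simp add: real_sqrt_mult)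
  also have "\<dots> \<le> (1 - h t) * (U t * (U t / 2))"
    using h1 True U_nonneg by (intro mult_left_mono) auto
  also have "\<dots> \<le> (1 - h t) * (2 * A t)"
    using h1 UA by (intro mult_left_mono) (auto simp: power2_eq_square)
  also have "\<dots> \<le> 2 * (2 ^ (J0 + t) * v)" using shrink_bound[OF assms(1)] by linarith
  also have "\<dots> = sqrt v * (2 * 2 ^ (J0 + t) * sqrt v)" using v_pos by simp
  finally have "(1 - h t) * \<bar>C t\<bar> \<le> 2 * 2 ^ (J0 + t) * sqrt v"
    using v_pos by (simp add: mult_le_cancel_left)
  moreover have "0 \<le> 4 * sqrt v * W t" using v_pos W_nonneg[of t] by simp
  ultimately show ?thesis by linarith
next
  case False
  have "\<bar>C t\<bar> \<le> 2 * sqrt (v * W t) * sqrt (W t)"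
    by (rule order_trans[OF C_le]) (use False W_nonneg[of t] in \<open>auto intro!: mult_right_mono\<close>)
  also have "\<dots> = 2 * sqrt v * W t" using W_nonneg[of t] by (simp add: real_sqrt_mult)
  finally have C: "\<bar>C t\<bar> \<le> 2 * sqrt v * W t" .
  have "(1 - h t) * \<bar>C t\<bar> \<le> 2 * (2 * sqrt v * W t)"
    using C assms(2) monotone_chain_le_one[OF mono assms(1)] by (intro mult_mono) auto
  moreover have "0 \<le> 2 * 2 ^ (J0 + t) * sqrt v" using v_pos by simp
  ultimately show ?thesis by linarith
qed

text \<open>The unknown squared bias (1-h)^2 \<open>U t\<close>^2 occurs in the loss and in its
  estimate and cancels. What remains is affine in \<open>h\<close>; v and sqrt v become \<sigma>^2 /
  sqrt n and \<sigma> after multiplication by sqrt n.\<close>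

lemma loss_minus_risk:
  "sqrt n * ((\<Sum>t\<le>R. \<Sum>l\<in>level_block J0 t. (\<mu> l - h t * (\<mu> l + sqrt v * w l))\<^sup>2) - chain_risk v R N A h)
    = \<sigma>\<^sup>2 / sqrt n * (\<Sum>t\<le>R. (2 * h t - 1) * D t) - 2 * \<sigma> * (\<Sum>t\<le>R. (1 - h t) * C t)"
proof -
  have sv: "sqrt v * sqrt v = v" using v_pos by simp
  have diff: "(\<Sum>l\<in>level_block J0 t. (\<mu> l - h t * (\<mu> l + sqrt v * w l))\<^sup>2)
      - ((h t)\<^sup>2 * (N t * v) + (1 - h t)\<^sup>2 * (A t - N t * v))
      = v * ((2 * h t - 1) * D t) - 2 * sqrt v * ((1 - h t) * C t)" for t
  proof -
    have "(\<mu> l - h t * (\<mu> l + sqrt v * w l))\<^sup>2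
        = (1 - h t)\<^sup>2 * (\<mu> l)\<^sup>2 - 2 * h t * (1 - h t) * sqrt v * (\<mu> l * w l) + (h t)\<^sup>2 * v * (w l)\<^sup>2" for l
    proof -
      have "(\<mu> l - h t * (\<mu> l + sqrt v * w l))\<^sup>2
        = (1 - h t)\<^sup>2 * (\<mu> l)\<^sup>2 - 2 * h t * (1 - h t) * sqrt v * (\<mu> l * w l) + (h t)\<^sup>2 * (sqrt v * sqrt v) * (w l)\<^sup>2"
        by (simp add: power2_eq_square algebra_simps del: real_sqrt_mult_self)
      then show ?thesis by (simp only: sv)
    qed
    then have "(\<Sum>l\<in>level_block J0 t. (\<mu> l - h t * (\<mu> l + sqrt v * w l))\<^sup>2)
        = (1 - h t)\<^sup>2 * (U t)\<^sup>2 - 2 * h t * (1 - h t) * sqrt v * C t + (h t)\<^sup>2 * v * W t"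
      by (simp add: U_square C_def W_def sum.distrib sum_subtractf sum_distrib_left)
    moreover have "(1 - x)\<^sup>2 * u - 2 * x * (1 - x) * s * c + x\<^sup>2 * v * y
        - (x\<^sup>2 * (m * v) + (1 - x)\<^sup>2 * (u + 2 * s * c + v * y - m * v))
        = v * ((2 * x - 1) * (y - m)) - 2 * s * ((1 - x) * c)" for x u s c y m :: real
      by (simp add: power2_eq_square algebra_simps)
    ultimately show ?thesis
      by (simp only: A_eq D_eq)
  qed
  have "(\<Sum>t\<le>R. \<Sum>l\<in>level_block J0 t. (\<mu> l - h t * (\<mu> l + sqrt v * w l))\<^sup>2) - chain_risk v R N A h
      = v * (\<Sum>t\<le>R. (2 * h t - 1) * D t) - 2 * sqrt v * (\<Sum>t\<le>R. (1 - h t) * C t)"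
    unfolding chain_risk_def sum_subtractf[symmetric] diff unfolding sum_subtractf sum_distrib_left ..
  moreover have "sqrt n * v = \<sigma>\<^sup>2 / sqrt n" "sqrt n * sqrt v = \<sigma>"
    using n_pos sigma by (simp_all add: v_def real_sqrt_divide field_simps)
  ultimately show ?thesis by (simp only: right_diff_distrib mult.assoc[symmetric]) (simp add: mult_ac)
qed


text \<open>Upper side: on the finest blocks the energies are nearly v times the sizes, so the
  vertices lie below \<epsilon> and \<open>chain_minimizer_le\<close> applies. Lower side: if
  \<open>h R\<close> were below -4\<epsilon>, the segment of constancy ending at R would have too
  much energy, since all but the fraction \<epsilon> of the indices lie in the finest
  blocks.\<close>

lemma shrink_small:
  fixes m :: nat and \<epsilon> :: real
  assumes m: "1 \<le> m" "m < R" and eps: "\<epsilon> = 1 / 2 ^ (m + 1)"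
    and A: "\<And>t. R - m \<le> t \<Longrightarrow> t \<le> R \<Longrightarrow> \<bar>A t - v * N t\<bar> \<le> \<epsilon> * (v * N t)"
  shows "\<And>t. t \<le> R \<Longrightarrow> \<bar>h t\<bar> \<le> 1" "\<And>t. R - m \<le> t \<Longrightarrow> t \<le> R \<Longrightarrow> \<bar>h t\<bar> \<le> 4 * \<epsilon>"
proof -
  have "(2::real) ^ 2 \<le> 2 ^ (m + 1)" using m by (intro power_increasing) auto
  then have e: "0 < \<epsilon>" "\<epsilon> \<le> 1/4" unfolding eps by (auto simp: field_simps)
  have vN: "0 < v * N t" for t using v_pos N_pos by simp
  have up: "h (R - m) \<le> \<epsilon>"
  proof (rule chain_minimizer_le[OF minimizer])
    fix t assume t: "R - m \<le> t" "t \<le> R"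
    have "A t \<le> (1 + \<epsilon>) * (v * N t)" using A[OF t] by (simp add: algebra_simps)
    then have "(1 - \<epsilon>) * A t \<le> (1 - \<epsilon>) * ((1 + \<epsilon>) * (v * N t))"
      using e by (intro mult_left_mono) auto
    also have "\<dots> = (1 - \<epsilon>\<^sup>2) * (v * N t)" by (simp add: algebra_simps power2_eq_square)
    also have "\<dots> \<le> 1 * (v * N t)" using vN[of t] by (intro mult_right_mono) auto
    finally show "(1 - \<epsilon>) * A t \<le> N t * v" by (simp add: mult_ac)
  qed (use A_nonneg vN in \<open>auto simp: mult.commute\<close>)
  have low: "- 4 * \<epsilon> \<le> h R"
  proof (rule ccontr)
    assume "\<not> ?thesis"
    then have h: "1 + 4 * \<epsilon> < 1 - h R" by simp
    obtain a where a: "a \<le> R" "(1 - h R) * (\<Sum>s=a..R. A s) \<le> (\<Sum>s=a..R. N s) * v"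
      using chain_minimizer_block[OF minimizer, of R] vN
      by (metis less_imp_le mult.commute order_refl)
    \<comment> \<open>The segment may begin inside or before the finest blocks; the energies are
      controlled only on its part within them.\<close>
    define b where "b = max a (R - m)"
    define Na Nb where "Na = (\<Sum>s=a..R. N s)" and "Nb = (\<Sum>s=b..R. N s)"
    have Na0: "Na > 0" using a N_pos unfolding Na_def by (intro sum_pos) auto
    have "(1 - \<epsilon>) * (v * Nb) \<le> (\<Sum>s=b..R. A s)"
      unfolding Nb_def sum_distrib_left
    proof (rule sum_mono)
      fix s assume "s \<in> {b..R}"
      then show "(1 - \<epsilon>) * (v * N s) \<le> A s" using A[of s] by (simp add: b_def algebra_simps)
    qed
    also have "\<dots> \<le> (\<Sum>s=a..R. A s)"
      using A_nonneg by (intro sum_mono2) (auto simp: b_def)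
    finally have SA: "(1 - \<epsilon>) * (v * Nb) \<le> (\<Sum>s=a..R. A s)" .
    have Nab: "(1 - \<epsilon>) * Na \<le> Nb"
    proof (cases "b = a")
      case True
      then show ?thesis using e Na0 by (simp add: Na_def Nb_def mult_le_cancel_right1)
    next
      case False
      then have "b = R - m" by (simp add: b_def max_def split: if_splits)
      then have "Nb = 2 ^ (J0 + R) - 2 ^ (J0 + (R - m) - 1)"
        using m by (simp add: Nb_def N_def sum_card_level_block_from)
      also have "(2::real) ^ (J0 + (R - m) - 1) = \<epsilon> * 2 ^ (J0 + R)"
      proof -
        have "(2::real) ^ (J0 + R) = 2 ^ (J0 + (R - m) - 1) * 2 ^ (m + 1)"
          by (rule power_two_split) (use m in simp)
        then show ?thesis by (simp add: eps)
      qed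
      finally have "Nb = (1 - \<epsilon>) * n" by (simp add: n_def algebra_simps)
      moreover have "Na \<le> n" using sum_N_le[of R a] by (simp add: Na_def n_def)
      ultimately show ?thesis using e by (simp add: mult_left_mono)
    qed
    have "(1 + 4 * \<epsilon>) * (1 - \<epsilon>)\<^sup>2 * (v * Na) = (1 + 4 * \<epsilon>) * ((1 - \<epsilon>) * (v * ((1 - \<epsilon>) * Na)))"
      by (simp add: power2_eq_square)
    also have "\<dots> \<le> (1 + 4 * \<epsilon>) * ((1 - \<epsilon>) * (v * Nb))"
      using e v_pos Nab by (intro mult_left_mono) auto
    also have "\<dots> \<le> (1 + 4 * \<epsilon>) * (\<Sum>s=a..R. A s)"
      using SA e by (intro mult_left_mono) auto
    also have "\<dots> \<le> (1 - h R) * (\<Sum>s=a..R. A s)"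
      using h A_nonneg by (intro mult_right_mono sum_nonneg) auto
    also have "\<dots> \<le> 1 * (v * Na)" using a(2) by (simp add: Na_def mult_ac)
    finally have le1: "(1 + 4 * \<epsilon>) * (1 - \<epsilon>)\<^sup>2 \<le> 1"
      using Na0 v_pos by (simp only: mult_le_cancel_right) (simp add: zero_less_mult_iff)
    \<comment> \<open>The factor 4 pays for two losses of \<epsilon>, one in the energies and one in
      the number of indices; for \<epsilon> <= 1/4 a positive margin remains.\<close>
    have "(1 + 4 * \<epsilon>) * (1 - \<epsilon>)\<^sup>2 = 1 + \<epsilon> * (2 - 7 * \<epsilon>) + 4 * \<epsilon> * \<epsilon>\<^sup>2"
      by (simp add: power2_eq_square algebra_simps)
    moreover have "\<epsilon> * (2 - 7 * \<epsilon>) > 0" "4 * \<epsilon> * \<epsilon>\<^sup>2 > 0" using e by auto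
    ultimately show False using le1 by linarith
  qed
  have ge: "- 4 * \<epsilon> \<le> h t" if "t \<le> R" for t
    using low monotone_chain_antimono[OF mono that] by simp
  show "\<bar>h t\<bar> \<le> 1" if "t \<le> R" for t
    using ge[OF that] monotone_chain_le_one[OF mono that] e by simp
  show "\<bar>h t\<bar> \<le> 4 * \<epsilon>" if "R - m \<le> t" "t \<le> R" for t
    using ge[OF that(2)] monotone_chain_antimono[OF mono that] up e by simp
qed

text \<open>The deviation is U^2 + 2 sqrt v C + v D. With the stated constants the parts are at most
  1/100, 2/5 and 1/2 of \<sigma>^2 \<epsilon>^2, and \<sigma>^2 \<epsilon>^2 = \<epsilon> v
  (\<epsilon> n), where \<epsilon> n is the size of block R-m, the smallest one considered.\<close>

lemma A_close:
  assumes m: "1 \<le> m" "m < R" and eps: "\<epsilon> = 1 / 2 ^ (m + 1)"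
    and D: "\<And>t. R - m \<le> t \<Longrightarrow> t \<le> R \<Longrightarrow> \<bar>D t\<bar> \<le> \<epsilon>\<^sup>2 / 2 * n"
    and U: "\<And>t. R - m \<le> t \<Longrightarrow> t \<le> R \<Longrightarrow> U t \<le> \<sigma> * \<epsilon>\<^sup>2 / 10"
    and t: "R - m \<le> t" "t \<le> R"
  shows "\<bar>A t - v * N t\<bar> \<le> \<epsilon> * (v * N t)"
proof -
  have e: "0 < \<epsilon>" "\<epsilon> \<le> 1"
    unfolding eps using one_le_power[of "2::real" "m + 1"] by (auto simp: divide_le_eq_1)
  then have e2: "0 < \<epsilon>\<^sup>2" "\<epsilon>\<^sup>2 \<le> 1" by (auto simp: power_le_one)
  have "\<epsilon> * n = 2 ^ (J0 + (R - m) - 1)"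
  proof -
    have "(2::real) ^ (J0 + R) = 2 ^ (J0 + (R - m) - 1) * 2 ^ (m + 1)"
      by (rule power_two_split) (use m in simp)
    then show ?thesis by (simp add: eps n_def)
  qed
  also have "\<dots> \<le> 2 ^ (J0 + t - 1)" using t m by (intro power_increasing) auto
  also have "\<dots> = N t"
  proof -
    have "t \<noteq> 0" using t m by simp
    then show ?thesis by (simp add: N_def card_level_block)
  qed
  finally have Nt: "\<epsilon> * n \<le> N t" .
  have "N t \<le> n" using member_le_sum[of t "{..R}" N] N_pos sum_N t by (simp add: less_imp_le)
  moreover have "\<bar>D t\<bar> \<le> 1 * n"
  proof -
    have "\<epsilon>\<^sup>2 / 2 * n \<le> 1 * n" using e2 n_pos by (intro mult_right_mono) auto
    then show ?thesis using D[OF t] by simp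
  qed
  \<comment> \<open>A crude constant, chosen as a square for the root in the next line.\<close>
  ultimately have "W t \<le> 2\<^sup>2 * n" using D_eq[of t] n_pos by simp
  then have "sqrt (W t) \<le> sqrt (2\<^sup>2 * n)" by (rule real_sqrt_le_mono)
  then have sW: "sqrt (W t) \<le> 2 * sqrt n" by (simp add: real_sqrt_mult)
  have "\<bar>C t\<bar> \<le> (\<sigma> * \<epsilon>\<^sup>2 / 10) * (2 * sqrt n)"
    by (rule order_trans[OF C_le]) (intro mult_mono U t sW, use sigma W_nonneg in auto)
  then have "sqrt v * \<bar>C t\<bar> \<le> sqrt v * ((\<sigma> * \<epsilon>\<^sup>2 / 10) * (2 * sqrt n))"
    using v_pos by (intro mult_left_mono) auto
  also have "\<dots> = (sqrt v * sqrt n) * (\<sigma> * \<epsilon>\<^sup>2 / 5)" by simp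
  also have "sqrt v * sqrt n = \<sigma>" using vn sigma by (simp flip: real_sqrt_mult)
  finally have C: "sqrt v * \<bar>C t\<bar> \<le> \<sigma>\<^sup>2 * \<epsilon>\<^sup>2 / 5" by (simp add: power2_eq_square)
  have "(U t)\<^sup>2 \<le> (\<sigma> * \<epsilon>\<^sup>2 / 10)\<^sup>2" by (rule power_mono[OF U[OF t] U_nonneg])
  also have "\<dots> = \<sigma>\<^sup>2 * (\<epsilon>\<^sup>2 * \<epsilon>\<^sup>2) / 100" by (simp add: power2_eq_square)
  also have "\<dots> \<le> \<sigma>\<^sup>2 * (\<epsilon>\<^sup>2 * 1) / 100"
    using e2 by (intro divide_right_mono mult_left_mono) auto
  finally have U2: "(U t)\<^sup>2 \<le> \<sigma>\<^sup>2 * \<epsilon>\<^sup>2 / 100" by simp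
  have "v * \<bar>D t\<bar> \<le> v * (\<epsilon>\<^sup>2 / 2 * n)" using D[OF t] v_pos by (intro mult_left_mono) auto
  also have "\<dots> = (v * n) * \<epsilon>\<^sup>2 / 2" by simp
  finally have vD: "v * \<bar>D t\<bar> \<le> \<sigma>\<^sup>2 * \<epsilon>\<^sup>2 / 2" by (simp add: vn)
  have "A t - v * N t = (U t)\<^sup>2 + 2 * (sqrt v * C t) + v * D t"
    unfolding A_eq D_eq by (simp add: algebra_simps)
  then have "\<bar>A t - v * N t\<bar> \<le> (U t)\<^sup>2 + 2 * (sqrt v * \<bar>C t\<bar>) + v * \<bar>D t\<bar>"
  proof -
    have "\<bar>u + 2 * x + y\<bar> \<le> u + 2 * \<bar>x\<bar> + \<bar>y\<bar>" if "0 \<le> u" for u x y :: real using that by linarith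
    from this[of "(U t)\<^sup>2" "sqrt v * C t" "v * D t"] v_pos show ?thesis
      unfolding \<open>A t - v * N t = _\<close> by (simp add: abs_mult)
  qed
  also have "\<dots> \<le> \<sigma>\<^sup>2 * \<epsilon>\<^sup>2"
  proof -
    have "0 \<le> \<sigma>\<^sup>2 * \<epsilon>\<^sup>2" by simp
    then show ?thesis using C U2 vD by linarith
  qed
  also have "\<dots> = \<epsilon> * (v * (\<epsilon> * n))" unfolding vn[symmetric] by (simp add: power2_eq_square)
  also have "\<dots> \<le> \<epsilon> * (v * N t)" using e v_pos Nt by (intro mult_left_mono) auto
  finally show ?thesis .
qed


section \<open>Pivot and scale estimate when the finest blocks are nearly pure noise\<close>

context
  fixes m :: nat and \<epsilon> :: real
  assumes m: "1 \<le> m" "m < R" and eps: "\<epsilon> = 1 / 2 ^ (m + 1)"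
    and D_small: "\<And>t. R - m \<le> t \<Longrightarrow> t \<le> R \<Longrightarrow> \<bar>D t\<bar> \<le> \<epsilon>\<^sup>2 / 2 * n"
    and U_small: "\<And>t. R - m \<le> t \<Longrightarrow> t \<le> R \<Longrightarrow> U t \<le> \<sigma> * \<epsilon>\<^sup>2 / 10"
begin

lemma h_bound: "t \<le> R \<Longrightarrow> \<bar>h t\<bar> \<le> (if t < R - m then 1 else 4 * \<epsilon>)"
  and h_le_one: "t \<le> R \<Longrightarrow> \<bar>h t\<bar> \<le> 1"
  using shrink_small[OF m eps A_close[OF m eps D_small U_small]] by auto

text \<open>Writing 2h-1 as -1 + 2h splits off the leading term. The rest is 2 \<sigma>^2 / sqrt n
  times the sum of h D, which the bounds on \<open>h\<close> control, and the cross term, which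
  \<open>cross_bound\<close> controls on the coarse blocks.\<close>

lemma process_error_bound:
  "\<bar>\<sigma>\<^sup>2 / sqrt n * (\<Sum>t\<le>R. (2 * h t - 1) * D t) - 2 * \<sigma> * (\<Sum>t\<le>R. (1 - h t) * C t)
      + \<sigma>\<^sup>2 / sqrt n * (\<Sum>t\<le>R. D t)\<bar> \<le> process_error J0 R \<sigma> \<mu> w m"
proof -
  have "\<sigma>\<^sup>2 / sqrt n * (\<Sum>t\<le>R. (2 * h t - 1) * D t) - 2 * \<sigma> * (\<Sum>t\<le>R. (1 - h t) * C t)
      + \<sigma>\<^sup>2 / sqrt n * (\<Sum>t\<le>R. D t)
      = 2 * \<sigma>\<^sup>2 / sqrt n * (\<Sum>t\<le>R. h t * D t) - 2 * \<sigma> * (\<Sum>t\<le>R. (1 - h t) * C t)"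
  proof -
    have "(\<Sum>t\<le>R. (2 * h t - 1) * D t) = 2 * (\<Sum>t\<le>R. h t * D t) - (\<Sum>t\<le>R. D t)"
      by (simp add: left_diff_distrib sum_subtractf sum_distrib_left mult.assoc)
    then show ?thesis by (simp only:) (simp add: right_diff_distrib diff_divide_distrib)
  qed
  moreover have "\<bar>\<Sum>t\<le>R. h t * D t\<bar> \<le> (\<Sum>t\<le>R. (if t < R - m then 1 else 4 * \<epsilon>) * \<bar>D t\<bar>)"
  proof (rule order_trans[OF sum_abs sum_mono])
    fix t assume "t \<in> {..R}"
    then show "\<bar>h t * D t\<bar> \<le> (if t < R - m then 1 else 4 * \<epsilon>) * \<bar>D t\<bar>"
      unfolding abs_mult using h_bound[of t] by (intro mult_right_mono) auto
  qed
  then have "\<bar>2 * \<sigma>\<^sup>2 / sqrt n * (\<Sum>t\<le>R. h t * D t)\<bar>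
      \<le> 2 * \<sigma>\<^sup>2 / sqrt n * (\<Sum>t\<le>R. (if t < R - m then 1 else 4 * \<epsilon>) * \<bar>D t\<bar>)"
    unfolding abs_mult[of "2 * \<sigma>\<^sup>2 / sqrt n"] using n_pos by (simp add: mult_left_mono divide_right_mono)
  moreover have "\<bar>\<Sum>t\<le>R. (1 - h t) * C t\<bar>
      \<le> (\<Sum>t\<le>R. if t \<le> m then 2 * 2 ^ (J0 + t) * sqrt v + 4 * sqrt v * W t else 2 * \<bar>C t\<bar>)"
  proof (rule order_trans[OF sum_abs sum_mono])
    fix t assume "t \<in> {..R}"
    then have t: "\<bar>h t\<bar> \<le> 1" "t \<le> R" using h_le_one by auto
    then have "\<bar>(1 - h t) * C t\<bar> = (1 - h t) * \<bar>C t\<bar>" by (simp add: abs_mult)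
    moreover have "(1 - h t) * \<bar>C t\<bar> \<le> 2 * \<bar>C t\<bar>" using t by (intro mult_right_mono) auto
    ultimately show "\<bar>(1 - h t) * C t\<bar>
        \<le> (if t \<le> m then 2 * 2 ^ (J0 + t) * sqrt v + 4 * sqrt v * W t else 2 * \<bar>C t\<bar>)"
      using cross_bound[of t] t by auto
  qed
  then have "\<bar>2 * \<sigma> * (\<Sum>t\<le>R. (1 - h t) * C t)\<bar>
      \<le> 2 * \<sigma> * (\<Sum>t\<le>R. if t \<le> m then 2 * 2 ^ (J0 + t) * sqrt v + 4 * sqrt v * W t else 2 * \<bar>C t\<bar>)"
    unfolding abs_mult[of "2 * \<sigma>"] using sigma by (simp add: mult_left_mono)
  moreover have "process_error J0 R \<sigma> \<mu> w m
      = 2 * \<sigma>\<^sup>2 / sqrt n * (\<Sum>t\<le>R. (if t < R - m then 1 else 4 * \<epsilon>) * \<bar>D t\<bar>)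
      + 2 * \<sigma> * (\<Sum>t\<le>R. if t \<le> m then 2 * 2 ^ (J0 + t) * sqrt v + 4 * sqrt v * W t else 2 * \<bar>C t\<bar>)"
  proof -
    have "4 / 2 ^ (m + 1) = 4 * \<epsilon>" by (simp add: eps)
    then show ?thesis
      unfolding process_error_def n_def v_def D_def W_def C_def excess_def energy_def cross_def
      by (simp only:)
  qed
  moreover have "\<bar>a - b\<bar> \<le> c + d" if "\<bar>a\<bar> \<le> c" "\<bar>b\<bar> \<le> d" for a b c d :: real
    using that by linarith
  ultimately show ?thesis by (simp only:)
qed

text \<open>Since (2h-1)^2 - 1 = 4h(h-1) is at most 8|h| in size, the blocks before R-m contribute 8
  \<epsilon> n and the remaining ones at most 32 \<epsilon> n, together 40 \<epsilon> n. The second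
  sum is small because its coarse part is bounded by ((1-h) A)^2, of order v^2, and its fine part by
  fourth powers of \<mu> and of the noise.\<close>

lemma variance_error_bound:
  "\<bar>2 * \<sigma> ^ 4 / n * (\<Sum>t\<le>R. \<Sum>l\<in>level_block J0 t. (2 * h t - 1)\<^sup>2)
      + 4 * \<sigma>\<^sup>2 * (\<Sum>t\<le>R. \<Sum>l\<in>level_block J0 t. ((\<mu> l + sqrt v * w l)\<^sup>2 - v)\<^sup>2 * (1 - h t)\<^sup>2)
      - 2 * \<sigma> ^ 4\<bar> \<le> variance_error J0 R \<sigma> \<mu> w m"
proof -
  have e: "0 < \<epsilon>" by (simp add: eps)
  have "\<bar>(\<Sum>t\<le>R. N t * (2 * h t - 1)\<^sup>2) - n\<bar> = \<bar>\<Sum>t\<le>R. N t * (4 * (h t * (h t - 1)))\<bar>"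
    unfolding sum_N[symmetric] sum_subtractf[symmetric]
    by (rule arg_cong[where f=abs], rule sum.cong) (simp_all add: power2_eq_square algebra_simps)
  also have "\<dots> \<le> (\<Sum>t\<le>R. N t * (if t < R - m then 8 else 0) + N t * (32 * \<epsilon>))"
  proof (rule order_trans[OF sum_abs sum_mono])
    fix t assume "t \<in> {..R}"
    then have t: "t \<le> R" by simp
    have "\<bar>4 * (h t * (h t - 1))\<bar> \<le> 4 * (\<bar>h t\<bar> * 2)"
    proof -
      have "\<bar>h t - 1\<bar> \<le> 2" using h_le_one[OF t] by linarith
      then have "\<bar>h t\<bar> * \<bar>h t - 1\<bar> \<le> \<bar>h t\<bar> * 2" by (intro mult_left_mono) auto
      then show ?thesis unfolding abs_mult by simp
    qed
    also have "\<dots> \<le> (if t < R - m then 8 else 0) + 32 * \<epsilon>"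
      using h_bound[OF t] e by (auto split: if_splits)
    finally show "\<bar>N t * (4 * (h t * (h t - 1)))\<bar> \<le> N t * (if t < R - m then 8 else 0) + N t * (32 * \<epsilon>)"
      unfolding abs_mult[of "N t"] distrib_left[symmetric] using N_pos[of t] by (intro mult_mono) auto
  qed
  also have "\<dots> = 8 * (\<Sum>t\<in>{..R-m-1}. N t) + 32 * \<epsilon> * n"
  proof -
    have "(\<Sum>t\<le>R. N t * (if t < R - m then 8 else 0)) = (\<Sum>t\<in>{..R-m-1}. N t * 8)"
      using m by (intro sum.mono_neutral_cong_right) auto
    then show ?thesis
      by (simp add: sum.distrib sum_distrib_left flip: sum_N) (simp add: mult_ac)
  qed
  also have "(\<Sum>t\<in>{..R-m-1}. N t) = \<epsilon> * n"
    using m power_two_split[OF m(2), of J0] by (simp add: N_def sum_card_level_block eps n_def)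
  finally have first: "\<bar>(\<Sum>t\<le>R. N t * (2 * h t - 1)\<^sup>2) - n\<bar> \<le> 40 * \<epsilon> * n" by simp
  have "\<bar>2 * \<sigma> ^ 4 / n * (\<Sum>t\<le>R. N t * (2 * h t - 1)\<^sup>2) - 2 * \<sigma> ^ 4\<bar>
      = \<bar>2 * \<sigma> ^ 4 / n * ((\<Sum>t\<le>R. N t * (2 * h t - 1)\<^sup>2) - n)\<bar>"
    using n_pos by (simp add: right_diff_distrib)
  also have "\<dots> = 2 * \<sigma> ^ 4 / n * \<bar>(\<Sum>t\<le>R. N t * (2 * h t - 1)\<^sup>2) - n\<bar>"
    using n_pos by (simp add: abs_mult)
  also have "\<dots> \<le> 2 * \<sigma> ^ 4 / n * (40 * \<epsilon> * n)"
    using n_pos by (intro mult_left_mono first) simp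
  also have "\<dots> = 80 * \<sigma> ^ 4 * \<epsilon>" using n_pos by simp
  finally have first': "\<bar>2 * \<sigma> ^ 4 / n * (\<Sum>t\<le>R. N t * (2 * h t - 1)\<^sup>2) - 2 * \<sigma> ^ 4\<bar> \<le> 80 * \<sigma> ^ 4 * \<epsilon>" .
  define Q where "Q t = (\<Sum>l\<in>level_block J0 t. ((\<mu> l + sqrt v * w l)\<^sup>2 - v)\<^sup>2 * (1 - h t)\<^sup>2)" for t
  have Q: "Q t \<le> (if t \<le> m then 2 * (2 ^ (J0 + t) * v)\<^sup>2 else 64 * U t ^ 4)
      + (8 * v\<^sup>2 * N t + 64 * v\<^sup>2 * (\<Sum>l\<in>level_block J0 t. (w l) ^ 4))" if t: "t \<le> R" for t
  proof -
    have h4: "(1 - h t)\<^sup>2 \<le> 4"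
    proof -
      have "(1 - h t)\<^sup>2 \<le> 2\<^sup>2" using h_le_one[OF t] by (intro power_mono) auto
      then show ?thesis by simp
    qed
    have "Q t \<le> (\<Sum>l\<in>level_block J0 t. (2 * (\<mu> l + sqrt v * w l) ^ 4 + 2 * v\<^sup>2) * (1 - h t)\<^sup>2)"
      unfolding Q_def
    proof (intro sum_mono mult_right_mono)
      fix l
      have "(y - v)\<^sup>2 \<le> 2 * y\<^sup>2 + 2 * v\<^sup>2" for y
        using zero_le_power2[of "y + v"] by (simp add: power2_eq_square algebra_simps)
      from this[of "(\<mu> l + sqrt v * w l)\<^sup>2"]
      show "((\<mu> l + sqrt v * w l)\<^sup>2 - v)\<^sup>2 \<le> 2 * (\<mu> l + sqrt v * w l) ^ 4 + 2 * v\<^sup>2"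
        by (simp flip: power_mult)
    qed simp
    also have "\<dots> = 2 * ((1 - h t)\<^sup>2 * (\<Sum>l\<in>level_block J0 t. (\<mu> l + sqrt v * w l) ^ 4))
        + 2 * v\<^sup>2 * N t * (1 - h t)\<^sup>2"
      by (simp add: sum_distrib_right[symmetric] sum.distrib sum_distrib_left[symmetric] N_def distrib_right)
    also have "2 * v\<^sup>2 * N t * (1 - h t)\<^sup>2 \<le> 2 * v\<^sup>2 * N t * 4"
      using h4 N_pos[of t] by (intro mult_left_mono) auto
    finally have Q1: "Q t \<le> 2 * ((1 - h t)\<^sup>2 * (\<Sum>l\<in>level_block J0 t. (\<mu> l + sqrt v * w l) ^ 4))
        + 8 * v\<^sup>2 * N t" by simp
    have w4: "0 \<le> 64 * v\<^sup>2 * (\<Sum>l\<in>level_block J0 t. (w l) ^ 4)"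
      by (intro mult_nonneg_nonneg sum_nonneg) auto
    show ?thesis
    proof (cases "t \<le> m")
      case True
      \<comment> \<open>The sum of fourth powers is at most \<open>A t\<close> squared, which leads
        back to \<open>shrink_bound\<close>.\<close>
      have "(1 - h t)\<^sup>2 * (\<Sum>l\<in>level_block J0 t. (\<mu> l + sqrt v * w l) ^ 4) \<le> (1 - h t)\<^sup>2 * (A t)\<^sup>2"
        unfolding A_def by (intro mult_left_mono sum_power4_le) auto
      also have "\<dots> = ((1 - h t) * A t)\<^sup>2" by (simp add: power_mult_distrib)
      also have "\<dots> \<le> (2 ^ (J0 + t) * v)\<^sup>2"
        using h_le_one[OF t] A_nonneg by (intro power_mono shrink_bound[OF t]) auto
      finally show ?thesis using Q1 w4 True by simp
    next
      case False
      have "(\<Sum>l\<in>level_block J0 t. (\<mu> l + sqrt v * w l) ^ 4)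
          \<le> (\<Sum>l\<in>level_block J0 t. 8 * ((\<mu> l) ^ 4 + (sqrt v * w l) ^ 4))"
        by (intro sum_mono power4_add_le)
      also have "\<dots> = 8 * (\<Sum>l\<in>level_block J0 t. (\<mu> l) ^ 4) + 8 * v\<^sup>2 * (\<Sum>l\<in>level_block J0 t. (w l) ^ 4)"
      proof -
        have "sqrt v ^ 4 = v\<^sup>2" using v_pos by (simp add: power4_eq_xxxx power2_eq_square)
        then show ?thesis by (simp add: power_mult_distrib sum.distrib sum_distrib_left mult.assoc)
      qed
      also have "(\<Sum>l\<in>level_block J0 t. (\<mu> l) ^ 4) \<le> U t ^ 4"
        using sum_power4_le[of \<mu> "level_block J0 t"] by (simp add: U_square[symmetric] flip: power_mult)
      finally have X: "(\<Sum>l\<in>level_block J0 t. (\<mu> l + sqrt v * w l) ^ 4)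
          \<le> 8 * U t ^ 4 + 8 * v\<^sup>2 * (\<Sum>l\<in>level_block J0 t. (w l) ^ 4)" by simp
      have "(1 - h t)\<^sup>2 * (\<Sum>l\<in>level_block J0 t. (\<mu> l + sqrt v * w l) ^ 4)
          \<le> 4 * (8 * U t ^ 4 + 8 * v\<^sup>2 * (\<Sum>l\<in>level_block J0 t. (w l) ^ 4))"
        using h4 X by (intro mult_mono) (auto intro!: sum_nonneg)
      then show ?thesis using Q1 False by simp
    qed
  qed
  have "(\<Sum>t\<le>R. Q t) \<le> (\<Sum>t\<le>R. (if t \<le> m then 2 * (2 ^ (J0 + t) * v)\<^sup>2 else 64 * U t ^ 4)
      + (8 * v\<^sup>2 * N t + 64 * v\<^sup>2 * (\<Sum>l\<in>level_block J0 t. (w l) ^ 4)))"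
    by (intro sum_mono Q) simp
  also have "\<dots> = (\<Sum>t\<le>m. 2 * (2 ^ (J0 + t) * v)\<^sup>2) + 64 * (\<Sum>t\<in>{m<..R}. U t ^ 4)
      + (8 * v\<^sup>2 * n + 64 * v\<^sup>2 * (\<Sum>t\<le>R. \<Sum>l\<in>level_block J0 t. (w l) ^ 4))"
  proof -
    have "{..R} = {..m} \<union> {m<..R}" using m by auto
    then have "(\<Sum>t\<le>R. (if t \<le> m then 2 * (2 ^ (J0 + t) * v)\<^sup>2 else 64 * U t ^ 4))
        = (\<Sum>t\<le>m. 2 * (2 ^ (J0 + t) * v)\<^sup>2) + 64 * (\<Sum>t\<in>{m<..R}. U t ^ 4)"
      by (simp only:) (subst sum.union_disjoint, auto simp: sum_distrib_left)
    then show ?thesis by (simp add: sum.distrib sum_distrib_left flip: sum_N)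
  qed
  also have "8 * v\<^sup>2 * n = 8 * \<sigma> ^ 4 / n" using n_pos by (simp add: v_def power2_eq_square power4_eq_xxxx)
  finally have second: "(\<Sum>t\<le>R. Q t) \<le> (\<Sum>t\<le>m. 2 * (2 ^ (J0 + t) * v)\<^sup>2) + 64 * (\<Sum>t\<in>{m<..R}. U t ^ 4)
      + (8 * \<sigma> ^ 4 / n + 64 * v\<^sup>2 * (\<Sum>t\<le>R. \<Sum>l\<in>level_block J0 t. (w l) ^ 4))" .
  have "0 \<le> 4 * \<sigma>\<^sup>2 * (\<Sum>t\<le>R. Q t)" unfolding Q_def by (intro mult_nonneg_nonneg sum_nonneg) auto
  moreover have "4 * \<sigma>\<^sup>2 * (\<Sum>t\<le>R. Q t) \<le> 4 * \<sigma>\<^sup>2 * ((\<Sum>t\<le>m. 2 * (2 ^ (J0 + t) * v)\<^sup>2)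
      + 8 * \<sigma> ^ 4 / n + 64 * (\<Sum>t\<in>{m<..R}. U t ^ 4) + 64 * v\<^sup>2 * (\<Sum>t\<le>R. \<Sum>l\<in>level_block J0 t. (w l) ^ 4))"
    using second by (intro mult_left_mono) auto
  moreover have "\<bar>a + b - c\<bar> \<le> d + e" if "\<bar>a - c\<bar> \<le> d" "0 \<le> b" "b \<le> e" for a b c d e :: real
    using that by linarith
  moreover note first'
  ultimately have "\<bar>2 * \<sigma> ^ 4 / n * (\<Sum>t\<le>R. N t * (2 * h t - 1)\<^sup>2) + 4 * \<sigma>\<^sup>2 * (\<Sum>t\<le>R. Q t) - 2 * \<sigma> ^ 4\<bar>
      \<le> 80 * \<sigma> ^ 4 * \<epsilon> + 4 * \<sigma>\<^sup>2 * ((\<Sum>t\<le>m. 2 * (2 ^ (J0 + t) * v)\<^sup>2)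
      + 8 * \<sigma> ^ 4 / n + 64 * (\<Sum>t\<in>{m<..R}. U t ^ 4) + 64 * v\<^sup>2 * (\<Sum>t\<le>R. \<Sum>l\<in>level_block J0 t. (w l) ^ 4))"
    by (simp only:)
  moreover have "(\<Sum>l\<in>level_block J0 t. (2 * h t - 1)\<^sup>2) = N t * (2 * h t - 1)\<^sup>2" for t
    by (simp add: N_def)
  moreover have "80 * \<sigma> ^ 4 * \<epsilon> = 80 * \<sigma> ^ 4 / 2 ^ (m + 1)" by (simp add: eps)
  ultimately show ?thesis
    unfolding variance_error_def Q_def U_def n_def[symmetric] v_def[symmetric] by (simp only:)
qed

text \<open>Coverage means P <= \<tau> z for the pivot P. After division by sqrt 2 \<sigma>^2 the
  left side is close to -S / sqrt (2n) and the right side to z, and \<open>fit_error\<close> is the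
  sum of the two distances. A negative squared radius needs no separate case.\<close>

lemma coverage_sandwich:
  fixes z S \<tau> :: real
  defines "\<tau> \<equiv> sqrt (2 * \<sigma> ^ 4 / n * (\<Sum>t\<le>R. \<Sum>l\<in>level_block J0 t. (2 * h t - 1)\<^sup>2)
      + 4 * \<sigma>\<^sup>2 * (\<Sum>t\<le>R. \<Sum>l\<in>level_block J0 t. ((\<mu> l + sqrt v * w l)\<^sup>2 - v)\<^sup>2 * (1 - h t)\<^sup>2))"
    and "cover \<equiv> (\<Sum>t\<le>R. \<Sum>l\<in>level_block J0 t. (\<mu> l - h t * (\<mu> l + sqrt v * w l))\<^sup>2)
        \<le> \<tau> * z / sqrt n + chain_risk v R N A h"
  shows "cover \<Longrightarrow> - S / sqrt (2 * n) \<le> z + fit_error J0 R \<sigma> \<mu> w m z S"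
    and "- S / sqrt (2 * n) \<le> z - fit_error J0 R \<sigma> \<mu> w m z S \<Longrightarrow> cover"
proof -
  define P where "P = \<sigma>\<^sup>2 / sqrt n * (\<Sum>t\<le>R. (2 * h t - 1) * D t) - 2 * \<sigma> * (\<Sum>t\<le>R. (1 - h t) * C t)"
  define E where "E = \<sigma>\<^sup>2 / sqrt n * \<bar>(\<Sum>t\<le>R. D t) - S\<bar> + process_error J0 R \<sigma> \<mu> w m"
  define k where "k = sqrt 2 * \<sigma>\<^sup>2"
  have k: "k > 0" using sigma by (simp add: k_def)
  have cover: "cover \<longleftrightarrow> P \<le> \<tau> * z"
  proof -
    have "cover \<longleftrightarrow> sqrt n * ((\<Sum>t\<le>R. \<Sum>l\<in>level_block J0 t. (\<mu> l - h t * (\<mu> l + sqrt v * w l))\<^sup>2) - chain_risk v R N A h)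
      \<le> sqrt n * (\<tau> * z / sqrt n)"
      unfolding cover_def using n_pos by (subst mult_le_cancel_left_pos) auto
    then show ?thesis unfolding loss_minus_risk P_def using n_pos by simp
  qed
  have "\<bar>P + \<sigma>\<^sup>2 / sqrt n * (\<Sum>t\<le>R. D t)\<bar> \<le> process_error J0 R \<sigma> \<mu> w m"
    unfolding P_def by (rule process_error_bound)
  moreover have "\<bar>\<sigma>\<^sup>2 / sqrt n * (\<Sum>t\<le>R. D t) - \<sigma>\<^sup>2 / sqrt n * S\<bar> = \<sigma>\<^sup>2 / sqrt n * \<bar>(\<Sum>t\<le>R. D t) - S\<bar>"
    by (simp only: right_diff_distrib[symmetric] abs_mult) (use n_pos in simp)
  ultimately have PS: "\<bar>P + \<sigma>\<^sup>2 / sqrt n * S\<bar> \<le> E" 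
  proof -
    have "\<bar>p + b\<bar> \<le> \<bar>a - b\<bar> + q" if "\<bar>p + a\<bar> \<le> q" for p a b q :: real using that by linarith
    from this[OF \<open>\<bar>P + \<sigma>\<^sup>2 / sqrt n * (\<Sum>t\<le>R. D t)\<bar> \<le> _\<close>, of "\<sigma>\<^sup>2 / sqrt n * S"] show ?thesis
      unfolding E_def \<open>\<bar>\<sigma>\<^sup>2 / sqrt n * (\<Sum>t\<le>R. D t) - \<sigma>\<^sup>2 / sqrt n * S\<bar> = _\<close> .
  qed
  have "\<sigma>\<^sup>2 / sqrt n * S = k * (S / sqrt (2 * n))" by (simp add: k_def real_sqrt_mult)
  then have "\<bar>P / k + S / sqrt (2 * n)\<bar> = \<bar>P + \<sigma>\<^sup>2 / sqrt n * S\<bar> / k"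
  proof -
    have "P / k + S / sqrt (2 * n) = (P + k * (S / sqrt (2 * n))) / k"
      using k by (simp add: add_divide_distrib)
    then show ?thesis
      unfolding \<open>\<sigma>\<^sup>2 / sqrt n * S = _\<close> using k by (simp only: abs_div_pos[OF k])
  qed
  also have "\<dots> \<le> E / k" using PS k by (intro divide_right_mono) auto
  finally have 1: "\<bar>P / k + S / sqrt (2 * n)\<bar> \<le> E / k" .
  define \<tau>2 where "\<tau>2 = 2 * \<sigma> ^ 4 / n * (\<Sum>t\<le>R. \<Sum>l\<in>level_block J0 t. (2 * h t - 1)\<^sup>2)
      + 4 * \<sigma>\<^sup>2 * (\<Sum>t\<le>R. \<Sum>l\<in>level_block J0 t. ((\<mu> l + sqrt v * w l)\<^sup>2 - v)\<^sup>2 * (1 - h t)\<^sup>2)"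
  have "0 \<le> \<tau>2"
    unfolding \<tau>2_def using n_pos by (intro add_nonneg_nonneg mult_nonneg_nonneg sum_nonneg divide_nonneg_pos; simp)
  moreover have "\<tau> = sqrt \<tau>2" by (simp only: \<tau>_def \<tau>2_def)
  ultimately have \<tau>2: "\<tau> = sqrt \<tau>2" "0 \<le> \<tau>2" by auto
  have "sqrt (2 * \<sigma> ^ 4) = k" using sigma by (simp add: k_def real_sqrt_mult power4_eq_xxxx power2_eq_square)
  then have "\<bar>\<tau> / k - 1\<bar> \<le> \<bar>\<tau>2 - 2 * \<sigma> ^ 4\<bar> / (2 * \<sigma> ^ 4)"
    using abs_sqrt_ratio_le[OF \<tau>2(2), of "2 * \<sigma> ^ 4"] sigma \<tau>2(1) by simp
  also have "\<dots> \<le> variance_error J0 R \<sigma> \<mu> w m / (2 * \<sigma> ^ 4)"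
    using variance_error_bound unfolding \<tau>2_def[symmetric] by (intro divide_right_mono) auto
  finally have "\<bar>z\<bar> * \<bar>\<tau> / k - 1\<bar> \<le> \<bar>z\<bar> * (variance_error J0 R \<sigma> \<mu> w m / (2 * \<sigma> ^ 4))"
    by (intro mult_left_mono) auto
  then have 2: "\<bar>\<tau> * z / k - z\<bar> \<le> \<bar>z\<bar> * variance_error J0 R \<sigma> \<mu> w m / (2 * \<sigma> ^ 4)"
    by (simp add: algebra_simps flip: abs_mult)
  have fe: "fit_error J0 R \<sigma> \<mu> w m z S = E / k + \<bar>z\<bar> * variance_error J0 R \<sigma> \<mu> w m / (2 * \<sigma> ^ 4)"
    unfolding fit_error_def E_def k_def by (simp add: n_def D_def excess_def)
  have "cover \<longleftrightarrow> P / k \<le> \<tau> * z / k" unfolding cover using k by (simp add: divide_le_cancel)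
  then show "cover \<Longrightarrow> - S / sqrt (2 * n) \<le> z + fit_error J0 R \<sigma> \<mu> w m z S"
    and "- S / sqrt (2 * n) \<le> z - fit_error J0 R \<sigma> \<mu> w m z S \<Longrightarrow> cover"
    unfolding fe using 1 2 by (auto simp: abs_le_iff)
qed

end

end

section \<open>Moments of Gaussian linear forms\<close>

abbreviation gauss_product :: "nat set \<Rightarrow> (nat \<Rightarrow> real) measure" where
  "gauss_product I \<equiv> PiM I (\<lambda>_. std_normal_distribution)"

lemma prob_space_std_normal: "prob_space std_normal_distribution"
  by (rule prob_space_normal_density) simp

lemma prob_space_gauss_product: "prob_space (gauss_product I)"
  by (intro prob_space_PiM prob_space_std_normal)

lemma measurable_gauss_product_component [measurable]:
  "i \<in> I \<Longrightarrow> (\<lambda>\<omega>. \<omega> i) \<in> borel_measurable (gauss_product I)"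
  using measurable_component_singleton[of i I "\<lambda>_. std_normal_distribution"]
  by (simp add: measurable_def)

lemma distr_gauss_component:
  assumes "i \<in> I"
  shows "distr (gauss_product I) borel (\<lambda>\<omega>. \<omega> i) = std_normal_distribution"
  using distr_PiM_component[OF prob_space_std_normal assms]
  by (metis distr_cong sets_density sets_lborel)

lemma distributed_gauss_component:
  assumes "i \<in> I"
  shows "distributed (gauss_product I) lborel (\<lambda>\<omega>. \<omega> i) std_normal_density"
  unfolding distributed_def
  using distr_gauss_component[OF assms] measurable_gauss_product_component[OF assms]
  by (auto simp: distr_cong[OF refl sets_lborel refl])

lemma indep_gauss_components:
  assumes "I \<noteq> {}"
  shows "prob_space.indep_vars (gauss_product I) (\<lambda>_. borel) (\<lambda>i \<omega>. \<omega> i) I"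
proof -
  interpret prob_space "gauss_product I" by (rule prob_space_gauss_product)
  have "distr (gauss_product I) (PiM I (\<lambda>_. borel)) (\<lambda>x. \<lambda>i\<in>I. x i) = gauss_product I"
  proof -
    have "distr (gauss_product I) (PiM I (\<lambda>_. borel)) (\<lambda>x. \<lambda>i\<in>I. x i)
        = distr (gauss_product I) (gauss_product I) (\<lambda>x. x)"
      by (intro distr_cong sets_PiM_cong) (auto simp: space_PiM)
    then show ?thesis by simp
  qed
  also have "\<dots> = PiM I (\<lambda>i. distr (gauss_product I) borel (\<lambda>\<omega>. \<omega> i))"
    by (intro PiM_cong) (simp_all add: distr_gauss_component)
  finally show ?thesis
    by (subst indep_vars_iff_distr_eq_PiM'[OF assms]) auto
qed

section \<open>Linear forms in independent normal variables\<close>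

definition lin :: "nat set \<Rightarrow> (nat \<Rightarrow> real) \<Rightarrow> (nat \<Rightarrow> real) \<Rightarrow> real" where
  "lin I a \<omega> = (\<Sum>i\<in>I. a i * \<omega> i)"

text \<open>The deviations of the empirical coefficients from \<mu> in units of sqrt v: row l of the
  rotation applied to the errors, plus the discretization bias u.\<close>

definition shifted ::
    "nat set \<Rightarrow> (nat \<Rightarrow> nat \<Rightarrow> real) \<Rightarrow> (nat \<Rightarrow> real) \<Rightarrow> (nat \<Rightarrow> real) \<Rightarrow> nat \<Rightarrow> real" where
  "shifted I B u \<omega> l = lin I (B l) \<omega> + u l"

context
  fixes I :: "nat set"
  assumes fin: "finite I"
begin

interpretation prob_space "gauss_product I" by (rule prob_space_gauss_product)

lemma distributed_lin_unit:
  assumes "(\<Sum>i\<in>I. (a i)\<^sup>2) = 1"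
  shows "distributed (gauss_product I) lborel (lin I a) std_normal_density"
proof -
  \<comment> \<open>Summands with coefficient 0 have no normal density and are dropped.\<close>
  define J where "J = {i\<in>I. a i \<noteq> 0}"
  have J: "J \<subseteq> I" "finite J" using fin by (auto simp: J_def)
  have a1: "(\<Sum>i\<in>J. (a i)\<^sup>2) = 1"
    unfolding assms[symmetric] J_def using fin by (intro sum.mono_neutral_left) auto
  then have ne: "J \<noteq> {}" by auto
  then have "indep_vars (\<lambda>_. borel) (\<lambda>i \<omega>. \<omega> i) J"
    using indep_gauss_components[of I] J by (auto intro: indep_vars_subset)
  then have ind: "indep_vars (\<lambda>_. borel) (\<lambda>i \<omega>. a i * \<omega> i) J"
    by (rule indep_vars_compose2) auto
  have "distributed (gauss_product I) lborel (\<lambda>\<omega>. a i * \<omega> i) (normal_density 0 \<bar>a i\<bar>)" if "i \<in> J" for i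
    using normal_density_affine[OF distributed_gauss_component[of i I], of "a i" 0] that
    by (simp add: J_def)
  then have "distributed (gauss_product I) lborel (\<lambda>\<omega>. \<Sum>i\<in>J. a i * \<omega> i)
      (normal_density (\<Sum>i\<in>J. 0) (sqrt (\<Sum>i\<in>J. \<bar>a i\<bar>\<^sup>2)))"
    by (intro sum_indep_normal J ne ind) (auto simp: J_def)
  moreover have "(\<lambda>\<omega>. \<Sum>i\<in>J. a i * \<omega> i) = lin I a"
    unfolding lin_def using fin by (intro ext sum.mono_neutral_left) (auto simp: J_def)
  ultimately show ?thesis by (simp add: a1)
qed

lemma lin_unit_moments:
  assumes "(\<Sum>i\<in>I. (a i)\<^sup>2) = 1"
  shows "integrable (gauss_product I) (\<lambda>\<omega>. lin I a \<omega> ^ k)"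
    and "expectation (\<lambda>\<omega>. lin I a \<omega> ^ 2) = 1"
    and "expectation (\<lambda>\<omega>. lin I a \<omega> ^ 4) = 3"
proof -
  note d = distributed_lin_unit[OF assms]
  show "integrable (gauss_product I) (\<lambda>\<omega>. lin I a \<omega> ^ k)"
    using distributed_integrable[OF d, of "\<lambda>x. x ^ k"] integrable_std_normal_moment[of k] by simp
  show "expectation (\<lambda>\<omega>. lin I a \<omega> ^ 2) = 1"
    using distributed_integral[OF d, of "\<lambda>x. x ^ 2"] integral_std_normal_moment_even[of 1] by simp
  show "expectation (\<lambda>\<omega>. lin I a \<omega> ^ 4) = 3"
    using distributed_integral[OF d, of "\<lambda>x. x ^ 4"] integral_std_normal_moment_even[of 2]
    by (simp add: fact_numeral)
qed

lemma lin_scale: "lin I (\<lambda>i. c * a i) \<omega> = c * lin I a \<omega>"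
  by (simp add: lin_def sum_distrib_left mult.assoc)

lemma lin_add: "lin I (\<lambda>i. a i + b i) \<omega> = lin I a \<omega> + lin I b \<omega>"
  by (simp add: lin_def sum.distrib distrib_right)

lemma lin_diff: "lin I (\<lambda>i. a i - b i) \<omega> = lin I a \<omega> - lin I b \<omega>"
  by (simp add: lin_def sum_subtractf left_diff_distrib)

lemma lin_moments:
  shows integrable_lin_power: "integrable (gauss_product I) (\<lambda>\<omega>. lin I a \<omega> ^ k)"
    and expectation_lin_square: "expectation (\<lambda>\<omega>. lin I a \<omega> ^ 2) = (\<Sum>i\<in>I. (a i)\<^sup>2)"
    and expectation_lin_power4: "expectation (\<lambda>\<omega>. lin I a \<omega> ^ 4) = 3 * (\<Sum>i\<in>I. (a i)\<^sup>2)\<^sup>2"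
proof -
  define s where "s = sqrt (\<Sum>i\<in>I. (a i)\<^sup>2)"
  have s2: "s\<^sup>2 = (\<Sum>i\<in>I. (a i)\<^sup>2)" by (simp add: s_def sum_nonneg)
  have "integrable (gauss_product I) (\<lambda>\<omega>. lin I a \<omega> ^ k) \<and>
      expectation (\<lambda>\<omega>. lin I a \<omega> ^ 2) = s\<^sup>2 \<and> expectation (\<lambda>\<omega>. lin I a \<omega> ^ 4) = 3 * (s\<^sup>2)\<^sup>2"
  proof (cases "s = 0")
    case True
    then have "\<forall>i\<in>I. a i = 0" using s2 fin by (simp add: sum_nonneg_eq_0_iff)
    then have "lin I a = (\<lambda>_. 0)" by (auto simp: lin_def)
    then show ?thesis using True by simp
  next
    case False
    define b where "b i = a i / s" for i
    have "(\<Sum>i\<in>I. (b i)\<^sup>2) = 1"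
      using False by (simp add: b_def power_divide s2[symmetric] flip: sum_divide_distrib)
    note m = lin_unit_moments[OF this]
    have "lin I a \<omega> = s * lin I b \<omega>" for \<omega>
      using False by (simp add: b_def flip: lin_scale)
    then show ?thesis
      using m(2,3) m(1)[of k] by (simp add: power_mult_distrib flip: power_mult)
  qed
  then show "integrable (gauss_product I) (\<lambda>\<omega>. lin I a \<omega> ^ k)"
    "expectation (\<lambda>\<omega>. lin I a \<omega> ^ 2) = (\<Sum>i\<in>I. (a i)\<^sup>2)"
    "expectation (\<lambda>\<omega>. lin I a \<omega> ^ 4) = 3 * (\<Sum>i\<in>I. (a i)\<^sup>2)\<^sup>2"
    by (auto simp: s2)
qed

lemma integrable_lin: "integrable (gauss_product I) (lin I a)"
  using integrable_lin_power[of a 1] by simp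

lemma measurable_lin [measurable]: "lin I a \<in> borel_measurable (gauss_product I)"
  using integrable_lin by (rule borel_measurable_integrable)

text \<open>Polarisation: for orthonormal $a, b$ the fourth moments of the unit combinations
  $(a \pm b)/\sqrt 2$ determine the mixed moment.\<close>

lemma lin_mixed_moment:
  assumes "(\<Sum>i\<in>I. (a i)\<^sup>2) = 1" "(\<Sum>i\<in>I. (b i)\<^sup>2) = 1" "(\<Sum>i\<in>I. a i * b i) = 0"
  shows "integrable (gauss_product I) (\<lambda>\<omega>. (lin I a \<omega>)\<^sup>2 * (lin I b \<omega>)\<^sup>2)"
    and "expectation (\<lambda>\<omega>. (lin I a \<omega>)\<^sup>2 * (lin I b \<omega>)\<^sup>2) = 1"
proof -
  have eq: "(lin I a \<omega>)\<^sup>2 * (lin I b \<omega>)\<^sup>2 =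
      (lin I (\<lambda>i. a i + b i) \<omega> ^ 4 + lin I (\<lambda>i. a i - b i) \<omega> ^ 4 - 2 * lin I a \<omega> ^ 4 - 2 * lin I b \<omega> ^ 4) / 12" for \<omega>
    by (simp add: lin_add lin_diff power2_eq_square power4_eq_xxxx field_simps)
  have n: "(\<Sum>i\<in>I. (a i + b i)\<^sup>2) = 2" "(\<Sum>i\<in>I. (a i - b i)\<^sup>2) = 2"
    using assms by (simp_all add: power2_sum power2_diff sum.distrib sum_subtractf mult.assoc
        flip: sum_distrib_left)
  show "integrable (gauss_product I) (\<lambda>\<omega>. (lin I a \<omega>)\<^sup>2 * (lin I b \<omega>)\<^sup>2)"
    unfolding eq by (intro integrable_divide Bochner_Integration.integrable_diff
        Bochner_Integration.integrable_add integrable_mult_right integrable_lin_power)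
  show "expectation (\<lambda>\<omega>. (lin I a \<omega>)\<^sup>2 * (lin I b \<omega>)\<^sup>2) = 1"
    unfolding eq using n assms
    by (simp add: integrable_lin_power expectation_lin_power4)
qed

text \<open>Nonnegativity of the variance of |X|; it reduces first moments to second
  moments.\<close>

lemma expectation_abs_le_sqrt:
  assumes "X \<in> borel_measurable (gauss_product I)" "integrable (gauss_product I) (\<lambda>\<omega>. (X \<omega>)\<^sup>2)"
  shows "integrable (gauss_product I) X"
    and "expectation (\<lambda>\<omega>. \<bar>X \<omega>\<bar>) \<le> sqrt (expectation (\<lambda>\<omega>. (X \<omega>)\<^sup>2))"
proof -
  show int: "integrable (gauss_product I) X"
    using assms by (rule square_integrable_imp_integrable)
  have "0 \<le> variance (\<lambda>\<omega>. \<bar>X \<omega>\<bar>)" by (rule variance_positive)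
  also have "variance (\<lambda>\<omega>. \<bar>X \<omega>\<bar>) = expectation (\<lambda>\<omega>. \<bar>X \<omega>\<bar>\<^sup>2) - (expectation (\<lambda>\<omega>. \<bar>X \<omega>\<bar>))\<^sup>2"
    using int assms by (intro variance_eq) auto
  finally show "expectation (\<lambda>\<omega>. \<bar>X \<omega>\<bar>) \<le> sqrt (expectation (\<lambda>\<omega>. (X \<omega>)\<^sup>2))"
    by (intro real_le_rsqrt) simp
qed

lemma expectation_abs_lin: "expectation (\<lambda>\<omega>. \<bar>lin I a \<omega>\<bar>) \<le> sqrt (\<Sum>i\<in>I. (a i)\<^sup>2)"
  using expectation_abs_le_sqrt(2)[of "lin I a"] by (simp add: integrable_lin_power expectation_lin_square)

section \<open>Orthonormal families of linear forms\<close>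

context
  fixes B :: "nat \<Rightarrow> nat \<Rightarrow> real" and \<Lambda> :: "nat set"
  assumes orth: "\<And>l m. l \<in> \<Lambda> \<Longrightarrow> m \<in> \<Lambda> \<Longrightarrow> (\<Sum>i\<in>I. B l i * B m i) = (if l = m then 1 else 0)"
begin

lemma unit_norm: "l \<in> \<Lambda> \<Longrightarrow> (\<Sum>i\<in>I. (B l i)\<^sup>2) = 1"
  using orth[of l l] by (simp add: power2_eq_square)

text \<open>Only fourth and second moments enter: the product expands to 3-1-1+1 = 2 on the diagonal
  and, by the mixed moment, to 1-1-1+1 = 0 off it.\<close>

lemma expectation_excess_product:
  assumes "l \<in> \<Lambda>" "m \<in> \<Lambda>"
  shows "integrable (gauss_product I) (\<lambda>\<omega>. ((lin I (B l) \<omega>)\<^sup>2 - 1) * ((lin I (B m) \<omega>)\<^sup>2 - 1))"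
    and "expectation (\<lambda>\<omega>. ((lin I (B l) \<omega>)\<^sup>2 - 1) * ((lin I (B m) \<omega>)\<^sup>2 - 1)) = (if l = m then 2 else 0)"
proof -
  have eq: "((lin I (B l) \<omega>)\<^sup>2 - 1) * ((lin I (B m) \<omega>)\<^sup>2 - 1)
      = (lin I (B l) \<omega>)\<^sup>2 * (lin I (B m) \<omega>)\<^sup>2 - (lin I (B l) \<omega>)\<^sup>2 - (lin I (B m) \<omega>)\<^sup>2 + 1" for \<omega>
    by (simp add: algebra_simps)
  have mix: "integrable (gauss_product I) (\<lambda>\<omega>. (lin I (B l) \<omega>)\<^sup>2 * (lin I (B m) \<omega>)\<^sup>2)
      \<and> expectation (\<lambda>\<omega>. (lin I (B l) \<omega>)\<^sup>2 * (lin I (B m) \<omega>)\<^sup>2) = (if l = m then 3 else 1)"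
  proof (cases "l = m")
    case True
    have "(lin I (B l) \<omega>)\<^sup>2 * (lin I (B m) \<omega>)\<^sup>2 = lin I (B l) \<omega> ^ 4" for \<omega>
      using True by (simp flip: power_add)
    then show ?thesis using True unit_norm[OF assms(1)]
      by (simp add: integrable_lin_power expectation_lin_power4)
  next
    case False
    then show ?thesis using lin_mixed_moment[of "B l" "B m"] unit_norm assms orth by simp
  qed
  show "integrable (gauss_product I) (\<lambda>\<omega>. ((lin I (B l) \<omega>)\<^sup>2 - 1) * ((lin I (B m) \<omega>)\<^sup>2 - 1))"
    unfolding eq using mix by (simp add: integrable_lin_power)
  show "expectation (\<lambda>\<omega>. ((lin I (B l) \<omega>)\<^sup>2 - 1) * ((lin I (B m) \<omega>)\<^sup>2 - 1)) = (if l = m then 2 else 0)"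
    unfolding eq using mix assms
    by (simp add: integrable_lin_power expectation_lin_square unit_norm prob_space)
qed

lemma expectation_abs_excess:
  assumes "G \<subseteq> \<Lambda>" "finite G"
  shows "expectation (\<lambda>\<omega>. \<bar>\<Sum>l\<in>G. (lin I (B l) \<omega>)\<^sup>2 - 1\<bar>) \<le> sqrt (2 * real (card G))"
proof -
  have sq: "(\<Sum>l\<in>G. (lin I (B l) \<omega>)\<^sup>2 - 1)\<^sup>2
      = (\<Sum>l\<in>G. \<Sum>m\<in>G. ((lin I (B l) \<omega>)\<^sup>2 - 1) * ((lin I (B m) \<omega>)\<^sup>2 - 1))" for \<omega>
    by (simp add: power2_eq_square sum_product)
  have "expectation (\<lambda>\<omega>. (\<Sum>l\<in>G. (lin I (B l) \<omega>)\<^sup>2 - 1)\<^sup>2)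
      = (\<Sum>l\<in>G. \<Sum>m\<in>G. expectation (\<lambda>\<omega>. ((lin I (B l) \<omega>)\<^sup>2 - 1) * ((lin I (B m) \<omega>)\<^sup>2 - 1)))"
    unfolding sq using assms(1)
    by (subst Bochner_Integration.integral_sum)
      (auto intro!: Bochner_Integration.integrable_sum Bochner_Integration.integral_sum sum.cong expectation_excess_product(1))
  also have "\<dots> = (\<Sum>l\<in>G. \<Sum>m\<in>G. if l = m then 2 else 0)"
    using assms(1) by (intro sum.cong refl expectation_excess_product(2)) auto
  also have "\<dots> = 2 * real (card G)" using assms(2) by simp
  finally have e: "expectation (\<lambda>\<omega>. (\<Sum>l\<in>G. (lin I (B l) \<omega>)\<^sup>2 - 1)\<^sup>2) = 2 * real (card G)" .
  have "integrable (gauss_product I) (\<lambda>\<omega>. (\<Sum>l\<in>G. (lin I (B l) \<omega>)\<^sup>2 - 1)\<^sup>2)"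
    unfolding sq using assms(1)
    by (intro Bochner_Integration.integrable_sum expectation_excess_product(1)) auto
  from expectation_abs_le_sqrt(2)[OF _ this] show ?thesis by (simp add: e)
qed

lemma lin_combination:
  "(\<Sum>l\<in>G. c l * lin I (B l) \<omega>) = lin I (\<lambda>i. \<Sum>l\<in>G. c l * B l i) \<omega>"
proof -
  have "(\<Sum>l\<in>G. c l * lin I (B l) \<omega>) = (\<Sum>l\<in>G. \<Sum>i\<in>I. c l * B l i * \<omega> i)"
    by (simp add: lin_def sum_distrib_left mult.assoc)
  also have "\<dots> = (\<Sum>i\<in>I. \<Sum>l\<in>G. c l * B l i * \<omega> i)" by (rule sum.swap)
  finally show ?thesis by (simp add: lin_def sum_distrib_right)
qed

text \<open>Apart from combinations of rows, it also serves for the transposed matrix, where it says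
  that the rotation preserves sums of squares.\<close>

lemma combination_norm:
  assumes "G \<subseteq> \<Lambda>" "finite G"
  shows "(\<Sum>i\<in>I. (\<Sum>l\<in>G. c l * B l i)\<^sup>2) = (\<Sum>l\<in>G. (c l)\<^sup>2)"
proof -
  have "(\<Sum>i\<in>I. (\<Sum>l\<in>G. c l * B l i)\<^sup>2) = (\<Sum>i\<in>I. \<Sum>l\<in>G. \<Sum>m\<in>G. c l * c m * (B l i * B m i))"
    by (simp add: power2_eq_square sum_product mult_ac)
  also have "\<dots> = (\<Sum>l\<in>G. \<Sum>m\<in>G. \<Sum>i\<in>I. c l * c m * (B l i * B m i))"
    by (subst sum.swap, rule sum.cong[OF refl], subst sum.swap) simp
  also have "\<dots> = (\<Sum>l\<in>G. \<Sum>m\<in>G. if l = m then (c l)\<^sup>2 else 0)"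
    using assms(1)
    by (intro sum.cong refl) (auto simp: sum_distrib_left[symmetric] orth subset_iff power2_eq_square)
  also have "\<dots> = (\<Sum>l\<in>G. (c l)\<^sup>2)" using assms(2) by simp
  finally show ?thesis .
qed

lemma expectation_abs_combination:
  assumes "G \<subseteq> \<Lambda>" "finite G"
  shows "integrable (gauss_product I) (\<lambda>\<omega>. \<Sum>l\<in>G. c l * lin I (B l) \<omega>)"
    and "expectation (\<lambda>\<omega>. \<bar>\<Sum>l\<in>G. c l * lin I (B l) \<omega>\<bar>) \<le> L2_set c G"
proof -
  show "integrable (gauss_product I) (\<lambda>\<omega>. \<Sum>l\<in>G. c l * lin I (B l) \<omega>)"
    unfolding lin_combination by (rule integrable_lin)
  show "expectation (\<lambda>\<omega>. \<bar>\<Sum>l\<in>G. c l * lin I (B l) \<omega>\<bar>) \<le> L2_set c G"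
    using expectation_abs_lin[of "\<lambda>i. \<Sum>l\<in>G. c l * B l i"]
    unfolding lin_combination L2_set_def combination_norm[OF assms] .
qed

section \<open>Effect of a bounded deterministic shift\<close>

context
  fixes u :: "nat \<Rightarrow> real" and K :: real
  assumes finite_index: "finite \<Lambda>" and K: "0 \<le> K" and u: "(\<Sum>l\<in>\<Lambda>. (u l)\<^sup>2) \<le> K\<^sup>2"
begin

lemma finite_sub: "G \<subseteq> \<Lambda> \<Longrightarrow> finite G"
  by (rule finite_subset[OF _ finite_index])

lemma u_sub:
  assumes "G \<subseteq> \<Lambda>"
  shows "(\<Sum>l\<in>G. (u l)\<^sup>2) \<le> K\<^sup>2" "L2_set u G \<le> K"
proof -
  show *: "(\<Sum>l\<in>G. (u l)\<^sup>2) \<le> K\<^sup>2"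
    by (rule order_trans[OF sum_mono2[OF finite_index assms] u]) simp
  then show "L2_set u G \<le> K" using K by (simp add: L2_set_def real_le_lsqrt sum_nonneg)
qed

lemma integrable_shifted_power: "integrable (gauss_product I) (\<lambda>\<omega>. shifted I B u \<omega> l ^ k)"
proof -
  have "shifted I B u \<omega> l ^ k = (\<Sum>j\<le>k. of_nat (k choose j) * lin I (B l) \<omega> ^ j * u l ^ (k - j))" for \<omega>
    by (simp add: shifted_def binomial_ring)
  then show ?thesis by (simp add: integrable_lin_power)
qed

lemma measurable_shifted [measurable]: "(\<lambda>\<omega>. shifted I B u \<omega> l) \<in> borel_measurable (gauss_product I)"
  unfolding shifted_def by simp

lemma expectation_energy:
  assumes "G \<subseteq> \<Lambda>"
  shows "integrable (gauss_product I) (\<lambda>\<omega>. \<Sum>l\<in>G. (shifted I B u \<omega> l)\<^sup>2)"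
    and "expectation (\<lambda>\<omega>. \<Sum>l\<in>G. (shifted I B u \<omega> l)\<^sup>2) \<le> 2 * real (card G) + 2 * K\<^sup>2"
proof -
  show int: "integrable (gauss_product I) (\<lambda>\<omega>. \<Sum>l\<in>G. (shifted I B u \<omega> l)\<^sup>2)"
    by (intro Bochner_Integration.integrable_sum integrable_shifted_power)
  have "expectation (\<lambda>\<omega>. \<Sum>l\<in>G. (shifted I B u \<omega> l)\<^sup>2) \<le> expectation (\<lambda>\<omega>. \<Sum>l\<in>G. 2 * (lin I (B l) \<omega>)\<^sup>2 + 2 * (u l)\<^sup>2)"
  proof (intro integral_mono int sum_mono)
    show "integrable (gauss_product I) (\<lambda>\<omega>. \<Sum>l\<in>G. 2 * (lin I (B l) \<omega>)\<^sup>2 + 2 * (u l)\<^sup>2)"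
      by (simp add: integrable_lin_power)
    fix \<omega> l
    show "(shifted I B u \<omega> l)\<^sup>2 \<le> 2 * (lin I (B l) \<omega>)\<^sup>2 + 2 * (u l)\<^sup>2"
      using zero_le_power2[of "lin I (B l) \<omega> - u l"] by (simp add: shifted_def power2_eq_square algebra_simps)
  qed
  also have "\<dots> = (\<Sum>l\<in>G. 2 * (\<Sum>i\<in>I. (B l i)\<^sup>2) + 2 * (u l)\<^sup>2)"
    by (simp add: integrable_lin_power expectation_lin_square prob_space)
  also have "\<dots> = (\<Sum>l\<in>G. 2 + 2 * (u l)\<^sup>2)"
    using assms by (intro sum.cong refl) (auto simp: unit_norm subset_iff)
  also have "\<dots> = 2 * real (card G) + 2 * (\<Sum>l\<in>G. (u l)\<^sup>2)" by (simp add: sum.distrib sum_distrib_left)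
  also have "\<dots> \<le> 2 * real (card G) + 2 * K\<^sup>2" using u_sub(1)[OF assms] by simp
  finally show "expectation (\<lambda>\<omega>. \<Sum>l\<in>G. (shifted I B u \<omega> l)\<^sup>2) \<le> 2 * real (card G) + 2 * K\<^sup>2" .
qed

lemma expectation_power4:
  assumes "G \<subseteq> \<Lambda>"
  shows "integrable (gauss_product I) (\<lambda>\<omega>. \<Sum>l\<in>G. shifted I B u \<omega> l ^ 4)"
    and "expectation (\<lambda>\<omega>. \<Sum>l\<in>G. shifted I B u \<omega> l ^ 4) \<le> 24 * real (card G) + 8 * K ^ 4"
proof -
  show int: "integrable (gauss_product I) (\<lambda>\<omega>. \<Sum>l\<in>G. shifted I B u \<omega> l ^ 4)"
    by (intro Bochner_Integration.integrable_sum integrable_shifted_power)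
  have "expectation (\<lambda>\<omega>. \<Sum>l\<in>G. shifted I B u \<omega> l ^ 4) \<le> expectation (\<lambda>\<omega>. \<Sum>l\<in>G. 8 * (lin I (B l) \<omega> ^ 4 + u l ^ 4))"
  proof (intro integral_mono int sum_mono)
    show "integrable (gauss_product I) (\<lambda>\<omega>. \<Sum>l\<in>G. 8 * (lin I (B l) \<omega> ^ 4 + u l ^ 4))"
      by (simp add: integrable_lin_power)
    show "shifted I B u \<omega> l ^ 4 \<le> 8 * (lin I (B l) \<omega> ^ 4 + u l ^ 4)" for \<omega> l
      unfolding shifted_def by (rule power4_add_le)
  qed
  also have "\<dots> = (\<Sum>l\<in>G. 8 * (3 * (\<Sum>i\<in>I. (B l i)\<^sup>2)\<^sup>2 + u l ^ 4))"
    by (simp add: integrable_lin_power expectation_lin_power4 prob_space)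
  also have "\<dots> = (\<Sum>l\<in>G. 24 + 8 * u l ^ 4)"
    using assms by (intro sum.cong refl) (auto simp: unit_norm subset_iff)
  also have "\<dots> = 24 * real (card G) + 8 * (\<Sum>l\<in>G. u l ^ 4)" by (simp add: sum.distrib sum_distrib_left)
  also have "(\<Sum>l\<in>G. u l ^ 4) \<le> (K\<^sup>2)\<^sup>2"
    by (rule order_trans[OF sum_power4_le]) (intro power_mono u_sub(1) assms sum_nonneg zero_le_power2)
  finally show "expectation (\<lambda>\<omega>. \<Sum>l\<in>G. shifted I B u \<omega> l ^ 4) \<le> 24 * real (card G) + 8 * K ^ 4"
    by (simp flip: power_mult)
qed

lemma expectation_abs_shifted_combination:
  assumes "G \<subseteq> \<Lambda>"
  shows "integrable (gauss_product I) (\<lambda>\<omega>. \<bar>\<Sum>l\<in>G. c l * shifted I B u \<omega> l\<bar>)"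
    and "expectation (\<lambda>\<omega>. \<bar>\<Sum>l\<in>G. c l * shifted I B u \<omega> l\<bar>) \<le> L2_set c G * (1 + K)"
proof -
  note fG = finite_sub[OF assms]
  have eq: "(\<Sum>l\<in>G. c l * shifted I B u \<omega> l) = (\<Sum>l\<in>G. c l * lin I (B l) \<omega>) + (\<Sum>l\<in>G. c l * u l)" for \<omega>
    by (simp add: shifted_def distrib_left sum.distrib)
  note int = expectation_abs_combination(1)[OF assms fG, of c]
  show "integrable (gauss_product I) (\<lambda>\<omega>. \<bar>\<Sum>l\<in>G. c l * shifted I B u \<omega> l\<bar>)"
    unfolding eq using int by simp
  have cu: "\<bar>\<Sum>l\<in>G. c l * u l\<bar> \<le> L2_set c G * K"
  proof -
    have "\<bar>\<Sum>l\<in>G. c l * u l\<bar> \<le> (\<Sum>l\<in>G. \<bar>c l\<bar> * \<bar>u l\<bar>)" unfolding abs_mult[symmetric] by (rule sum_abs)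
    also have "\<dots> \<le> L2_set c G * L2_set u G" by (rule L2_set_mult_ineq)
    also have "\<dots> \<le> L2_set c G * K" using u_sub(2)[OF assms] by (intro mult_left_mono) (auto simp: L2_set_nonneg)
    finally show ?thesis .
  qed
  have "expectation (\<lambda>\<omega>. \<bar>\<Sum>l\<in>G. c l * shifted I B u \<omega> l\<bar>)
      \<le> expectation (\<lambda>\<omega>. \<bar>\<Sum>l\<in>G. c l * lin I (B l) \<omega>\<bar> + \<bar>\<Sum>l\<in>G. c l * u l\<bar>)"
    unfolding eq using int by (intro integral_mono) (auto intro: abs_triangle_ineq)
  also have "\<dots> = expectation (\<lambda>\<omega>. \<bar>\<Sum>l\<in>G. c l * lin I (B l) \<omega>\<bar>) + \<bar>\<Sum>l\<in>G. c l * u l\<bar>"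
    using int by (simp add: prob_space)
  also have "\<dots> \<le> L2_set c G * (1 + K)"
    using expectation_abs_combination(2)[OF assms fG, of c] cu by (simp add: distrib_left)
  finally show "expectation (\<lambda>\<omega>. \<bar>\<Sum>l\<in>G. c l * shifted I B u \<omega> l\<bar>) \<le> L2_set c G * (1 + K)" .
qed

text \<open>The shift changes the excess by a linear form and a constant. Both are bounded in mean
  in terms of K alone, whereas the excess itself is of the order of the square root of the number of
  indices.\<close>

lemma excess_shifted:
  "(\<Sum>l\<in>G. (shifted I B u \<omega> l)\<^sup>2 - 1) = (\<Sum>l\<in>G. (lin I (B l) \<omega>)\<^sup>2 - 1) + (2 * (\<Sum>l\<in>G. u l * lin I (B l) \<omega>) + (\<Sum>l\<in>G. (u l)\<^sup>2))"
  by (simp add: shifted_def power2_sum sum.distrib sum_subtractf sum_distrib_left mult_ac)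

lemma expectation_shift_error:
  assumes "G \<subseteq> \<Lambda>"
  shows "integrable (gauss_product I) (\<lambda>\<omega>. \<bar>2 * (\<Sum>l\<in>G. u l * lin I (B l) \<omega>) + (\<Sum>l\<in>G. (u l)\<^sup>2)\<bar>)"
    and "expectation (\<lambda>\<omega>. \<bar>2 * (\<Sum>l\<in>G. u l * lin I (B l) \<omega>) + (\<Sum>l\<in>G. (u l)\<^sup>2)\<bar>) \<le> 2 * K + K\<^sup>2"
proof -
  note int = expectation_abs_combination[OF assms finite_sub[OF assms], of u]
  show "integrable (gauss_product I) (\<lambda>\<omega>. \<bar>2 * (\<Sum>l\<in>G. u l * lin I (B l) \<omega>) + (\<Sum>l\<in>G. (u l)\<^sup>2)\<bar>)"
    using int(1) by (intro integrable_abs Bochner_Integration.integrable_add integrable_mult_right) auto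
  then have "expectation (\<lambda>\<omega>. \<bar>2 * (\<Sum>l\<in>G. u l * lin I (B l) \<omega>) + (\<Sum>l\<in>G. (u l)\<^sup>2)\<bar>)
      \<le> expectation (\<lambda>\<omega>. 2 * \<bar>\<Sum>l\<in>G. u l * lin I (B l) \<omega>\<bar> + (\<Sum>l\<in>G. (u l)\<^sup>2))"
  proof (intro integral_mono)
    show "integrable (gauss_product I) (\<lambda>\<omega>. 2 * \<bar>\<Sum>l\<in>G. u l * lin I (B l) \<omega>\<bar> + (\<Sum>l\<in>G. (u l)\<^sup>2))"
      using int(1) by (intro Bochner_Integration.integrable_add integrable_mult_right integrable_abs) auto
    have "0 \<le> (\<Sum>l\<in>G. (u l)\<^sup>2)" by (simp add: sum_nonneg)
    then show "\<bar>2 * (\<Sum>l\<in>G. u l * lin I (B l) \<omega>) + (\<Sum>l\<in>G. (u l)\<^sup>2)\<bar>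
        \<le> 2 * \<bar>\<Sum>l\<in>G. u l * lin I (B l) \<omega>\<bar> + (\<Sum>l\<in>G. (u l)\<^sup>2)" for \<omega> by linarith
  qed
  also have "\<dots> = 2 * expectation (\<lambda>\<omega>. \<bar>\<Sum>l\<in>G. u l * lin I (B l) \<omega>\<bar>) + (\<Sum>l\<in>G. (u l)\<^sup>2)"
    using int(1) by (subst Bochner_Integration.integral_add) (auto simp: prob_space)
  also have "\<dots> \<le> 2 * K + K\<^sup>2" using int(2) u_sub[OF assms] by linarith
  finally show "expectation (\<lambda>\<omega>. \<bar>2 * (\<Sum>l\<in>G. u l * lin I (B l) \<omega>) + (\<Sum>l\<in>G. (u l)\<^sup>2)\<bar>) \<le> 2 * K + K\<^sup>2" .
qed

text \<open>A nonempty block has sqrt (card G) >= 1, which absorbs the bounded contribution of the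
  shift.\<close>

lemma expectation_abs_excess_shifted:
  assumes "G \<subseteq> \<Lambda>" "G \<noteq> {}"
  shows "integrable (gauss_product I) (\<lambda>\<omega>. \<bar>\<Sum>l\<in>G. (shifted I B u \<omega> l)\<^sup>2 - 1\<bar>)"
    and "expectation (\<lambda>\<omega>. \<bar>\<Sum>l\<in>G. (shifted I B u \<omega> l)\<^sup>2 - 1\<bar>) \<le> (2 + 2 * K + K\<^sup>2) * sqrt (real (card G))"
proof -
  note fG = finite_sub[OF assms(1)]
  show "integrable (gauss_product I) (\<lambda>\<omega>. \<bar>\<Sum>l\<in>G. (shifted I B u \<omega> l)\<^sup>2 - 1\<bar>)"
    by (intro integrable_abs Bochner_Integration.integrable_sum Bochner_Integration.integrable_diff
        integrable_shifted_power) simp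
  have i1: "integrable (gauss_product I) (\<lambda>\<omega>. \<bar>\<Sum>l\<in>G. (lin I (B l) \<omega>)\<^sup>2 - 1\<bar>)"
    by (intro integrable_abs Bochner_Integration.integrable_sum Bochner_Integration.integrable_diff
        integrable_lin_power) simp
  note i2 = expectation_shift_error[OF assms(1)]
  have "expectation (\<lambda>\<omega>. \<bar>\<Sum>l\<in>G. (shifted I B u \<omega> l)\<^sup>2 - 1\<bar>)
      \<le> expectation (\<lambda>\<omega>. \<bar>\<Sum>l\<in>G. (lin I (B l) \<omega>)\<^sup>2 - 1\<bar>
        + \<bar>2 * (\<Sum>l\<in>G. u l * lin I (B l) \<omega>) + (\<Sum>l\<in>G. (u l)\<^sup>2)\<bar>)"
    using i1 i2(1) unfolding excess_shifted by (intro integral_mono') (auto intro: abs_triangle_ineq)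
  also have "\<dots> \<le> sqrt (2 * real (card G)) + (2 * K + K\<^sup>2)"
    using expectation_abs_excess[OF assms(1) fG] i2 i1 by (subst Bochner_Integration.integral_add) auto
  also have "\<dots> \<le> 2 * sqrt (real (card G)) + (2 * K + K\<^sup>2) * sqrt (real (card G))"
  proof (intro add_mono)
    have "sqrt 2 \<le> (2::real)" by (rule real_le_lsqrt) auto
    then show "sqrt (2 * real (card G)) \<le> 2 * sqrt (real (card G))"
      by (simp add: real_sqrt_mult mult_right_mono)
    have "1 \<le> sqrt (real (card G))" using assms(2) fG by (simp add: Suc_leI card_gt_0_iff)
    then show "2 * K + K\<^sup>2 \<le> (2 * K + K\<^sup>2) * sqrt (real (card G))"
      using mult_left_mono[of 1 "sqrt (real (card G))" "2 * K + K\<^sup>2"] K by simp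
  qed
  also have "\<dots> = (2 + 2 * K + K\<^sup>2) * sqrt (real (card G))" by (simp add: algebra_simps)
  finally show "expectation (\<lambda>\<omega>. \<bar>\<Sum>l\<in>G. (shifted I B u \<omega> l)\<^sup>2 - 1\<bar>) \<le> (2 + 2 * K + K\<^sup>2) * sqrt (real (card G))" .
qed

end

end

end

section \<open>Expected size of the error terms\<close>

text \<open>The finest block dominates this geometric sum, so no factor for the number of levels
  appears. The constant 4 makes the induction close, since 4 + 1 <= 4 sqrt 2.\<close>

lemma sum_sqrt_card_level_block:
  "(\<Sum>t\<le>T. sqrt (real (card (level_block J0 t)))) \<le> 4 * sqrt (2 ^ (J0 + T))"
proof (induction T)
  case 0
  then show ?case by (simp add: card_level_block)
next
  case (Suc T)
  have "(\<Sum>t\<le>Suc T. sqrt (real (card (level_block J0 t)))) \<le> 4 * sqrt (2 ^ (J0 + T)) + sqrt (2 ^ (J0 + T))"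
    using Suc by (simp add: card_level_block)
  also have "\<dots> = 5 * sqrt (2 ^ (J0 + T))" by simp
  also have "\<dots> \<le> (4 * sqrt 2) * sqrt (2 ^ (J0 + T))"
  proof (intro mult_right_mono)
    have "5 / 4 \<le> sqrt (2::real)" by (rule real_le_rsqrt) (simp add: power2_eq_square)
    then show "5 \<le> 4 * sqrt (2::real)" by simp
  qed simp
  also have "\<dots> = 4 * sqrt (2 ^ (J0 + Suc T))" by (simp add: real_sqrt_mult)
  finally show ?case .
qed

text \<open>Bound for the mean of \<open>fit_error\<close>, with \<open>tail\<close> for the sum of
  g over the blocks beyond m. The signal, the bias and the rotation enter only through c, K and g,
  which is the source of uniformity.\<close>

definition error_bound :: "nat \<Rightarrow> real \<Rightarrow> real \<Rightarrow> real \<Rightarrow> real \<Rightarrow> real \<Rightarrow> nat \<Rightarrow> real \<Rightarrow> real" where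
  "error_bound J0 \<sigma> K z c tail m n =
     (\<sigma>\<^sup>2 / sqrt n * (2 * K + K\<^sup>2) +
      2 * \<sigma>\<^sup>2 * (2 + 2 * K + K\<^sup>2) * (4 / sqrt (2 ^ (m + 1)) + 16 / 2 ^ (m + 1)) +
      2 * \<sigma> * ((\<Sum>t\<le>m. 2 * 2 ^ (J0 + t) + 4 * (2 * 2 ^ (J0 + t) + 2 * K\<^sup>2)) * (\<sigma> / sqrt n) + 2 * (1 + K) * tail))
       / (sqrt 2 * \<sigma>\<^sup>2) +
     \<bar>z\<bar> * (80 * \<sigma> ^ 4 / 2 ^ (m + 1) + 4 * \<sigma>\<^sup>2 *
       ((\<Sum>t\<le>m. 2 * (2 ^ (J0 + t) * (\<sigma>\<^sup>2 / n))\<^sup>2) + 8 * \<sigma> ^ 4 / n + 64 * (c ^ 3 * tail) +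
        64 * (\<sigma>\<^sup>2 / n)\<^sup>2 * (24 * n + 8 * K ^ 4))) / (2 * \<sigma> ^ 4)"

text \<open>\<open>B\<close> is orthogonal and u is the bias in noise units. The bound on \<mu>
  starts at t = 1: the Besov norm does not restrict the scaling coefficients in block 0.\<close>

locale gaussian_sequence =
  fixes J0 R :: nat and \<sigma> K c :: real and \<mu> u g :: "nat \<Rightarrow> real" and B :: "nat \<Rightarrow> nat \<Rightarrow> real"
    and I :: "nat set" and n v :: real
  assumes sigma: "\<sigma> > 0" and K: "0 \<le> K"
    and I_def: "I = {1..2 ^ (J0 + R)}" and n_def: "n = 2 ^ (J0 + R)" and v_def: "v = \<sigma>\<^sup>2 / n"
    and rows: "\<And>l m. l \<in> I \<Longrightarrow> m \<in> I \<Longrightarrow> (\<Sum>i\<in>I. B l i * B m i) = (if l = m then 1 else 0)"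
    and columns: "\<And>i j. i \<in> I \<Longrightarrow> j \<in> I \<Longrightarrow> (\<Sum>l\<in>I. B l i * B l j) = (if i = j then 1 else 0)"
    and u: "(\<Sum>l\<in>I. (u l)\<^sup>2) \<le> K\<^sup>2"
    and \<mu>: "\<And>t. 1 \<le> t \<Longrightarrow> t \<le> R \<Longrightarrow> L2_set \<mu> (level_block J0 t) \<le> g t"
    and g: "\<And>t. 1 \<le> t \<Longrightarrow> g t \<le> c"
begin

definition M where "M = gauss_product I"

definition w where "w \<omega> = shifted I B u \<omega>"

text \<open>Formed with the original errors instead of the rotated ones, so that its law depends on
  n only and the central limit theorem applies directly.\<close>

definition S where "S \<omega> = (\<Sum>i\<in>I. (\<omega> i)\<^sup>2) - n"

sublocale prob_space M unfolding M_def by (rule prob_space_gauss_product)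

lemma finite_I: "finite I" by (simp add: I_def)

lemma n_pos: "n > 0" by (simp add: n_def)

lemma card_I: "real (card I) = n" by (simp add: I_def n_def)

lemma block_subset:
  assumes "t \<le> R"
  shows "level_block J0 t \<subseteq> I"
proof
  fix l assume "l \<in> level_block J0 t"
  then have l: "1 \<le> l" "l \<le> 2 ^ (J0 + t)" by (auto simp: level_block_def split: if_splits)
  have "(2::nat) ^ (J0 + t) \<le> 2 ^ (J0 + R)"
    using assms by (intro power_increasing) auto
  with l(2) have "l \<le> 2 ^ (J0 + R)" by (rule le_trans)
  with l(1) show "l \<in> I" unfolding I_def by simp
qed

lemma block_nonempty: "level_block J0 t \<noteq> {}"
  using card_level_block[of J0 t] by (metis card.empty power_eq_0_iff zero_neq_numeral)

lemma card_block_le: "real (card (level_block J0 t)) \<le> 2 ^ (J0 + t)"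
  by (simp add: card_level_block power_increasing)

text \<open>The premises of the nested contexts above, in their order; \<open>finite_I\<close>
  occurs twice because \<open>I\<close> indexes both the errors and the coefficients.\<close>

lemmas shift_facts = finite_I rows finite_I K u

lemma measurable_w [measurable]: "(\<lambda>\<omega>. w \<omega> l) \<in> borel_measurable M"
  unfolding w_def M_def by (rule measurable_shifted[OF shift_facts])

lemma measurable_M_component [measurable]: "i \<in> I \<Longrightarrow> (\<lambda>\<omega>. \<omega> i) \<in> borel_measurable M"
  unfolding M_def by (rule measurable_gauss_product_component)

lemma measurable_S [measurable]: "S \<in> borel_measurable M"
  unfolding S_def by measurable

lemma excess_bound:
  assumes "t \<le> R"
  shows "integrable M (\<lambda>\<omega>. \<bar>excess J0 (w \<omega>) t\<bar>)"
    and "expectation (\<lambda>\<omega>. \<bar>excess J0 (w \<omega>) t\<bar>) \<le> (2 + 2 * K + K\<^sup>2) * sqrt (real (card (level_block J0 t)))"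
  using expectation_abs_excess_shifted[OF shift_facts block_subset[OF assms] block_nonempty]
  unfolding excess_def w_def M_def by auto

lemma energy_bound:
  assumes "t \<le> R"
  shows "integrable M (\<lambda>\<omega>. energy J0 (w \<omega>) t)"
    and "expectation (\<lambda>\<omega>. energy J0 (w \<omega>) t) \<le> 2 * 2 ^ (J0 + t) + 2 * K\<^sup>2"
proof -
  note * = expectation_energy[OF shift_facts block_subset[OF assms]]
  show "integrable M (\<lambda>\<omega>. energy J0 (w \<omega>) t)"
    using *(1) unfolding energy_def w_def M_def .
  show "expectation (\<lambda>\<omega>. energy J0 (w \<omega>) t) \<le> 2 * 2 ^ (J0 + t) + 2 * K\<^sup>2"
    using *(2) card_block_le[of t] unfolding energy_def w_def M_def by linarith
qed

lemma cross_expectation_bound: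
  assumes "1 \<le> t" "t \<le> R"
  shows "integrable M (\<lambda>\<omega>. \<bar>cross J0 \<mu> (w \<omega>) t\<bar>)"
    and "expectation (\<lambda>\<omega>. \<bar>cross J0 \<mu> (w \<omega>) t\<bar>) \<le> g t * (1 + K)"
proof -
  note * = expectation_abs_shifted_combination[OF shift_facts block_subset[OF assms(2)], of \<mu>]
  show "integrable M (\<lambda>\<omega>. \<bar>cross J0 \<mu> (w \<omega>) t\<bar>)"
    using *(1) unfolding cross_def w_def M_def .
  have "L2_set \<mu> (level_block J0 t) * (1 + K) \<le> g t * (1 + K)"
    using \<mu>[OF assms] K by (intro mult_right_mono) auto
  then show "expectation (\<lambda>\<omega>. \<bar>cross J0 \<mu> (w \<omega>) t\<bar>) \<le> g t * (1 + K)"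
    using *(2) unfolding cross_def w_def M_def by linarith
qed

lemma total_excess_bound:
  "integrable M (\<lambda>\<omega>. \<Sum>t\<le>R. \<bar>excess J0 (w \<omega>) t\<bar>)"
  "expectation (\<lambda>\<omega>. \<Sum>t\<le>R. \<bar>excess J0 (w \<omega>) t\<bar>) \<le> (2 + 2 * K + K\<^sup>2) * (4 * sqrt n)"
proof -
  show "integrable M (\<lambda>\<omega>. \<Sum>t\<le>R. \<bar>excess J0 (w \<omega>) t\<bar>)"
    by (intro Bochner_Integration.integrable_sum excess_bound) auto
  have "expectation (\<lambda>\<omega>. \<Sum>t\<le>R. \<bar>excess J0 (w \<omega>) t\<bar>) = (\<Sum>t\<le>R. expectation (\<lambda>\<omega>. \<bar>excess J0 (w \<omega>) t\<bar>))"
    by (intro Bochner_Integration.integral_sum excess_bound) auto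
  also have "\<dots> \<le> (\<Sum>t\<le>R. (2 + 2 * K + K\<^sup>2) * sqrt (real (card (level_block J0 t))))"
    by (intro sum_mono excess_bound) auto
  also have "\<dots> \<le> (2 + 2 * K + K\<^sup>2) * (4 * sqrt n)"
    unfolding sum_distrib_left[symmetric] n_def
    using sum_sqrt_card_level_block K by (intro mult_left_mono) auto
  finally show "expectation (\<lambda>\<omega>. \<Sum>t\<le>R. \<bar>excess J0 (w \<omega>) t\<bar>) \<le> (2 + 2 * K + K\<^sup>2) * (4 * sqrt n)" .
qed

text \<open>Orthogonality of the columns makes the rotated and the original sums of squares equal,
  so that only the effect of the shift is left.\<close>

lemma excess_difference_bound:
  "integrable M (\<lambda>\<omega>. \<bar>(\<Sum>t\<le>R. excess J0 (w \<omega>) t) - S \<omega>\<bar>)"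
  "expectation (\<lambda>\<omega>. \<bar>(\<Sum>t\<le>R. excess J0 (w \<omega>) t) - S \<omega>\<bar>) \<le> 2 * K + K\<^sup>2"
proof -
  have "(\<Sum>t\<le>R. excess J0 (w \<omega>) t) - S \<omega> = 2 * (\<Sum>l\<in>I. u l * lin I (B l) \<omega>) + (\<Sum>l\<in>I. (u l)\<^sup>2)" for \<omega>
  proof -
    have "(\<Sum>t\<le>R. excess J0 (w \<omega>) t) = (\<Sum>l\<in>I. (w \<omega> l)\<^sup>2 - 1)"
      unfolding excess_def I_def by (rule sum_level_blocks[symmetric])
    also have "\<dots> = (\<Sum>l\<in>I. (lin I (B l) \<omega>)\<^sup>2 - 1) + (2 * (\<Sum>l\<in>I. u l * lin I (B l) \<omega>) + (\<Sum>l\<in>I. (u l)\<^sup>2))"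
      unfolding w_def by (rule excess_shifted[OF shift_facts])
    also have "(\<Sum>l\<in>I. (lin I (B l) \<omega>)\<^sup>2 - 1) = S \<omega>"
    proof -
      have "(\<Sum>l\<in>I. (lin I (B l) \<omega>)\<^sup>2) = (\<Sum>l\<in>I. (\<Sum>i\<in>I. \<omega> i * B l i)\<^sup>2)"
        by (simp add: lin_def mult.commute)
      also have "\<dots> = (\<Sum>i\<in>I. (\<omega> i)\<^sup>2)"
        by (rule combination_norm[OF finite_I, where B="\<lambda>i l. B l i" and \<Lambda>=I]) (use columns finite_I in auto)
      finally show ?thesis by (simp add: sum_subtractf S_def card_I)
    qed
    finally show ?thesis by simp
  qed
  then show "integrable M (\<lambda>\<omega>. \<bar>(\<Sum>t\<le>R. excess J0 (w \<omega>) t) - S \<omega>\<bar>)"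
    "expectation (\<lambda>\<omega>. \<bar>(\<Sum>t\<le>R. excess J0 (w \<omega>) t) - S \<omega>\<bar>) \<le> 2 * K + K\<^sup>2"
    using expectation_shift_error[OF shift_facts, of I] unfolding M_def by simp_all
qed

text \<open>The blocks before R-m contain n/2^(m+1) indices and contribute 4 sqrt n / sqrt (2^(m+1))
  to the weighted sum of root sizes; the weight 4/2^(m+1) on all blocks contributes 16 sqrt n /
  2^(m+1). In the cross part the coarse blocks give O(n^(-1/2)) and the others the tail of
  g.\<close>

lemma process_error_expectation:
  assumes m: "m < R"
  shows "integrable M (\<lambda>\<omega>. process_error J0 R \<sigma> \<mu> (w \<omega>) m)"
    and "expectation (\<lambda>\<omega>. process_error J0 R \<sigma> \<mu> (w \<omega>) m)
      \<le> 2 * \<sigma>\<^sup>2 * (2 + 2 * K + K\<^sup>2) * (4 / sqrt (2 ^ (m + 1)) + 16 / 2 ^ (m + 1)) +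
        2 * \<sigma> * ((\<Sum>t\<le>m. 2 * 2 ^ (J0 + t) + 4 * (2 * 2 ^ (J0 + t) + 2 * K\<^sup>2)) * (\<sigma> / sqrt n)
          + 2 * (1 + K) * (\<Sum>t\<in>{m<..R}. g t))"
proof -
  define wt :: "nat \<Rightarrow> real" where "wt t = (if t < R - m then 1 else 4 / 2 ^ (m + 1))" for t
  define L where "L = 2 + 2 * K + K\<^sup>2"
  have L: "L \<ge> 0" using K by (simp add: L_def)
  define s where "s = sqrt v"
  have s: "s = \<sigma> / sqrt n" "0 \<le> s" using sigma n_pos by (simp_all add: s_def v_def real_sqrt_divide)
  define X1 where "X1 \<omega> = (\<Sum>t\<le>R. wt t * \<bar>excess J0 (w \<omega>) t\<bar>)" for \<omega>
  define X2 where "X2 \<omega> = (\<Sum>t\<le>m. 2 * 2 ^ (J0 + t) * s + 4 * s * energy J0 (w \<omega>) t)" for \<omega>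
  define X3 where "X3 \<omega> = (\<Sum>t\<in>{m<..R}. 2 * \<bar>cross J0 \<mu> (w \<omega>) t\<bar>)" for \<omega>
  have pe: "process_error J0 R \<sigma> \<mu> (w \<omega>) m = 2 * \<sigma>\<^sup>2 / sqrt n * X1 \<omega> + 2 * \<sigma> * (X2 \<omega> + X3 \<omega>)" for \<omega>
  proof -
    have "{..R} = {..m} \<union> {m<..R}" using m by auto
    then have "(\<Sum>t\<le>R. if t \<le> m then 2 * 2 ^ (J0 + t) * s + 4 * s * energy J0 (w \<omega>) t
        else 2 * \<bar>cross J0 \<mu> (w \<omega>) t\<bar>) = X2 \<omega> + X3 \<omega>"
      unfolding X2_def X3_def by (simp only:) (subst sum.union_disjoint, auto)
    then show ?thesis
      unfolding process_error_def X1_def wt_def s_def v_def n_def by simp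
  qed
  have int: "integrable M X1" "integrable M X2" "integrable M X3"
    unfolding X1_def X2_def X3_def using m
    by (intro Bochner_Integration.integrable_sum integrable_mult_right Bochner_Integration.integrable_add
        excess_bound energy_bound cross_expectation_bound; simp)+
  then show "integrable M (\<lambda>\<omega>. process_error J0 R \<sigma> \<mu> (w \<omega>) m)"
    unfolding pe by simp
  have "expectation X1 = (\<Sum>t\<le>R. wt t * expectation (\<lambda>\<omega>. \<bar>excess J0 (w \<omega>) t\<bar>))"
    unfolding X1_def using excess_bound(1) by simp
  also have "\<dots> \<le> (\<Sum>t\<le>R. wt t * (L * sqrt (real (card (level_block J0 t)))))"
    unfolding L_def by (intro sum_mono mult_left_mono excess_bound) (auto simp: wt_def)
  also have "\<dots> \<le> (\<Sum>t\<le>R. (if t < R - m then L * sqrt (real (card (level_block J0 t))) else 0)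
      + 4 / 2 ^ (m + 1) * (L * sqrt (real (card (level_block J0 t)))))"
    using L by (intro sum_mono) (auto simp: wt_def)
  also have "\<dots> = L * (\<Sum>t\<in>{..R-m-1}. sqrt (real (card (level_block J0 t))))
      + 4 / 2 ^ (m + 1) * (L * (\<Sum>t\<le>R. sqrt (real (card (level_block J0 t)))))"
  proof -
    have "(\<Sum>t\<le>R. (if t < R - m then L * sqrt (real (card (level_block J0 t))) else 0))
        = (\<Sum>t\<in>{..R-m-1}. L * sqrt (real (card (level_block J0 t))))"
      using m by (intro sum.mono_neutral_cong_right) auto
    then show ?thesis by (simp add: sum.distrib sum_distrib_left)
  qed
  also have "\<dots> \<le> L * (4 * sqrt (2 ^ (J0 + (R - m - 1)))) + 4 / 2 ^ (m + 1) * (L * (4 * sqrt (2 ^ (J0 + R))))"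
    using L by (intro add_mono mult_left_mono sum_sqrt_card_level_block) auto
  also have "sqrt (2 ^ (J0 + (R - m - 1))) = sqrt n / sqrt (2 ^ (m + 1))"
  proof -
    have "n = 2 ^ (J0 + (R - m) - 1) * 2 ^ (m + 1)" unfolding n_def by (rule power_two_split[OF m])
    moreover have "J0 + (R - m) - 1 = J0 + (R - m - 1)" using m by simp
    ultimately show ?thesis by (simp add: real_sqrt_mult)
  qed
  also have "L * (4 * (sqrt n / sqrt (2 ^ (m + 1)))) + 4 / 2 ^ (m + 1) * (L * (4 * sqrt (2 ^ (J0 + R))))
      = sqrt n * (L * (4 / sqrt (2 ^ (m + 1)) + 16 / 2 ^ (m + 1)))"
    unfolding n_def[symmetric] by (simp add: field_simps del: power_Suc)
  finally have X1: "2 * \<sigma>\<^sup>2 / sqrt n * expectation X1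
      \<le> 2 * \<sigma>\<^sup>2 / sqrt n * (sqrt n * (L * (4 / sqrt (2 ^ (m + 1)) + 16 / 2 ^ (m + 1))))"
    using n_pos by (intro mult_left_mono) auto
  also have "\<dots> = 2 * \<sigma>\<^sup>2 * L * (4 / sqrt (2 ^ (m + 1)) + 16 / 2 ^ (m + 1))"
    using n_pos by simp
  finally have X1: "2 * \<sigma>\<^sup>2 / sqrt n * expectation X1 \<le> 2 * \<sigma>\<^sup>2 * L * (4 / sqrt (2 ^ (m + 1)) + 16 / 2 ^ (m + 1))" .
  have "expectation X2 = (\<Sum>t\<le>m. 2 * 2 ^ (J0 + t) * s + 4 * s * expectation (\<lambda>\<omega>. energy J0 (w \<omega>) t))"
    unfolding X2_def using energy_bound(1) m by (simp add: prob_space)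
  also have "\<dots> \<le> (\<Sum>t\<le>m. 2 * 2 ^ (J0 + t) * s + 4 * s * (2 * 2 ^ (J0 + t) + 2 * K\<^sup>2))"
    using s m by (intro sum_mono add_left_mono mult_left_mono energy_bound) auto
  also have "\<dots> = (\<Sum>t\<le>m. 2 * 2 ^ (J0 + t) + 4 * (2 * 2 ^ (J0 + t) + 2 * K\<^sup>2)) * s"
    unfolding sum_distrib_right by (intro sum.cong refl) (simp add: algebra_simps)
  finally have X2: "expectation X2 \<le> (\<Sum>t\<le>m. 2 * 2 ^ (J0 + t) + 4 * (2 * 2 ^ (J0 + t) + 2 * K\<^sup>2)) * s" .
  have "expectation X3 = (\<Sum>t\<in>{m<..R}. 2 * expectation (\<lambda>\<omega>. \<bar>cross J0 \<mu> (w \<omega>) t\<bar>))"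
    unfolding X3_def using cross_expectation_bound(1) by simp
  also have "\<dots> \<le> (\<Sum>t\<in>{m<..R}. 2 * (g t * (1 + K)))"
    by (intro sum_mono mult_left_mono cross_expectation_bound) auto
  also have "\<dots> = 2 * (1 + K) * (\<Sum>t\<in>{m<..R}. g t)"
    unfolding sum_distrib_left by (intro sum.cong refl) (simp add: algebra_simps)
  finally have X3: "expectation X3 \<le> 2 * (1 + K) * (\<Sum>t\<in>{m<..R}. g t)" .
  have "expectation (\<lambda>\<omega>. process_error J0 R \<sigma> \<mu> (w \<omega>) m)
      = 2 * \<sigma>\<^sup>2 / sqrt n * expectation X1 + 2 * \<sigma> * (expectation X2 + expectation X3)"
    unfolding pe using int by simp
  also have "\<dots> \<le> 2 * \<sigma>\<^sup>2 * L * (4 / sqrt (2 ^ (m + 1)) + 16 / 2 ^ (m + 1)) +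
      2 * \<sigma> * ((\<Sum>t\<le>m. 2 * 2 ^ (J0 + t) + 4 * (2 * 2 ^ (J0 + t) + 2 * K\<^sup>2)) * s
          + 2 * (1 + K) * (\<Sum>t\<in>{m<..R}. g t))"
    using sigma by (intro add_mono X1 mult_left_mono X2 X3) auto
  finally show "expectation (\<lambda>\<omega>. process_error J0 R \<sigma> \<mu> (w \<omega>) m)
      \<le> 2 * \<sigma>\<^sup>2 * (2 + 2 * K + K\<^sup>2) * (4 / sqrt (2 ^ (m + 1)) + 16 / 2 ^ (m + 1)) +
        2 * \<sigma> * ((\<Sum>t\<le>m. 2 * 2 ^ (J0 + t) + 4 * (2 * 2 ^ (J0 + t) + 2 * K\<^sup>2)) * (\<sigma> / sqrt n)
          + 2 * (1 + K) * (\<Sum>t\<in>{m<..R}. g t))"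
    unfolding L_def s(1) .
qed

lemma variance_error_expectation:
  assumes m: "m < R"
  shows "integrable M (\<lambda>\<omega>. variance_error J0 R \<sigma> \<mu> (w \<omega>) m)"
    and "expectation (\<lambda>\<omega>. variance_error J0 R \<sigma> \<mu> (w \<omega>) m)
      \<le> 80 * \<sigma> ^ 4 / 2 ^ (m + 1) + 4 * \<sigma>\<^sup>2 *
       ((\<Sum>t\<le>m. 2 * (2 ^ (J0 + t) * (\<sigma>\<^sup>2 / n))\<^sup>2) + 8 * \<sigma> ^ 4 / n + 64 * (c ^ 3 * (\<Sum>t\<in>{m<..R}. g t)) +
        64 * (\<sigma>\<^sup>2 / n)\<^sup>2 * (24 * n + 8 * K ^ 4))"
proof -
  define X where "X \<omega> = (\<Sum>l\<in>I. w \<omega> l ^ 4)" for \<omega>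
  have X: "integrable M X" "expectation X \<le> 24 * n + 8 * K ^ 4"
    using expectation_power4[OF shift_facts, of I]
    unfolding X_def M_def w_def card_I by auto
  define U where "U t = L2_set \<mu> (level_block J0 t)" for t
  have ve: "variance_error J0 R \<sigma> \<mu> (w \<omega>) m = 80 * \<sigma> ^ 4 / 2 ^ (m + 1) + 4 * \<sigma>\<^sup>2 *
       ((\<Sum>t\<le>m. 2 * (2 ^ (J0 + t) * (\<sigma>\<^sup>2 / n))\<^sup>2) + 8 * \<sigma> ^ 4 / n + 64 * (\<Sum>t\<in>{m<..R}. U t ^ 4) +
        64 * (\<sigma>\<^sup>2 / n)\<^sup>2 * X \<omega>)" for \<omega>
    unfolding variance_error_def X_def U_def n_def I_def sum_level_blocks ..
  show "integrable M (\<lambda>\<omega>. variance_error J0 R \<sigma> \<mu> (w \<omega>) m)"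
    unfolding ve by (intro Bochner_Integration.integrable_add integrable_mult_right X integrable_const)
  \<comment> \<open>Trading three of the four powers for c lets the same tail of g control this
    sum.\<close>
  have U4: "(\<Sum>t\<in>{m<..R}. U t ^ 4) \<le> c ^ 3 * (\<Sum>t\<in>{m<..R}. g t)"
    unfolding sum_distrib_left
  proof (rule sum_mono)
    fix t assume "t \<in> {m<..R}"
    then have t: "U t \<le> g t" "g t \<le> c" "0 \<le> U t" using \<mu>[of t] g[of t] by (auto simp: U_def L2_set_nonneg)
    then have "U t ^ 3 * U t \<le> c ^ 3 * g t" by (intro mult_mono power_mono) auto
    then show "U t ^ 4 \<le> c ^ 3 * g t" by (simp add: numeral_eq_Suc mult_ac)
  qed
  have "expectation (\<lambda>\<omega>. variance_error J0 R \<sigma> \<mu> (w \<omega>) m) = 80 * \<sigma> ^ 4 / 2 ^ (m + 1) + 4 * \<sigma>\<^sup>2 *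
       ((\<Sum>t\<le>m. 2 * (2 ^ (J0 + t) * (\<sigma>\<^sup>2 / n))\<^sup>2) + 8 * \<sigma> ^ 4 / n + 64 * (\<Sum>t\<in>{m<..R}. U t ^ 4) +
        64 * (\<sigma>\<^sup>2 / n)\<^sup>2 * expectation X)"
    unfolding ve using X(1) by (simp add: prob_space)
  also have "\<dots> \<le> 80 * \<sigma> ^ 4 / 2 ^ (m + 1) + 4 * \<sigma>\<^sup>2 *
       ((\<Sum>t\<le>m. 2 * (2 ^ (J0 + t) * (\<sigma>\<^sup>2 / n))\<^sup>2) + 8 * \<sigma> ^ 4 / n + 64 * (c ^ 3 * (\<Sum>t\<in>{m<..R}. g t)) +
        64 * (\<sigma>\<^sup>2 / n)\<^sup>2 * (24 * n + 8 * K ^ 4))"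
    by (intro add_left_mono mult_left_mono add_mono order_refl U4 X) auto
  finally show "expectation (\<lambda>\<omega>. variance_error J0 R \<sigma> \<mu> (w \<omega>) m) \<le> \<dots>" .
qed

lemma fit_error_expectation:
  assumes m: "m < R"
  shows "integrable M (\<lambda>\<omega>. fit_error J0 R \<sigma> \<mu> (w \<omega>) m z (S \<omega>))"
    and "expectation (\<lambda>\<omega>. fit_error J0 R \<sigma> \<mu> (w \<omega>) m z (S \<omega>))
      \<le> error_bound J0 \<sigma> K z c (\<Sum>t\<in>{m<..R}. g t) m n"
proof -
  note p = process_error_expectation[OF m] and v = variance_error_expectation[OF m] and d = excess_difference_bound
  show "integrable M (\<lambda>\<omega>. fit_error J0 R \<sigma> \<mu> (w \<omega>) m z (S \<omega>))"
    unfolding fit_error_def using p(1) v(1) d(1)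
    by (intro Bochner_Integration.integrable_add integrable_divide integrable_mult_right) auto
  have "expectation (\<lambda>\<omega>. fit_error J0 R \<sigma> \<mu> (w \<omega>) m z (S \<omega>))
      = (\<sigma>\<^sup>2 / sqrt n * expectation (\<lambda>\<omega>. \<bar>(\<Sum>t\<le>R. excess J0 (w \<omega>) t) - S \<omega>\<bar>)
         + expectation (\<lambda>\<omega>. process_error J0 R \<sigma> \<mu> (w \<omega>) m)) / (sqrt 2 * \<sigma>\<^sup>2)
        + \<bar>z\<bar> * expectation (\<lambda>\<omega>. variance_error J0 R \<sigma> \<mu> (w \<omega>) m) / (2 * \<sigma> ^ 4)"
    unfolding fit_error_def n_def[symmetric] using p(1) v(1) d(1) by simp
  also have "\<dots> \<le> (\<sigma>\<^sup>2 / sqrt n * (2 * K + K\<^sup>2) +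
        (2 * \<sigma>\<^sup>2 * (2 + 2 * K + K\<^sup>2) * (4 / sqrt (2 ^ (m + 1)) + 16 / 2 ^ (m + 1)) +
        2 * \<sigma> * ((\<Sum>t\<le>m. 2 * 2 ^ (J0 + t) + 4 * (2 * 2 ^ (J0 + t) + 2 * K\<^sup>2)) * (\<sigma> / sqrt n)
          + 2 * (1 + K) * (\<Sum>t\<in>{m<..R}. g t)))) / (sqrt 2 * \<sigma>\<^sup>2) +
        \<bar>z\<bar> * (80 * \<sigma> ^ 4 / 2 ^ (m + 1) + 4 * \<sigma>\<^sup>2 *
       ((\<Sum>t\<le>m. 2 * (2 ^ (J0 + t) * (\<sigma>\<^sup>2 / n))\<^sup>2) + 8 * \<sigma> ^ 4 / n + 64 * (c ^ 3 * (\<Sum>t\<in>{m<..R}. g t)) +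
        64 * (\<sigma>\<^sup>2 / n)\<^sup>2 * (24 * n + 8 * K ^ 4))) / (2 * \<sigma> ^ 4)"
    by (rule add_mono[OF divide_right_mono[OF add_mono[OF mult_left_mono[OF d(2)] p(2)]]
        divide_right_mono[OF mult_left_mono[OF v(2)]]]) (use sigma n_pos in simp_all)
  also have "\<dots> = error_bound J0 \<sigma> K z c (\<Sum>t\<in>{m<..R}. g t) m n"
    unfolding error_bound_def by (simp only: add.assoc)
  finally show "expectation (\<lambda>\<omega>. fit_error J0 R \<sigma> \<mu> (w \<omega>) m z (S \<omega>))
      \<le> error_bound J0 \<sigma> K z c (\<Sum>t\<in>{m<..R}. g t) m n" .
qed

lemma fit_error_nonneg:
  "0 \<le> fit_error J0 R \<sigma> \<mu> (w \<omega>) m z (S \<omega>)"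
  unfolding fit_error_def process_error_def variance_error_def energy_def using sigma
  by (intro add_nonneg_nonneg divide_nonneg_nonneg mult_nonneg_nonneg sum_nonneg)
    (auto intro!: add_nonneg_nonneg mult_nonneg_nonneg sum_nonneg)

end

section \<open>Laws of the data and of the normal quantile\<close>

lemma distr_affine_std_normal:
  assumes "\<sigma> > (0::real)"
  shows "distr std_normal_distribution lborel (\<lambda>x. c + \<sigma> * x) = density lborel (\<lambda>x. ennreal (normal_density c \<sigma> x))"
proof -
  interpret prob_space std_normal_distribution by (rule prob_space_std_normal)
  have "distributed std_normal_distribution lborel (\<lambda>x. x) (\<lambda>x. ennreal (normal_density 0 1 x))"
    unfolding distributed_def by (auto simp: distr_id2)
  from normal_density_affine[OF this, of \<sigma> c] assms show ?thesis
    by (simp add: distributed_distr_eq_density)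
qed

text \<open>With the affine image computed below it exhibits the law of the data as absolutely
  continuous with respect to Lebesgue measure.\<close>

lemma PiM_density_lborel:
  fixes f :: "'i \<Rightarrow> real \<Rightarrow> ennreal"
  assumes "finite I" and f: "\<And>i. f i \<in> borel_measurable borel"
    and sf: "\<And>i. sigma_finite_measure (density lborel (f i))"
  shows "PiM I (\<lambda>i. density lborel (f i)) = density (PiM I (\<lambda>_. lborel)) (\<lambda>x. \<Prod>i\<in>I. f i (x i))"
proof -
  interpret product_sigma_finite "\<lambda>i. density lborel (f i)" by (rule product_sigma_finite.intro[OF sf])
  interpret L: product_sigma_finite "\<lambda>_::'i. lborel :: real measure" by standard
  note f[measurable]
  have meas: "(\<lambda>x. \<Prod>i\<in>I. f i (x i)) \<in> borel_measurable (PiM I (\<lambda>_. lborel))"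
    by (intro borel_measurable_prod_ennreal measurable_compose[OF measurable_component_singleton]) auto
  show ?thesis
  proof (rule PiM_eqI[OF assms(1), symmetric])
    show "sets (density (PiM I (\<lambda>_. lborel)) (\<lambda>x. \<Prod>i\<in>I. f i (x i))) = sets (PiM I (\<lambda>i. density lborel (f i)))"
      by (simp cong: sets_PiM_cong)
    fix A :: "'i \<Rightarrow> real set"
    assume A: "\<And>i. i \<in> I \<Longrightarrow> A i \<in> sets (density lborel (f i))"
    then have A': "\<And>i. i \<in> I \<Longrightarrow> A i \<in> sets borel" by simp
    have "emeasure (density (PiM I (\<lambda>_. lborel)) (\<lambda>x. \<Prod>i\<in>I. f i (x i))) (Pi\<^sub>E I A)
        = (\<integral>\<^sup>+x. (\<Prod>i\<in>I. f i (x i)) * indicator (Pi\<^sub>E I A) x \<partial>PiM I (\<lambda>_. lborel))"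
      using A' assms(1) by (intro emeasure_density meas sets_PiM_I_finite) auto
    also have "\<dots> = (\<integral>\<^sup>+x. (\<Prod>i\<in>I. f i (x i) * indicator (A i) (x i)) \<partial>PiM I (\<lambda>_. lborel))"
    proof (rule nn_integral_cong)
      fix x :: "'i \<Rightarrow> real" assume "x \<in> space (PiM I (\<lambda>_. lborel))"
      then have "indicator (Pi\<^sub>E I A) x = (\<Prod>i\<in>I. indicator (A i) (x i) :: ennreal)"
        using assms(1) by (auto simp: indicator_def space_PiM PiE_iff prod_zero_iff)
      then show "(\<Prod>i\<in>I. f i (x i)) * indicator (Pi\<^sub>E I A) x = (\<Prod>i\<in>I. f i (x i) * indicator (A i) (x i))"
        by (simp add: prod.distrib)
    qed
    also have "\<dots> = (\<Prod>i\<in>I. \<integral>\<^sup>+x. f i x * indicator (A i) x \<partial>lborel)"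
      using A' assms(1) by (intro L.product_nn_integral_prod) auto
    also have "\<dots> = (\<Prod>i\<in>I. emeasure (density lborel (f i)) (A i))"
      using A' by (intro prod.cong refl) (simp add: emeasure_density)
    finally show "emeasure (density (PiM I (\<lambda>_. lborel)) (\<lambda>x. \<Prod>i\<in>I. f i (x i))) (Pi\<^sub>E I A)
        = (\<Prod>i\<in>I. emeasure (density lborel (f i)) (A i))" .
  qed
qed

lemma distr_affine_gauss_product:
  assumes "finite I" "\<sigma> > (0::real)"
  shows "distr (gauss_product I) (PiM I (\<lambda>_. lborel)) (\<lambda>\<epsilon>. \<lambda>i\<in>I. c i + \<sigma> * \<epsilon> i)
    = PiM I (\<lambda>i. density lborel (\<lambda>x. ennreal (normal_density (c i) \<sigma> x)))"
proof -
  interpret N: product_prob_space "\<lambda>i. density lborel (\<lambda>x. ennreal (normal_density (c i) \<sigma> x))"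
    by (intro product_prob_spaceI prob_space_normal_density assms)
  interpret G: product_prob_space "\<lambda>_::nat. std_normal_distribution"
    by (intro product_prob_spaceI prob_space_std_normal)
  have [measurable]: "(\<lambda>\<epsilon>. \<lambda>i\<in>I. c i + \<sigma> * \<epsilon> i) \<in> measurable (gauss_product I) (PiM I (\<lambda>_. lborel))"
    by (intro measurable_restrict) (auto simp: measurable_lborel1)
  show ?thesis
  proof (rule N.PiM_eqI[OF assms(1)])
    show "sets (distr (gauss_product I) (PiM I (\<lambda>_. lborel)) (\<lambda>\<epsilon>. \<lambda>i\<in>I. c i + \<sigma> * \<epsilon> i))
        = sets (PiM I (\<lambda>i. density lborel (\<lambda>x. ennreal (normal_density (c i) \<sigma> x))))"
      by (simp cong: sets_PiM_cong)
    fix A :: "nat \<Rightarrow> real set"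
    assume "\<And>i. i \<in> I \<Longrightarrow> A i \<in> sets (density lborel (\<lambda>x. ennreal (normal_density (c i) \<sigma> x)))"
    then have A: "\<And>i. i \<in> I \<Longrightarrow> A i \<in> sets borel" by simp
    define A' where "A' i = (\<lambda>x. c i + \<sigma> * x) -` A i" for i
    have A': "A' i \<in> sets borel" if "i \<in> I" for i
      using measurable_sets[of "\<lambda>x. c i + \<sigma> * x" borel borel "A i"] A[OF that] by (simp add: A'_def)
    have "emeasure (distr (gauss_product I) (PiM I (\<lambda>_. lborel)) (\<lambda>\<epsilon>. \<lambda>i\<in>I. c i + \<sigma> * \<epsilon> i)) (Pi\<^sub>E I A)
        = emeasure (gauss_product I) ((\<lambda>\<epsilon>. \<lambda>i\<in>I. c i + \<sigma> * \<epsilon> i) -` Pi\<^sub>E I A \<inter> space (gauss_product I))"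
      using A assms(1) by (intro emeasure_distr sets_PiM_I_finite) auto
    also have "(\<lambda>\<epsilon>. \<lambda>i\<in>I. c i + \<sigma> * \<epsilon> i) -` Pi\<^sub>E I A \<inter> space (gauss_product I) = Pi\<^sub>E I A'"
      by (auto simp: space_PiM PiE_iff A'_def)
    also have "emeasure (gauss_product I) (Pi\<^sub>E I A') = (\<Prod>i\<in>I. emeasure std_normal_distribution (A' i))"
      using A' assms(1) by (intro G.emeasure_PiM) auto
    also have "\<dots> = (\<Prod>i\<in>I. emeasure (density lborel (\<lambda>x. ennreal (normal_density (c i) \<sigma> x))) (A i))"
    proof (rule prod.cong[OF refl])
      fix i assume "i \<in> I"
      then show "emeasure std_normal_distribution (A' i)
          = emeasure (density lborel (\<lambda>x. ennreal (normal_density (c i) \<sigma> x))) (A i)"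
        using A unfolding distr_affine_std_normal[OF assms(2), symmetric]
        by (subst emeasure_distr) (auto simp: A'_def)
    qed
    finally show "emeasure (distr (gauss_product I) (PiM I (\<lambda>_. lborel)) (\<lambda>\<epsilon>. \<lambda>i\<in>I. c i + \<sigma> * \<epsilon> i)) (Pi\<^sub>E I A)
        = (\<Prod>i\<in>I. emeasure (density lborel (\<lambda>x. ennreal (normal_density (c i) \<sigma> x))) (A i))" .
  qed
qed

text \<open>An estimator minimizes only outside a Lebesgue null set of data; absolute continuity
  makes this an almost sure statement for every regression function, which enters through c.\<close>

lemma AE_affine_gauss_product:
  assumes "finite I" "\<sigma> > (0::real)" "AE y in PiM I (\<lambda>_. lborel). P y"
  shows "AE \<epsilon> in gauss_product I. P (\<lambda>i\<in>I. c i + \<sigma> * \<epsilon> i)"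
proof -
  have eq: "PiM I (\<lambda>i. density lborel (\<lambda>x. ennreal (normal_density (c i) \<sigma> x)))
      = density (PiM I (\<lambda>_. lborel)) (\<lambda>x. \<Prod>i\<in>I. ennreal (normal_density (c i) \<sigma> (x i)))"
    using assms(2)
    by (intro PiM_density_lborel assms(1) prob_space_imp_sigma_finite prob_space_normal_density) auto
  have meas: "(\<lambda>x. \<Prod>i\<in>I. ennreal (normal_density (c i) \<sigma> (x i))) \<in> borel_measurable (PiM I (\<lambda>_. lborel))"
    by (intro borel_measurable_prod_ennreal measurable_compose[OF measurable_component_singleton]) auto
  have "AE y in PiM I (\<lambda>i. density lborel (\<lambda>x. ennreal (normal_density (c i) \<sigma> x))). P y"
    unfolding eq using assms(3) by (auto simp: AE_density[OF meas])
  then have "AE y in distr (gauss_product I) (PiM I (\<lambda>_. lborel)) (\<lambda>\<epsilon>. \<lambda>i\<in>I. c i + \<sigma> * \<epsilon> i). P y"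
    by (simp only: distr_affine_gauss_product[OF assms(1,2)])
  then show ?thesis
    by (rule AE_distrD[rotated]) (intro measurable_restrict, auto simp: measurable_lborel1)
qed

section \<open>The normal distribution function and its quantile\<close>

lemma measure_std_normal_singleton: "measure std_normal_distribution {x} = 0"
proof -
  have "{x} \<in> null_sets std_normal_distribution"
    using AE_lborel_singleton[of x] by (subst null_sets_density_iff) (auto simp: frequently_def)
  then show ?thesis by (simp add: measure_def null_setsD1)
qed

lemma isCont_cdf_std_normal: "isCont (cdf std_normal_distribution) x"
proof -
  interpret real_distribution std_normal_distribution by (rule real_dist_normal_dist)
  show ?thesis by (simp add: isCont_cdf measure_std_normal_singleton)
qed

text \<open>The density is positive, so an interval of positive length is not a null set. Strictness
  gives the uniqueness that the definite description of the quantile requires.\<close>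

lemma cdf_std_normal_strict_mono:
  assumes "a < b"
  shows "cdf std_normal_distribution a < cdf std_normal_distribution b"
proof -
  interpret real_distribution std_normal_distribution by (rule real_dist_normal_dist)
  have "measure std_normal_distribution {a<..b} \<noteq> 0"
  proof
    assume "measure std_normal_distribution {a<..b} = 0"
    then have "{a<..b} \<in> null_sets std_normal_distribution"
      by (auto simp: null_sets_def emeasure_eq_measure)
    then have "AE x in lborel. x \<notin> {a<..b}"
      using normal_density_pos[of 1 0]
      by (subst (asm) null_sets_density_iff) (auto elim!: eventually_mono simp: less_le)
    then have "{a<..b} \<in> null_sets lborel"
      by (subst AE_iff_null_sets) auto
    then show False using assms by (auto simp: null_sets_def)
  qed
  then have "0 < measure std_normal_distribution {a<..b}" by (simp add: less_le)
  then show ?thesis using cdf_diff_eq[OF assms] by simp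
qed

lemma cdf_normal_upper_quantile:
  assumes "0 < \<alpha>" "\<alpha> < 1"
  shows "cdf std_normal_distribution (normal_upper_quantile \<alpha>) = 1 - \<alpha>"
proof -
  interpret real_distribution std_normal_distribution by (rule real_dist_normal_dist)
  have compl: "measure std_normal_distribution {z<..} = 1 - cdf std_normal_distribution z" for z
    using prob_compl[of "{..z}"] by (simp add: cdf_def Compl_eq_Diff_UNIV[symmetric])
  have "eventually (\<lambda>x. cdf std_normal_distribution x < 1 - \<alpha>) at_bot"
    using order_tendstoD(2)[OF cdf_lim_at_bot, of "1 - \<alpha>"] assms by simp
  then obtain a where a: "cdf std_normal_distribution a < 1 - \<alpha>"
    by (auto simp: eventually_at_bot_linorder)
  have "eventually (\<lambda>x. 1 - \<alpha> < cdf std_normal_distribution x) at_top"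
    using order_tendstoD(1)[OF cdf_lim_at_top_prob, of "1 - \<alpha>"] assms by simp
  then obtain b where b: "1 - \<alpha> < cdf std_normal_distribution b"
    by (auto simp: eventually_at_top_linorder)
  have "a \<le> b" using a b cdf_nondecreasing[of b a] by linarith
  then obtain z where z: "cdf std_normal_distribution z = 1 - \<alpha>"
    using IVT[of "cdf std_normal_distribution" a "1 - \<alpha>" b] a b isCont_cdf_std_normal by force
  have "normal_upper_quantile \<alpha> = z"
    unfolding normal_upper_quantile_def compl
  proof (rule the_equality)
    show "1 - cdf std_normal_distribution z = \<alpha>" using z by simp
    fix y assume "1 - cdf std_normal_distribution y = \<alpha>"
    then show "y = z"
      using cdf_std_normal_strict_mono[of y z] cdf_std_normal_strict_mono[of z y] z by (cases y z rule: linorder_cases) auto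
  qed
  then show ?thesis using z by simp
qed

text \<open>The central limit theorem for the variables 1 - x^2, centred with variance 2, on the
  infinite product; the finite product is its image under a choice of coordinates.\<close>

lemma chi_square_limit:
  "(\<lambda>n. measure (gauss_product {1..n})
      {\<omega>\<in>space (gauss_product {1..n}). - ((\<Sum>i\<in>{1..n}. (\<omega> i)\<^sup>2) - real n) / sqrt (2 * real n) \<le> x})
    \<longlonglongrightarrow> cdf std_normal_distribution x"
proof -
  define P where "P = gauss_product UNIV"
  interpret prob_space P unfolding P_def by (rule prob_space_gauss_product)
  interpret N: prob_space std_normal_distribution by (rule prob_space_std_normal)
  have comp [measurable]: "(\<lambda>\<omega>. \<omega> i) \<in> borel_measurable P" for i
    unfolding P_def by (rule measurable_gauss_product_component) simp
  have dist: "distr P borel (\<lambda>\<omega>. \<omega> i) = std_normal_distribution" for i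
    unfolding P_def by (rule distr_gauss_component) simp
  define X :: "nat \<Rightarrow> (nat \<Rightarrow> real) \<Rightarrow> real" where "X i \<omega> = 1 - (\<omega> i)\<^sup>2" for i \<omega>
  have mom: "integrable std_normal_distribution (\<lambda>x. x ^ k)" for k
    by (rule integrable_std_normal_distribution_moment)
  have m2: "(LINT x|std_normal_distribution. x ^ 2) = 1" "(LINT x|std_normal_distribution. x ^ 4) = 3"
    using std_normal_distribution_even_moments(1)[of 1] std_normal_distribution_even_moments(1)[of 2]
    by (simp_all add: fact_numeral)
  have intP: "integrable P (\<lambda>\<omega>. \<omega> i ^ k)" and expP: "expectation (\<lambda>\<omega>. \<omega> i ^ k) = (LINT x|std_normal_distribution. x ^ k)" for i k
    using mom[of k] integrable_distr_eq[of "\<lambda>\<omega>. \<omega> i" P borel "\<lambda>x. x ^ k"]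
      integral_distr[of "\<lambda>\<omega>. \<omega> i" P borel "\<lambda>x. x ^ k"] by (simp_all add: dist)
  have X2: "(X i \<omega>)\<^sup>2 = 1 - 2 * \<omega> i ^ 2 + \<omega> i ^ 4" for i \<omega>
    by (simp add: X_def power2_eq_square power4_eq_xxxx algebra_simps)
  have mean: "expectation (X i) = 0" for i
    using intP[of i 2] expP[of i 2] m2 by (simp add: X_def[abs_def] prob_space)
  have "indep_vars (\<lambda>_. borel) (\<lambda>i \<omega>. \<omega> i) UNIV"
    unfolding P_def by (rule indep_gauss_components) simp
  then have ind: "indep_vars (\<lambda>_. borel) X UNIV"
    unfolding X_def[abs_def] by (rule indep_vars_compose2) auto
  have dX: "distr P borel (X i) = distr std_normal_distribution borel (\<lambda>x. 1 - x\<^sup>2)" for i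
    unfolding dist[of i, symmetric] by (subst distr_distr) (auto simp: X_def[abs_def] comp_def)
  have "weak_conv_m (\<lambda>n. distr P borel (\<lambda>\<omega>. (\<Sum>i<n. X i \<omega> - 0) / sqrt (real n * (sqrt 2)\<^sup>2))) std_normal_distribution"
  proof (rule central_limit_theorem[OF ind mean _ _ _ dX])
    show "integrable P (\<lambda>\<omega>. (X i \<omega>)\<^sup>2)" for i
      unfolding X2 using intP by simp
    show "variance (X i) = (sqrt 2)\<^sup>2" for i
      unfolding mean using intP expP m2 by (simp add: X2 prob_space)
  qed simp
  then have lim: "(\<lambda>n. cdf (distr P borel (\<lambda>\<omega>. (\<Sum>i<n. X i \<omega> - 0) / sqrt (real n * (sqrt 2)\<^sup>2))) x)
      \<longlonglongrightarrow> cdf std_normal_distribution x"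
    using isCont_cdf_std_normal by (simp add: weak_conv_m_def weak_conv_def)
  have "cdf (distr P borel (\<lambda>\<omega>. (\<Sum>i<n. X i \<omega> - 0) / sqrt (real n * (sqrt 2)\<^sup>2))) x
      = measure (gauss_product {1..n})
      {\<omega>\<in>space (gauss_product {1..n}). - ((\<Sum>i\<in>{1..n}. (\<omega> i)\<^sup>2) - real n) / sqrt (2 * real n) \<le> x}" for n
  proof -
    \<comment> \<open>The limit theorem counts from 0, the regression errors from 1.\<close>
    let ?T = "\<lambda>\<omega>. \<lambda>i\<in>{1..n}. \<omega> (i - 1) :: real"
    let ?G = "gauss_product {1..n}"
    have T: "?T \<in> measurable P ?G"
      by (intro measurable_restrict) (auto simp: measurable_density_eq2 intro: comp)
    have G: "?G = distr P ?G ?T"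
      unfolding P_def
      by (rule distr_PiM_reindex[symmetric, where M="\<lambda>_. std_normal_distribution"]) (auto simp: prob_space_std_normal inj_on_def)
    have E: "{\<omega>\<in>space ?G. - ((\<Sum>i\<in>{1..n}. (\<omega> i)\<^sup>2) - real n) / sqrt (2 * real n) \<le> x} \<in> sets ?G"
      by measurable
    have "measure ?G {\<omega>\<in>space ?G. - ((\<Sum>i\<in>{1..n}. (\<omega> i)\<^sup>2) - real n) / sqrt (2 * real n) \<le> x}
        = measure P (?T -` {\<omega>\<in>space ?G. - ((\<Sum>i\<in>{1..n}. (\<omega> i)\<^sup>2) - real n) / sqrt (2 * real n) \<le> x} \<inter> space P)"
      by (subst G) (rule measure_distr[OF T E])
    also have "?T -` {\<omega>\<in>space ?G. - ((\<Sum>i\<in>{1..n}. (\<omega> i)\<^sup>2) - real n) / sqrt (2 * real n) \<le> x} \<inter> space P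
        = (\<lambda>\<omega>. (\<Sum>i<n. X i \<omega> - 0) / sqrt (real n * (sqrt 2)\<^sup>2)) -` {..x} \<inter> space P"
    proof -
      have "(\<Sum>i\<in>{1..n}. (?T \<omega> i)\<^sup>2) = (\<Sum>i<n. (\<omega> i)\<^sup>2)" for \<omega>
        by (rule sum.reindex_bij_witness[of _ Suc "\<lambda>i. i - 1"]) auto
      then have "- ((\<Sum>i\<in>{1..n}. (?T \<omega> i)\<^sup>2) - real n) / sqrt (2 * real n)
          = (\<Sum>i<n. X i \<omega> - 0) / sqrt (real n * (sqrt 2)\<^sup>2)" for \<omega>
        by (simp add: X_def sum_subtractf mult.commute)
      then show ?thesis using measurable_space[OF T] by auto
    qed
    also have "measure P \<dots> = cdf (distr P borel (\<lambda>\<omega>. (\<Sum>i<n. X i \<omega> - 0) / sqrt (real n * (sqrt 2)\<^sup>2))) x"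
      unfolding cdf_def by (rule measure_distr[symmetric]) (auto simp: X_def)
    finally show ?thesis by simp
  qed
  with lim show ?thesis by simp
qed

section \<open>Uniform coverage in the sequence model\<close>

context gaussian_sequence
begin

text \<open>Outside of a bad event \<open>coverage_sandwich\<close> places E between two half-lines
  for the normalized sum; \<open>e\<close> is Markov's bound for the probability of the bad
  event.\<close>

lemma coverage_bounds:
  fixes h :: "(nat \<Rightarrow> real) \<Rightarrow> nat \<Rightarrow> real" and z \<kappa> :: real and m :: nat and E :: "(nat \<Rightarrow> real) set"
  assumes minimizer: "AE \<omega> in M. chain_minimizer v R (\<lambda>t. real (card (level_block J0 t)))
      (\<lambda>t. \<Sum>l\<in>level_block J0 t. (\<mu> l + sqrt v * w \<omega> l)\<^sup>2) (h \<omega>)"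
    and m: "1 \<le> m" "m < R" and eps: "\<epsilon> = 1 / 2 ^ (m + 1)"
    and g_small: "\<And>t. R - m \<le> t \<Longrightarrow> t \<le> R \<Longrightarrow> g t \<le> \<sigma> * \<epsilon>\<^sup>2 / 10"
    and \<kappa>: "\<kappa> > 0"
    and E: "E \<in> sets M" "\<And>\<omega>. \<omega> \<in> space M \<Longrightarrow> \<omega> \<in> E \<longleftrightarrow>
      (\<Sum>t\<le>R. \<Sum>l\<in>level_block J0 t. (\<mu> l - h \<omega> t * (\<mu> l + sqrt v * w \<omega> l))\<^sup>2)
      \<le> sqrt (2 * \<sigma> ^ 4 / n * (\<Sum>t\<le>R. \<Sum>l\<in>level_block J0 t. (2 * h \<omega> t - 1)\<^sup>2)
          + 4 * \<sigma>\<^sup>2 * (\<Sum>t\<le>R. \<Sum>l\<in>level_block J0 t. ((\<mu> l + sqrt v * w \<omega> l)\<^sup>2 - v)\<^sup>2 * (1 - h \<omega> t)\<^sup>2)) * z / sqrt n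
        + chain_risk v R (\<lambda>t. real (card (level_block J0 t)))
            (\<lambda>t. \<Sum>l\<in>level_block J0 t. (\<mu> l + sqrt v * w \<omega> l)\<^sup>2) (h \<omega>)"
  defines "F \<equiv> \<lambda>x. measure M {\<omega>\<in>space M. - S \<omega> / sqrt (2 * n) \<le> x}"
    and "e \<equiv> (2 + 2 * K + K\<^sup>2) * 8 / \<epsilon>\<^sup>2 / sqrt n + error_bound J0 \<sigma> K z c (\<Sum>t\<in>{m<..R}. g t) m n / \<kappa>"
  shows "measure M E \<le> F (z + \<kappa>) + e" and "F (z - \<kappa>) - e \<le> measure M E"
proof -
  define fe where "fe \<omega> = fit_error J0 R \<sigma> \<mu> (w \<omega>) m z (S \<omega>)" for \<omega>
  define te where "te \<omega> = (\<Sum>t\<le>R. \<bar>excess J0 (w \<omega>) t\<bar>)" for \<omega>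
  have e0: "\<epsilon> > 0" by (simp add: eps)
  \<comment> \<open>The total absolute excess dominates that of each block, so one event secures the
    noise condition on all finest blocks.\<close>
  define bad where "bad = {\<omega>\<in>space M. \<epsilon>\<^sup>2 / 2 * n \<le> te \<omega>} \<union> {\<omega>\<in>space M. \<kappa> \<le> fe \<omega>}"
  have fe_int: "integrable M fe" unfolding fe_def by (rule fit_error_expectation(1)[OF m(2)])
  have te_int: "integrable M te" unfolding te_def by (rule total_excess_bound(1))
  have [measurable]: "fe \<in> borel_measurable M" "te \<in> borel_measurable M"
    using fe_int te_int by auto
  have bad_sets: "bad \<in> sets M" unfolding bad_def by measurable
  have "measure M bad \<le> measure M {\<omega>\<in>space M. \<epsilon>\<^sup>2 / 2 * n \<le> te \<omega>} + measure M {\<omega>\<in>space M. \<kappa> \<le> fe \<omega>}"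
    unfolding bad_def by (rule measure_Un_le) measurable
  also have "measure M {\<omega>\<in>space M. \<epsilon>\<^sup>2 / 2 * n \<le> te \<omega>} \<le> expectation te / (\<epsilon>\<^sup>2 / 2 * n)"
    using e0 n_pos by (intro integral_Markov_inequality_measure[where A="space M"] te_int)
      (auto simp: te_def intro!: sum_nonneg)
  also have "\<dots> \<le> (2 + 2 * K + K\<^sup>2) * (4 * sqrt n) / (\<epsilon>\<^sup>2 / 2 * n)"
    using total_excess_bound(2) e0 n_pos unfolding te_def by (intro divide_right_mono) auto
  also have "\<dots> = (2 + 2 * K + K\<^sup>2) * 8 / \<epsilon>\<^sup>2 / sqrt n"
  proof -
    have "L * (4 * s) / (\<epsilon>\<^sup>2 / 2 * (s * s)) = L * 8 / \<epsilon>\<^sup>2 / s" if "s > 0" for L s :: real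
      using that e0 by (simp add: field_simps)
    from this[of "sqrt n"] n_pos show ?thesis by simp
  qed
  also have "measure M {\<omega>\<in>space M. \<kappa> \<le> fe \<omega>} \<le> expectation fe / \<kappa>"
    using \<kappa> fit_error_nonneg by (intro integral_Markov_inequality_measure[where A="space M"] fe_int)
      (auto simp: fe_def)
  also have "\<dots> \<le> error_bound J0 \<sigma> K z c (\<Sum>t\<in>{m<..R}. g t) m n / \<kappa>"
    using fit_error_expectation(2)[OF m(2)] \<kappa> unfolding fe_def by (intro divide_right_mono) auto
  finally have bad: "measure M bad \<le> e" by (simp add: e_def)
  have key: "AE \<omega> in M. \<omega> \<notin> bad \<longrightarrow>
      (\<omega> \<in> E \<longrightarrow> - S \<omega> / sqrt (2 * n) \<le> z + \<kappa>) \<and> (- S \<omega> / sqrt (2 * n) \<le> z - \<kappa> \<longrightarrow> \<omega> \<in> E)"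
    using minimizer AE_space
  proof eventually_elim
    case (elim \<omega>)
    show ?case
    proof (intro impI)
      assume "\<omega> \<notin> bad"
      then have small: "te \<omega> < \<epsilon>\<^sup>2 / 2 * n" "fe \<omega> < \<kappa>" using elim(2) by (auto simp: bad_def)
      interpret sf: sequence_fit J0 R \<sigma> \<mu> "w \<omega>" "h \<omega>" n v
        "\<lambda>t. \<Sum>l\<in>level_block J0 t. (\<mu> l + sqrt v * w \<omega> l)\<^sup>2" "\<lambda>t. real (card (level_block J0 t))"
        "excess J0 (w \<omega>)" "cross J0 \<mu> (w \<omega>)" "\<lambda>t. L2_set \<mu> (level_block J0 t)" "energy J0 (w \<omega>)"
        by unfold_locales
          (use sigma elim(1) in \<open>auto simp: n_def v_def excess_def cross_def energy_def\<close>)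
      have D: "\<bar>excess J0 (w \<omega>) t\<bar> \<le> \<epsilon>\<^sup>2 / 2 * n" if "R - m \<le> t" "t \<le> R" for t
      proof -
        have "\<bar>excess J0 (w \<omega>) t\<bar> \<le> te \<omega>"
          unfolding te_def using that by (intro member_le_sum) auto
        then show ?thesis using small by simp
      qed
      have U: "L2_set \<mu> (level_block J0 t) \<le> \<sigma> * \<epsilon>\<^sup>2 / 10" if "R - m \<le> t" "t \<le> R" for t
        using \<mu>[of t] g_small[OF that] that m by fastforce
      note cs = sf.coverage_sandwich[where z=z and S="S \<omega>", OF m eps D U]
      have "- S \<omega> / sqrt (2 * n) \<le> z + \<kappa>" if "\<omega> \<in> E"
      proof -
        have "- S \<omega> / sqrt (2 * n) \<le> z + fit_error J0 R \<sigma> \<mu> (w \<omega>) m z (S \<omega>)"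
          by (rule cs(1)) (use that E(2)[OF elim(2)] in auto)
        then show ?thesis using small(2) unfolding fe_def by linarith
      qed
      moreover have "\<omega> \<in> E" if "- S \<omega> / sqrt (2 * n) \<le> z - \<kappa>"
        unfolding E(2)[OF elim(2)]
      proof (rule cs(2))
        show "- S \<omega> / sqrt (2 * n) \<le> z - fit_error J0 R \<sigma> \<mu> (w \<omega>) m z (S \<omega>)"
          using that small(2) unfolding fe_def by linarith
      qed auto
      ultimately show "(\<omega> \<in> E \<longrightarrow> - S \<omega> / sqrt (2 * n) \<le> z + \<kappa>) \<and> (- S \<omega> / sqrt (2 * n) \<le> z - \<kappa> \<longrightarrow> \<omega> \<in> E)"
        by simp
    qed
  qed
  let ?A = "\<lambda>x. {\<omega>\<in>space M. - S \<omega> / sqrt (2 * n) \<le> x}"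
  have A: "?A x \<in> sets M" for x by measurable
  have "measure M E \<le> measure M (?A (z + \<kappa>) \<union> bad)"
  proof (rule finite_measure_mono_AE)
    show "AE \<omega>\<in>E in M. \<omega> \<in> ?A (z + \<kappa>) \<union> bad" using key AE_space by eventually_elim blast
    show "?A (z + \<kappa>) \<union> bad \<in> sets M" using A bad_sets by (rule sets.Un)
  qed
  also have "\<dots> \<le> F (z + \<kappa>) + measure M bad"
    unfolding F_def by (rule measure_Un_le[OF A bad_sets])
  finally show "measure M E \<le> F (z + \<kappa>) + e" using bad by simp
  have "measure M (?A (z - \<kappa>)) \<le> measure M (E \<union> bad)"
  proof (rule finite_measure_mono_AE)
    show "AE \<omega>\<in>?A (z - \<kappa>) in M. \<omega> \<in> E \<union> bad" using key by eventually_elim blast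
    show "E \<union> bad \<in> sets M" using E(1) bad_sets by (rule sets.Un)
  qed
  also have "\<dots> \<le> measure M E + measure M bad"
    by (rule measure_Un_le[OF E(1) bad_sets])
  finally show "F (z - \<kappa>) - e \<le> measure M E" unfolding F_def using bad by simp
qed

end

section \<open>Limits of the error bounds and choice of the cutoff\<close>

lemma error_bound_mono_tail:
  assumes "a \<le> b" "0 \<le> c" "0 \<le> K" "0 < \<sigma>"
  shows "error_bound J0 \<sigma> K z c a m n \<le> error_bound J0 \<sigma> K z c b m n"
  unfolding error_bound_def
  by (rule add_mono[OF
      divide_right_mono[OF add_left_mono[OF mult_left_mono[OF add_left_mono[OF mult_left_mono[OF assms(1)]]]]]
      divide_right_mono[OF mult_left_mono[OF add_left_mono[OF mult_left_mono[OF
        add_right_mono[OF add_left_mono[OF mult_left_mono[OF mult_left_mono[OF assms(1)]]]]]]]]])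
    (use assms in simp_all)

text \<open>What is left of \<open>error_bound\<close> for fixed m when n tends to infinity.\<close>

definition error_limit :: "real \<Rightarrow> real \<Rightarrow> real \<Rightarrow> real \<Rightarrow> real \<Rightarrow> nat \<Rightarrow> real" where
  "error_limit \<sigma> K z c tail m =
     (2 * \<sigma>\<^sup>2 * (2 + 2 * K + K\<^sup>2) * (4 / sqrt (2 ^ (m + 1)) + 16 / 2 ^ (m + 1)) + 2 * \<sigma> * (2 * (1 + K) * tail))
       / (sqrt 2 * \<sigma>\<^sup>2) +
     \<bar>z\<bar> * (80 * \<sigma> ^ 4 / 2 ^ (m + 1) + 4 * \<sigma>\<^sup>2 * (64 * (c ^ 3 * tail))) / (2 * \<sigma> ^ 4)"

lemma error_bound_tendsto:
  "((\<lambda>n. error_bound J0 \<sigma> K z c tail m n) \<longlongrightarrow> error_limit \<sigma> K z c tail m) at_top"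
proof -
  have r: "((\<lambda>n::real. a / sqrt n) \<longlongrightarrow> 0) at_top" "((\<lambda>n::real. a / n) \<longlongrightarrow> 0) at_top" for a
    by (auto intro!: real_tendsto_divide_at_top filterlim_ident sqrt_at_top)
  \<comment> \<open>A vanishing factor times an unbounded one; the limit is visible only after
    expansion.\<close>
  have q: "((\<lambda>n::real. (\<sigma>\<^sup>2 / n)\<^sup>2 * (24 * n + 8 * K ^ 4)) \<longlongrightarrow> 0) at_top"
  proof (rule Lim_transform_eventually)
    have "((\<lambda>n::real. 24 * (\<sigma>\<^sup>2)\<^sup>2 / n + 8 * K ^ 4 * (\<sigma>\<^sup>2 / n)\<^sup>2) \<longlongrightarrow> 0 + 8 * K ^ 4 * 0\<^sup>2) at_top"
      by (intro tendsto_intros r)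
    then show "((\<lambda>n::real. 24 * (\<sigma>\<^sup>2)\<^sup>2 / n + 8 * K ^ 4 * (\<sigma>\<^sup>2 / n)\<^sup>2) \<longlongrightarrow> 0) at_top" by simp
    show "\<forall>\<^sub>F n::real in at_top. 24 * (\<sigma>\<^sup>2)\<^sup>2 / n + 8 * K ^ 4 * (\<sigma>\<^sup>2 / n)\<^sup>2 = (\<sigma>\<^sup>2 / n)\<^sup>2 * (24 * n + 8 * K ^ 4)"
      using eventually_gt_at_top[of 0]
    proof eventually_elim
      case (elim n)
      then show ?case by (simp add: power_divide distrib_left power2_eq_square[of n] mult_ac)
    qed
  qed
  define k1 k2 k3 k4 where "k1 = 2 * K + K\<^sup>2"
    and "k2 = 2 * \<sigma>\<^sup>2 * (2 + 2 * K + K\<^sup>2) * (4 / sqrt (2 ^ (m + 1)) + 16 / 2 ^ (m + 1))"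
    and "k3 = (\<Sum>t\<le>m. 2 * 2 ^ (J0 + t) + 4 * (2 * 2 ^ (J0 + t) + 2 * K\<^sup>2))"
    and "k4 = 2 * (1 + K) * tail"
  define k5 k6 k7 k8 where "k5 = 80 * \<sigma> ^ 4 / 2 ^ (m + 1)" and "k6 = 64 * (c ^ 3 * tail)"
    and "k7 = inverse (sqrt 2 * \<sigma>\<^sup>2)" and "k8 = inverse (2 * \<sigma> ^ 4)"
  have s: "((\<lambda>n. \<Sum>t\<le>m. 2 * (2 ^ (J0 + t) * (\<sigma>\<^sup>2 / n))\<^sup>2) \<longlongrightarrow> (\<Sum>t\<le>m. 2 * (2 ^ (J0 + t) * 0)\<^sup>2)) at_top"
    by (intro tendsto_sum tendsto_mult tendsto_power tendsto_const r)
  have eq: "error_bound J0 \<sigma> K z c tail m n = (\<sigma>\<^sup>2 / sqrt n * k1 + k2 + 2 * \<sigma> * (k3 * (\<sigma> / sqrt n) + k4)) * k7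
      + \<bar>z\<bar> * (k5 + 4 * \<sigma>\<^sup>2 * ((\<Sum>t\<le>m. 2 * (2 ^ (J0 + t) * (\<sigma>\<^sup>2 / n))\<^sup>2) + 8 * \<sigma> ^ 4 / n + k6
        + 64 * ((\<sigma>\<^sup>2 / n)\<^sup>2 * (24 * n + 8 * K ^ 4)))) * k8" for n
    unfolding error_bound_def k1_def k2_def k3_def k4_def k5_def k6_def k7_def k8_def
    by (simp only: divide_inverse[of _ "sqrt 2 * \<sigma>\<^sup>2"] divide_inverse[of _ "2 * \<sigma> ^ 4"] mult.assoc)
  have "((\<lambda>n. error_bound J0 \<sigma> K z c tail m n) \<longlongrightarrow> (0 * k1 + k2 + 2 * \<sigma> * (k3 * 0 + k4)) * k7
      + \<bar>z\<bar> * (k5 + 4 * \<sigma>\<^sup>2 * ((\<Sum>t\<le>m. 2 * (2 ^ (J0 + t) * 0)\<^sup>2) + 0 + k6 + 64 * 0)) * k8) at_top"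
    unfolding eq by (intro tendsto_add tendsto_mult tendsto_const r q s)
  moreover have "(0 * k1 + k2 + 2 * \<sigma> * (k3 * 0 + k4)) * k7
      + \<bar>z\<bar> * (k5 + 4 * \<sigma>\<^sup>2 * ((\<Sum>t\<le>m. 2 * (2 ^ (J0 + t) * 0)\<^sup>2) + 0 + k6 + 64 * 0)) * k8
      = error_limit \<sigma> K z c tail m"
    unfolding error_limit_def k2_def k4_def k5_def k6_def k7_def k8_def divide_inverse[of _ "sqrt 2 * \<sigma>\<^sup>2"]
      divide_inverse[of _ "2 * \<sigma> ^ 4"] by simp
  ultimately show ?thesis by simp
qed

lemma error_limit_tendsto:
  assumes "tail \<longlonglongrightarrow> 0"
  shows "(\<lambda>m. error_limit \<sigma> K z c (tail m) m) \<longlonglongrightarrow> 0"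
proof -
  have p: "(\<lambda>m. a / 2 ^ (m + 1)) \<longlonglongrightarrow> 0" for a :: real
    by (rule LIMSEQ_ignore_initial_segment[where k=1 and f="\<lambda>m. a / 2 ^ m"])
      (rule LIMSEQ_divide_realpow_zero, simp)
  have "(\<lambda>m. 4 / sqrt 2 ^ (m + 1)) \<longlonglongrightarrow> 0"
    by (rule LIMSEQ_ignore_initial_segment[where k=1 and f="\<lambda>m. 4 / sqrt 2 ^ m"])
      (rule LIMSEQ_divide_realpow_zero, simp)
  then have q: "(\<lambda>m. 4 / sqrt (2 ^ (m + 1))) \<longlonglongrightarrow> 0" by (simp only: real_sqrt_power)
  define k1 k2 k3 where "k1 = 2 * \<sigma>\<^sup>2 * (2 + 2 * K + K\<^sup>2)" and "k2 = inverse (sqrt 2 * \<sigma>\<^sup>2)"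
    and "k3 = inverse (2 * \<sigma> ^ 4)"
  have "(\<lambda>m. error_limit \<sigma> K z c (tail m) m) \<longlonglongrightarrow>
     (k1 * (0 + 0) + 2 * \<sigma> * (2 * (1 + K) * 0)) * k2 + \<bar>z\<bar> * (0 + 4 * \<sigma>\<^sup>2 * (64 * (c ^ 3 * 0))) * k3"
    unfolding error_limit_def divide_inverse[of _ "sqrt 2 * \<sigma>\<^sup>2"] divide_inverse[of _ "2 * \<sigma> ^ 4"]
      k1_def[symmetric] k2_def[symmetric] k3_def[symmetric]
    by (intro tendsto_add tendsto_mult tendsto_const p q assms)
  then show ?thesis by simp
qed

text \<open>The choices are made in the order \<kappa> (continuity of the distribution function at
  z), m (tail of g), R0. None depends on the signal, bias, rotation or modulator, hence the position
  of the quantifiers. The error \<delta> is spent as 2\<delta>/3 on the central limit theorem with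
  the continuity margin and \<delta>/6 on each half of the bad event.\<close>

lemma uniform_coverage:
  fixes g :: "nat \<Rightarrow> real"
  assumes sigma: "\<sigma> > 0" and K: "0 \<le> K" and c: "0 \<le> c" and g0: "\<And>t. 0 \<le> g t" and g: "summable g"
    and alpha: "0 < \<alpha>" "\<alpha> < 1" and "\<delta> > 0"
  shows "\<exists>R0. \<forall>R\<ge>R0. \<forall>\<mu> u B I n v h E. gaussian_sequence J0 R \<sigma> K c \<mu> u g B I n v \<longrightarrow>
    (AE \<omega> in gauss_product I. chain_minimizer v R (\<lambda>t. real (card (level_block J0 t)))
      (\<lambda>t. \<Sum>l\<in>level_block J0 t. (\<mu> l + sqrt v * shifted I B u \<omega> l)\<^sup>2) (h \<omega>)) \<longrightarrow>
    E \<in> sets (gauss_product I) \<longrightarrow>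
    (\<forall>\<omega>\<in>space (gauss_product I). \<omega> \<in> E \<longleftrightarrow>
      (\<Sum>t\<le>R. \<Sum>l\<in>level_block J0 t. (\<mu> l - h \<omega> t * (\<mu> l + sqrt v * shifted I B u \<omega> l))\<^sup>2)
      \<le> sqrt (2 * \<sigma> ^ 4 / n * (\<Sum>t\<le>R. \<Sum>l\<in>level_block J0 t. (2 * h \<omega> t - 1)\<^sup>2)
          + 4 * \<sigma>\<^sup>2 * (\<Sum>t\<le>R. \<Sum>l\<in>level_block J0 t.
              ((\<mu> l + sqrt v * shifted I B u \<omega> l)\<^sup>2 - v)\<^sup>2 * (1 - h \<omega> t)\<^sup>2)) * normal_upper_quantile \<alpha> / sqrt n
        + chain_risk v R (\<lambda>t. real (card (level_block J0 t)))
            (\<lambda>t. \<Sum>l\<in>level_block J0 t. (\<mu> l + sqrt v * shifted I B u \<omega> l)\<^sup>2) (h \<omega>)) \<longrightarrow>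
    \<bar>measure (gauss_product I) E - (1 - \<alpha>)\<bar> \<le> \<delta>"
proof -
  define z where "z = normal_upper_quantile \<alpha>"
  define \<Phi> where "\<Phi> = cdf std_normal_distribution"
  have z: "\<Phi> z = 1 - \<alpha>" unfolding \<Phi>_def z_def by (rule cdf_normal_upper_quantile[OF alpha])
  obtain d where d: "d > 0" "\<And>x. \<bar>x - z\<bar> < d \<Longrightarrow> \<bar>\<Phi> x - \<Phi> z\<bar> < \<delta> / 3"
    using isCont_cdf_std_normal[of z] \<open>\<delta> > 0\<close> unfolding continuous_at_eps_delta \<Phi>_def dist_real_def
    by (metis divide_pos_pos zero_less_numeral)
  define \<kappa> where "\<kappa> = d / 2"
  have \<kappa>: "\<kappa> > 0" "\<bar>\<Phi> (z + \<kappa>) - (1 - \<alpha>)\<bar> < \<delta> / 3" "\<bar>\<Phi> (z - \<kappa>) - (1 - \<alpha>)\<bar> < \<delta> / 3"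
    using d(1) d(2)[of "z + \<kappa>"] d(2)[of "z - \<kappa>"] by (auto simp: \<kappa>_def z)
  define tail where "tail m = (\<Sum>t. g (t + Suc m))" for m
  have tail: "(\<Sum>t\<in>{m<..R}. g t) \<le> tail m" for m R
  proof -
    have "(\<Sum>t\<in>{m<..R}. g t) = (\<Sum>t<R - m. g (t + Suc m))"
      by (rule sum.reindex_bij_witness[of _ "\<lambda>t. t + Suc m" "\<lambda>t. t - Suc m"]) auto
    also have "\<dots> \<le> tail m"
      unfolding tail_def using g0 g by (intro sum_le_suminf) (auto simp del: add_Suc_right)
    finally show ?thesis .
  qed
  have "(\<lambda>m. \<Sum>t. g (t + m)) \<longlonglongrightarrow> 0" by (rule suminf_exist_split2[OF g])
  then have "tail \<longlonglongrightarrow> 0" unfolding tail_def by (rule LIMSEQ_Suc)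
  then have "(\<lambda>m. error_limit \<sigma> K z c (tail m) m) \<longlonglongrightarrow> 0" by (rule error_limit_tendsto)
  \<comment> \<open>Markov's inequality divides by \<kappa>, which leaves \<delta>/6.\<close>
  then have "eventually (\<lambda>m. error_limit \<sigma> K z c (tail m) m < \<kappa> * \<delta> / 6) sequentially"
    by (rule order_tendstoD(2)) (use \<kappa>(1) \<open>\<delta> > 0\<close> in simp)
  then obtain m where m: "1 \<le> m" "error_limit \<sigma> K z c (tail m) m < \<kappa> * \<delta> / 6"
    unfolding eventually_sequentially by (metis nat_le_linear)
  define \<epsilon> where "\<epsilon> = 1 / (2::real) ^ (m + 1)"
  have eps: "\<epsilon> > 0" by (simp add: \<epsilon>_def)
  define L where "L = (2 + 2 * K + K\<^sup>2) * 8 / \<epsilon>\<^sup>2"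
  define N :: "nat \<Rightarrow> real" where "N R = 2 ^ (J0 + R)" for R
  have NN: "filterlim (\<lambda>R. 2 ^ (J0 + R) :: nat) at_top sequentially"
    by (rule filterlim_at_top_mono[OF filterlim_ident]) (auto intro!: eventuallyI less_imp_le[OF le_less_trans[OF _ less_exp]])
  have N: "filterlim N at_top sequentially"
    using filterlim_compose[OF filterlim_real_sequentially NN] by (simp add: N_def[abs_def])
  have "(\<lambda>R. error_bound J0 \<sigma> K z c (tail m) m (N R)) \<longlonglongrightarrow> error_limit \<sigma> K z c (tail m) m"
    by (rule filterlim_compose[OF error_bound_tendsto N])
  then have ev1: "\<forall>\<^sub>F R in sequentially. error_bound J0 \<sigma> K z c (tail m) m (N R) < \<kappa> * \<delta> / 6"
    using m(2) by (rule order_tendstoD(2))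
  have "((\<lambda>n. L / sqrt n) \<longlongrightarrow> 0) at_top" by (auto intro!: real_tendsto_divide_at_top sqrt_at_top)
  then have "(\<lambda>R. L / sqrt (N R)) \<longlonglongrightarrow> 0" by (rule filterlim_compose[OF _ N])
  then have ev2: "\<forall>\<^sub>F R in sequentially. L / sqrt (N R) < \<delta> / 6"
    by (rule order_tendstoD(2)) (use \<open>\<delta> > 0\<close> in simp)
  define F where "F R x = measure (gauss_product {1..2 ^ (J0 + R)})
      {\<omega>\<in>space (gauss_product {1..2 ^ (J0 + R)}). - ((\<Sum>i\<in>{1..2 ^ (J0 + R)}. (\<omega> i)\<^sup>2) - real (2 ^ (J0 + R)))
         / sqrt (2 * real (2 ^ (J0 + R))) \<le> x}" for R x
  have F: "(\<lambda>R. F R x) \<longlonglongrightarrow> \<Phi> x" for x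
    unfolding F_def \<Phi>_def by (rule filterlim_compose[OF chi_square_limit NN])
  have ev3: "\<forall>\<^sub>F R in sequentially. F R (z + \<kappa>) < 1 - \<alpha> + 2 * \<delta> / 3"
    by (rule order_tendstoD(2)[OF F]) (use \<kappa> \<open>\<delta> > 0\<close> in linarith)
  have ev4: "\<forall>\<^sub>F R in sequentially. 1 - \<alpha> - 2 * \<delta> / 3 < F R (z - \<kappa>)"
    by (rule order_tendstoD(1)[OF F]) (use \<kappa> \<open>\<delta> > 0\<close> in linarith)
  have "\<forall>\<^sub>F t in sequentially. g t < \<sigma> * \<epsilon>\<^sup>2 / 10"
    by (rule order_tendstoD(2)[OF summable_LIMSEQ_zero[OF g]]) (use sigma eps in simp)
  then obtain T where T: "\<And>t. t \<ge> T \<Longrightarrow> g t < \<sigma> * \<epsilon>\<^sup>2 / 10" by (auto simp: eventually_sequentially)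
  \<comment> \<open>Then m < R, and the finest blocks start beyond T, where g is small.\<close>
  have "\<forall>\<^sub>F R in sequentially. R > m + T" by (rule eventually_gt_at_top)
  with ev1 ev2 ev3 ev4 have "\<forall>\<^sub>F R in sequentially. error_bound J0 \<sigma> K z c (tail m) m (N R) < \<kappa> * \<delta> / 6 \<and>
      L / sqrt (N R) < \<delta> / 6 \<and> F R (z + \<kappa>) < 1 - \<alpha> + 2 * \<delta> / 3 \<and> 1 - \<alpha> - 2 * \<delta> / 3 < F R (z - \<kappa>) \<and> R > m + T"
    by eventually_elim auto
  then obtain R0 where R0: "\<And>R. R \<ge> R0 \<Longrightarrow> error_bound J0 \<sigma> K z c (tail m) m (N R) < \<kappa> * \<delta> / 6 \<and>
      L / sqrt (N R) < \<delta> / 6 \<and> F R (z + \<kappa>) < 1 - \<alpha> + 2 * \<delta> / 3 \<and> 1 - \<alpha> - 2 * \<delta> / 3 < F R (z - \<kappa>) \<and> R > m + T"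
    by (auto simp: eventually_sequentially)
  show ?thesis
  proof (rule exI[of _ R0], intro allI impI, goal_cases)
    case (1 R \<mu> u B I n v h E)
    note R = R0[OF 1(1)]
    interpret gaussian_sequence J0 R \<sigma> K c \<mu> u g B I n v by (rule 1(2))
    have nN: "n = N R" by (simp add: n_def N_def)
    have Fr: "measure M {\<omega>\<in>space M. - S \<omega> / sqrt (2 * n) \<le> x} = F R x" for x
    proof -
      have "real (2 ^ (J0 + R)) = n" by (simp add: n_def)
      then show ?thesis unfolding F_def M_def S_def I_def[symmetric] by (simp only:)
    qed
    have gs: "g t \<le> \<sigma> * \<epsilon>\<^sup>2 / 10" if "R - m \<le> t" "t \<le> R" for t
      using T[of t] that R by (intro less_imp_le) auto
    have mR: "m < R" using R by simp
    have me: "AE \<omega> in M. chain_minimizer v R (\<lambda>t. real (card (level_block J0 t)))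
      (\<lambda>t. \<Sum>l\<in>level_block J0 t. (\<mu> l + sqrt v * w \<omega> l)\<^sup>2) (h \<omega>)"
      using 1(3) unfolding M_def w_def .
    have EM: "E \<in> sets M" using 1(4) unfolding M_def .
    note cb = coverage_bounds[where h=h and z=z and E=E, OF me m(1) mR \<epsilon>_def gs \<kappa>(1) EM
        1(5)[rule_format, folded M_def w_def z_def], unfolded Fr]
    have "error_bound J0 \<sigma> K z c (\<Sum>t\<in>{m<..R}. g t) m n \<le> error_bound J0 \<sigma> K z c (tail m) m n"
      by (rule error_bound_mono_tail[OF tail c K sigma])
    also have "\<dots> < \<kappa> * \<delta> / 6" using R nN by simp
    finally have "error_bound J0 \<sigma> K z c (\<Sum>t\<in>{m<..R}. g t) m n / \<kappa> < \<delta> / 6"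
      using \<kappa>(1) by (simp add: field_simps)
    moreover have "(2 + 2 * K + K\<^sup>2) * 8 / \<epsilon>\<^sup>2 / sqrt n < \<delta> / 6" using R nN by (simp add: L_def)
    ultimately have "\<bar>measure M E - (1 - \<alpha>)\<bar> \<le> \<delta>" using cb R by linarith
    then show ?case unfolding M_def .
  qed
qed

section \<open>The space of square integrable functions on the unit interval\<close>

abbreviation unit_measure :: "real measure" where "unit_measure \<equiv> lebesgue_on {0..1}"

lemma finite_measure_unit: "finite_measure unit_measure"
  by (rule finite_measure_lebesgue_on) simp

lemma L2_unit_measurable: "f \<in> L2_unit \<Longrightarrow> f \<in> borel_measurable unit_measure"
  by (simp add: L2_unit_def)

lemma L2_unit_mult_integrable:
  assumes f: "f \<in> L2_unit" and g: "g \<in> L2_unit"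
  shows "integrable unit_measure (\<lambda>x. f x * g x)"
proof (rule Bochner_Integration.integrable_bound)
  show "integrable unit_measure (\<lambda>x. (f x)\<^sup>2 + (g x)\<^sup>2)" using f g by (simp add: L2_unit_def)
  show "(\<lambda>x. f x * g x) \<in> borel_measurable unit_measure"
    using f g by (intro borel_measurable_times L2_unit_measurable)
  have "\<bar>a * b\<bar> \<le> a\<^sup>2 + b\<^sup>2" for a b :: real
    using zero_le_power2[of "\<bar>a\<bar> - \<bar>b\<bar>"] zero_le_power2[of a] zero_le_power2[of b]
    unfolding power2_diff abs_mult power2_abs using abs_ge_zero[of "a * b"] unfolding abs_mult by linarith
  then show "AE x in unit_measure. norm (f x * g x) \<le> norm ((f x)\<^sup>2 + (g x)\<^sup>2)"
    by (intro AE_I2) simp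
qed

lemma L2_unit_add:
  assumes f: "f \<in> L2_unit" and g: "g \<in> L2_unit"
  shows "(\<lambda>x. f x + g x) \<in> L2_unit"
proof -
  have "integrable unit_measure (\<lambda>x. (f x)\<^sup>2 + (g x)\<^sup>2 + 2 * (f x * g x))"
    using f g L2_unit_mult_integrable[OF f g] by (simp add: L2_unit_def)
  then have "integrable unit_measure (\<lambda>x. (f x + g x)\<^sup>2)" by (simp add: power2_sum mult.assoc)
  moreover have "(\<lambda>x. f x + g x) \<in> borel_measurable unit_measure"
    using f g by (intro borel_measurable_add L2_unit_measurable)
  ultimately show ?thesis by (simp add: L2_unit_def)
qed

lemma L2_unit_scale: "f \<in> L2_unit \<Longrightarrow> (\<lambda>x. a * f x) \<in> L2_unit"
  by (auto simp: L2_unit_def power_mult_distrib intro: borel_measurable_times)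

lemma L2_unit_diff:
  assumes "f \<in> L2_unit" "g \<in> L2_unit"
  shows "(\<lambda>x. f x - g x) \<in> L2_unit"
  using L2_unit_add[OF assms(1) L2_unit_scale[OF assms(2), of "-1"]] by simp

lemma L2_unit_zero: "(\<lambda>_. 0) \<in> L2_unit"
  by (simp add: L2_unit_def)

lemma L2_unit_sum:
  assumes "\<And>l. l \<in> A \<Longrightarrow> g l \<in> L2_unit"
  shows "(\<lambda>x. \<Sum>l\<in>A. c l * g l x) \<in> L2_unit"
  using assms
  by (induction A rule: infinite_finite_induct) (auto simp: L2_unit_zero intro!: L2_unit_add L2_unit_scale)

lemma bounded_L2_unit:
  assumes "f \<in> borel_measurable unit_measure" "\<And>x. \<bar>f x\<bar> \<le> C"
  shows "f \<in> L2_unit"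
proof -
  interpret finite_measure unit_measure by (rule finite_measure_unit)
  have "(f x)\<^sup>2 \<le> C\<^sup>2" for x using assms(2)[of x] by (simp add: abs_le_square_iff[symmetric])
  then have "integrable unit_measure (\<lambda>x. (f x)\<^sup>2)"
    using assms(1) by (intro integrable_const_bound[where B="C\<^sup>2"]) auto
  then show ?thesis using assms(1) by (simp add: L2_unit_def)
qed

lemma L2_unit_integrable:
  assumes "f \<in> L2_unit"
  shows "integrable unit_measure f"
  using L2_unit_mult_integrable[OF assms bounded_L2_unit[of "\<lambda>_. 1" 1]] by simp

lemma L2_inner_commute: "L2_inner f g = L2_inner g f"
  by (simp add: L2_inner_def mult.commute)

lemma L2_inner_add_left:
  assumes "f \<in> L2_unit" "g \<in> L2_unit" "h \<in> L2_unit"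
  shows "L2_inner (\<lambda>x. f x + g x) h = L2_inner f h + L2_inner g h"
  using assms by (simp add: L2_inner_def distrib_right L2_unit_mult_integrable)

lemma L2_inner_scale_left: "L2_inner (\<lambda>x. a * f x) h = a * L2_inner f h"
  by (simp add: L2_inner_def mult.assoc)

lemma L2_inner_diff_left:
  assumes "f \<in> L2_unit" "g \<in> L2_unit" "h \<in> L2_unit"
  shows "L2_inner (\<lambda>x. f x - g x) h = L2_inner f h - L2_inner g h"
  using assms by (simp add: L2_inner_def left_diff_distrib L2_unit_mult_integrable)

lemma L2_inner_sum_left:
  assumes "\<And>l. l \<in> A \<Longrightarrow> g l \<in> L2_unit" "h \<in> L2_unit"
  shows "L2_inner (\<lambda>x. \<Sum>l\<in>A. c l * g l x) h = (\<Sum>l\<in>A. c l * L2_inner (g l) h)"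
  using assms(1)
proof (induction A rule: infinite_finite_induct)
  case (insert l A)
  then show ?case
    using assms(2) by (simp add: L2_inner_add_left L2_unit_scale L2_unit_sum L2_inner_scale_left)
qed (simp_all add: L2_inner_def)

lemma L2_inner_self_nonneg: "0 \<le> L2_inner f f"
  by (simp add: L2_inner_def)

lemma L2_inner_cong_AE:
  assumes "AE x in unit_measure. f x = g x" "f \<in> L2_unit" "g \<in> L2_unit" "h \<in> L2_unit"
  shows "L2_inner f h = L2_inner g h"
  unfolding L2_inner_def
  by (rule integral_cong_AE) (use assms in \<open>auto intro: L2_unit_measurable borel_measurable_times\<close>)

lemma L2_inner_self_eq_0:
  assumes "f \<in> L2_unit" "L2_inner f f = 0"
  shows "AE x in unit_measure. f x = 0"
  using assms integral_nonneg_eq_0_iff_AE[of unit_measure "\<lambda>x. (f x)\<^sup>2"]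
  by (simp add: L2_unit_def L2_inner_def power2_eq_square)

text \<open>The common squared norm q covers both uses: q = 1 for the wavelet basis and q = 1/n for
  the indicators of the cells.\<close>

lemma L2_inner_self_residual:
  assumes "finite A" "f \<in> L2_unit" and g: "\<And>l. l \<in> A \<Longrightarrow> g l \<in> L2_unit"
    and orth: "\<And>l m. l \<in> A \<Longrightarrow> m \<in> A \<Longrightarrow> L2_inner (g l) (g m) = (if l = m then q else 0)"
  shows "L2_inner (\<lambda>x. f x - (\<Sum>l\<in>A. c l * g l x)) (\<lambda>x. f x - (\<Sum>l\<in>A. c l * g l x))
    = L2_inner f f - 2 * (\<Sum>l\<in>A. c l * L2_inner f (g l)) + q * (\<Sum>l\<in>A. (c l)\<^sup>2)"
proof -
  define s where "s x = (\<Sum>l\<in>A. c l * g l x)" for x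
  have s: "s \<in> L2_unit" unfolding s_def by (intro L2_unit_sum g)
  have sh: "L2_inner s h = (\<Sum>l\<in>A. c l * L2_inner (g l) h)" if "h \<in> L2_unit" for h
    unfolding s_def by (intro L2_inner_sum_left g that)
  have gs: "L2_inner (g l) s = c l * q" if "l \<in> A" for l
  proof -
    have "L2_inner (g l) s = (\<Sum>m\<in>A. c m * L2_inner (g m) (g l))"
      by (subst L2_inner_commute) (rule sh[OF g[OF that]])
    also have "\<dots> = (\<Sum>m\<in>A. if m = l then c l * q else 0)"
      by (intro sum.cong refl) (auto simp: orth that)
    also have "\<dots> = c l * q" using assms(1) that by simp
    finally show ?thesis .
  qed
  have ss: "L2_inner s s = q * (\<Sum>l\<in>A. (c l)\<^sup>2)"
    unfolding sh[OF s] sum_distrib_left by (intro sum.cong refl) (simp add: gs power2_eq_square)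
  have fs: "L2_inner s f = (\<Sum>l\<in>A. c l * L2_inner f (g l))"
    unfolding sh[OF assms(2)] by (simp add: L2_inner_commute)
  have "L2_inner (\<lambda>x. f x - s x) (\<lambda>x. f x - s x) = L2_inner f (\<lambda>x. f x - s x) - L2_inner s (\<lambda>x. f x - s x)"
    by (intro L2_inner_diff_left assms(2) s L2_unit_diff)
  also have "L2_inner f (\<lambda>x. f x - s x) = L2_inner f f - L2_inner s f"
    by (subst L2_inner_commute) (intro L2_inner_diff_left assms(2) s)
  also have "L2_inner s (\<lambda>x. f x - s x) = L2_inner s f - L2_inner s s"
    using L2_inner_diff_left[OF assms(2) s s] by (metis L2_inner_commute)
  finally show ?thesis unfolding s_def[symmetric] by (simp add: ss fs)
qed

lemma bessel:
  assumes "finite A" "f \<in> L2_unit" "\<And>l. l \<in> A \<Longrightarrow> g l \<in> L2_unit" "q > 0"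
    and "\<And>l m. l \<in> A \<Longrightarrow> m \<in> A \<Longrightarrow> L2_inner (g l) (g m) = (if l = m then q else 0)"
  shows "(\<Sum>l\<in>A. (L2_inner f (g l))\<^sup>2) \<le> q * L2_inner f f"
proof -
  have "0 \<le> L2_inner (\<lambda>x. f x - (\<Sum>l\<in>A. L2_inner f (g l) / q * g l x)) (\<lambda>x. f x - (\<Sum>l\<in>A. L2_inner f (g l) / q * g l x))"
    by (rule L2_inner_self_nonneg)
  also have "\<dots> = L2_inner f f - 2 * (\<Sum>l\<in>A. L2_inner f (g l) / q * L2_inner f (g l)) + q * (\<Sum>l\<in>A. (L2_inner f (g l) / q)\<^sup>2)"
    by (rule L2_inner_self_residual) (use assms in auto)
  also have "\<dots> = L2_inner f f - (\<Sum>l\<in>A. (L2_inner f (g l))\<^sup>2) / q"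
  proof -
    have "(\<Sum>l\<in>A. L2_inner f (g l) / q * L2_inner f (g l)) = (\<Sum>l\<in>A. (L2_inner f (g l))\<^sup>2) / q"
      unfolding sum_divide_distrib by (intro sum.cong refl) (simp add: power2_eq_square)
    moreover have "q * (\<Sum>l\<in>A. (L2_inner f (g l) / q)\<^sup>2) = (\<Sum>l\<in>A. (L2_inner f (g l))\<^sup>2) / q"
      unfolding sum_divide_distrib sum_distrib_left
      using assms(4) by (intro sum.cong refl) (simp add: power2_eq_square)
    ultimately show ?thesis by simp
  qed
  finally show ?thesis using assms(4) by (simp add: field_simps)
qed

text \<open>Substitution without an integrability hypothesis: if one side is not integrable, neither
  is the other, and both integrals have the default value 0.\<close>

lemma lebesgue_affine_set_integral:
  fixes g :: "real \<Rightarrow> real"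
  assumes "c > 0"
  shows "(LINT x:{a..b}|lebesgue. g (c * x - d)) = (LINT y:{c * a - d..c * b - d}|lebesgue. g y) / c"
proof -
  define F where "F y = indicator {c * a - d..c * b - d} y *\<^sub>R g y" for y
  have F: "F (- d + c * x) = indicator {a..b} x *\<^sub>R g (c * x - d)" for x
    using assms by (auto simp: F_def indicator_def)
  have "has_bochner_integral lebesgue F i \<longleftrightarrow>
      has_bochner_integral lebesgue (\<lambda>x. indicator {a..b} x *\<^sub>R g (c * x - d)) (i /\<^sub>R \<bar>c\<bar>)" for i
    using has_bochner_integral_lebesgue_real_affine_iff[of c F i "- d"] assms unfolding F by simp
  note iff = this
  show ?thesis
  proof (cases "integrable lebesgue F")
    case True
    then have "has_bochner_integral lebesgue F (integral\<^sup>L lebesgue F)" by (rule has_bochner_integral_integrable)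
    then have "has_bochner_integral lebesgue (\<lambda>x. indicator {a..b} x *\<^sub>R g (c * x - d)) (integral\<^sup>L lebesgue F /\<^sub>R \<bar>c\<bar>)"
      by (simp add: iff)
    from has_bochner_integral_integral_eq[OF this]
    have "(LINT x:{a..b}|lebesgue. g (c * x - d)) = integral\<^sup>L lebesgue F / c"
      unfolding set_lebesgue_integral_def using assms by (simp add: divide_inverse mult.commute)
    then show ?thesis unfolding F_def[abs_def] set_lebesgue_integral_def .
  next
    case False
    have "\<not> integrable lebesgue (\<lambda>x. indicator {a..b} x *\<^sub>R g (c * x - d))"
    proof
      assume "integrable lebesgue (\<lambda>x. indicator {a..b} x *\<^sub>R g (c * x - d))"
      then obtain i where "has_bochner_integral lebesgue (\<lambda>x. indicator {a..b} x *\<^sub>R g (c * x - d)) i"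
        by (meson has_bochner_integral_integrable)
      moreover have "(i * \<bar>c\<bar>) /\<^sub>R \<bar>c\<bar> = i" using assms by simp
      ultimately have "has_bochner_integral lebesgue F (i * \<bar>c\<bar>)" unfolding iff by (simp only:)
      then show False using False by (auto simp: integrable.simps)
    qed
    then have "(LINT x:{a..b}|lebesgue. g (c * x - d)) = integral\<^sup>L lebesgue F / c"
      using False by (simp add: set_lebesgue_integral_def not_integrable_integral_eq)
    then show ?thesis unfolding F_def[abs_def] set_lebesgue_integral_def .
  qed
qed

lemma integral_unit_eq:
  fixes f :: "real \<Rightarrow> real"
  shows "integral\<^sup>L unit_measure f = (LINT x:{0..1}|lebesgue. f x)"
  unfolding set_lebesgue_integral_def by (rule integral_restrict_space) simp

lemma L2_inner_indicator:
  assumes "A \<subseteq> {0..1}"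
  shows "L2_inner f (indicator A) = (LINT x:A|lebesgue. f x)"
proof -
  have "indicator {0..1} x *\<^sub>R (f x * indicator A x) = indicator A x *\<^sub>R f x" for x
    using assms by (auto simp: indicator_def)
  then show ?thesis
    unfolding L2_inner_def integral_unit_eq set_lebesgue_integral_def by (simp only:)
qed

lemma indicator_L2_unit:
  assumes "A \<in> sets borel"
  shows "(indicator A :: real \<Rightarrow> real) \<in> L2_unit"
proof (rule bounded_L2_unit[where C=1])
  have "(indicator A :: real \<Rightarrow> real) \<in> borel_measurable borel" using assms by simp
  then show "(indicator A :: real \<Rightarrow> real) \<in> borel_measurable unit_measure"
    by (intro measurable_restrict_space1) (simp add: borel_measurable_if_I measurable_completion)
qed (simp add: indicator_def)

lemma cell_subset: "1 \<le> i \<Longrightarrow> i \<le> n \<Longrightarrow> cell n i \<subseteq> {0..1}"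
  by (auto simp: cell_def field_simps)

text \<open>Distinct closed cells meet in at most one point, a null set.\<close>

lemma L2_inner_cell_cell:
  assumes "i \<in> {1..n}" "j \<in> {1..n}"
  shows "L2_inner (indicator (cell n i)) (indicator (cell n j)) = (if i = j then 1 / real n else 0)"
proof -
  have n: "n > 0" using assms by auto
  have "L2_inner (indicator (cell n i)) (indicator (cell n j)) = (LINT x:cell n j|lebesgue. indicator (cell n i) x)"
    using assms by (intro L2_inner_indicator cell_subset) auto
  also have "\<dots> = measure lebesgue (cell n i \<inter> cell n j)"
    by (simp add: set_lebesgue_integral_def Int_commute flip: indicator_inter_arith)
  also have "\<dots> = (if i = j then 1 / real n else 0)"
  proof (cases i j rule: linorder_cases)
    case less
    then have "cell n i \<inter> cell n j \<subseteq> {real i / real n}"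
      using n by (auto simp: cell_def divide_simps)
    then have "measure lebesgue (cell n i \<inter> cell n j) \<le> measure lebesgue {real i / real n}"
      by (intro measure_mono_fmeasurable lmeasurable_compact) (auto simp: cell_def)
    then show ?thesis using less by (simp add: measure_le_0_iff)
  next
    case greater
    then have "cell n i \<inter> cell n j \<subseteq> {real j / real n}"
      using n by (auto simp: cell_def divide_simps)
    then have "measure lebesgue (cell n i \<inter> cell n j) \<le> measure lebesgue {real j / real n}"
      by (intro measure_mono_fmeasurable lmeasurable_compact) (auto simp: cell_def)
    then show ?thesis using greater by (simp add: measure_le_0_iff)
  next
    case equal
    have "(real i - 1) / real n \<le> real i / real n" using n by (simp add: divide_right_mono)
    then show ?thesis using equal n by (simp add: cell_def diff_divide_distrib)
  qed
  finally show ?thesis .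
qed

section \<open>The mother wavelet has mean zero\<close>

lemma regular_wavelet_measurable:
  assumes "regular_wavelet g"
  shows "g \<in> borel_measurable borel"
proof -
  obtain S where S: "finite S" "\<And>x. x \<notin> S \<Longrightarrow> g differentiable (at x)"
    using assms by (auto simp: regular_wavelet_def)
  have "continuous_on (- S) g"
    using S(2) by (intro continuous_at_imp_continuous_on ballI differentiable_imp_continuous_within) auto
  then have "(\<lambda>x. indicator (- S) x *\<^sub>R g x) \<in> borel_measurable borel"
    using S(1) by (intro borel_measurable_continuous_on_indicator) (auto simp: finite_imp_closed)
  then show ?thesis
    by (rule measurable_discrete_difference[where X=S]) (use S(1) in \<open>auto simp: countable_finite\<close>)
qed

lemma bounded_compact_support_integrable:
  assumes "f \<in> borel_measurable borel" "bounded (range f)" "\<And>x. x \<notin> {-a..a} \<Longrightarrow> f x = 0"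
  shows "integrable lebesgue (f :: real \<Rightarrow> real)"
proof -
  obtain C where C: "\<And>x. \<bar>f x\<bar> \<le> C" using assms(2) by (auto simp: bounded_iff)
  have "integrable lebesgue (\<lambda>x. C * indicator {-a..a} x)"
    by (intro integrable_mult_right integrable_real_indicator) (auto simp: emeasure_lborel_Icc_eq)
  then show ?thesis
  proof (rule Bochner_Integration.integrable_bound)
    show "f \<in> borel_measurable lebesgue" using assms(1) by (simp add: measurable_completion)
    show "AE x in lebesgue. norm (f x) \<le> norm (C * indicator {-a..a} x)"
    proof (rule AE_I2)
      fix x show "norm (f x) \<le> norm (C * indicator {-a..a} x)"
        using C[of x] assms(3)[of x] by (cases "x \<in> {-a..a}") auto
    qed
  qed
qed

locale wavelets =
  fixes \<phi> \<psi> :: "real \<Rightarrow> real" and J0 :: nat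
  assumes system: "wavelet_system \<phi> \<psi> J0"
begin

abbreviation basis :: "nat \<Rightarrow> real \<Rightarrow> real" where "basis \<equiv> basis_fun \<phi> \<psi> J0"

lemma basis_L2: "1 \<le> l \<Longrightarrow> basis l \<in> L2_unit"
  using system unfolding wavelet_system_def by blast

lemma basis_orth: "1 \<le> l \<Longrightarrow> 1 \<le> m \<Longrightarrow> L2_inner (basis l) (basis m) = (if l = m then 1 else 0)"
  using system unfolding wavelet_system_def by blast

lemma basis_complete:
  "f \<in> L2_unit \<Longrightarrow> (\<And>l. 1 \<le> l \<Longrightarrow> L2_inner f (basis l) = 0) \<Longrightarrow> AE x in unit_measure. f x = 0"
  using system unfolding wavelet_system_def by blast

lemma psi_regular: "regular_wavelet \<psi>"
  using system unfolding wavelet_system_def by blast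

lemma floor_log_level:
  assumes "k < 2 ^ j"
  shows "floor_log (2 ^ j + k) = j"
proof -
  have "(2::nat) ^ floor_log (2 ^ j + k) < 2 ^ Suc j"
    using floor_log_exp2_le[of "2 ^ j + k"] assms by simp
  moreover have "(2::nat) ^ j < 2 ^ Suc (floor_log (2 ^ j + k))"
    using floor_log_exp2_gt[of "2 ^ j + k"] by simp
  ultimately show ?thesis by (simp only: power_strict_increasing_iff one_less_numeral_iff semiring_norm)
qed

lemma basis_psi:
  assumes "J0 \<le> j" "k < 2 ^ j"
  shows "basis (2 ^ j + k + 1) = dilate \<psi> j k"
proof -
  have "(2::nat) ^ J0 \<le> 2 ^ j" using assms by (intro power_increasing) auto
  then have "\<not> 2 ^ j + k + 1 \<le> (2::nat) ^ J0" by linarith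
  then show ?thesis using floor_log_level[OF assms(2)] by (simp add: basis_fun_def)
qed

lemma basis_phi: "k < 2 ^ J0 \<Longrightarrow> basis (k + 1) = dilate \<phi> J0 k"
  by (simp add: basis_fun_def)

lemma index_cases:
  fixes l :: nat
  assumes "2 ^ r < l" "J0 \<le> r"
  obtains j k where "r \<le> j" "k < 2 ^ j" "l = 2 ^ j + k + 1"
proof -
  define j where "j = floor_log (l - 1)"
  have l: "l - 1 > 0" "2 ^ r \<le> l - 1" using assms one_le_power[of "2::nat" r] by linarith+
  have "2 ^ j \<le> l - 1" unfolding j_def using l by (intro floor_log_exp2_le) auto
  moreover have "l - 1 < 2 * 2 ^ j" unfolding j_def by (rule floor_log_exp2_gt)
  moreover have "r \<le> j" unfolding j_def using floor_log_le_iff[OF l(2)] by simp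
  ultimately show thesis using l by (intro that[of j "l - 1 - 2 ^ j"]) auto
qed

lemma psi_measurable: "\<psi> \<in> borel_measurable borel"
  by (rule regular_wavelet_measurable[OF psi_regular])

lemma psi_support: obtains a :: nat where "1 \<le> a" "\<And>x. x \<notin> {- real a..real a} \<Longrightarrow> \<psi> x = 0"
proof -
  obtain K where K: "compact K" "\<And>x. x \<notin> K \<Longrightarrow> \<psi> x = 0"
    using psi_regular by (auto simp: regular_wavelet_def)
  obtain B where B: "\<And>x. x \<in> K \<Longrightarrow> \<bar>x\<bar> \<le> B" using compact_imp_bounded[OF K(1)] by (auto simp: bounded_iff)
  obtain a :: nat where a: "max 1 B \<le> real a" using real_arch_simple by blast
  show thesis
  proof (rule that[of a])
    fix x assume "x \<notin> {- real a..real a}"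
    then have "x \<notin> K" using B[of x] a by auto
    then show "\<psi> x = 0" by (rule K(2))
  qed (use a in simp)
qed

lemma psi_integrable: "integrable lebesgue \<psi>" "integrable lebesgue (\<lambda>x. (\<psi> x)\<^sup>2)"
proof -
  obtain a where a: "\<And>x. x \<notin> {- real a..real a} \<Longrightarrow> \<psi> x = 0" by (rule psi_support) blast
  have b: "bounded (range \<psi>)" using psi_regular by (simp add: regular_wavelet_def)
  then obtain C where C: "\<And>x. \<bar>\<psi> x\<bar> \<le> C" by (auto simp: bounded_iff)
  show "integrable lebesgue \<psi>"
    by (rule bounded_compact_support_integrable[OF psi_measurable b a])
  show "integrable lebesgue (\<lambda>x. (\<psi> x)\<^sup>2)"
  proof (rule bounded_compact_support_integrable)
    show "(\<lambda>x. (\<psi> x)\<^sup>2) \<in> borel_measurable borel" using psi_measurable by simp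
    have "\<bar>(\<psi> x)\<^sup>2\<bar> \<le> C\<^sup>2" for x using C[of x] by (simp add: abs_le_square_iff[symmetric])
    then show "bounded (range (\<lambda>x. (\<psi> x)\<^sup>2))" by (auto simp: bounded_iff)
  qed (use a in auto)
qed

lemma psi_dilate_norm:
  assumes "J0 \<le> j" "k < 2 ^ j"
  shows "(LINT y:{- real k..2 ^ j - real k}|lebesgue. (\<psi> y)\<^sup>2) = 1"
proof -
  have "1 = L2_inner (dilate \<psi> j k) (dilate \<psi> j k)"
    using basis_orth[of "2 ^ j + k + 1" "2 ^ j + k + 1"] basis_psi[OF assms] by simp
  also have "\<dots> = (LINT x:{0..1}|lebesgue. 2 ^ j * (\<psi> (2 ^ j * x - real k))\<^sup>2)"
  proof -
    have "2 powr (real j / 2) * 2 powr (real j / 2) = (2::real) ^ j"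
      by (simp add: powr_realpow flip: powr_add)
    moreover have "dilate \<psi> j k x * dilate \<psi> j k x
        = (2 powr (real j / 2) * 2 powr (real j / 2)) * (\<psi> (2 ^ j * x - real k))\<^sup>2" for x
      by (simp only: dilate_def power2_eq_square mult_ac)
    ultimately have "dilate \<psi> j k x * dilate \<psi> j k x = 2 ^ j * (\<psi> (2 ^ j * x - real k))\<^sup>2" for x
      by (simp only:)
    then show ?thesis unfolding L2_inner_def integral_unit_eq by simp
  qed
  also have "\<dots> = 2 ^ j * (LINT x:{0..1}|lebesgue. (\<psi> (2 ^ j * x - real k))\<^sup>2)" by simp
  also have "(LINT x:{0..1}|lebesgue. (\<psi> (2 ^ j * x - real k))\<^sup>2)
      = (LINT y:{2 ^ j * 0 - real k..2 ^ j * 1 - real k}|lebesgue. (\<psi> y)\<^sup>2) / 2 ^ j"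
    by (rule lebesgue_affine_set_integral) simp
  finally show ?thesis by simp
qed

text \<open>The norms of $\psi_{j,k}$ on the unit interval for small, intermediate and large $k$
  show that $\psi$ has no mass outside of the unit interval.\<close>

lemma psi_zero_outside: "AE x in lebesgue. x \<notin> {0..1} \<longrightarrow> \<psi> x = 0"
proof -
  obtain a where a: "1 \<le> a" "\<And>x. x \<notin> {- real a..real a} \<Longrightarrow> \<psi> x = 0" by (rule psi_support) blast
  \<comment> \<open>Fine enough that 2^j > 2a+2, so that window a, reaching from -a to 2^j - a,
    covers the whole support of \<psi>.\<close>
  define j where "j = J0 + (2 * a + 2)"
  have j: "J0 \<le> j" by (simp add: j_def)
  have "2 * a + 2 < (2::nat) ^ (2 * a + 2)" by (rule less_exp)
  also have "\<dots> \<le> 2 ^ j" by (rule power_increasing) (auto simp: j_def)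
  finally have big: "2 * a + 2 < 2 ^ j" .
  then have "real (2 * a + 2) < real (2 ^ j)" by (simp only: of_nat_less_iff)
  then have big': "2 * real a + 2 < 2 ^ j" by simp
  define P where "P k = {- real k..2 ^ j - real k}" for k
  have P: "(LINT y:P k|lebesgue. (\<psi> y)\<^sup>2) = 1" if "k < 2 ^ j" for k
    unfolding P_def by (rule psi_dilate_norm[OF j that])
  have ind: "indicator (P a) y *\<^sub>R (\<psi> y)\<^sup>2 = (\<psi> y)\<^sup>2" for y
    using a(2)[of y] big' by (cases "y \<in> {- real a..real a}") (auto simp: P_def indicator_def)
  then have total: "(LINT y|lebesgue. (\<psi> y)\<^sup>2) = 1"
    using P[of a] big unfolding set_lebesgue_integral_def ind by simp
  \<comment> \<open>Window k also carries the full mass 1, so none is left outside of it.\<close>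
  have null: "AE y in lebesgue. y \<notin> P k \<longrightarrow> \<psi> y = 0" if k: "k < 2 ^ j" for k
  proof -
    have int: "integrable lebesgue (\<lambda>y. indicator (P k) y *\<^sub>R (\<psi> y)\<^sup>2)"
      by (rule integrable_mult_indicator) (auto simp: P_def psi_integrable)
    have "(LINT y|lebesgue. (\<psi> y)\<^sup>2 - indicator (P k) y *\<^sub>R (\<psi> y)\<^sup>2) = 0"
      using int psi_integrable(2) total P[OF k] by (simp add: set_lebesgue_integral_def)
    then have "AE y in lebesgue. (\<psi> y)\<^sup>2 - indicator (P k) y *\<^sub>R (\<psi> y)\<^sup>2 = 0"
      using int psi_integrable(2)
      by (subst (asm) integral_nonneg_eq_0_iff_AE) (auto simp: indicator_def)
    then show ?thesis by eventually_elim (auto simp: indicator_def)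
  qed
  \<comment> \<open>The first and the last window meet exactly in the unit interval.\<close>
  have "AE y in lebesgue. y \<notin> P 0 \<longrightarrow> \<psi> y = 0" by (rule null) simp
  moreover have "AE y in lebesgue. y \<notin> P (2 ^ j - 1) \<longrightarrow> \<psi> y = 0" by (rule null) simp
  ultimately show ?thesis
  proof eventually_elim
    case (elim x)
    have "real (2 ^ j - 1) = 2 ^ j - 1" by (simp add: of_nat_diff)
    then have "P 0 \<inter> P (2 ^ j - 1) = {0..1}" using big' by (auto simp: P_def)
    then show ?case using elim by blast
  qed
qed

definition psi_mean :: real where "psi_mean = (LINT x|lebesgue. \<psi> x)"

lemma psi_integral_superset:
  assumes "a \<le> 0" "1 \<le> b"
  shows "(LINT y:{a..b}|lebesgue. \<psi> y) = psi_mean"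
  unfolding set_lebesgue_integral_def psi_mean_def
proof (rule integral_cong_AE)
  show "AE x in lebesgue. indicator {a..b} x *\<^sub>R \<psi> x = \<psi> x"
    using psi_zero_outside by eventually_elim (use assms in \<open>auto simp: indicator_def\<close>)
qed (use psi_measurable in \<open>auto intro!: measurable_completion\<close>)

lemma psi_integral_disjoint:
  assumes "1 \<le> a \<or> b \<le> 0"
  shows "(LINT y:{a..b}|lebesgue. \<psi> y) = 0"
proof -
  have "(LINT y:{a..b}|lebesgue. \<psi> y) = (LINT y::real|lebesgue. 0)"
    unfolding set_lebesgue_integral_def
  proof (rule integral_cong_AE)
    \<comment> \<open>The interval may touch the unit interval in an end point.\<close>
    have "{0, 1::real} \<in> null_sets lebesgue"
      by (intro null_sets_completionI finite_imp_null_set_lborel) auto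
    then have "AE x in lebesgue. x \<notin> {0, 1::real}" by (rule AE_not_in)
    then show "AE x in lebesgue. indicator {a..b} x *\<^sub>R \<psi> x = 0"
      using psi_zero_outside by eventually_elim (use assms in \<open>auto simp: indicator_def\<close>)
  qed (use psi_measurable in \<open>auto intro!: measurable_completion\<close>)
  then show ?thesis by simp
qed

lemma psi_dilate_integral:
  "(LINT x:{a..b}|lebesgue. dilate \<psi> j k x)
    = 2 powr (real j / 2) / 2 ^ j * (LINT y:{2 ^ j * a - real k..2 ^ j * b - real k}|lebesgue. \<psi> y)"
proof -
  have "(LINT x:{a..b}|lebesgue. dilate \<psi> j k x)
      = 2 powr (real j / 2) * (LINT x:{a..b}|lebesgue. \<psi> (2 ^ j * x - real k))"
    by (simp add: dilate_def)
  then show ?thesis by (simp add: lebesgue_affine_set_integral)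
qed

text \<open>Each level contributes $(\int\psi)^2$ to the squared norm of the constant function $1$,
  so Bessel's inequality forces $\int\psi = 0$.\<close>

lemma psi_mean_zero: "psi_mean = 0"
proof (rule ccontr)
  assume ne: "psi_mean \<noteq> 0"
  define one :: "real \<Rightarrow> real" where "one = indicator {0..1}"
  have one: "one \<in> L2_unit" unfolding one_def by (rule indicator_L2_unit) simp
  have inner: "(L2_inner one (basis (2 ^ j + k + 1)))\<^sup>2 = psi_mean\<^sup>2 / 2 ^ j" if "J0 \<le> j" "k < 2 ^ j" for j k
  proof -
    have "L2_inner one (basis (2 ^ j + k + 1)) = (LINT x:{0..1}|lebesgue. dilate \<psi> j k x)"
      unfolding one_def basis_psi[OF that] by (subst L2_inner_commute) (rule L2_inner_indicator, simp)
    also have "\<dots> = 2 powr (real j / 2) / 2 ^ j * psi_mean"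
    proof -
      have "real (k + 1) \<le> real (2 ^ j)" using that(2) by (simp only: of_nat_le_iff)
      then have "real k + 1 \<le> 2 ^ j" by simp
      then show ?thesis unfolding psi_dilate_integral by (subst psi_integral_superset) auto
    qed
    finally have "(L2_inner one (basis (2 ^ j + k + 1)))\<^sup>2 = (2 powr (real j / 2))\<^sup>2 / (2 ^ j)\<^sup>2 * psi_mean\<^sup>2"
      by (simp add: power_mult_distrib power_divide)
    also have "(2 powr (real j / 2))\<^sup>2 = (2::real) ^ j"
      unfolding power2_eq_square by (simp add: powr_realpow flip: powr_add)
    finally show ?thesis by (simp add: power2_eq_square)
  qed
  have level: "(\<Sum>l\<in>level_block J0 (Suc t). (L2_inner one (basis l))\<^sup>2) = psi_mean\<^sup>2" for t
  proof -
    define j where "j = J0 + t"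
    have "(\<Sum>l\<in>level_block J0 (Suc t). (L2_inner one (basis l))\<^sup>2)
        = (\<Sum>k<2 ^ j. (L2_inner one (basis (2 ^ j + k + 1)))\<^sup>2)"
      by (rule sum.reindex_bij_witness[of _ "\<lambda>k. 2 ^ j + k + 1" "\<lambda>l. l - 2 ^ j - 1"])
        (auto simp: level_block_def j_def)
    also have "\<dots> = (\<Sum>k<(2::nat) ^ j. psi_mean\<^sup>2 / 2 ^ j)"
      by (intro sum.cong refl inner) (auto simp: j_def)
    finally show ?thesis by simp
  qed
  obtain T :: nat where T: "L2_inner one one / psi_mean\<^sup>2 < real T" using reals_Archimedean2 by blast
  have "real T * psi_mean\<^sup>2 = (\<Sum>t<T. psi_mean\<^sup>2)" by simp
  also have "\<dots> = (\<Sum>t<T. \<Sum>l\<in>level_block J0 (Suc t). (L2_inner one (basis l))\<^sup>2)" by (simp add: level)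
  also have "\<dots> = (\<Sum>t\<in>{1..T}. \<Sum>l\<in>level_block J0 t. (L2_inner one (basis l))\<^sup>2)"
    by (rule sum.reindex_bij_witness[of _ "\<lambda>t. t - 1" Suc]) auto
  also have "\<dots> \<le> (\<Sum>t\<le>T. \<Sum>l\<in>level_block J0 t. (L2_inner one (basis l))\<^sup>2)"
    by (intro sum_mono2 sum_nonneg) auto
  also have "\<dots> = (\<Sum>l\<in>{1..2 ^ (J0 + T)}. (L2_inner one (basis l))\<^sup>2)"
    by (rule sum_level_blocks[symmetric])
  also have "\<dots> \<le> 1 * L2_inner one one"
    by (rule bessel) (use one basis_L2 basis_orth in auto)
  finally show False using T ne by (simp add: field_simps)
qed

end

section \<open>Dyadic cells and the wavelet basis\<close>

context wavelets
begin

text \<open>The weights of the observations in the empirical coefficients. Multiplied by sqrt n they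
  form the orthogonal matrix of the sequence model.\<close>

definition cell_coeff :: "nat \<Rightarrow> nat \<Rightarrow> nat \<Rightarrow> real" where
  "cell_coeff r l i = (LINT x:cell (2 ^ r) i|lebesgue. basis l x)"

lemma cell_borel: "cell n i \<in> sets borel"
  by (simp add: cell_def)

lemma cell_L2: "indicator (cell n i) \<in> L2_unit"
  by (rule indicator_L2_unit[OF cell_borel])

lemma inner_cell: "i \<in> {1..n} \<Longrightarrow> L2_inner f (indicator (cell n i)) = (LINT x:cell n i|lebesgue. f x)"
  by (rule L2_inner_indicator[OF cell_subset]) auto

lemma cell_coeff_inner: "i \<in> {1..2 ^ r} \<Longrightarrow> L2_inner (basis l) (indicator (cell (2 ^ r) i)) = cell_coeff r l i"
  unfolding cell_coeff_def by (rule inner_cell)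

text \<open>Scaling by 2^j and translating by k turns a cell of width 2^(-r) into an interval with
  integer ends. It contains the unit interval, where the vanishing mean of \<psi> is the integral,
  or meets it in at most an end point.\<close>

lemma cell_coeff_fine:
  assumes "J0 \<le> r" "r \<le> j" "k < 2 ^ j" "i \<in> {1..2 ^ r}"
  shows "cell_coeff r (2 ^ j + k + 1) i = 0"
proof -
  have j: "J0 \<le> j" using assms by simp
  have pow: "(2::real) ^ j = 2 ^ (j - r) * 2 ^ r" using assms by (simp flip: power_add)
  define p q :: int where "p = 2 ^ (j - r) * (int i - 1) - int k" and "q = 2 ^ (j - r) * int i - int k"
  have pq: "2 ^ j * ((real i - 1) / real (2 ^ r)) - real k = of_int p"
    "2 ^ j * (real i / real (2 ^ r)) - real k = of_int q"
    by (simp_all add: p_def q_def pow)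
  have "cell_coeff r (2 ^ j + k + 1) i
      = 2 powr (real j / 2) / 2 ^ j * (LINT y:{of_int p..of_int q}|lebesgue. \<psi> y)"
    unfolding cell_coeff_def basis_psi[OF j assms(3)] cell_def psi_dilate_integral pq ..
  also have "(LINT y:{of_int p..of_int q::real}|lebesgue. \<psi> y) = 0"
  proof (cases "p \<le> 0 \<and> 1 \<le> q")
    case True
    then have "(of_int p :: real) \<le> 0" "1 \<le> (of_int q :: real)" by auto
    then show ?thesis using psi_integral_superset psi_mean_zero by simp
  next
    case False
    then have "1 \<le> (of_int p :: real) \<or> (of_int q :: real) \<le> 0" by linarith
    then show ?thesis by (rule psi_integral_disjoint)
  qed
  finally show ?thesis by simp
qed

text \<open>The difference of the two sides has all coefficients 0, up to 2^r by orthonormality and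
  beyond by \<open>cell_coeff_fine\<close>; completeness does the rest.\<close>

lemma cell_expansion:
  assumes r: "J0 \<le> r" and i: "i \<in> {1..2 ^ r}"
  shows "AE x in unit_measure. indicator (cell (2 ^ r) i) x = (\<Sum>l=1..2 ^ r. cell_coeff r l i * basis l x)"
proof -
  define e :: "real \<Rightarrow> real" where "e = indicator (cell (2 ^ r) i)"
  define s where "s x = (\<Sum>l=1..2 ^ r. cell_coeff r l i * basis l x)" for x
  have e: "e \<in> L2_unit" unfolding e_def by (rule cell_L2)
  have s: "s \<in> L2_unit" unfolding s_def by (intro L2_unit_sum basis_L2) auto
  have eb: "L2_inner e (basis l) = cell_coeff r l i" for l
    unfolding e_def by (subst L2_inner_commute) (rule cell_coeff_inner[OF i])
  have sb: "L2_inner s (basis m) = (if m \<in> {1..2 ^ r} then cell_coeff r m i else 0)" if "1 \<le> m" for m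
  proof -
    have "L2_inner s (basis m) = (\<Sum>l=1..2 ^ r. cell_coeff r l i * L2_inner (basis l) (basis m))"
      unfolding s_def using that by (intro L2_inner_sum_left basis_L2) auto
    also have "\<dots> = (\<Sum>l=1..2 ^ r. if l = m then cell_coeff r l i else 0)"
      using that by (intro sum.cong refl) (auto simp: basis_orth)
    finally show ?thesis by simp
  qed
  have "AE x in unit_measure. e x - s x = 0"
  proof (rule basis_complete)
    show "(\<lambda>x. e x - s x) \<in> L2_unit" by (rule L2_unit_diff[OF e s])
    fix m :: nat assume m: "1 \<le> m"
    have "L2_inner (\<lambda>x. e x - s x) (basis m) = cell_coeff r m i - (if m \<in> {1..2 ^ r} then cell_coeff r m i else 0)"
      using L2_inner_diff_left[OF e s basis_L2[OF m]] by (simp add: eb sb[OF m])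
    also have "\<dots> = 0"
    proof (cases "m \<in> {1..2 ^ r}")
      case False
      then have "2 ^ r < m" using m by simp
      then obtain j k where "r \<le> j" "k < 2 ^ j" "m = 2 ^ j + k + 1" using index_cases r by blast
      then show ?thesis using cell_coeff_fine[OF r _ _ i] False by simp
    qed simp
    finally show "L2_inner (\<lambda>x. e x - s x) (basis m) = 0" .
  qed
  then show ?thesis unfolding e_def s_def by eventually_elim simp
qed

lemma cell_coeff_columns:
  assumes r: "J0 \<le> r" and i: "i \<in> {1..2 ^ r}" and j: "j \<in> {1..2 ^ r}"
  shows "(\<Sum>l=1..2 ^ r. cell_coeff r l i * cell_coeff r l j) = (if i = j then 1 / 2 ^ r else 0)"
proof -
  have "(\<Sum>l=1..2 ^ r. cell_coeff r l i * cell_coeff r l j)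
      = L2_inner (\<lambda>x. \<Sum>l=1..2 ^ r. cell_coeff r l i * basis l x) (indicator (cell (2 ^ r) j))"
    by (subst L2_inner_sum_left) (auto simp: cell_coeff_inner[OF j] intro!: basis_L2 cell_L2)
  also have "\<dots> = L2_inner (indicator (cell (2 ^ r) i)) (indicator (cell (2 ^ r) j))"
    using cell_expansion[OF r i]
    by (intro L2_inner_cong_AE L2_unit_sum basis_L2 cell_L2) (auto elim: eventually_mono)
  also have "\<dots> = (if i = j then 1 / 2 ^ r else 0)"
    using L2_inner_cell_cell[OF i j] by simp
  finally show ?thesis .
qed

text \<open>Bessel's inequality for the cell indicators bounds each row norm by $1$, and by the
  column relations the row norms add up to their number.\<close>

lemma cell_coeff_row_norm:
  assumes r: "J0 \<le> r" and l: "l \<in> {1..2 ^ r}"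
  shows "2 ^ r * (\<Sum>i=1..2 ^ r. (cell_coeff r l i)\<^sup>2) = 1"
proof -
  have le: "2 ^ r * (\<Sum>i=1..2 ^ r. (cell_coeff r m i)\<^sup>2) \<le> 1" if "m \<in> {1..2 ^ r}" for m
  proof -
    have "(\<Sum>i=1..2 ^ r. (L2_inner (basis m) (indicator (cell (2 ^ r) i)))\<^sup>2)
        \<le> 1 / 2 ^ r * L2_inner (basis m) (basis m)"
    proof (rule bessel)
      show "basis m \<in> L2_unit" using that by (intro basis_L2) auto
      fix i j :: nat assume ij: "i \<in> {1..2 ^ r}" "j \<in> {1..2 ^ r}"
      show "L2_inner (indicator (cell (2 ^ r) i)) (indicator (cell (2 ^ r) j)) = (if i = j then 1 / 2 ^ r else 0)"
        using L2_inner_cell_cell[OF ij] by simp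
    qed (auto intro: cell_L2)
    moreover have "(\<Sum>i=1..2 ^ r. (L2_inner (basis m) (indicator (cell (2 ^ r) i)))\<^sup>2) = (\<Sum>i=1..2 ^ r. (cell_coeff r m i)\<^sup>2)"
      by (intro sum.cong refl) (simp only: cell_coeff_inner)
    ultimately show ?thesis using basis_orth[of m m] that by (simp add: field_simps)
  qed
  have "(\<Sum>m=1..2 ^ r. 2 ^ r * (\<Sum>i=1..2 ^ r. (cell_coeff r m i)\<^sup>2))
      = 2 ^ r * (\<Sum>i=1..2 ^ r. \<Sum>m=1..2 ^ r. cell_coeff r m i * cell_coeff r m i)"
    unfolding sum_distrib_left[symmetric] by (subst sum.swap) (simp add: power2_eq_square)
  also have "\<dots> = 2 ^ r * (\<Sum>i=1..(2::nat) ^ r. 1 / 2 ^ r)"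
    by (intro arg_cong2[where f="(*)"] refl sum.cong) (simp only: cell_coeff_columns[OF r] if_True simp_thms)
  also have "\<dots> = 2 ^ r" by simp
  finally have "(\<Sum>m=1..2 ^ r. 1 - 2 ^ r * (\<Sum>i=1..2 ^ r. (cell_coeff r m i)\<^sup>2)) = 0"
    by (simp only: sum_subtractf) simp
  then have "\<forall>m\<in>{1..2 ^ r}. 1 - 2 ^ r * (\<Sum>i=1..2 ^ r. (cell_coeff r m i)\<^sup>2) = 0"
    using le by (subst (asm) sum_nonneg_eq_0_iff) auto
  then show ?thesis using l by force
qed

text \<open>The converse of \<open>cell_expansion\<close>: by the row norms the squared distance of
  the basis function from its step function is 1 - 2 + 1 = 0.\<close>

lemma basis_cells:
  assumes r: "J0 \<le> r" and l: "l \<in> {1..2 ^ r}"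
  shows "AE x in unit_measure. basis l x = (\<Sum>i=1..2 ^ r. (2 ^ r * cell_coeff r l i) * indicator (cell (2 ^ r) i) x)"
proof -
  define s where "s x = (\<Sum>i=1..2 ^ r. (2 ^ r * cell_coeff r l i) * indicator (cell (2 ^ r) i) x)" for x
  have s: "s \<in> L2_unit" unfolding s_def by (intro L2_unit_sum cell_L2)
  have b: "basis l \<in> L2_unit" using l by (intro basis_L2) auto
  have "L2_inner (\<lambda>x. basis l x - s x) (\<lambda>x. basis l x - s x)
      = L2_inner (basis l) (basis l)
        - 2 * (\<Sum>i=1..2 ^ r. 2 ^ r * cell_coeff r l i * L2_inner (basis l) (indicator (cell (2 ^ r) i)))
        + 1 / 2 ^ r * (\<Sum>i=1..2 ^ r. (2 ^ r * cell_coeff r l i)\<^sup>2)"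
    unfolding s_def
  proof (rule L2_inner_self_residual[OF _ b])
    fix i j :: nat assume ij: "i \<in> {1..2 ^ r}" "j \<in> {1..2 ^ r}"
    show "L2_inner (indicator (cell (2 ^ r) i)) (indicator (cell (2 ^ r) j)) = (if i = j then 1 / 2 ^ r else 0)"
      using L2_inner_cell_cell[OF ij] by simp
  qed (auto intro: cell_L2)
  also have "(\<Sum>i=1..2 ^ r. 2 ^ r * cell_coeff r l i * L2_inner (basis l) (indicator (cell (2 ^ r) i)))
      = 2 ^ r * (\<Sum>i=1..2 ^ r. (cell_coeff r l i)\<^sup>2)"
    unfolding sum_distrib_left by (intro sum.cong refl) (simp add: cell_coeff_inner power2_eq_square)
  also have "1 / 2 ^ r * (\<Sum>i=1..2 ^ r. (2 ^ r * cell_coeff r l i)\<^sup>2) = 2 ^ r * (\<Sum>i=1..2 ^ r. (cell_coeff r l i)\<^sup>2)"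
    unfolding sum_distrib_left by (intro sum.cong refl) (simp add: power2_eq_square)
  finally have "L2_inner (\<lambda>x. basis l x - s x) (\<lambda>x. basis l x - s x) = 0"
    using cell_coeff_row_norm[OF assms] basis_orth[of l l] l by simp
  then have "AE x in unit_measure. basis l x - s x = 0"
    by (intro L2_inner_self_eq_0 L2_unit_diff b s)
  then show ?thesis unfolding s_def by eventually_elim simp
qed

lemma inner_basis_cells:
  assumes r: "J0 \<le> r" and l: "l \<in> {1..2 ^ r}" and f: "f \<in> L2_unit"
  shows "L2_inner f (basis l) = (\<Sum>i=1..2 ^ r. 2 ^ r * cell_coeff r l i * (LINT x:cell (2 ^ r) i|lebesgue. f x))"
proof -
  have "L2_inner (basis l) f = L2_inner (\<lambda>x. \<Sum>i=1..2 ^ r. (2 ^ r * cell_coeff r l i) * indicator (cell (2 ^ r) i) x) f"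
    using l by (intro L2_inner_cong_AE basis_cells[OF r l] basis_L2 L2_unit_sum cell_L2 f) auto
  also have "\<dots> = (\<Sum>i=1..2 ^ r. (2 ^ r * cell_coeff r l i) * L2_inner (indicator (cell (2 ^ r) i)) f)"
    by (intro L2_inner_sum_left cell_L2 f)
  also have "\<dots> = (\<Sum>i=1..2 ^ r. (2 ^ r * cell_coeff r l i) * (LINT x:cell (2 ^ r) i|lebesgue. f x))"
    by (intro sum.cong refl) (simp add: inner_cell[symmetric] L2_inner_commute)
  finally show ?thesis by (simp add: L2_inner_commute)
qed

lemma cell_coeff_rows:
  assumes r: "J0 \<le> r" and l: "l \<in> {1..2 ^ r}" and m: "m \<in> {1..2 ^ r}"
  shows "(\<Sum>i=1..2 ^ r. 2 ^ r * cell_coeff r l i * cell_coeff r m i) = (if l = m then 1 else 0)"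
  using inner_basis_cells[OF r l basis_L2[of m]] basis_orth[of m l] m l by (simp add: cell_coeff_def)

section \<open>The orthogonal transform between cell averages and coefficients\<close>

definition average :: "(real \<Rightarrow> real) \<Rightarrow> nat \<Rightarrow> nat \<Rightarrow> real" where
  "average f r i = 2 ^ r * (LINT x:cell (2 ^ r) i|lebesgue. f x)"

lemma inner_basis_average:
  assumes "J0 \<le> r" "l \<in> {1..2 ^ r}" "f \<in> L2_unit"
  shows "L2_inner f (basis l) = (\<Sum>i=1..2 ^ r. cell_coeff r l i * average f r i)"
  unfolding inner_basis_cells[OF assms] average_def by (intro sum.cong refl) simp

lemma inner_transform:
  assumes "J0 \<le> r" "i \<in> {1..2 ^ r}"
  shows "(\<Sum>l=1..2 ^ r. cell_coeff r l i * (\<Sum>j=1..2 ^ r. cell_coeff r l j * d j)) = d i / 2 ^ r"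
proof -
  have "(\<Sum>l=1..2 ^ r. cell_coeff r l i * (\<Sum>j=1..2 ^ r. cell_coeff r l j * d j))
      = (\<Sum>l=1..2 ^ r. \<Sum>j=1..2 ^ r. d j * (cell_coeff r l i * cell_coeff r l j))"
    by (simp add: sum_distrib_left mult_ac)
  also have "\<dots> = (\<Sum>j=1..2 ^ r. d j * (\<Sum>l=1..2 ^ r. cell_coeff r l i * cell_coeff r l j))"
    by (subst sum.swap) (simp add: sum_distrib_left)
  also have "\<dots> = (\<Sum>j=1..2 ^ r. if j = i then d i / 2 ^ r else 0)"
  proof (intro sum.cong refl)
    fix j :: nat assume "j \<in> {1..2 ^ r}"
    then show "d j * (\<Sum>l=1..2 ^ r. cell_coeff r l i * cell_coeff r l j) = (if j = i then d i / 2 ^ r else 0)"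
      by (subst cell_coeff_columns[OF assms]) auto
  qed
  finally show ?thesis using assms by simp
qed

lemma transform_norm:
  assumes "J0 \<le> r"
  shows "(\<Sum>l=1..2 ^ r. (\<Sum>i=1..2 ^ r. cell_coeff r l i * d i)\<^sup>2) = (\<Sum>i=1..2 ^ r. (d i)\<^sup>2) / 2 ^ r"
proof -
  have "(\<Sum>l=1..2 ^ r. (\<Sum>i=1..2 ^ r. cell_coeff r l i * d i)\<^sup>2)
      = (\<Sum>l=1..2 ^ r. \<Sum>i=1..2 ^ r. d i * (cell_coeff r l i * (\<Sum>j=1..2 ^ r. cell_coeff r l j * d j)))"
    unfolding power2_eq_square sum_distrib_right by (intro sum.cong refl) (simp add: mult_ac)
  also have "\<dots> = (\<Sum>i=1..2 ^ r. d i * (\<Sum>l=1..2 ^ r. cell_coeff r l i * (\<Sum>j=1..2 ^ r. cell_coeff r l j * d j)))"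
    by (subst sum.swap) (simp add: sum_distrib_left)
  also have "\<dots> = (\<Sum>i=1..2 ^ r. (d i)\<^sup>2 / 2 ^ r)"
    by (intro sum.cong refl) (simp only: inner_transform[OF assms] power2_eq_square times_divide_eq_right)
  finally show ?thesis by (simp add: sum_divide_distrib)
qed

end

section \<open>Discretization bias\<close>

context wavelets
begin

lemma average_refine:
  assumes f: "f \<in> L2_unit" and i: "i \<in> {1..2 ^ r}"
  shows "average f r i = (average f (Suc r) (2 * i - 1) + average f (Suc r) (2 * i)) / 2"
proof -
  define c1 c2 :: "real \<Rightarrow> real" where "c1 = indicator (cell (2 ^ Suc r) (2 * i - 1))"
    and "c2 = indicator (cell (2 ^ Suc r) (2 * i))"
  have idx: "2 * i - 1 \<in> {1..2 ^ Suc r}" "2 * i \<in> {1..2 ^ Suc r}" using i by auto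
  have c: "c1 \<in> L2_unit" "c2 \<in> L2_unit" unfolding c1_def c2_def by (rule cell_L2)+
  have ri: "real (2 * i - 1) = 2 * real i - 1" using i by (simp add: of_nat_diff)
  have "AE x in unit_measure. indicator (cell (2 ^ r) i) x = c1 x + c2 x"
  proof -
    \<comment> \<open>At the common end point of the two halves both indicators are 1.\<close>
    have "{(2 * real i - 1) / 2 ^ Suc r} \<in> null_sets lebesgue"
      by (intro null_sets_completionI finite_imp_null_set_lborel) auto
    then have "AE x in lebesgue. x \<notin> {(2 * real i - 1) / 2 ^ Suc r}" by (rule AE_not_in)
    then have "AE x in lebesgue. x \<in> {0..1} \<longrightarrow> indicator (cell (2 ^ r) i) x = c1 x + c2 x"
    proof eventually_elim
      case (elim x)
      have "indicator (cell (2 ^ r) i) x = c1 x + c2 x"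
        using elim i ri by (auto simp: c1_def c2_def cell_def indicator_def field_simps)
      then show ?case by simp
    qed
    then show ?thesis by (subst AE_restrict_space_iff) auto
  qed
  then have "L2_inner (indicator (cell (2 ^ r) i)) f = L2_inner (\<lambda>x. c1 x + c2 x) f"
    by (intro L2_inner_cong_AE cell_L2 L2_unit_add c f)
  also have "\<dots> = L2_inner c1 f + L2_inner c2 f" by (rule L2_inner_add_left[OF c f])
  finally have "L2_inner f (indicator (cell (2 ^ r) i)) = L2_inner f c1 + L2_inner f c2"
    by (simp add: L2_inner_commute)
  then have "(LINT x:cell (2 ^ r) i|lebesgue. f x)
      = (LINT x:cell (2 ^ Suc r) (2 * i - 1)|lebesgue. f x) + (LINT x:cell (2 ^ Suc r) (2 * i)|lebesgue. f x)"
    unfolding c1_def c2_def inner_cell[OF i] inner_cell[OF idx(1)] inner_cell[OF idx(2)] .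
  then show ?thesis by (simp add: average_def distrib_left)
qed

lemma sum_pairs: "(\<Sum>i=1..2 * m. F i) = (\<Sum>i=1..m. F (2 * i - 1) + F (2 * i :: nat))"
  for F :: "nat \<Rightarrow> 'b::comm_monoid_add"
proof (induction m)
  case (Suc m)
  have "{1..2 * Suc m} = insert (2 * m + 2) (insert (2 * m + 1) {1..2 * m})" by auto
  then show ?case using Suc by (simp add: add_ac)
qed simp

definition level_norm :: "(real \<Rightarrow> real) \<Rightarrow> nat \<Rightarrow> real" where
  "level_norm f j = L2_set (\<lambda>l. L2_inner f (basis l)) {2 ^ j + 1..2 ^ Suc j}"

lemma energy_averages:
  assumes "J0 \<le> r" "f \<in> L2_unit"
  shows "(\<Sum>l=1..2 ^ r. (L2_inner f (basis l))\<^sup>2) = (\<Sum>i=1..2 ^ r. (average f r i)\<^sup>2) / 2 ^ r"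
  unfolding transform_norm[OF assms(1), symmetric]
  by (intro sum.cong refl) (simp only: inner_basis_average[OF assms(1) _ assms(2)])

text \<open>The energy of level r is the difference of the mean squares of the averages at two
  consecutive resolutions, and x^2 + y^2 = 2(y-a)^2 + 2a^2 for the mean a of two halves. The right
  half is singled out because the sampling point of a cell is its right end.\<close>

lemma increment_norm:
  assumes r: "J0 \<le> r" and f: "f \<in> L2_unit"
  shows "(\<Sum>i=1..2 ^ r. (average f (Suc r) (2 * i) - average f r i)\<^sup>2) = 2 ^ r * (level_norm f r)\<^sup>2"
proof -
  let ?c = "\<lambda>l. (L2_inner f (basis l))\<^sup>2"
  have "{1..(2::nat) ^ Suc r} = {1..2 ^ r} \<union> {2 ^ r + 1..2 ^ Suc r}" by auto
  then have "(\<Sum>l=1..2 ^ Suc r. ?c l) = (\<Sum>l=1..2 ^ r. ?c l) + (\<Sum>l\<in>{2 ^ r + 1..2 ^ Suc r}. ?c l)"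
    by (simp only:) (subst sum.union_disjoint, auto)
  then have "(level_norm f r)\<^sup>2 = (\<Sum>l=1..2 ^ Suc r. ?c l) - (\<Sum>l=1..2 ^ r. ?c l)"
    by (simp add: level_norm_def L2_set_def sum_nonneg)
  also have "\<dots> = (\<Sum>i=1..2 ^ Suc r. (average f (Suc r) i)\<^sup>2) / 2 ^ Suc r - (\<Sum>i=1..2 ^ r. (average f r i)\<^sup>2) / 2 ^ r"
    using r by (simp only: energy_averages[OF _ f] le_SucI)
  also have "(\<Sum>i=1..2 ^ Suc r. (average f (Suc r) i)\<^sup>2)
      = (\<Sum>i=1..2 ^ r. (average f (Suc r) (2 * i - 1))\<^sup>2 + (average f (Suc r) (2 * i))\<^sup>2)"
    unfolding power_Suc by (rule sum_pairs)
  also have "\<dots> = (\<Sum>i=1..2 ^ r. 2 * (average f (Suc r) (2 * i) - average f r i)\<^sup>2 + 2 * (average f r i)\<^sup>2)"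
  proof (intro sum.cong refl)
    fix i :: nat assume i: "i \<in> {1..2 ^ r}"
    have "x\<^sup>2 + y\<^sup>2 = 2 * (y - (x + y) / 2)\<^sup>2 + 2 * ((x + y) / 2)\<^sup>2" for x y :: real
      by (simp add: power2_eq_square field_simps)
    then show "(average f (Suc r) (2 * i - 1))\<^sup>2 + (average f (Suc r) (2 * i))\<^sup>2
        = 2 * (average f (Suc r) (2 * i) - average f r i)\<^sup>2 + 2 * (average f r i)\<^sup>2"
      unfolding average_refine[OF f i] .
  qed
  also have "\<dots> = 2 * (\<Sum>i=1..2 ^ r. (average f (Suc r) (2 * i) - average f r i)\<^sup>2) + 2 * (\<Sum>i=1..2 ^ r. (average f r i)\<^sup>2)"
    by (simp add: sum.distrib sum_distrib_left)
  finally show ?thesis by (simp add: field_simps)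
qed

text \<open>What the Besov bounds give in terms of level energies. The parameters p, q and s have
  disappeared, so estimates over this class are automatically uniform over them.\<close>

definition smooth_class :: "real \<Rightarrow> real \<Rightarrow> (real \<Rightarrow> real) set" where
  "smooth_class \<eta> c = {f \<in> L2_unit. \<forall>j\<ge>J0. level_norm f j \<le> c * 2 powr (- real j * (1/2 + \<eta>))}"

text \<open>Passing from coefficients to averages costs sqrt (2^r), exactly the 1/2 in the decay
  exponent. The excess \<eta> of \<gamma> over 1/2 is left as a geometric rate.\<close>

lemma increment_bound:
  assumes "J0 \<le> r" and f: "f \<in> smooth_class \<eta> c" and c: "0 \<le> c" and \<eta>: "0 < \<eta>"
  shows "L2_set (\<lambda>i. average f (Suc r) (2 * i) - average f r i) {1..2 ^ r} \<le> c * (2 powr - \<eta>) ^ r"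
proof -
  have "L2_set (\<lambda>i. average f (Suc r) (2 * i) - average f r i) {1..2 ^ r} = sqrt (2 ^ r) * level_norm f r"
  proof -
    have "f \<in> L2_unit" using f by (simp add: smooth_class_def)
    moreover have "0 \<le> level_norm f r" by (simp add: level_norm_def L2_set_nonneg)
    ultimately show ?thesis
      unfolding L2_set_def by (simp only: increment_norm[OF assms(1)] real_sqrt_mult real_sqrt_abs abs_of_nonneg)
  qed
  also have "\<dots> \<le> sqrt (2 ^ r) * (c * 2 powr (- real r * (1/2 + \<eta>)))"
    using f assms(1) by (intro mult_left_mono) (auto simp: smooth_class_def)
  also have "sqrt (2 ^ r) = 2 powr (real r / 2)"
    by (simp add: powr_half_sqrt[symmetric] powr_powr flip: powr_realpow)
  also have "2 powr (real r / 2) * (c * 2 powr (- real r * (1/2 + \<eta>))) = c * (2 powr - \<eta>) ^ r"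
    by (simp add: powr_add[symmetric] powr_powr algebra_simps flip: powr_realpow)
  finally show ?thesis .
qed

lemma geometric_ratio:
  fixes \<eta> :: real
  shows "0 < \<eta> \<Longrightarrow> 0 < 2 powr - \<eta>" "0 < \<eta> \<Longrightarrow> 2 powr - \<eta> < (1::real)"
  by (auto simp: powr_less_one)

text \<open>Cell 2^T i of generation r+T is the descendant of cell i that ends at the same point
  i/2^r. At each generation these are some of the right halves whose increments
  \<open>increment_bound\<close> controls together.\<close>

lemma average_chain_bound:
  assumes r: "J0 \<le> r" and f: "f \<in> smooth_class \<eta> c" and c: "0 \<le> c" and \<eta>: "0 < \<eta>"
  shows "L2_set (\<lambda>i. average f (r + T) (2 ^ T * i) - average f r i) {1..2 ^ r}
    \<le> (\<Sum>t<T. c * (2 powr - \<eta>) ^ (r + t))"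
proof (induction T)
  case (Suc T)
  have "L2_set (\<lambda>i. average f (r + Suc T) (2 ^ Suc T * i) - average f r i) {1..2 ^ r}
      = L2_set (\<lambda>i. (average f (r + T) (2 ^ T * i) - average f r i)
        + (average f (Suc (r + T)) (2 * (2 ^ T * i)) - average f (r + T) (2 ^ T * i))) {1..2 ^ r}"
    by (simp add: mult.assoc)
  also have "\<dots> \<le> L2_set (\<lambda>i. average f (r + T) (2 ^ T * i) - average f r i) {1..2 ^ r}
        + L2_set (\<lambda>i. average f (Suc (r + T)) (2 * (2 ^ T * i)) - average f (r + T) (2 ^ T * i)) {1..2 ^ r}"
    by (rule L2_set_triangle_ineq)
  also have "L2_set (\<lambda>i. average f (Suc (r + T)) (2 * (2 ^ T * i)) - average f (r + T) (2 ^ T * i)) {1..2 ^ r}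
      = L2_set (\<lambda>i. average f (Suc (r + T)) (2 * i) - average f (r + T) i) ((\<lambda>i. 2 ^ T * i) ` {1..2 ^ r})"
    unfolding L2_set_def by (subst sum.reindex) (auto simp: inj_on_def)
  also have "\<dots> \<le> L2_set (\<lambda>i. average f (Suc (r + T)) (2 * i) - average f (r + T) i) {1..2 ^ (r + T)}"
    unfolding L2_set_def by (intro real_sqrt_le_mono sum_mono2) (auto simp: power_add)
  also have "\<dots> \<le> c * (2 powr - \<eta>) ^ (r + T)"
    using r by (intro increment_bound f c \<eta>) auto
  finally show ?case using Suc by simp
qed (simp add: L2_set_def)

lemma geometric_partial_bound:
  fixes c \<eta> :: real
  assumes "0 \<le> c" "0 < \<eta>"
  shows "(\<Sum>t<T. c * (2 powr - \<eta>) ^ (r + t)) \<le> c / (1 - 2 powr - \<eta>)"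
proof -
  let ?q = "(2::real) powr - \<eta>"
  have q: "0 < ?q" "?q < 1" using geometric_ratio assms by auto
  have "(\<Sum>t<T. c * ?q ^ (r + t)) \<le> (\<Sum>t<T. c * ?q ^ t)"
    using assms q by (intro sum_mono mult_left_mono power_decreasing) auto
  also have "\<dots> = c * (\<Sum>t<T. ?q ^ t)" by (simp add: sum_distrib_left)
  also have "\<dots> \<le> c * (\<Sum>t. ?q ^ t)"
    using assms q by (intro mult_left_mono sum_le_suminf summable_geometric) auto
  also have "\<dots> = c / (1 - ?q)" using q by (simp add: suminf_geometric)
  finally show ?thesis .
qed

text \<open>The cells are intervals of length 2^(-s) ending at x, so left continuity at x makes the
  averages converge to the value there.\<close>

lemma average_tendsto_left:
  assumes f: "f \<in> L2_unit" and cont: "continuous (at_left x) f"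
    and idx: "\<And>T. i T \<in> {1..2 ^ s T}" "\<And>T. real (i T) / 2 ^ s T = x" and s: "filterlim s at_top sequentially"
  shows "(\<lambda>T. average f (s T) (i T)) \<longlonglongrightarrow> f x"
proof (rule LIMSEQ_I)
  fix e :: real assume "e > 0"
  have "(f \<longlongrightarrow> f x) (at_left x)" using cont by (simp add: continuous_within)
  then have "eventually (\<lambda>y. dist (f y) (f x) < e / 2) (at_left x)" using \<open>e > 0\<close> by (intro tendstoD) auto
  then obtain b where b: "b < x" "\<And>y. b < y \<Longrightarrow> y < x \<Longrightarrow> \<bar>f y - f x\<bar> < e / 2"
    by (auto simp: eventually_at_left_field dist_real_def)
  have "filterlim (\<lambda>T. real (s T)) at_top sequentially" by (rule filterlim_compose[OF filterlim_real_sequentially s])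
  then obtain T0 where T0: "\<And>T. T \<ge> T0 \<Longrightarrow> real (s T) > 1 / (x - b)"
    unfolding filterlim_at_top_dense eventually_sequentially by blast
  show "\<exists>no. \<forall>T\<ge>no. norm (average f (s T) (i T) - f x) < e"
  proof (intro exI[of _ T0] allI impI)
    fix T assume "T0 \<le> T"
    let ?C = "cell (2 ^ s T) (i T)"
    have "1 / (x - b) < 2 ^ s T" using T0[OF \<open>T0 \<le> T\<close>] of_nat_less_two_power[of "s T"] by (meson less_trans)
    then have h: "b < x - 1 / 2 ^ s T" using b(1) by (simp add: field_simps)
    have C: "?C = {x - 1 / 2 ^ s T..x}"
      unfolding idx(2)[of T, symmetric] by (simp add: cell_def diff_divide_distrib)
    have bound: "\<bar>f y - f x\<bar> \<le> e / 2" if "y \<in> ?C" for y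
      using that b(2)[of y] h \<open>e > 0\<close> by (cases "y = x") (auto simp: C)
    have sub: "?C \<subseteq> {0..1}" using idx(1)[of T] by (intro cell_subset) auto
    have intf: "integrable lebesgue (\<lambda>y. indicator ?C y *\<^sub>R f y)"
    proof -
      have "integrable lebesgue (\<lambda>y. indicator {0..1} y *\<^sub>R f y)"
        using L2_unit_integrable[OF f] by (simp add: integrable_restrict_space)
      then have "integrable lebesgue (\<lambda>y. indicator ?C y *\<^sub>R (indicator {0..1} y *\<^sub>R f y))"
        by (rule integrable_mult_indicator[rotated]) (simp add: cell_def)
      moreover have "indicator ?C y *\<^sub>R (indicator {0..1} y *\<^sub>R f y) = indicator ?C y *\<^sub>R f y" for y
        using sub by (auto simp: indicator_def)
      ultimately show ?thesis by (simp only:)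
    qed
    have ind: "integrable lebesgue (indicator ?C :: real \<Rightarrow> real)" "(LINT y|lebesgue. (indicator ?C y :: real)) = 1 / 2 ^ s T"
      unfolding C by (auto intro!: integrable_real_indicator simp: emeasure_lborel_Icc_eq)
    have "(LINT y:?C|lebesgue. f y) - f x / 2 ^ s T = (LINT y|lebesgue. indicator ?C y *\<^sub>R f y - f x * indicator ?C y)"
      using intf ind by (simp add: set_lebesgue_integral_def)
    also have "\<bar>\<dots>\<bar> \<le> (LINT y|lebesgue. \<bar>indicator ?C y *\<^sub>R f y - f x * indicator ?C y\<bar>)"
      by (rule integral_abs_bound)
    also have "\<dots> \<le> (LINT y|lebesgue. e / 2 * indicator ?C y)"
    proof (rule integral_mono)
      fix y show "\<bar>indicator ?C y *\<^sub>R f y - f x * indicator ?C y\<bar> \<le> e / 2 * indicator ?C y"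
        using bound[of y] by (auto simp: indicator_def)
    qed (use intf ind in auto)
    also have "\<dots> = e / 2 / 2 ^ s T" using ind by simp
    finally have 1: "\<bar>(LINT y:?C|lebesgue. f y) - f x / 2 ^ s T\<bar> \<le> e / 2 / 2 ^ s T" .
    have "\<bar>average f (s T) (i T) - f x\<bar> = 2 ^ s T * \<bar>(LINT y:?C|lebesgue. f y) - f x / 2 ^ s T\<bar>"
    proof -
      have "average f (s T) (i T) - f x = 2 ^ s T * ((LINT y:?C|lebesgue. f y) - f x / 2 ^ s T)"
        by (simp add: average_def right_diff_distrib)
      then show ?thesis by (simp add: abs_mult)
    qed
    also have "\<dots> \<le> 2 ^ s T * (e / 2 / 2 ^ s T)" by (intro mult_left_mono 1) simp
    also have "\<dots> < e" using \<open>e > 0\<close> by simp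
    finally show "norm (average f (s T) (i T) - f x) < e" by simp
  qed
qed

text \<open>Let T grow in \<open>average_chain_bound\<close>. The bound on the root of the sum over
  all 2^r cells is independent of r, which makes the bias bounded in noise units.\<close>

lemma sampling_bias:
  assumes r: "J0 \<le> r" and f: "f \<in> smooth_class \<eta> c" "f \<in> left_continuous_versions" and c: "0 \<le> c" and \<eta>: "0 < \<eta>"
  shows "L2_set (\<lambda>i. f (real i / 2 ^ r) - average f r i) {1..2 ^ r} \<le> c / (1 - 2 powr - \<eta>)"
proof -
  have fL: "f \<in> L2_unit" using f(1) by (simp add: smooth_class_def)
  have lim: "(\<lambda>T. average f (r + T) (2 ^ T * i)) \<longlonglongrightarrow> f (real i / 2 ^ r)" if i: "i \<in> {1..2 ^ r}" for i
  proof (rule average_tendsto_left[OF fL])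
    have "real i \<le> 2 ^ r" using i by (metis atLeastAtMost_iff of_nat_le_iff of_nat_numeral of_nat_power)
    then have "real i / 2 ^ r \<in> {0<..1}" using i by (auto simp: field_simps)
    then show "continuous (at_left (real i / 2 ^ r)) f" using f(2) unfolding left_continuous_versions_def by blast
    show "2 ^ T * i \<in> {1..2 ^ (r + T)}" for T using i by (auto simp: power_add)
    show "real (2 ^ T * i) / 2 ^ (r + T) = real i / 2 ^ r" for T by (simp add: power_add)
    show "filterlim (\<lambda>T. r + T) at_top sequentially" by (rule filterlim_at_top_mono[OF filterlim_ident]) auto
  qed
  have "(\<lambda>T. L2_set (\<lambda>i. average f (r + T) (2 ^ T * i) - average f r i) {1..2 ^ r})
      \<longlonglongrightarrow> L2_set (\<lambda>i. f (real i / 2 ^ r) - average f r i) {1..2 ^ r}"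
    unfolding L2_set_def by (intro tendsto_real_sqrt tendsto_sum tendsto_power tendsto_diff tendsto_const lim)
  then show ?thesis
    by (rule LIMSEQ_le_const2)
      (use order_trans[OF average_chain_bound[OF r f(1) c \<eta>] geometric_partial_bound[OF c \<eta>]] in blast)
qed

end

section \<open>Approximation by cell averages\<close>

lemma L2_unit_cong_AE:
  assumes "AE x in unit_measure. f x = g x" "f \<in> borel_measurable unit_measure" "g \<in> L2_unit"
  shows "f \<in> L2_unit"
proof -
  have "integrable unit_measure (\<lambda>x. (f x)\<^sup>2) \<longleftrightarrow> integrable unit_measure (\<lambda>x. (g x)\<^sup>2)"
    by (rule integrable_cong_AE) (use assms in \<open>auto simp: L2_unit_def elim: eventually_mono\<close>)
  then show ?thesis using assms by (simp add: L2_unit_def)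
qed

lemma L2_inner_self_bounded:
  assumes "h \<in> L2_unit" "AE x in unit_measure. \<bar>h x\<bar> \<le> C"
  shows "L2_inner h h \<le> C\<^sup>2"
proof -
  interpret finite_measure unit_measure by (rule finite_measure_unit)
  have "L2_inner h h \<le> (\<integral>x. C\<^sup>2 \<partial>unit_measure)"
    unfolding L2_inner_def
  proof (rule integral_mono_AE)
    show "integrable unit_measure (\<lambda>x. h x * h x)" by (rule L2_unit_mult_integrable[OF assms(1,1)])
    show "AE x in unit_measure. h x * h x \<le> C\<^sup>2"
      using assms(2)
    proof eventually_elim
      case (elim x)
      then have "\<bar>h x\<bar>\<^sup>2 \<le> C\<^sup>2" by (intro power_mono) auto
      then show ?case by (simp add: power2_eq_square)
    qed
  qed simp
  also have "\<dots> = C\<^sup>2" by (simp add: measure_restrict_space)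
  finally show ?thesis .
qed

lemma AE_unit_interior:
  assumes "finite S"
  shows "AE x in unit_measure. x \<in> {0<..1} \<and> x \<notin> S"
proof -
  have "insert 0 S \<in> null_sets lebesgue"
    using assms by (intro null_sets_completionI finite_imp_null_set_lborel) auto
  then have "AE x in lebesgue. x \<notin> insert 0 S" by (rule AE_not_in)
  then have "AE x in lebesgue. x \<in> {0..1} \<longrightarrow> x \<in> {0<..1} \<and> x \<notin> S" by eventually_elim auto
  then show ?thesis by (subst AE_restrict_space_iff) auto
qed

lemma ceiling_index:
  assumes "x \<in> {0<..1::real}"
  shows "nat \<lceil>2 ^ r * x\<rceil> \<in> {1..2 ^ r}"
proof -
  have "0 < 2 ^ r * x" "2 ^ r * x \<le> 2 ^ r" using assms by auto
  then have "0 < \<lceil>2 ^ r * x\<rceil>" "\<lceil>2 ^ r * x\<rceil> \<le> 2 ^ r" by (auto simp: ceiling_le_iff)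
  then show ?thesis by (simp add: Suc_le_eq nat_le_iff)
qed

context wavelets
begin

lemma cell_average_eq: "cell_average (2 ^ r) f x = average f r (nat \<lceil>2 ^ r * x\<rceil>)"
  by (simp add: cell_average_def average_def)

lemma cell_average_measurable: "cell_average n f \<in> borel_measurable unit_measure"
proof -
  have "(\<lambda>x. \<lceil>real n * x\<rceil>) \<in> measurable borel (count_space UNIV)"
    by measurable
  then have "(\<lambda>x. real n * (LINT t:cell n (nat \<lceil>real n * x\<rceil>)|lebesgue. f t)) \<in> borel_measurable borel"
    by (rule measurable_compose[where g="\<lambda>i. real n * (LINT t:cell n (nat i)|lebesgue. f t)"]) simp
  then have "cell_average n f \<in> borel_measurable borel" by (simp add: cell_average_def[abs_def])
  then show ?thesis by (intro measurable_restrict_space1) (simp add: measurable_completion)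
qed

lemma cell_average_AE:
  "AE x in unit_measure. cell_average (2 ^ r) f x = (\<Sum>i=1..2 ^ r. average f r i * indicator (cell (2 ^ r) i) x)"
proof -
  have "AE x in unit_measure. x \<in> {0<..1} \<and> x \<notin> (\<lambda>i. real i / 2 ^ r) ` {0..2 ^ r}"
    by (rule AE_unit_interior) simp
  then show ?thesis
  proof eventually_elim
    case (elim x)
    let ?k = "nat \<lceil>2 ^ r * x\<rceil>"
    have k: "?k \<in> {1..2 ^ r}" using elim by (intro ceiling_index) auto
    have "indicator (cell (2 ^ r) i) x = (if i = ?k then 1 else 0 :: real)" if i: "i \<in> {1..2 ^ r}" for i
    proof -
      have "x \<noteq> real k / 2 ^ r" if "k \<le> 2 ^ r" for k using elim that by auto
      from this[of i] this[of "i - 1"] have ne: "x \<noteq> real i / 2 ^ r" "x \<noteq> real (i - 1) / 2 ^ r"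
        using i le_trans[OF diff_le_self[of i 1]] by auto
      have "x \<in> cell (2 ^ r) i \<longleftrightarrow> real i - 1 < 2 ^ r * x \<and> 2 ^ r * x \<le> real i"
        using ne i by (auto simp: cell_def field_simps of_nat_diff)
      also have "\<dots> \<longleftrightarrow> \<lceil>2 ^ r * x\<rceil> = int i" by (auto simp: ceiling_eq_iff)
      also have "\<dots> \<longleftrightarrow> i = ?k" using i k by auto
      finally show ?thesis by (simp add: indicator_def)
    qed
    then have "(\<Sum>i=1..2 ^ r. average f r i * indicator (cell (2 ^ r) i) x)
        = (\<Sum>i=1..2 ^ r. if i = ?k then average f r ?k else 0)"
      by (intro sum.cong refl) auto
    also have "\<dots> = average f r ?k" using k by simp
    finally show ?case by (simp add: cell_average_eq)
  qed
qed

lemma cell_average_L2: "cell_average (2 ^ r) f \<in> L2_unit"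
  by (rule L2_unit_cong_AE[OF cell_average_AE cell_average_measurable]) (intro L2_unit_sum cell_L2)

text \<open>The first n basis functions are step functions on the cells, so the approximate
  coefficients coincide with the exact ones for l <= n.\<close>

lemma cell_average_inner:
  assumes "J0 \<le> r" "l \<in> {1..2 ^ r}" "f \<in> L2_unit"
  shows "L2_inner (cell_average (2 ^ r) f) (basis l) = L2_inner f (basis l)"
proof -
  have b: "basis l \<in> L2_unit" using assms by (intro basis_L2) auto
  have "L2_inner (cell_average (2 ^ r) f) (basis l)
      = L2_inner (\<lambda>x. \<Sum>i=1..2 ^ r. average f r i * indicator (cell (2 ^ r) i) x) (basis l)"
    by (intro L2_inner_cong_AE cell_average_AE cell_average_L2 L2_unit_sum cell_L2 b)
  also have "\<dots> = (\<Sum>i=1..2 ^ r. average f r i * L2_inner (indicator (cell (2 ^ r) i)) (basis l))"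
    by (intro L2_inner_sum_left cell_L2 b)
  also have "\<dots> = (\<Sum>i=1..2 ^ r. cell_coeff r l i * average f r i)"
    by (intro sum.cong refl) (simp add: cell_coeff_inner[symmetric] L2_inner_commute)
  finally show ?thesis using inner_basis_average[OF assms] by simp
qed

text \<open>Cell averaging is the orthogonal projection onto the first 2^r basis functions; this
  allows pointwise estimates of the partial sums.\<close>

lemma projection_AE:
  assumes r: "J0 \<le> r" and f: "f \<in> L2_unit"
  shows "AE x in unit_measure. cell_average (2 ^ r) f x = (\<Sum>l=1..2 ^ r. L2_inner f (basis l) * basis l x)"
proof -
  have "AE x in unit_measure. \<forall>l\<in>{1..2 ^ r}. basis l x = (\<Sum>i=1..2 ^ r. (2 ^ r * cell_coeff r l i) * indicator (cell (2 ^ r) i) x)"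
    by (rule AE_finite_allI[OF finite_atLeastAtMost basis_cells[OF r]])
  with cell_average_AE[of r f] show ?thesis
  proof eventually_elim
    case (elim x)
    have "(\<Sum>l=1..2 ^ r. L2_inner f (basis l) * basis l x)
        = (\<Sum>l=1..2 ^ r. \<Sum>i=1..2 ^ r. 2 ^ r * indicator (cell (2 ^ r) i) x * (cell_coeff r l i * L2_inner f (basis l)))"
      using elim(2) by (intro sum.cong refl) (simp only: sum_distrib_left mult_ac)
    also have "\<dots> = (\<Sum>i=1..2 ^ r. 2 ^ r * indicator (cell (2 ^ r) i) x * (\<Sum>l=1..2 ^ r. cell_coeff r l i * L2_inner f (basis l)))"
      by (subst sum.swap) (simp only: sum_distrib_left)
    also have "\<dots> = (\<Sum>i=1..2 ^ r. average f r i * indicator (cell (2 ^ r) i) x)"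
    proof (intro sum.cong refl)
      fix i :: nat assume i: "i \<in> {1..2 ^ r}"
      have "(\<Sum>l=1..2 ^ r. cell_coeff r l i * L2_inner f (basis l)) = average f r i / 2 ^ r"
        unfolding inner_transform[OF r i, symmetric]
        by (intro sum.cong refl) (simp only: inner_basis_average[OF r _ f])
      then show "2 ^ r * indicator (cell (2 ^ r) i) x * (\<Sum>l=1..2 ^ r. cell_coeff r l i * L2_inner f (basis l))
          = average f r i * indicator (cell (2 ^ r) i) x" by simp
    qed
    finally show ?case using elim(1) by simp
  qed
qed

text \<open>The increments on the two halves of a cell differ only in sign, and a single one is
  bounded by the norm of the whole family.\<close>

lemma cell_average_step:
  assumes "J0 \<le> r" "x \<in> {0<..1}" and f: "f \<in> smooth_class \<eta> c" and c: "0 \<le> c" and \<eta>: "0 < \<eta>"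
  shows "\<bar>cell_average (2 ^ Suc r) f x - cell_average (2 ^ r) f x\<bar> \<le> c * (2 powr - \<eta>) ^ r"
proof -
  define i where "i = nat \<lceil>2 ^ r * x\<rceil>"
  have i: "i \<in> {1..2 ^ r}" unfolding i_def by (rule ceiling_index[OF assms(2)])
  define k where "k = nat \<lceil>2 ^ Suc r * x\<rceil>"
  have pos: "0 < \<lceil>2 ^ r * x\<rceil>" "0 < \<lceil>2 ^ Suc r * x\<rceil>" using assms(2) by auto
  have "int i = \<lceil>2 ^ r * x\<rceil>" unfolding i_def using pos(1) by simp
  then have ix: "real i - 1 < 2 ^ r * x" "2 ^ r * x \<le> real i" by linarith+
  have "int k = \<lceil>2 ^ Suc r * x\<rceil>" unfolding k_def by (rule nat_0_le) (use pos(2) in linarith)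
  then have "int k = \<lceil>2 * (2 ^ r * x)\<rceil>" by (simp add: mult.assoc)
  then have kx: "real k - 1 < 2 * (2 ^ r * x)" "2 * (2 ^ r * x) \<le> real k" by linarith+
  have "real k < 2 * real i + 1" "2 * real i - 2 < real k" using ix kx by linarith+
  then have "k = 2 * i \<or> k = 2 * i - 1" by linarith
  moreover have fL: "f \<in> L2_unit" using f by (simp add: smooth_class_def)
  ultimately have "\<bar>average f (Suc r) k - average f r i\<bar> = \<bar>average f (Suc r) (2 * i) - average f r i\<bar>"
    using average_refine[OF fL i] by (auto simp: field_simps abs_minus_commute)
  also have "\<dots> \<le> L2_set (\<lambda>i. average f (Suc r) (2 * i) - average f r i) {1..2 ^ r}"
    using member_le_L2_set[of "{1..2 ^ r}" i "\<lambda>i. \<bar>average f (Suc r) (2 * i) - average f r i\<bar>"] i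
    by (simp add: L2_set_def)
  also have "\<dots> \<le> c * (2 powr - \<eta>) ^ r" by (rule increment_bound[OF assms(1) f c \<eta>])
  finally show ?thesis unfolding cell_average_eq i_def k_def .
qed

lemma cell_average_uniform:
  assumes r: "J0 \<le> r" and x: "x \<in> {0<..1}" and f: "f \<in> smooth_class \<eta> c" and c: "0 \<le> c" and \<eta>: "0 < \<eta>"
  shows "\<bar>cell_average (2 ^ (r + T)) f x - cell_average (2 ^ r) f x\<bar> \<le> (2 powr - \<eta>) ^ r * (c / (1 - 2 powr - \<eta>))"
proof -
  let ?q = "(2::real) powr - \<eta>"
  have "\<bar>cell_average (2 ^ (r + T)) f x - cell_average (2 ^ r) f x\<bar> \<le> (\<Sum>t<T. c * ?q ^ (r + t))"
  proof (induction T)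
    case (Suc T)
    have "\<bar>cell_average (2 ^ Suc (r + T)) f x - cell_average (2 ^ (r + T)) f x\<bar> \<le> c * ?q ^ (r + T)"
      using r by (intro cell_average_step x f c \<eta>) auto
    then show ?case using Suc by simp
  qed simp
  also have "\<dots> = ?q ^ r * (\<Sum>t<T. c * ?q ^ (0 + t))"
    by (simp add: power_add sum_distrib_left mult_ac)
  also have "\<dots> \<le> ?q ^ r * (c / (1 - ?q))"
    by (intro mult_left_mono geometric_partial_bound c \<eta>) auto
  finally show ?thesis .
qed

lemma residual_eq:
  assumes r: "J0 \<le> r" and f: "f \<in> L2_unit"
  shows "L2_inner (\<lambda>x. f x - (\<Sum>l=1..2 ^ r. m l * basis l x)) (\<lambda>x. f x - (\<Sum>l=1..2 ^ r. m l * basis l x))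
    = L2_inner f f - (\<Sum>l=1..2 ^ r. (L2_inner f (basis l))\<^sup>2) + (\<Sum>l=1..2 ^ r. (L2_inner f (basis l) - m l)\<^sup>2)"
proof -
  have "L2_inner (\<lambda>x. f x - (\<Sum>l=1..2 ^ r. m l * basis l x)) (\<lambda>x. f x - (\<Sum>l=1..2 ^ r. m l * basis l x))
      = L2_inner f f - 2 * (\<Sum>l=1..2 ^ r. m l * L2_inner f (basis l)) + 1 * (\<Sum>l=1..2 ^ r. (m l)\<^sup>2)"
    by (rule L2_inner_self_residual[OF _ f]) (auto simp: basis_orth intro: basis_L2)
  also have "\<dots> = L2_inner f f + (\<Sum>l=1..2 ^ r. (m l)\<^sup>2 - 2 * (m l * L2_inner f (basis l)))"
    by (simp add: sum_subtractf sum_distrib_left)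
  also have "(\<Sum>l=1..2 ^ r. (m l)\<^sup>2 - 2 * (m l * L2_inner f (basis l)))
      = (\<Sum>l=1..2 ^ r. (L2_inner f (basis l) - m l)\<^sup>2 - (L2_inner f (basis l))\<^sup>2)"
    by (intro sum.cong refl) (simp add: power2_eq_square algebra_simps)
  finally show ?thesis by (simp add: sum_subtractf)
qed

text \<open>The uniform limit of the cell averages has the coefficients of $f$, so by completeness it
  agrees with $f$ almost everywhere; this yields Parseval's identity for $f$.\<close>

lemma residual_small:
  assumes r: "J0 \<le> r" and f: "f \<in> smooth_class \<eta> c" and c: "0 \<le> c" and \<eta>: "0 < \<eta>"
  shows "L2_inner f f - (\<Sum>l=1..2 ^ r. (L2_inner f (basis l))\<^sup>2) \<le> ((2 powr - \<eta>) ^ r * (c / (1 - 2 powr - \<eta>)))\<^sup>2"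
proof -
  let ?q = "(2::real) powr - \<eta>"
  define C where "C = c / (1 - ?q)"
  have q: "0 < ?q" "?q < 1" using geometric_ratio \<eta> by auto
  have fL: "f \<in> L2_unit" using f by (simp add: smooth_class_def)
  define A where "A N = cell_average (2 ^ N) f" for N
  define L where "L x = lim (\<lambda>N. A N x)" for x
  \<comment> \<open>Convergence is known on the half-open interval; elsewhere the value of
    \<open>lim\<close> may be arbitrary, and G keeps that of the first average.\<close>
  define G where "G x = A J0 x + indicator {0<..1} x * (L x - A J0 x)" for x
  have qC: "(\<lambda>N. ?q ^ N * C) \<longlonglongrightarrow> 0"
    using tendsto_mult_left_zero[OF LIMSEQ_power_zero[of ?q]] q by simp
  have unif: "\<bar>A (N + T) x - A N x\<bar> \<le> ?q ^ N * C" if "J0 \<le> N" "x \<in> {0<..1}" for N T x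
    unfolding A_def C_def by (rule cell_average_uniform[OF that f c \<eta>])
  have conv: "(\<lambda>N. A N x) \<longlonglongrightarrow> L x" if x: "x \<in> {0<..1}" for x
  proof -
    have "Cauchy (\<lambda>N. A N x)"
    proof (rule CauchyI')
      fix e :: real assume "0 < e"
      then have "\<forall>\<^sub>F N in sequentially. ?q ^ N * C < e" using qC by (auto intro: order_tendstoD)
      then obtain M where M: "\<And>N. N \<ge> M \<Longrightarrow> ?q ^ N * C < e" by (auto simp: eventually_sequentially)
      show "\<exists>M. \<forall>m\<ge>M. \<forall>n>m. dist (A m x) (A n x) < e"
      proof (intro exI[of _ "max M J0"] allI impI)
        fix m n :: nat assume m: "max M J0 \<le> m" and "m < n"
        then have "\<bar>A (m + (n - m)) x - A m x\<bar> \<le> ?q ^ m * C" by (intro unif x) auto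
        also have "\<dots> < e" using M m by simp
        finally show "dist (A m x) (A n x) < e" using \<open>m < n\<close> by (simp add: dist_real_def)
      qed
    qed
    from Cauchy_convergent[OF this] show ?thesis unfolding L_def convergent_LIMSEQ_iff .
  qed
  have LA: "\<bar>L x - A N x\<bar> \<le> ?q ^ N * C" if N: "J0 \<le> N" and x: "x \<in> {0<..1}" for N x
  proof -
    have "(\<lambda>T. \<bar>A (N + T) x - A N x\<bar>) \<longlonglongrightarrow> \<bar>L x - A N x\<bar>"
      using LIMSEQ_ignore_initial_segment[OF conv[OF x], of N] by (intro tendsto_intros) (simp add: add.commute)
    then show ?thesis by (rule LIMSEQ_le_const2) (use unif[OF N x] in blast)
  qed
  have AL: "A N \<in> L2_unit" for N unfolding A_def by (rule cell_average_L2)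
  have Am [measurable]: "A N \<in> borel_measurable unit_measure" for N using AL by (rule L2_unit_measurable)
  have Lm [measurable]: "L \<in> borel_measurable unit_measure" unfolding L_def by measurable
  have GL: "G \<in> L2_unit"
    unfolding G_def
  proof (rule L2_unit_add[OF AL])
    show "(\<lambda>x. indicator {0<..1} x * (L x - A J0 x)) \<in> L2_unit"
    proof (rule bounded_L2_unit)
      have "(indicator {0<..1} :: real \<Rightarrow> real) \<in> borel_measurable unit_measure"
        using indicator_L2_unit[of "{0<..1}"] by (intro L2_unit_measurable) simp
      then show "(\<lambda>x. indicator {0<..1} x * (L x - A J0 x)) \<in> borel_measurable unit_measure" by measurable
      show "\<bar>indicator {0<..1} x * (L x - A J0 x)\<bar> \<le> \<bar>?q ^ J0 * C\<bar>" for x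
        using LA[of J0 x] by (auto simp: indicator_def)
    qed
  qed
  have GA: "L2_inner (\<lambda>x. G x - A N x) (\<lambda>x. G x - A N x) \<le> (?q ^ N * C)\<^sup>2" if N: "J0 \<le> N" for N
  proof (rule L2_inner_self_bounded)
    show "(\<lambda>x. G x - A N x) \<in> L2_unit" by (rule L2_unit_diff[OF GL AL])
    have "AE x in unit_measure. x \<in> {0<..1} \<and> x \<notin> {}" by (rule AE_unit_interior) simp
    then show "AE x in unit_measure. \<bar>G x - A N x\<bar> \<le> ?q ^ N * C"
      by eventually_elim (use LA[OF N] in \<open>auto simp: G_def\<close>)
  qed
  have "AE x in unit_measure. G x - f x = 0"
  proof (rule basis_complete)
    show "(\<lambda>x. G x - f x) \<in> L2_unit" by (rule L2_unit_diff[OF GL fL])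
    fix l :: nat assume l: "1 \<le> l"
    define a where "a = L2_inner (\<lambda>x. G x - f x) (basis l)"
    have "a\<^sup>2 \<le> (?q ^ N * C)\<^sup>2" if N: "J0 + l \<le> N" for N
    proof -
      have "l < 2 ^ l" by (rule less_exp)
      also have "(2::nat) ^ l \<le> 2 ^ N" using N by (intro power_increasing) auto
      finally have lN: "l \<in> {1..2 ^ N}" using l by simp
      have "a = L2_inner (\<lambda>x. G x - A N x) (basis l)"
        unfolding a_def L2_inner_diff_left[OF GL fL basis_L2[OF l]] L2_inner_diff_left[OF GL AL basis_L2[OF l]]
        using cell_average_inner[OF _ lN fL] N by (simp add: A_def)
      \<comment> \<open>Bessel's inequality for a single unit vector is Cauchy-Schwarz.\<close>
      moreover have "(\<Sum>l\<in>{l}. (L2_inner (\<lambda>x. G x - A N x) (basis l))\<^sup>2) \<le> 1 * L2_inner (\<lambda>x. G x - A N x) (\<lambda>x. G x - A N x)"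
        by (rule bessel) (use l in \<open>auto simp: basis_orth intro: basis_L2 L2_unit_diff GL AL\<close>)
      ultimately show ?thesis using GA[of N] N by simp
    qed
    moreover have "(\<lambda>N. (?q ^ N * C)\<^sup>2) \<longlonglongrightarrow> 0\<^sup>2" by (intro tendsto_power qC)
    ultimately have "a\<^sup>2 \<le> 0\<^sup>2" by (intro LIMSEQ_le_const) blast+
    then show "L2_inner (\<lambda>x. G x - f x) (basis l) = 0" by (simp add: a_def)
  qed
  then have Gf: "AE x in unit_measure. G x = f x" by eventually_elim simp
  have "L2_inner f f - (\<Sum>l=1..2 ^ r. (L2_inner f (basis l))\<^sup>2)
      = L2_inner (\<lambda>x. f x - (\<Sum>l=1..2 ^ r. L2_inner f (basis l) * basis l x))
          (\<lambda>x. f x - (\<Sum>l=1..2 ^ r. L2_inner f (basis l) * basis l x))"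
    using residual_eq[OF r fL, of "\<lambda>l. L2_inner f (basis l)"] by simp
  also have "\<dots> = L2_inner (\<lambda>x. G x - A r x) (\<lambda>x. G x - A r x)"
  proof -
    have s: "(\<lambda>x. \<Sum>l=1..2 ^ r. L2_inner f (basis l) * basis l x) \<in> L2_unit"
      by (intro L2_unit_sum basis_L2) auto
    have "(\<lambda>x. f x - (\<Sum>l=1..2 ^ r. L2_inner f (basis l) * basis l x)) \<in> borel_measurable unit_measure"
      "(\<lambda>x. G x - A r x) \<in> borel_measurable unit_measure"
      by (intro L2_unit_measurable L2_unit_diff fL s GL AL)+
    moreover have "AE x in unit_measure. f x - (\<Sum>l=1..2 ^ r. L2_inner f (basis l) * basis l x) = G x - A r x"
      using Gf projection_AE[OF r fL] unfolding A_def by eventually_elim simp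
    ultimately show ?thesis
      unfolding L2_inner_def by (intro integral_cong_AE) (auto elim: eventually_mono)
  qed
  also have "\<dots> \<le> (?q ^ r * C)\<^sup>2" by (rule GA[OF r])
  finally show ?thesis unfolding C_def .
qed

text \<open>\<open>residual_small\<close> gives only the rate 2^(-2\<eta>r); part (iii) requires
  o(1/n). The energies of the levels from r to r+T are therefore summed directly, and
  \<open>residual_small\<close> is used at r+T, where T tends to infinity. The factor 2 is 1/(1-p)
  for p <= 1/2.\<close>

lemma residual_tail:
  assumes r: "J0 \<le> r" and f: "f \<in> smooth_class \<eta> c" and c: "0 \<le> c" and \<eta>: "0 < \<eta>"
  shows "L2_inner f f - (\<Sum>l=1..2 ^ r. (L2_inner f (basis l))\<^sup>2) \<le> 2 * c\<^sup>2 * (2 powr - (1 + 2 * \<eta>)) ^ r"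
proof -
  define p where "p = (2::real) powr - (1 + 2 * \<eta>)"
  have "p \<le> 2 powr - 1" unfolding p_def using \<eta> by (intro powr_mono) auto
  then have p: "0 < p" "p \<le> 1 / 2" by (auto simp: p_def powr_minus_divide)
  define E where "E r = (\<Sum>l=1..2 ^ r. (L2_inner f (basis l))\<^sup>2)" for r
  have step: "E (r + T) - E r \<le> (\<Sum>t<T. c\<^sup>2 * p ^ (r + t))" for T
  proof (induction T)
    case (Suc T)
    have "{1..(2::nat) ^ Suc (r + T)} = {1..2 ^ (r + T)} \<union> {2 ^ (r + T) + 1..2 ^ Suc (r + T)}" by auto
    then have "E (Suc (r + T)) = E (r + T) + (\<Sum>l\<in>{2 ^ (r + T) + 1..2 ^ Suc (r + T)}. (L2_inner f (basis l))\<^sup>2)"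
      unfolding E_def by (simp only:) (subst sum.union_disjoint, auto)
    also have "(\<Sum>l\<in>{2 ^ (r + T) + 1..2 ^ Suc (r + T)}. (L2_inner f (basis l))\<^sup>2) = (level_norm f (r + T))\<^sup>2"
      unfolding level_norm_def L2_set_def by (rule real_sqrt_pow2[symmetric]) (simp add: sum_nonneg)
    also have "\<dots> \<le> (c * 2 powr (- real (r + T) * (1/2 + \<eta>)))\<^sup>2"
    proof (rule power_mono)
      show "level_norm f (r + T) \<le> c * 2 powr (- real (r + T) * (1/2 + \<eta>))"
        using f r unfolding smooth_class_def by (simp del: of_nat_add)
      show "0 \<le> level_norm f (r + T)" by (simp add: level_norm_def L2_set_nonneg)
    qed
    also have "\<dots> = c\<^sup>2 * p ^ (r + T)"
    proof -
      have "(2 powr (- real (r + T) * (1/2 + \<eta>)))\<^sup>2 = p ^ (r + T)"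
      proof -
        have "p ^ (r + T) = 2 powr (- (1 + 2 * \<eta>) * real (r + T))"
          using p(1) by (simp only: powr_realpow[symmetric] p_def powr_powr)
        also have "- (1 + 2 * \<eta>) * real (r + T) = - real (r + T) * (1/2 + \<eta>) + - real (r + T) * (1/2 + \<eta>)"
          by (simp add: algebra_simps)
        finally show ?thesis by (simp only: power2_eq_square powr_add)
      qed
      then show ?thesis by (simp add: power_mult_distrib)
    qed
    finally show ?case using Suc by simp
  qed simp
  have geo: "(\<Sum>t<T. c\<^sup>2 * p ^ (r + t)) \<le> 2 * c\<^sup>2 * p ^ r" for T
  proof -
    have "(\<Sum>t<T. p ^ t) \<le> (\<Sum>t. p ^ t)" using p by (intro sum_le_suminf summable_geometric) auto
    also have "\<dots> = 1 / (1 - p)" using p by (intro suminf_geometric) auto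
    also have "\<dots> \<le> 2" using p by (simp add: field_simps)
    finally have "c\<^sup>2 * p ^ r * (\<Sum>t<T. p ^ t) \<le> c\<^sup>2 * p ^ r * 2" using p by (intro mult_left_mono) auto
    moreover have "(\<Sum>t<T. c\<^sup>2 * p ^ (r + t)) = c\<^sup>2 * p ^ r * (\<Sum>t<T. p ^ t)"
      unfolding sum_distrib_left by (simp add: power_add mult.assoc)
    ultimately show ?thesis by simp
  qed
  let ?q = "(2::real) powr - \<eta>"
  define C where "C = c / (1 - ?q)"
  have q: "0 < ?q" "?q < 1" using geometric_ratio \<eta> by auto
  have "L2_inner f f - E r \<le> (?q ^ (T + r) * C)\<^sup>2 + 2 * c\<^sup>2 * p ^ r" for T
  proof -
    have "L2_inner f f - E (r + T) \<le> (?q ^ (r + T) * C)\<^sup>2"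
      unfolding E_def C_def using r by (intro residual_small f c \<eta>) auto
    then show ?thesis using step[of T] geo[of T] by (simp add: add.commute)
  qed
  moreover have "(\<lambda>T. (?q ^ (T + r) * C)\<^sup>2 + 2 * c\<^sup>2 * p ^ r) \<longlonglongrightarrow> (0 * C)\<^sup>2 + 2 * c\<^sup>2 * p ^ r"
    using q by (intro tendsto_intros LIMSEQ_ignore_initial_segment LIMSEQ_power_zero) auto
  ultimately have "L2_inner f f - E r \<le> (0 * C)\<^sup>2 + 2 * c\<^sup>2 * p ^ r" by (intro LIMSEQ_le_const) blast+
  then show ?thesis by (simp add: E_def p_def)
qed

end

section \<open>Besov bodies\<close>

text \<open>With S for the p-norm every |b k| is at most S, so b^2 <= S^(2-p) |b|^p, and these terms
  sum to S^2.\<close>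

lemma L2_set_le_lp_norm:
  fixes b :: "nat \<Rightarrow> real"
  assumes fin: "finite A" and p: "0 < p" "p \<le> 2"
  shows "L2_set b A \<le> (\<Sum>k\<in>A. \<bar>b k\<bar> powr p) powr (1/p)"
proof -
  define P where "P = (\<Sum>k\<in>A. \<bar>b k\<bar> powr p)"
  define S where "S = P powr (1/p)"
  have P0: "0 \<le> P" by (simp add: P_def sum_nonneg)
  have le: "\<bar>b k\<bar> \<le> S" if "k \<in> A" for k
  proof -
    have "\<bar>b k\<bar> powr p \<le> P" unfolding P_def using fin that by (intro member_le_sum) auto
    then have "(\<bar>b k\<bar> powr p) powr (1/p) \<le> S" unfolding S_def using p by (intro powr_mono2) auto
    then show ?thesis using p by (simp add: powr_powr)
  qed
  have "(\<Sum>k\<in>A. (b k)\<^sup>2) \<le> (\<Sum>k\<in>A. S powr (2 - p) * \<bar>b k\<bar> powr p)"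
  proof (rule sum_mono)
    fix k assume k: "k \<in> A"
    show "(b k)\<^sup>2 \<le> S powr (2 - p) * \<bar>b k\<bar> powr p"
    proof (cases "b k = 0")
      case False
      then have "(b k)\<^sup>2 = \<bar>b k\<bar> powr (2 - p) * \<bar>b k\<bar> powr p"
        by (simp flip: powr_add)
      also have "\<dots> \<le> S powr (2 - p) * \<bar>b k\<bar> powr p"
        using le[OF k] p by (intro mult_right_mono powr_mono2) auto
      finally show ?thesis .
    qed simp
  qed
  also have "\<dots> = S powr (2 - p) * P" by (simp add: P_def sum_distrib_left)
  also have "\<dots> = S powr (2 - p) * S powr p" using p P0 by (simp add: S_def powr_powr)
  also have "\<dots> = S\<^sup>2" by (simp add: S_def flip: powr_add)
  finally show ?thesis
    unfolding L2_set_def P_def[symmetric] S_def[symmetric]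
    by (intro real_le_lsqrt) (auto simp: S_def sum_nonneg)
qed

lemma L2_set_le_card_lp_norm:
  fixes b :: "nat \<Rightarrow> real"
  assumes fin: "finite A" and p: "2 \<le> p"
  shows "L2_set b A \<le> real (card A) powr (1/2 - 1/p) * (\<Sum>k\<in>A. \<bar>b k\<bar> powr p) powr (1/p)"
proof -
  \<comment> \<open>Jensen's inequality for the power p/2 is applied to positive entries only; zeros
    contribute to neither sum.\<close>
  define B where "B = {k\<in>A. b k \<noteq> 0}"
  define P where "P = (\<Sum>k\<in>A. \<bar>b k\<bar> powr p)"
  have B: "finite B" "B \<subseteq> A" using fin by (auto simp: B_def)
  have PB: "P = (\<Sum>k\<in>B. \<bar>b k\<bar> powr p)"
    unfolding P_def B_def using fin p by (intro sum.mono_neutral_right) auto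
  have QB: "(\<Sum>k\<in>A. (b k)\<^sup>2) = (\<Sum>k\<in>B. (b k)\<^sup>2)"
    unfolding B_def using fin by (intro sum.mono_neutral_right) auto
  show ?thesis
  proof (cases "B = {}")
    case True
    then show ?thesis using QB by (simp add: L2_set_def)
  next
    case False
    define N where "N = real (card B)"
    have N: "N > 0" using False B by (simp add: N_def card_gt_0_iff)
    define Q where "Q = (\<Sum>k\<in>B. (b k)\<^sup>2)"
    have Q: "Q > 0" unfolding Q_def using False B by (intro sum_pos) (auto simp: B_def)
    have P: "P > 0" unfolding PB using False B by (intro sum_pos) (auto simp: B_def)
    have "(\<lambda>x. x powr (p/2)) (\<Sum>k\<in>B. (1/N) *\<^sub>R (b k)\<^sup>2) \<le> (\<Sum>k\<in>B. (1/N) * (\<lambda>x. x powr (p/2)) ((b k)\<^sup>2))"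
    proof (rule convex_on_sum[OF B(1) False powr_convex])
      show "(\<Sum>k\<in>B. 1 / N) = 1" using N by (simp add: N_def)
    qed (use p N in \<open>auto simp: B_def\<close>)
    also have "\<dots> = (\<Sum>k\<in>B. (1/N) * \<bar>b k\<bar> powr p)"
    proof (intro sum.cong refl arg_cong2[where f="(*)"])
      fix k assume "k \<in> B"
      then have "(b k)\<^sup>2 = \<bar>b k\<bar> powr 2" by (simp add: B_def)
      then show "((b k)\<^sup>2) powr (p/2) = \<bar>b k\<bar> powr p" by (simp only: powr_powr) simp
    qed
    also have "\<dots> = P / N" by (simp add: PB sum_divide_distrib)
    finally have "(Q / N) powr (p/2) \<le> P / N" by (simp add: Q_def sum_divide_distrib)
    then have "((Q / N) powr (p/2)) powr (1/p) \<le> (P / N) powr (1/p)"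
      using p by (intro powr_mono2) auto
    then have "(Q / N) powr (1/2) \<le> (P / N) powr (1/p)" using p by (simp add: powr_powr)
    then have "Q powr (1/2) / N powr (1/2) \<le> P powr (1/p) / N powr (1/p)"
      using Q P N by (simp add: powr_divide)
    then have "Q powr (1/2) \<le> N powr (1/2) * (P powr (1/p) / N powr (1/p))"
      using N by (simp add: pos_divide_le_eq mult.commute)
    also have "\<dots> = N powr (1/2 - 1/p) * P powr (1/p)" by (simp add: powr_diff)
    also have "\<dots> \<le> real (card A) powr (1/2 - 1/p) * P powr (1/p)"
    proof (intro mult_right_mono powr_mono2)
      show "0 \<le> 1/2 - 1/p" using p by (simp add: field_simps)
      show "N \<le> real (card A)" unfolding N_def using card_mono[OF fin B(2)] by simp
    qed (use N in auto)
    finally show ?thesis using Q by (simp add: L2_set_def QB Q_def[symmetric] P_def[symmetric] powr_half_sqrt)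
  qed
qed

context wavelets
begin

text \<open>The q-sum bounds each weighted p-norm by c. Passing to the 2-norm costs nothing for p <
  2 and 2^(j(1/2-1/p)) for p >= 2, and the decay exponent becomes \<gamma> in both cases, with the
  same constant c.\<close>

lemma besov_ball_smooth:
  assumes p: "1 \<le> p" and q: "1 \<le> q" and gam: "1/2 + \<eta> \<le> besov_gamma p s" and c: "0 < c"
    and f: "f \<in> besov_ball \<phi> \<psi> J0 p q s c"
  shows "f \<in> smooth_class \<eta> c"
proof -
  have fL: "f \<in> L2_unit" using f by (simp add: besov_ball_def)
  define \<mu> where "\<mu> = wavelet_coeff \<phi> \<psi> J0 f"
  define x where "x i = besov_level p s \<mu> (J0 + i)" for i
  have x0: "0 \<le> x i" for i by (simp add: x_def besov_level_def)
  have norm: "besov_norm J0 p q s \<mu> \<le> ereal c" using f by (simp add: besov_ball_def \<mu>_def)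
  then have sum: "summable (\<lambda>i. x i powr q)" unfolding besov_norm_def x_def by (auto split: if_splits)
  then have le: "(\<Sum>i. x i powr q) powr (1/q) \<le> c" using norm by (simp add: besov_norm_def x_def)
  have xc: "x i \<le> c" for i
  proof -
    have "x i powr q \<le> (\<Sum>i. x i powr q)"
      using sum_le_suminf[OF sum, of "{i}"] by simp
    then have "(x i powr q) powr (1/q) \<le> (\<Sum>i. x i powr q) powr (1/q)" using q by (intro powr_mono2) auto
    then show ?thesis using le q x0[of i] by (simp add: powr_powr)
  qed
  have "level_norm f j \<le> c * 2 powr (- real j * (1/2 + \<eta>))" if j: "J0 \<le> j" for j
  proof -
    define b where "b k = \<mu> (2 ^ j + k + 1)" for k
    define P where "P = (\<Sum>k<2 ^ j. \<bar>b k\<bar> powr p) powr (1/p)"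
    have ln: "level_norm f j = L2_set b {..<2 ^ j}"
    proof -
      have "(\<Sum>l\<in>{2 ^ j + 1..2 ^ Suc j}. (L2_inner f (basis l))\<^sup>2) = (\<Sum>k<2 ^ j. (b k)\<^sup>2)"
        by (rule sum.reindex_bij_witness[of _ "\<lambda>k. 2 ^ j + k + 1" "\<lambda>l. l - 2 ^ j - 1"])
          (auto simp: b_def \<mu>_def wavelet_coeff_def)
      then show ?thesis by (simp add: level_norm_def L2_set_def)
    qed
    have "2 powr (real j * (s + 1/2 - 1/p)) * P \<le> c"
      using xc[of "j - J0"] j by (simp add: x_def besov_level_def P_def b_def)
    then have P: "P \<le> c * 2 powr (- (real j * (s + 1/2 - 1/p)))"
      by (simp add: powr_minus field_simps)
    have "L2_set b {..<2 ^ j} \<le> c * 2 powr (- (real j * besov_gamma p s))"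
    proof (cases "p \<ge> 2")
      case True
      have "L2_set b {..<2 ^ j} \<le> real (card {..<(2::nat) ^ j}) powr (1/2 - 1/p) * P"
        unfolding P_def by (rule L2_set_le_card_lp_norm[OF _ True]) simp
      also have "real (card {..<(2::nat) ^ j}) powr (1/2 - 1/p) = 2 powr (real j * (1/2 - 1/p))"
        by (simp add: powr_powr flip: powr_realpow)
      also have "2 powr (real j * (1/2 - 1/p)) * P
          \<le> 2 powr (real j * (1/2 - 1/p)) * (c * 2 powr (- (real j * (s + 1/2 - 1/p))))"
        by (intro mult_left_mono P) simp
      also have "\<dots> = c * 2 powr (real j * (1/2 - 1/p) + - (real j * (s + 1/2 - 1/p)))"
        by (simp only: powr_add mult_ac)
      also have "real j * (1/2 - 1/p) + - (real j * (s + 1/2 - 1/p)) = - (real j * besov_gamma p s)"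
        using True by (simp add: besov_gamma_def algebra_simps)
      finally show ?thesis .
    next
      case False
      have "L2_set b {..<2 ^ j} \<le> P"
        unfolding P_def using p False by (intro L2_set_le_lp_norm) auto
      also note P
      finally show ?thesis using False by (simp add: besov_gamma_def)
    qed
    also have "\<dots> \<le> c * 2 powr (- real j * (1/2 + \<eta>))"
    proof (intro mult_left_mono powr_mono)
      have "real j * (1/2 + \<eta>) \<le> real j * besov_gamma p s" using gam by (intro mult_left_mono) auto
      then show "- (real j * besov_gamma p s) \<le> - real j * (1/2 + \<eta>)" by simp
    qed (use c in auto)
    finally show ?thesis unfolding ln .
  qed
  then show ?thesis using fL by (simp add: smooth_class_def)
qed

lemma besov_union_smooth: "0 < c \<Longrightarrow> f \<in> besov_union \<phi> \<psi> J0 \<eta> c \<Longrightarrow> f \<in> smooth_class \<eta> c"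
  by (auto simp: besov_union_def intro: besov_ball_smooth)

end

section \<open>Reduction of the regression model to the sequence model\<close>

definition modulator_chain :: "nat \<Rightarrow> modulator \<Rightarrow> nat \<Rightarrow> real" where
  "modulator_chain J0 \<xi> t = (if t = 0 then fst \<xi> else snd \<xi> (J0 + t - 1))"

lemma monotone_modulators_chain:
  assumes "J0 \<le> J1"
  shows "\<xi> \<in> monotone_modulators J0 J1 \<longleftrightarrow> monotone_chain (Suc J1 - J0) (modulator_chain J0 \<xi>)"
proof -
  have "(\<forall>t<Suc J1 - J0. modulator_chain J0 \<xi> (Suc t) \<le> modulator_chain J0 \<xi> t)
      \<longleftrightarrow> snd \<xi> J0 \<le> fst \<xi> \<and> (\<forall>j\<in>{J0..<J1}. snd \<xi> (Suc j) \<le> snd \<xi> j)" (is "?L \<longleftrightarrow> ?R")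
  proof
    assume L: ?L
    show ?R
    proof (intro conjI ballI)
      show "snd \<xi> J0 \<le> fst \<xi>" using L[rule_format, of 0] assms by (simp add: modulator_chain_def)
      fix j assume "j \<in> {J0..<J1}"
      then have "Suc (j - J0) < Suc J1 - J0" "J0 + Suc (j - J0) = Suc j" "J0 + (j - J0) = j" by auto
      then show "snd \<xi> (Suc j) \<le> snd \<xi> j"
        using L[rule_format, of "Suc (j - J0)"] by (simp add: modulator_chain_def)
    qed
  next
    assume R: ?R
    show ?L
    proof (intro allI impI)
      fix t assume "t < Suc J1 - J0"
      then show "modulator_chain J0 \<xi> (Suc t) \<le> modulator_chain J0 \<xi> t"
        using R by (cases t) (auto simp: modulator_chain_def)
    qed
  qed
  then show ?thesis by (auto simp: monotone_modulators_def monotone_chain_def modulator_chain_def)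
qed

context wavelets
begin

lemma shrinkage_block:
  assumes "l \<in> level_block J0 t"
  shows "shrinkage J0 \<xi> l = modulator_chain J0 \<xi> t"
proof (cases t)
  case 0
  then show ?thesis using assms by (simp add: level_block_def shrinkage_def modulator_chain_def)
next
  case (Suc s)
  define k where "k = l - 1 - 2 ^ (J0 + s)"
  have l: "2 ^ (J0 + s) + 1 \<le> l" "l \<le> 2 ^ Suc (J0 + s)" using assms Suc by (auto simp: level_block_def)
  then have k: "k < 2 ^ (J0 + s)" "l - 1 = 2 ^ (J0 + s) + k" by (auto simp: k_def)
  have "(2::nat) ^ J0 \<le> 2 ^ (J0 + s)" by (rule power_increasing) auto
  then have "\<not> l \<le> 2 ^ J0" using l by linarith
  then show ?thesis
    using floor_log_level[OF k(1)] k(2) Suc by (simp add: shrinkage_def modulator_chain_def)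
qed

lemma sum_shrinkage:
  assumes "J0 \<le> J1"
  shows "(\<Sum>l=1..2 ^ Suc J1. F (shrinkage J0 \<xi> l) l)
    = (\<Sum>t\<le>Suc J1 - J0. \<Sum>l\<in>level_block J0 t. F (modulator_chain J0 \<xi> t) l)"
proof -
  have eq: "J0 + (Suc J1 - J0) = Suc J1" using assms by simp
  have "(\<Sum>l=1..2 ^ Suc J1. F (shrinkage J0 \<xi> l) l)
      = (\<Sum>t\<le>Suc J1 - J0. \<Sum>l\<in>level_block J0 t. F (shrinkage J0 \<xi> l) l)"
    using sum_level_blocks[of "\<lambda>l. F (shrinkage J0 \<xi> l) l" J0 "Suc J1 - J0"] unfolding eq .
  also have "\<dots> = (\<Sum>t\<le>Suc J1 - J0. \<Sum>l\<in>level_block J0 t. F (modulator_chain J0 \<xi> t) l)"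
    by (intro sum.cong refl) (simp only: shrinkage_block)
  finally show ?thesis .
qed

lemma sure_chain_risk:
  assumes "J0 \<le> J1"
  shows "sure \<phi> \<psi> J0 \<sigma> J1 y \<xi> = chain_risk (\<sigma>\<^sup>2 / 2 ^ Suc J1) (Suc J1 - J0) (\<lambda>t. real (card (level_block J0 t)))
    (\<lambda>t. \<Sum>l\<in>level_block J0 t. (empirical_coeff J1 y (basis l))\<^sup>2) (modulator_chain J0 \<xi>)"
proof -
  define v where "v = \<sigma>\<^sup>2 / 2 ^ Suc J1"
  define q where "q h l = h\<^sup>2 * v + (1 - h)\<^sup>2 * ((empirical_coeff J1 y (basis l))\<^sup>2 - v)" for h l
  have v: "\<sigma>\<^sup>2 / real (sample_size J1) = v" by (simp add: sample_size_def v_def)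
  have "(\<Sum>k<2 ^ J0. (fst \<xi>)\<^sup>2 * v + (1 - fst \<xi>)\<^sup>2 * ((empirical_coeff J1 y (dilate \<phi> J0 k))\<^sup>2 - v))
      = (\<Sum>k<2 ^ J0. q (fst \<xi>) (k + 1))"
    by (intro sum.cong refl) (simp add: q_def basis_phi[symmetric])
  also have "\<dots> = (\<Sum>l\<in>level_block J0 0. q (modulator_chain J0 \<xi> 0) l)"
    by (rule sum.reindex_bij_witness[of _ "\<lambda>l. l - 1" "\<lambda>k. k + 1"]) (auto simp: level_block_def modulator_chain_def)
  finally have first: "(\<Sum>k<2 ^ J0. (fst \<xi>)\<^sup>2 * v + (1 - fst \<xi>)\<^sup>2 * ((empirical_coeff J1 y (dilate \<phi> J0 k))\<^sup>2 - v))
      = (\<Sum>l\<in>level_block J0 0. q (modulator_chain J0 \<xi> 0) l)" .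
  have lev: "(\<Sum>k<2 ^ j. (snd \<xi> j)\<^sup>2 * v + (1 - snd \<xi> j)\<^sup>2 * ((empirical_coeff J1 y (dilate \<psi> j k))\<^sup>2 - v))
      = (\<Sum>l\<in>level_block J0 (Suc (j - J0)). q (modulator_chain J0 \<xi> (Suc (j - J0))) l)" if "J0 \<le> j" for j
  proof -
    have "(\<Sum>k<2 ^ j. (snd \<xi> j)\<^sup>2 * v + (1 - snd \<xi> j)\<^sup>2 * ((empirical_coeff J1 y (dilate \<psi> j k))\<^sup>2 - v))
        = (\<Sum>k<2 ^ j. q (snd \<xi> j) (2 ^ j + k + 1))"
      by (intro sum.cong refl) (simp only: q_def lessThan_iff basis_psi[OF that])
    also have "\<dots> = (\<Sum>l\<in>level_block J0 (Suc (j - J0)). q (snd \<xi> j) l)"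
      by (rule sum.reindex_bij_witness[of _ "\<lambda>l. l - 2 ^ j - 1" "\<lambda>k. 2 ^ j + k + 1"])
        (use that in \<open>auto simp: level_block_def\<close>)
    finally show ?thesis using that by (simp add: modulator_chain_def)
  qed
  have "sure \<phi> \<psi> J0 \<sigma> J1 y \<xi> = (\<Sum>l\<in>level_block J0 0. q (modulator_chain J0 \<xi> 0) l)
      + (\<Sum>j=J0..J1. \<Sum>l\<in>level_block J0 (Suc (j - J0)). q (modulator_chain J0 \<xi> (Suc (j - J0))) l)"
    unfolding sure_def Let_def v first by (intro arg_cong2[where f="(+)"] refl sum.cong lev) simp
  also have "(\<Sum>j=J0..J1. \<Sum>l\<in>level_block J0 (Suc (j - J0)). q (modulator_chain J0 \<xi> (Suc (j - J0))) l)
      = (\<Sum>t\<in>{1..Suc J1 - J0}. \<Sum>l\<in>level_block J0 t. q (modulator_chain J0 \<xi> t) l)"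
    by (rule sum.reindex_bij_witness[of _ "\<lambda>t. J0 + t - 1" "\<lambda>j. Suc (j - J0)"]) (use assms in auto)
  also have "(\<Sum>l\<in>level_block J0 0. q (modulator_chain J0 \<xi> 0) l) + \<dots>
      = (\<Sum>t\<le>Suc J1 - J0. \<Sum>l\<in>level_block J0 t. q (modulator_chain J0 \<xi> t) l)"
  proof -
    have "{..Suc J1 - J0} = insert 0 {1..Suc J1 - J0}" by auto
    then show ?thesis by simp
  qed
  also have "\<dots> = chain_risk v (Suc J1 - J0) (\<lambda>t. real (card (level_block J0 t)))
    (\<lambda>t. \<Sum>l\<in>level_block J0 t. (empirical_coeff J1 y (basis l))\<^sup>2) (modulator_chain J0 \<xi>)"
    unfolding chain_risk_def
  proof (rule sum.cong[OF refl])
    fix t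
    show "(\<Sum>l\<in>level_block J0 t. q (modulator_chain J0 \<xi> t) l)
        = (modulator_chain J0 \<xi> t)\<^sup>2 * (real (card (level_block J0 t)) * v)
          + (1 - modulator_chain J0 \<xi> t)\<^sup>2 * ((\<Sum>l\<in>level_block J0 t. (empirical_coeff J1 y (basis l))\<^sup>2)
            - real (card (level_block J0 t)) * v)"
      by (simp add: q_def sum.distrib sum_subtractf sum_distrib_left[symmetric])
  qed
  finally show ?thesis unfolding v_def .
qed

lemma estimator_minimizer:
  assumes "J0 \<le> J1" "X \<in> monotone_modulators J0 J1"
    and "\<forall>\<zeta>\<in>monotone_modulators J0 J1. sure \<phi> \<psi> J0 \<sigma> J1 y X \<le> sure \<phi> \<psi> J0 \<sigma> J1 y \<zeta>"
  shows "chain_minimizer (\<sigma>\<^sup>2 / 2 ^ Suc J1) (Suc J1 - J0) (\<lambda>t. real (card (level_block J0 t)))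
    (\<lambda>t. \<Sum>l\<in>level_block J0 t. (empirical_coeff J1 y (basis l))\<^sup>2) (modulator_chain J0 X)"
  unfolding chain_minimizer_def
proof (intro conjI allI impI)
  show "monotone_chain (Suc J1 - J0) (modulator_chain J0 X)"
    using assms(1,2) by (simp add: monotone_modulators_chain)
  fix g assume g: "monotone_chain (Suc J1 - J0) g"
  \<comment> \<open>Every chain comes from a modulator, so minimality transfers to all
    chains.\<close>
  define \<zeta> where "\<zeta> = (g 0, \<lambda>j. g (Suc j - J0))"
  have \<zeta>: "modulator_chain J0 \<zeta> = g" by (auto simp: modulator_chain_def \<zeta>_def fun_eq_iff)
  then have "\<zeta> \<in> monotone_modulators J0 J1" using g assms(1) by (simp add: monotone_modulators_chain)
  then show "chain_risk (\<sigma>\<^sup>2 / 2 ^ Suc J1) (Suc J1 - J0) (\<lambda>t. real (card (level_block J0 t)))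
      (\<lambda>t. \<Sum>l\<in>level_block J0 t. (empirical_coeff J1 y (basis l))\<^sup>2) (modulator_chain J0 X)
    \<le> chain_risk (\<sigma>\<^sup>2 / 2 ^ Suc J1) (Suc J1 - J0) (\<lambda>t. real (card (level_block J0 t)))
      (\<lambda>t. \<Sum>l\<in>level_block J0 t. (empirical_coeff J1 y (basis l))\<^sup>2) g"
    using assms(3) \<zeta> by (auto simp: sure_chain_risk[OF assms(1)])
qed

lemma approx_coeff_eq:
  assumes "J0 \<le> J1" "l \<in> {1..2 ^ Suc J1}" "f \<in> L2_unit"
  shows "approx_coeff \<phi> \<psi> J0 J1 f l = L2_inner f (basis l)"
  using cell_average_inner[of "Suc J1" l f] assms
  by (simp add: approx_coeff_def wavelet_coeff_def sample_size_def)

definition rotation :: "nat \<Rightarrow> nat \<Rightarrow> nat \<Rightarrow> real" where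
  "rotation r l i = sqrt (2 ^ r) * cell_coeff r l i"

text \<open>Bias of the empirical coefficient, caused by sampling f instead of averaging it over the
  cell, in units of the noise level \<sigma> / sqrt n.\<close>

definition discretization_shift :: "real \<Rightarrow> nat \<Rightarrow> (real \<Rightarrow> real) \<Rightarrow> nat \<Rightarrow> real" where
  "discretization_shift \<sigma> r f l
    = sqrt (2 ^ r) / \<sigma> * (\<Sum>i=1..2 ^ r. cell_coeff r l i * (f (real i / 2 ^ r) - average f r i))"

text \<open>Each sampled value is its cell average plus a remainder. The averages reproduce the
  exact coefficient of f, the remainders form the shift and the errors the rotated noise; the
  identity is exact.\<close>

lemma empirical_coeff_observations:
  assumes J: "J0 \<le> J1" and l: "l \<in> {1..2 ^ Suc J1}" and f: "f \<in> L2_unit" and \<sigma>: "\<sigma> > 0"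
  shows "empirical_coeff J1 (observations \<sigma> J1 f \<epsilon>) (basis l)
    = L2_inner f (basis l) + sqrt (\<sigma>\<^sup>2 / 2 ^ Suc J1)
      * shifted {1..2 ^ Suc J1} (rotation (Suc J1)) (discretization_shift \<sigma> (Suc J1) f) \<epsilon> l"
proof -
  define r where "r = Suc J1"
  define I where "I = {1..(2::nat) ^ r}"
  have fin: "finite I" by (simp add: I_def)
  have ss: "sample_size J1 = 2 ^ r" by (simp add: sample_size_def r_def)
  have rJ: "J0 \<le> r" using J by (simp add: r_def)
  have sv: "sqrt (\<sigma>\<^sup>2 / 2 ^ r) = \<sigma> / sqrt (2 ^ r)" using \<sigma> by (simp add: real_sqrt_divide)
  have "empirical_coeff J1 (observations \<sigma> J1 f \<epsilon>) (basis l)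
      = (\<Sum>i\<in>I. (f (real i / 2 ^ r) + \<sigma> * \<epsilon> i) * cell_coeff r l i)"
    unfolding empirical_coeff_def observations_def cell_coeff_def ss I_def
    by (intro sum.cong refl) simp
  also have "\<dots> = (\<Sum>i\<in>I. cell_coeff r l i * average f r i)
      + (\<Sum>i\<in>I. cell_coeff r l i * (f (real i / 2 ^ r) - average f r i)) + \<sigma> * (\<Sum>i\<in>I. cell_coeff r l i * \<epsilon> i)"
    unfolding sum_distrib_left sum.distrib[symmetric] by (intro sum.cong refl) (simp add: algebra_simps)
  also have "(\<Sum>i\<in>I. cell_coeff r l i * average f r i) = L2_inner f (basis l)"
    unfolding I_def by (rule inner_basis_average[symmetric]) (use rJ l f in \<open>auto simp: r_def\<close>)
  also have "(\<Sum>i\<in>I. cell_coeff r l i * (f (real i / 2 ^ r) - average f r i))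
      = \<sigma> / sqrt (2 ^ r) * discretization_shift \<sigma> r f l"
    using \<sigma> by (simp add: discretization_shift_def I_def)
  also have "\<sigma> * (\<Sum>i\<in>I. cell_coeff r l i * \<epsilon> i) = \<sigma> / sqrt (2 ^ r) * lin I (rotation r l) \<epsilon>"
  proof -
    have "lin I (rotation r l) \<epsilon> = sqrt (2 ^ r) * (\<Sum>i\<in>I. cell_coeff r l i * \<epsilon> i)"
      unfolding lin_def rotation_def sum_distrib_left by (simp only: mult.assoc)
    then show ?thesis by simp
  qed
  finally have "empirical_coeff J1 (observations \<sigma> J1 f \<epsilon>) (basis l)
      = L2_inner f (basis l) + \<sigma> / sqrt (2 ^ r) * (lin I (rotation r l) \<epsilon> + discretization_shift \<sigma> r f l)"
    by (simp add: distrib_left add_ac)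
  then show ?thesis
    unfolding I_def[symmetric] r_def[symmetric] sv shifted_def .
qed

lemma rotation_rows:
  assumes "J0 \<le> r" "l \<in> {1..2 ^ r}" "m \<in> {1..2 ^ r}"
  shows "(\<Sum>i\<in>{1..2 ^ r}. rotation r l i * rotation r m i) = (if l = m then 1 else 0)"
  unfolding cell_coeff_rows[OF assms, symmetric] rotation_def by (intro sum.cong refl) simp

lemma rotation_columns:
  assumes "J0 \<le> r" "i \<in> {1..2 ^ r}" "j \<in> {1..2 ^ r}"
  shows "(\<Sum>l\<in>{1..2 ^ r}. rotation r l i * rotation r l j) = (if i = j then 1 else 0)"
proof -
  have "(\<Sum>l\<in>{1..2 ^ r}. rotation r l i * rotation r l j) = 2 ^ r * (\<Sum>l\<in>{1..2 ^ r}. cell_coeff r l i * cell_coeff r l j)"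
    unfolding rotation_def sum_distrib_left by (intro sum.cong refl) simp
  then show ?thesis unfolding cell_coeff_columns[OF assms] by simp
qed

text \<open>The factor n from the noise units cancels the 1/n of \<open>transform_norm\<close>, so
  the bound on the sampling bias carries over unchanged except for \<sigma>.\<close>

lemma discretization_shift_bound:
  assumes "J0 \<le> r" "f \<in> smooth_class \<eta> c" "f \<in> left_continuous_versions" "0 \<le> c" "0 < \<eta>" "0 < \<sigma>"
  shows "(\<Sum>l\<in>{1..2 ^ r}. (discretization_shift \<sigma> r f l)\<^sup>2) \<le> (c / (1 - 2 powr - \<eta>) / \<sigma>)\<^sup>2"
proof -
  let ?d = "\<lambda>i. f (real i / 2 ^ r) - average f r i"
  have "(\<Sum>l\<in>{1..2 ^ r}. (discretization_shift \<sigma> r f l)\<^sup>2)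
      = 2 ^ r / \<sigma>\<^sup>2 * (\<Sum>l\<in>{1..2 ^ r}. (\<Sum>i=1..2 ^ r. cell_coeff r l i * ?d i)\<^sup>2)"
  proof -
    have "(sqrt (2 ^ r) / \<sigma>)\<^sup>2 = 2 ^ r / \<sigma>\<^sup>2" by (simp add: power_divide)
    then show ?thesis
      unfolding sum_distrib_left by (intro sum.cong refl) (simp only: discretization_shift_def power_mult_distrib)
  qed
  also have "\<dots> = (\<Sum>i=1..2 ^ r. (?d i)\<^sup>2) / \<sigma>\<^sup>2"
    unfolding transform_norm[OF assms(1)] by simp
  also have "(\<Sum>i=1..2 ^ r. (?d i)\<^sup>2) = (L2_set ?d {1..2 ^ r})\<^sup>2"
    by (simp add: L2_set_def sum_nonneg)
  also have "\<dots> \<le> (c / (1 - 2 powr - \<eta>))\<^sup>2"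
    by (intro power_mono sampling_bias assms L2_set_nonneg)
  finally show ?thesis by (simp add: power_divide power_mult_distrib divide_right_mono)
qed

end

section \<open>Uniform coverage in the regression model\<close>

text \<open>A point at distance at most $\sqrt s + \sqrt{d^2-e}$ from the centre of a ball of squared
  radius $s$ can be moved along the line to the centre into the ball; conversely near minimizers
  of the distance bound the distance to the centre.\<close>

lemma INF_distance_ball:
  fixes \<mu> a :: "nat \<Rightarrow> real" and d e s :: real
  assumes fin: "finite I" and d: "0 \<le> d" and e: "0 \<le> e" "e \<le> d\<^sup>2"
  shows "(INF m\<in>{m. (\<Sum>l\<in>I. (m l - a l)\<^sup>2) \<le> s}. ereal (sqrt (e + (\<Sum>l\<in>I. (\<mu> l - m l)\<^sup>2)))) \<le> ereal d
    \<longleftrightarrow> 0 \<le> s \<and> L2_set (\<lambda>l. \<mu> l - a l) I \<le> sqrt s + sqrt (d\<^sup>2 - e)"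
    (is "?inf \<le> _ \<longleftrightarrow> ?R")
proof
  assume inf: "?inf \<le> ereal d"
  have near: "\<exists>m. (\<Sum>l\<in>I. (m l - a l)\<^sup>2) \<le> s \<and> sqrt (e + (\<Sum>l\<in>I. (\<mu> l - m l)\<^sup>2)) < d + r" if "0 < r" for r
  proof -
    have "?inf < ereal (d + r)" using inf that by (intro le_less_trans[OF inf]) simp
    then show ?thesis unfolding INF_less_iff by auto
  qed
  \<comment> \<open>A finite infimum means that the ball is not empty.\<close>
  obtain m1 where "(\<Sum>l\<in>I. (m1 l - a l)\<^sup>2) \<le> s" using near[of 1] by auto
  then have s: "0 \<le> s" by (rule order_trans[rotated]) (simp add: sum_nonneg)
  have "L2_set (\<lambda>l. \<mu> l - a l) I \<le> sqrt s + sqrt ((d + r)\<^sup>2 - e)" if r: "0 < r" for r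
  proof -
    obtain m where m: "(\<Sum>l\<in>I. (m l - a l)\<^sup>2) \<le> s" "sqrt (e + (\<Sum>l\<in>I. (\<mu> l - m l)\<^sup>2)) < d + r"
      using near[OF r] by blast
    have "e + (\<Sum>l\<in>I. (\<mu> l - m l)\<^sup>2) = (sqrt (e + (\<Sum>l\<in>I. (\<mu> l - m l)\<^sup>2)))\<^sup>2"
      using e by (simp add: sum_nonneg)
    also have "\<dots> \<le> (d + r)\<^sup>2" using m(2) e by (intro power_mono) (auto intro!: sum_nonneg add_nonneg_nonneg)
    finally have "L2_set (\<lambda>l. \<mu> l - m l) I \<le> sqrt ((d + r)\<^sup>2 - e)"
      unfolding L2_set_def by (intro real_sqrt_le_mono) simp
    moreover have "L2_set (\<lambda>l. m l - a l) I \<le> sqrt s"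
      unfolding L2_set_def by (intro real_sqrt_le_mono m)
    ultimately show ?thesis
      using L2_set_triangle_ineq[of "\<lambda>l. \<mu> l - m l" "\<lambda>l. m l - a l" I] by simp
  qed
  then have ev: "\<forall>\<^sub>F r in at_right 0. L2_set (\<lambda>l. \<mu> l - a l) I \<le> sqrt s + sqrt ((d + r)\<^sup>2 - e)"
    by (auto simp: eventually_at_right_field intro: exI[of _ 1])
  have "((\<lambda>r. sqrt s + sqrt ((d + r)\<^sup>2 - e)) \<longlongrightarrow> sqrt s + sqrt ((d + 0)\<^sup>2 - e)) (at_right 0)"
    by (intro tendsto_intros)
  from tendsto_lowerbound[OF this ev] s show ?R by simp
next
  assume R: ?R
  define D where "D = L2_set (\<lambda>l. \<mu> l - a l) I"
  have D0: "0 \<le> D" by (simp add: D_def L2_set_nonneg)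
  \<comment> \<open>A point inside the ball stays where it is; otherwise D > sqrt s >= 0 and the
    division is safe.\<close>
  define t where "t = (if D \<le> sqrt s then 1 else sqrt s / D)"
  define m where "m l = a l + t * (\<mu> l - a l)" for l
  have DD: "(\<Sum>l\<in>I. (\<mu> l - a l)\<^sup>2) = D\<^sup>2" by (simp add: D_def L2_set_def sum_nonneg)
  have t: "0 \<le> t" "t \<le> 1" "t * D \<le> sqrt s" "(1 - t) * D \<le> sqrt (d\<^sup>2 - e)"
  proof -
    have "0 \<le> sqrt (d\<^sup>2 - e)" using e by simp
    moreover have "0 \<le> sqrt s" "D \<le> sqrt s + sqrt (d\<^sup>2 - e)" using R by (auto simp: D_def)
    ultimately show "0 \<le> t" "t \<le> 1" "t * D \<le> sqrt s" "(1 - t) * D \<le> sqrt (d\<^sup>2 - e)"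
      using D0 by (auto simp: t_def divide_le_eq_1 left_diff_distrib)
  qed
  have "(\<Sum>l\<in>I. (m l - a l)\<^sup>2) = (t * D)\<^sup>2"
    by (simp add: m_def power_mult_distrib DD flip: sum_distrib_left)
  also have "\<dots> \<le> (sqrt s)\<^sup>2" using t D0 by (intro power_mono) auto
  finally have ms: "(\<Sum>l\<in>I. (m l - a l)\<^sup>2) \<le> s" using R by simp
  have "(\<Sum>l\<in>I. (\<mu> l - m l)\<^sup>2) = (\<Sum>l\<in>I. (1 - t)\<^sup>2 * (\<mu> l - a l)\<^sup>2)"
    by (intro sum.cong refl) (simp add: m_def power2_eq_square algebra_simps)
  also have "\<dots> = ((1 - t) * D)\<^sup>2" by (simp add: power_mult_distrib DD flip: sum_distrib_left)
  also have "\<dots> \<le> (sqrt (d\<^sup>2 - e))\<^sup>2" using t D0 by (intro power_mono) auto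
  finally have "sqrt (e + (\<Sum>l\<in>I. (\<mu> l - m l)\<^sup>2)) \<le> sqrt (d\<^sup>2)"
    using e by (intro real_sqrt_le_mono) simp
  then have "ereal (sqrt (e + (\<Sum>l\<in>I. (\<mu> l - m l)\<^sup>2))) \<le> ereal d" using d by simp
  then show "?inf \<le> ereal d" using ms by (intro INF_lower2[of m]) auto
qed

locale wavelet_regression = wavelets +
  fixes \<sigma> \<alpha> :: real and X :: "nat \<Rightarrow> (nat \<Rightarrow> real) \<Rightarrow> modulator"
  assumes sigma: "\<sigma> > 0" and alpha: "0 < \<alpha>" "\<alpha> < 1"
    and estimator: "\<And>J1. J0 \<le> J1 \<Longrightarrow> monotone_estimator \<phi> \<psi> J0 \<sigma> J1 (X J1)"
begin

definition fitted :: "nat \<Rightarrow> (nat \<Rightarrow> real) \<Rightarrow> nat \<Rightarrow> real" where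
  "fitted J1 y l = shrinkage J0 (X J1 y) l * empirical_coeff J1 y (basis l)"

definition radius :: "nat \<Rightarrow> (nat \<Rightarrow> real) \<Rightarrow> real" where
  "radius J1 y = radius_sq \<phi> \<psi> J0 \<sigma> \<alpha> J1 (X J1 y) y"

lemma conf_coeffs_eq:
  "conf_coeffs \<phi> \<psi> J0 \<sigma> \<alpha> J1 (X J1) y = {m. (\<Sum>l\<in>{1..2 ^ Suc J1}. (m l - fitted J1 y l)\<^sup>2) \<le> radius J1 y}"
  by (simp add: conf_coeffs_def fitted_def radius_def sample_size_def)

lemma noise_eq: "noise J1 = gauss_product {1..2 ^ Suc J1}"
  by (simp add: noise_def sample_size_def)

lemma observations_measurable [measurable]:
  "observations \<sigma> J1 f \<in> measurable (noise J1) (PiM {1..sample_size J1} (\<lambda>_. borel))"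
  unfolding observations_def[abs_def] noise_def
  by (intro measurable_restrict borel_measurable_add borel_measurable_times borel_measurable_const
      measurable_gauss_product_component)

lemma empirical_coeff_measurable [measurable]:
  "(\<lambda>y. empirical_coeff J1 y g) \<in> borel_measurable (PiM {1..sample_size J1} (\<lambda>_. borel))"
  unfolding empirical_coeff_def
  by (intro borel_measurable_sum borel_measurable_times borel_measurable_const measurable_component_singleton)

lemma X_measurable:
  assumes "J0 \<le> J1"
  shows "(\<lambda>y. fst (X J1 y)) \<in> borel_measurable (PiM {1..sample_size J1} (\<lambda>_. borel))"
    and "j \<in> {J0..J1} \<Longrightarrow> (\<lambda>y. snd (X J1 y) j) \<in> borel_measurable (PiM {1..sample_size J1} (\<lambda>_. borel))"
  using estimator[OF assms] by (auto simp: monotone_estimator_def)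

lemma chain_measurable:
  assumes "J0 \<le> J1" "t \<le> Suc J1 - J0"
  shows "(\<lambda>y. modulator_chain J0 (X J1 y) t) \<in> borel_measurable (PiM {1..sample_size J1} (\<lambda>_. borel))"
  using X_measurable(1)[OF assms(1)] X_measurable(2)[OF assms(1), of "J0 + t - 1"] assms(2)
  by (cases t) (auto simp: modulator_chain_def)

lemma shrinkage_measurable:
  assumes J: "J0 \<le> J1" and l: "l \<in> {1..2 ^ Suc J1}"
  shows "(\<lambda>y. shrinkage J0 (X J1 y) l) \<in> borel_measurable (PiM {1..sample_size J1} (\<lambda>_. borel))"
proof -
  have "\<exists>t\<le>Suc J1 - J0. l \<in> level_block J0 t"
  proof (cases "l \<le> 2 ^ J0")
    case True
    then show ?thesis using l by (intro exI[of _ 0]) (auto simp: level_block_def)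
  next
    case False
    then obtain j k where jk: "J0 \<le> j" "k < 2 ^ j" "l = 2 ^ j + k + 1" using index_cases[of J0 l] by auto
    have "(2::nat) ^ j < 2 ^ Suc J1" using l jk(3) by simp
    then have "j < Suc J1" by (rule power_less_imp_less_exp[rotated]) simp
    then show ?thesis using jk by (intro exI[of _ "Suc (j - J0)"]) (auto simp: level_block_def)
  qed
  then obtain t where t: "t \<le> Suc J1 - J0" "l \<in> level_block J0 t" by blast
  then show ?thesis using chain_measurable[OF J t(1)] by (simp add: shrinkage_block[OF t(2)])
qed

lemma fitted_measurable:
  assumes "J0 \<le> J1" "l \<in> {1..2 ^ Suc J1}"
  shows "(\<lambda>y. fitted J1 y l) \<in> borel_measurable (PiM {1..sample_size J1} (\<lambda>_. borel))"
  unfolding fitted_def by (intro borel_measurable_times shrinkage_measurable assms empirical_coeff_measurable)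

lemma radius_measurable:
  assumes J: "J0 \<le> J1"
  shows "radius J1 \<in> borel_measurable (PiM {1..sample_size J1} (\<lambda>_. borel))"
proof -
  note X_measurable[OF J, measurable]
  have [measurable]: "(\<lambda>y. sure \<phi> \<psi> J0 \<sigma> J1 y (X J1 y)) \<in> borel_measurable (PiM {1..sample_size J1} (\<lambda>_. borel))"
    unfolding sure_def Let_def by measurable
  have [measurable]: "(\<lambda>y. tau_hat \<phi> \<psi> J0 \<sigma> J1 (X J1 y) y) \<in> borel_measurable (PiM {1..sample_size J1} (\<lambda>_. borel))"
  proof -
    have "(\<lambda>y. \<Sum>l=1..sample_size J1. (2 * shrinkage J0 (X J1 y) l - 1)\<^sup>2)
        \<in> borel_measurable (PiM {1..sample_size J1} (\<lambda>_. borel))"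
      by (intro borel_measurable_sum borel_measurable_power borel_measurable_diff borel_measurable_times
          borel_measurable_const shrinkage_measurable J) (auto simp: sample_size_def)
    moreover have "(\<lambda>y. \<Sum>l=1..sample_size J1. ((empirical_coeff J1 y (basis l))\<^sup>2 - \<sigma>\<^sup>2 / real (sample_size J1))\<^sup>2
          * (1 - shrinkage J0 (X J1 y) l)\<^sup>2) \<in> borel_measurable (PiM {1..sample_size J1} (\<lambda>_. borel))"
      by (intro borel_measurable_sum borel_measurable_power borel_measurable_diff borel_measurable_times
          borel_measurable_const shrinkage_measurable empirical_coeff_measurable J) (auto simp: sample_size_def)
    ultimately show ?thesis unfolding tau_hat_def Let_def by measurable
  qed
  show ?thesis unfolding radius_def[abs_def] radius_sq_def by measurable
qed

lemma distance_event:
  assumes J: "J0 \<le> J1"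
  shows "{\<epsilon>\<in>space (noise J1). (\<Sum>l\<in>{1..2 ^ Suc J1}. (m l - fitted J1 (observations \<sigma> J1 f \<epsilon>) l)\<^sup>2)
      \<le> radius J1 (observations \<sigma> J1 f \<epsilon>)} \<in> sets (noise J1)"
    and "{\<epsilon>\<in>space (noise J1). 0 \<le> radius J1 (observations \<sigma> J1 f \<epsilon>) \<and>
      L2_set (\<lambda>l. m l - fitted J1 (observations \<sigma> J1 f \<epsilon>) l) {1..2 ^ Suc J1}
      \<le> sqrt (radius J1 (observations \<sigma> J1 f \<epsilon>)) + b} \<in> sets (noise J1)"
proof -
  have dist: "(\<lambda>\<epsilon>. \<Sum>l\<in>{1..2 ^ Suc J1}. (m l - fitted J1 (observations \<sigma> J1 f \<epsilon>) l)\<^sup>2) \<in> borel_measurable (noise J1)"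
    by (intro borel_measurable_sum borel_measurable_power borel_measurable_diff borel_measurable_const
        measurable_compose[OF observations_measurable fitted_measurable[OF J]])
  have rad: "(\<lambda>\<epsilon>. radius J1 (observations \<sigma> J1 f \<epsilon>)) \<in> borel_measurable (noise J1)"
    by (rule measurable_compose[OF observations_measurable radius_measurable[OF J]])
  show "{\<epsilon>\<in>space (noise J1). (\<Sum>l\<in>{1..2 ^ Suc J1}. (m l - fitted J1 (observations \<sigma> J1 f \<epsilon>) l)\<^sup>2)
      \<le> radius J1 (observations \<sigma> J1 f \<epsilon>)} \<in> sets (noise J1)"
    by (rule borel_measurable_le[OF dist rad])
  have "(\<lambda>\<epsilon>. L2_set (\<lambda>l. m l - fitted J1 (observations \<sigma> J1 f \<epsilon>) l) {1..2 ^ Suc J1}) \<in> borel_measurable (noise J1)"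
    unfolding L2_set_def by (rule measurable_compose[OF dist]) simp
  moreover have "(\<lambda>\<epsilon>. sqrt (radius J1 (observations \<sigma> J1 f \<epsilon>)) + b) \<in> borel_measurable (noise J1)"
    by (rule measurable_compose[OF rad, of "\<lambda>x. sqrt x + b"]) simp
  ultimately show "{\<epsilon>\<in>space (noise J1). 0 \<le> radius J1 (observations \<sigma> J1 f \<epsilon>) \<and>
      L2_set (\<lambda>l. m l - fitted J1 (observations \<sigma> J1 f \<epsilon>) l) {1..2 ^ Suc J1}
      \<le> sqrt (radius J1 (observations \<sigma> J1 f \<epsilon>)) + b} \<in> sets (noise J1)"
    by (intro sets.sets_Collect_conj borel_measurable_le borel_measurable_const rad)
qed


text \<open>The dominating sequence g of the sequence model. The value at 0 is a placeholder, since
  no bound is available for the scaling coefficients.\<close>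

definition level_decay :: "real \<Rightarrow> real \<Rightarrow> nat \<Rightarrow> real" where
  "level_decay \<eta> c t = (if t = 0 then 0 else c * (2 powr - (1/2 + \<eta>)) ^ (J0 + t - 1))"

lemma level_decay_facts:
  assumes "0 \<le> c" "0 < \<eta>"
  shows "0 \<le> level_decay \<eta> c t" "level_decay \<eta> c t \<le> c" "summable (level_decay \<eta> c)"
proof -
  let ?p = "(2::real) powr - (1/2 + \<eta>)"
  have p: "0 < ?p" "?p < 1" using assms by (auto simp: powr_less_one)
  show "0 \<le> level_decay \<eta> c t" using assms by (simp add: level_decay_def)
  show "level_decay \<eta> c t \<le> c"
    using assms p by (auto simp: level_decay_def intro!: mult_left_le power_le_one)
  have "summable (\<lambda>t. c * ?p ^ J0 * ?p ^ t)" using p by (intro summable_mult summable_geometric) auto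
  then have "summable (\<lambda>t. level_decay \<eta> c (Suc t))" by (simp add: level_decay_def power_add mult.assoc)
  then show "summable (level_decay \<eta> c)" by (simp only: summable_Suc_iff)
qed

lemma level_decay_bound:
  assumes f: "f \<in> smooth_class \<eta> c" and t: "1 \<le> t"
  shows "L2_set (\<lambda>l. L2_inner f (basis l)) (level_block J0 t) \<le> level_decay \<eta> c t"
proof -
  obtain s where s: "t = Suc s" using t by (cases t) auto
  have "L2_set (\<lambda>l. L2_inner f (basis l)) (level_block J0 t) = level_norm f (J0 + s)"
    by (simp add: level_norm_def level_block_def s)
  also have "\<dots> \<le> c * 2 powr (- real (J0 + s) * (1/2 + \<eta>))"
    using f unfolding smooth_class_def by (simp del: of_nat_add)
  also have "2 powr (- real (J0 + s) * (1/2 + \<eta>)) = (2 powr - (1/2 + \<eta>)) ^ (J0 + s)"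
  proof -
    have "- real (J0 + s) * (1/2 + \<eta>) = - (1/2 + \<eta>) * real (J0 + s)" by (simp add: algebra_simps)
    moreover have "(2::real) powr - (1/2 + \<eta>) > 0" by simp
    ultimately show ?thesis by (simp only: powr_realpow[symmetric] powr_powr)
  qed
  finally show ?thesis by (simp add: level_decay_def s)
qed

text \<open>The data form an instance of \<open>gaussian_sequence\<close> with R = J1+1-J0, whose
  constants K, c and dominating sequence depend on the class but not on f.\<close>

lemma coverage_uniform:
  assumes \<eta>: "0 < \<eta>" and c: "0 \<le> c" and "0 < \<delta>"
  shows "\<exists>J. \<forall>J1\<ge>J. J0 \<le> J1 \<and> (\<forall>f\<in>smooth_class \<eta> c \<inter> left_continuous_versions.
    \<bar>\<P>(\<epsilon> in noise J1. (\<Sum>l\<in>{1..2 ^ Suc J1}. (L2_inner f (basis l) - fitted J1 (observations \<sigma> J1 f \<epsilon>) l)\<^sup>2)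
        \<le> radius J1 (observations \<sigma> J1 f \<epsilon>)) - (1 - \<alpha>)\<bar> \<le> \<delta>)"
proof -
  define K where "K = c / (1 - 2 powr - \<eta>) / \<sigma>"
  have "(2::real) powr - \<eta> < 1" using geometric_ratio[OF \<eta>] by simp
  then have K: "0 \<le> K" using c sigma by (simp add: K_def)
  note ld = level_decay_facts[OF c \<eta>]
  obtain R0 where R0: "\<forall>R\<ge>R0. \<forall>\<mu> u B I n v h E. gaussian_sequence J0 R \<sigma> K c \<mu> u (level_decay \<eta> c) B I n v \<longrightarrow>
    (AE \<omega> in gauss_product I. chain_minimizer v R (\<lambda>t. real (card (level_block J0 t)))
      (\<lambda>t. \<Sum>l\<in>level_block J0 t. (\<mu> l + sqrt v * shifted I B u \<omega> l)\<^sup>2) (h \<omega>)) \<longrightarrow>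
    E \<in> sets (gauss_product I) \<longrightarrow>
    (\<forall>\<omega>\<in>space (gauss_product I). \<omega> \<in> E \<longleftrightarrow>
      (\<Sum>t\<le>R. \<Sum>l\<in>level_block J0 t. (\<mu> l - h \<omega> t * (\<mu> l + sqrt v * shifted I B u \<omega> l))\<^sup>2)
      \<le> sqrt (2 * \<sigma> ^ 4 / n * (\<Sum>t\<le>R. \<Sum>l\<in>level_block J0 t. (2 * h \<omega> t - 1)\<^sup>2)
          + 4 * \<sigma>\<^sup>2 * (\<Sum>t\<le>R. \<Sum>l\<in>level_block J0 t.
              ((\<mu> l + sqrt v * shifted I B u \<omega> l)\<^sup>2 - v)\<^sup>2 * (1 - h \<omega> t)\<^sup>2)) * normal_upper_quantile \<alpha> / sqrt n
        + chain_risk v R (\<lambda>t. real (card (level_block J0 t)))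
            (\<lambda>t. \<Sum>l\<in>level_block J0 t. (\<mu> l + sqrt v * shifted I B u \<omega> l)\<^sup>2) (h \<omega>)) \<longrightarrow>
    \<bar>measure (gauss_product I) E - (1 - \<alpha>)\<bar> \<le> \<delta>"
    using uniform_coverage[OF sigma K c ld(1) ld(3) alpha \<open>0 < \<delta>\<close>, of J0] by (elim exE)
  show ?thesis
  proof (intro exI[of _ "J0 + R0"] allI impI conjI ballI)
    fix J1 assume J1: "J0 + R0 \<le> J1"
    then show J: "J0 \<le> J1" by simp
    fix f assume "f \<in> smooth_class \<eta> c \<inter> left_continuous_versions"
    then have f: "f \<in> smooth_class \<eta> c" "f \<in> left_continuous_versions" by auto
    have fL: "f \<in> L2_unit" using f by (simp add: smooth_class_def)
    define r where "r = Suc J1"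
    define R where "R = r - J0"
    have r: "J0 \<le> r" "J0 + R = r" using J by (auto simp: r_def R_def)
    define I where "I = {1..(2::nat) ^ r}"
    define \<mu> where "\<mu> l = L2_inner f (basis l)" for l
    define u where "u = discretization_shift \<sigma> r f"
    define n :: real where "n = 2 ^ r"
    define v where "v = \<sigma>\<^sup>2 / n"
    define y where "y \<epsilon> = observations \<sigma> J1 f \<epsilon>" for \<epsilon>
    define h where "h \<epsilon> = modulator_chain J0 (X J1 (y \<epsilon>))" for \<epsilon>
    have gs: "gaussian_sequence J0 R \<sigma> K c \<mu> u (level_decay \<eta> c) (rotation r) I n v"
    proof
      show "\<sigma> > 0" "0 \<le> K" by (fact sigma K)+
      show "I = {1..2 ^ (J0 + R)}" "n = 2 ^ (J0 + R)" by (simp_all add: I_def n_def r(2))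
      show "v = \<sigma>\<^sup>2 / n" by (simp add: v_def)
      show "(\<Sum>i\<in>I. rotation r l i * rotation r m i) = (if l = m then 1 else 0)" if "l \<in> I" "m \<in> I" for l m
        using rotation_rows[OF r(1)] that unfolding I_def by blast
      show "(\<Sum>l\<in>I. rotation r l i * rotation r l j) = (if i = j then 1 else 0)" if "i \<in> I" "j \<in> I" for i j
        using rotation_columns[OF r(1)] that unfolding I_def by blast
      show "(\<Sum>l\<in>I. (u l)\<^sup>2) \<le> K\<^sup>2"
        unfolding I_def u_def K_def by (rule discretization_shift_bound[OF r(1) f c \<eta> sigma])
      show "L2_set \<mu> (level_block J0 t) \<le> level_decay \<eta> c t" if "1 \<le> t" for t
        unfolding \<mu>_def by (rule level_decay_bound[OF f(1) that])
      show "level_decay \<eta> c t \<le> c" for t by (rule ld(2))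
    qed
    have emp: "empirical_coeff J1 (y \<epsilon>) (basis l) = \<mu> l + sqrt v * shifted I (rotation r) u \<epsilon> l" if "l \<in> I" for \<epsilon> l
      using empirical_coeff_observations[OF J _ fL sigma, of l \<epsilon>] that
      unfolding y_def \<mu>_def v_def n_def I_def u_def r_def by blast
    have block: "l \<in> I" if "l \<in> level_block J0 t" "t \<le> R" for l t
      using gaussian_sequence.block_subset[OF gs that(2)] that(1) by blast
    have A: "(\<Sum>l\<in>level_block J0 t. (empirical_coeff J1 (y \<epsilon>) (basis l))\<^sup>2)
        = (\<Sum>l\<in>level_block J0 t. (\<mu> l + sqrt v * shifted I (rotation r) u \<epsilon> l)\<^sup>2)" if "t \<le> R" for t \<epsilon>
      using emp block that by (intro sum.cong refl) simp
    have cr: "chain_risk v R N (\<lambda>t. \<Sum>l\<in>level_block J0 t. (empirical_coeff J1 (y \<epsilon>) (basis l))\<^sup>2) g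
        = chain_risk v R N (\<lambda>t. \<Sum>l\<in>level_block J0 t. (\<mu> l + sqrt v * shifted I (rotation r) u \<epsilon> l)\<^sup>2) g" for N g \<epsilon>
      unfolding chain_risk_def by (intro sum.cong refl) (simp add: A)
    have vR: "\<sigma>\<^sup>2 / 2 ^ Suc J1 = v" "Suc J1 - J0 = R" by (simp_all add: v_def n_def r_def R_def)
    have AE: "AE \<epsilon> in gauss_product I. chain_minimizer v R (\<lambda>t. real (card (level_block J0 t)))
      (\<lambda>t. \<Sum>l\<in>level_block J0 t. (\<mu> l + sqrt v * shifted I (rotation r) u \<epsilon> l)\<^sup>2) (h \<epsilon>)"
    proof -
      have "AE y in PiM I (\<lambda>_. lborel). X J1 y \<in> monotone_modulators J0 J1 \<and>
        (\<forall>\<zeta>\<in>monotone_modulators J0 J1. sure \<phi> \<psi> J0 \<sigma> J1 y (X J1 y) \<le> sure \<phi> \<psi> J0 \<sigma> J1 y \<zeta>)"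
      proof -
        have "I = {1..sample_size J1}" by (simp add: I_def r_def sample_size_def)
        then show ?thesis using estimator[OF J] unfolding monotone_estimator_def by blast
      qed
      \<comment> \<open>The data are an affine image of the errors, so minimization for almost all
        data becomes almost sure minimization.\<close>
      from AE_affine_gauss_product[OF _ sigma this, of "\<lambda>i. f (real i / real (2 ^ r))"]
      have "AE \<epsilon> in gauss_product I. X J1 (y \<epsilon>) \<in> monotone_modulators J0 J1 \<and>
        (\<forall>\<zeta>\<in>monotone_modulators J0 J1. sure \<phi> \<psi> J0 \<sigma> J1 (y \<epsilon>) (X J1 (y \<epsilon>)) \<le> sure \<phi> \<psi> J0 \<sigma> J1 (y \<epsilon>) \<zeta>)"
        by (simp add: y_def observations_def I_def r_def sample_size_def)
      then show ?thesis
      proof eventually_elim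
        case (elim \<epsilon>)
        have "chain_minimizer (\<sigma>\<^sup>2 / 2 ^ Suc J1) (Suc J1 - J0) (\<lambda>t. real (card (level_block J0 t)))
            (\<lambda>t. \<Sum>l\<in>level_block J0 t. (empirical_coeff J1 (y \<epsilon>) (basis l))\<^sup>2) (modulator_chain J0 (X J1 (y \<epsilon>)))"
          by (rule estimator_minimizer[OF J conjunct1[OF elim] conjunct2[OF elim]])
        then show ?case unfolding vR h_def chain_minimizer_def cr .
      qed
    qed
    define E where "E = {\<epsilon>\<in>space (noise J1). (\<Sum>l\<in>{1..2 ^ Suc J1}. (\<mu> l - fitted J1 (y \<epsilon>) l)\<^sup>2) \<le> radius J1 (y \<epsilon>)}"
    have nI: "noise J1 = gauss_product I" by (simp add: noise_eq I_def r_def)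
    have "\<bar>measure (gauss_product I) E - (1 - \<alpha>)\<bar> \<le> \<delta>"
    proof (rule R0[rule_format, OF _ gs AE])
      show "R0 \<le> R" using J1 by (simp add: R_def r_def)
      show "E \<in> sets (gauss_product I)"
        using distance_event(1)[OF J] unfolding E_def y_def nI .
      show "\<omega> \<in> E \<longleftrightarrow>
        (\<Sum>t\<le>R. \<Sum>l\<in>level_block J0 t. (\<mu> l - h \<omega> t * (\<mu> l + sqrt v * shifted I (rotation r) u \<omega> l))\<^sup>2)
        \<le> sqrt (2 * \<sigma> ^ 4 / n * (\<Sum>t\<le>R. \<Sum>l\<in>level_block J0 t. (2 * h \<omega> t - 1)\<^sup>2)
            + 4 * \<sigma>\<^sup>2 * (\<Sum>t\<le>R. \<Sum>l\<in>level_block J0 t.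
                ((\<mu> l + sqrt v * shifted I (rotation r) u \<omega> l)\<^sup>2 - v)\<^sup>2 * (1 - h \<omega> t)\<^sup>2)) * normal_upper_quantile \<alpha> / sqrt n
          + chain_risk v R (\<lambda>t. real (card (level_block J0 t)))
              (\<lambda>t. \<Sum>l\<in>level_block J0 t. (\<mu> l + sqrt v * shifted I (rotation r) u \<omega> l)\<^sup>2) (h \<omega>)"
        if \<omega>: "\<omega> \<in> space (gauss_product I)" for \<omega>
      proof -
        have ss: "sample_size J1 = 2 ^ Suc J1" "real (sample_size J1) = n" by (simp_all add: sample_size_def n_def r_def)
        have "(\<Sum>l\<in>{1..2 ^ Suc J1}. (\<mu> l - fitted J1 (y \<omega>) l)\<^sup>2)
            = (\<Sum>t\<le>R. \<Sum>l\<in>level_block J0 t. (\<mu> l - h \<omega> t * empirical_coeff J1 (y \<omega>) (basis l))\<^sup>2)"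
          unfolding fitted_def h_def vR(2)[symmetric]
          by (rule sum_shrinkage[OF J, of "\<lambda>a l. (\<mu> l - a * empirical_coeff J1 (y \<omega>) (basis l))\<^sup>2"])
        also have "\<dots> = (\<Sum>t\<le>R. \<Sum>l\<in>level_block J0 t. (\<mu> l - h \<omega> t * (\<mu> l + sqrt v * shifted I (rotation r) u \<omega> l))\<^sup>2)"
          using emp block by (intro sum.cong refl) simp
        finally have 1: "(\<Sum>l\<in>{1..2 ^ Suc J1}. (\<mu> l - fitted J1 (y \<omega>) l)\<^sup>2)
            = (\<Sum>t\<le>R. \<Sum>l\<in>level_block J0 t. (\<mu> l - h \<omega> t * (\<mu> l + sqrt v * shifted I (rotation r) u \<omega> l))\<^sup>2)" .
        have 2: "(\<Sum>l=1..2 ^ Suc J1. (2 * shrinkage J0 (X J1 (y \<omega>)) l - 1)\<^sup>2)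
            = (\<Sum>t\<le>R. \<Sum>l\<in>level_block J0 t. (2 * h \<omega> t - 1)\<^sup>2)"
          unfolding h_def vR(2)[symmetric] by (rule sum_shrinkage[OF J, of "\<lambda>a l. (2 * a - 1)\<^sup>2"])
        have "(\<Sum>l=1..2 ^ Suc J1. ((empirical_coeff J1 (y \<omega>) (basis l))\<^sup>2 - \<sigma>\<^sup>2 / n)\<^sup>2 * (1 - shrinkage J0 (X J1 (y \<omega>)) l)\<^sup>2)
            = (\<Sum>t\<le>R. \<Sum>l\<in>level_block J0 t. ((empirical_coeff J1 (y \<omega>) (basis l))\<^sup>2 - \<sigma>\<^sup>2 / n)\<^sup>2 * (1 - h \<omega> t)\<^sup>2)"
          unfolding h_def vR(2)[symmetric]
          by (rule sum_shrinkage[OF J, of "\<lambda>a l. ((empirical_coeff J1 (y \<omega>) (basis l))\<^sup>2 - \<sigma>\<^sup>2 / n)\<^sup>2 * (1 - a)\<^sup>2"])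
        also have "\<dots> = (\<Sum>t\<le>R. \<Sum>l\<in>level_block J0 t. ((\<mu> l + sqrt v * shifted I (rotation r) u \<omega> l)\<^sup>2 - v)\<^sup>2 * (1 - h \<omega> t)\<^sup>2)"
          using emp block by (intro sum.cong refl) (simp add: v_def)
        finally have 3: "(\<Sum>l=1..2 ^ Suc J1. ((empirical_coeff J1 (y \<omega>) (basis l))\<^sup>2 - \<sigma>\<^sup>2 / n)\<^sup>2 * (1 - shrinkage J0 (X J1 (y \<omega>)) l)\<^sup>2)
            = (\<Sum>t\<le>R. \<Sum>l\<in>level_block J0 t. ((\<mu> l + sqrt v * shifted I (rotation r) u \<omega> l)\<^sup>2 - v)\<^sup>2 * (1 - h \<omega> t)\<^sup>2)" .
        have 4: "sure \<phi> \<psi> J0 \<sigma> J1 (y \<omega>) (X J1 (y \<omega>)) = chain_risk v R (\<lambda>t. real (card (level_block J0 t)))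
              (\<lambda>t. \<Sum>l\<in>level_block J0 t. (\<mu> l + sqrt v * shifted I (rotation r) u \<omega> l)\<^sup>2) (h \<omega>)"
          unfolding sure_chain_risk[OF J] vR cr h_def ..
        have rad: "radius J1 (y \<omega>) = sqrt (2 * \<sigma> ^ 4 / n * (\<Sum>t\<le>R. \<Sum>l\<in>level_block J0 t. (2 * h \<omega> t - 1)\<^sup>2)
            + 4 * \<sigma>\<^sup>2 * (\<Sum>t\<le>R. \<Sum>l\<in>level_block J0 t.
                ((\<mu> l + sqrt v * shifted I (rotation r) u \<omega> l)\<^sup>2 - v)\<^sup>2 * (1 - h \<omega> t)\<^sup>2)) * normal_upper_quantile \<alpha> / sqrt n
          + chain_risk v R (\<lambda>t. real (card (level_block J0 t)))
              (\<lambda>t. \<Sum>l\<in>level_block J0 t. (\<mu> l + sqrt v * shifted I (rotation r) u \<omega> l)\<^sup>2) (h \<omega>)"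
          unfolding radius_def radius_sq_def tau_hat_def Let_def ss(2) 4 unfolding ss(1) 2 3 ..
        show ?thesis
          using \<omega> unfolding E_def nI mem_Collect_eq rad 1 by simp
      qed
    qed
    then show "\<bar>\<P>(\<epsilon> in noise J1. (\<Sum>l\<in>{1..2 ^ Suc J1}. (L2_inner f (basis l) - fitted J1 (observations \<sigma> J1 f \<epsilon>) l)\<^sup>2)
        \<le> radius J1 (observations \<sigma> J1 f \<epsilon>)) - (1 - \<alpha>)\<bar> \<le> \<delta>"
      unfolding E_def nI \<mu>_def y_def .
  qed
qed

end

section \<open>Confidence sets for coefficients and functions\<close>

text \<open>A supremum of reals is meaningful only for nonempty bounded sets; for large n the
  uniform smallness also supplies the bound.\<close>

lemma SUP_tendsto_0:
  fixes F :: "nat \<Rightarrow> 'a \<Rightarrow> real"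
  assumes "A \<noteq> {}" and nonneg: "\<And>n x. 0 \<le> F n x"
    and small: "\<And>\<delta>. 0 < \<delta> \<Longrightarrow> \<exists>N. \<forall>n\<ge>N. \<forall>x\<in>A. F n x \<le> \<delta>"
  shows "(\<lambda>n. SUP x\<in>A. F n x) \<longlonglongrightarrow> 0"
proof (rule LIMSEQ_I)
  fix e :: real assume "0 < e"
  then obtain N where N: "\<And>n x. n \<ge> N \<Longrightarrow> x \<in> A \<Longrightarrow> F n x \<le> e / 2" using small[of "e / 2"] by auto
  obtain a where a: "a \<in> A" using assms(1) by auto
  show "\<exists>no. \<forall>n\<ge>no. norm ((SUP x\<in>A. F n x) - 0) < e"
  proof (intro exI[of _ N] allI impI)
    fix n assume n: "N \<le> n"
    have "(SUP x\<in>A. F n x) \<le> e / 2" using N[OF n] assms(1) by (intro cSUP_least)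
    moreover have "bdd_above (F n ` A)" by (rule bdd_aboveI2[where M="e / 2"]) (rule N[OF n])
    then have "0 \<le> (SUP x\<in>A. F n x)" by (rule cSUP_upper2[OF _ a nonneg])
    ultimately show "norm ((SUP x\<in>A. F n x) - 0) < e" using \<open>0 < e\<close> by simp
  qed
qed

context wavelet_regression
begin

lemma expansion_eq: "expansion \<phi> \<psi> J0 J1 m = (\<lambda>x. \<Sum>l=1..2 ^ Suc J1. m l * basis l x)"
  by (simp add: expansion_def[abs_def] sample_size_def)

lemma expansion_L2: "expansion \<phi> \<psi> J0 J1 m \<in> L2_unit"
  unfolding expansion_eq by (intro L2_unit_sum basis_L2) auto

lemma expansion_inner:
  assumes "k \<in> {1..2 ^ Suc J1}"
  shows "L2_inner (expansion \<phi> \<psi> J0 J1 m) (basis k) = m k"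
proof -
  have "L2_inner (expansion \<phi> \<psi> J0 J1 m) (basis k) = (\<Sum>l=1..2 ^ Suc J1. m l * L2_inner (basis l) (basis k))"
    unfolding expansion_eq using assms by (intro L2_inner_sum_left basis_L2) auto
  also have "\<dots> = (\<Sum>l=1..2 ^ Suc J1. if l = k then m k else 0)"
    using assms by (intro sum.cong refl) (auto simp: basis_orth)
  finally show ?thesis using assms by simp
qed

text \<open>By orthonormality the class of an expansion modulo null sets determines its first n
  coefficients, so (ii) concerns the same event as (i).\<close>

lemma expansion_in_conf_funs:
  "expansion \<phi> \<psi> J0 J1 a \<in> conf_funs \<phi> \<psi> J0 \<sigma> \<alpha> J1 (X J1) y \<longleftrightarrow> a \<in> conf_coeffs \<phi> \<psi> J0 \<sigma> \<alpha> J1 (X J1) y"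
proof
  assume "a \<in> conf_coeffs \<phi> \<psi> J0 \<sigma> \<alpha> J1 (X J1) y"
  then show "expansion \<phi> \<psi> J0 J1 a \<in> conf_funs \<phi> \<psi> J0 \<sigma> \<alpha> J1 (X J1) y"
    by (auto simp: conf_funs_def expansion_L2)
next
  assume "expansion \<phi> \<psi> J0 J1 a \<in> conf_funs \<phi> \<psi> J0 \<sigma> \<alpha> J1 (X J1) y"
  then obtain m where m: "m \<in> conf_coeffs \<phi> \<psi> J0 \<sigma> \<alpha> J1 (X J1) y"
    "AE x in unit_measure. expansion \<phi> \<psi> J0 J1 a x = expansion \<phi> \<psi> J0 J1 m x"
    by (auto simp: conf_funs_def)
  have "a l = m l" if "l \<in> {1..2 ^ Suc J1}" for l
  proof -
    have "1 \<le> l" using that by simp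
    then have "L2_inner (expansion \<phi> \<psi> J0 J1 a) (basis l) = L2_inner (expansion \<phi> \<psi> J0 J1 m) (basis l)"
      by (intro L2_inner_cong_AE m expansion_L2 basis_L2)
    then show ?thesis by (simp only: expansion_inner[OF that])
  qed
  then have "(\<Sum>l\<in>{1..2 ^ Suc J1}. (a l - fitted J1 y l)\<^sup>2) = (\<Sum>l\<in>{1..2 ^ Suc J1}. (m l - fitted J1 y l)\<^sup>2)"
    by (intro sum.cong refl) simp
  then show "a \<in> conf_coeffs \<phi> \<psi> J0 \<sigma> \<alpha> J1 (X J1) y"
    using m(1) unfolding conf_coeffs_eq by simp
qed

lemma approx_in_conf_coeffs:
  assumes "J0 \<le> J1" "f \<in> L2_unit"
  shows "approx_coeff \<phi> \<psi> J0 J1 f \<in> conf_coeffs \<phi> \<psi> J0 \<sigma> \<alpha> J1 (X J1) y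
    \<longleftrightarrow> (\<Sum>l\<in>{1..2 ^ Suc J1}. (L2_inner f (basis l) - fitted J1 y l)\<^sup>2) \<le> radius J1 y"
proof -
  have "(\<Sum>l\<in>{1..2 ^ Suc J1}. (approx_coeff \<phi> \<psi> J0 J1 f l - fitted J1 y l)\<^sup>2)
      = (\<Sum>l\<in>{1..2 ^ Suc J1}. (L2_inner f (basis l) - fitted J1 y l)\<^sup>2)"
    by (intro sum.cong refl) (simp only: approx_coeff_eq[OF assms(1) _ assms(2)])
  then show ?thesis unfolding conf_coeffs_eq by simp
qed

lemma coverage_coeffs:
  assumes "0 < \<eta>" "0 \<le> c" "0 < \<delta>"
  shows "\<exists>J. \<forall>J1\<ge>J. J0 \<le> J1 \<and> (\<forall>f\<in>smooth_class \<eta> c \<inter> left_continuous_versions.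
    \<bar>\<P>(\<epsilon> in noise J1. approx_coeff \<phi> \<psi> J0 J1 f \<in> conf_coeffs \<phi> \<psi> J0 \<sigma> \<alpha> J1 (X J1) (observations \<sigma> J1 f \<epsilon>)) - (1 - \<alpha>)\<bar> \<le> \<delta>)"
proof -
  obtain J where J: "\<And>J1. J1 \<ge> J \<Longrightarrow> J0 \<le> J1 \<and> (\<forall>f\<in>smooth_class \<eta> c \<inter> left_continuous_versions.
    \<bar>\<P>(\<epsilon> in noise J1. (\<Sum>l\<in>{1..2 ^ Suc J1}. (L2_inner f (basis l) - fitted J1 (observations \<sigma> J1 f \<epsilon>) l)\<^sup>2)
        \<le> radius J1 (observations \<sigma> J1 f \<epsilon>)) - (1 - \<alpha>)\<bar> \<le> \<delta>)"
    using coverage_uniform[OF assms] by blast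
  show ?thesis
  proof (intro exI[of _ J] allI impI conjI ballI)
    fix J1 assume J1: "J \<le> J1"
    then show le: "J0 \<le> J1" using J by blast
    fix f assume f: "f \<in> smooth_class \<eta> c \<inter> left_continuous_versions"
    then have "f \<in> L2_unit" by (simp add: smooth_class_def)
    then show "\<bar>\<P>(\<epsilon> in noise J1. approx_coeff \<phi> \<psi> J0 J1 f \<in> conf_coeffs \<phi> \<psi> J0 \<sigma> \<alpha> J1 (X J1) (observations \<sigma> J1 f \<epsilon>)) - (1 - \<alpha>)\<bar> \<le> \<delta>"
      using J[OF J1] f unfolding approx_in_conf_coeffs[OF le \<open>f \<in> L2_unit\<close>] by blast
  qed
qed

lemma besov_coverage:
  assumes "1 \<le> p" "1 \<le> q" "1/2 < besov_gamma p s" "0 < c"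
  shows "(\<lambda>J1. SUP f\<in>besov_ball \<phi> \<psi> J0 p q s c \<inter> left_continuous_versions.
      \<bar>\<P>(\<epsilon> in noise J1. approx_coeff \<phi> \<psi> J0 J1 f \<in> conf_coeffs \<phi> \<psi> J0 \<sigma> \<alpha> J1 (X J1) (observations \<sigma> J1 f \<epsilon>)) - (1 - \<alpha>)\<bar>) \<longlonglongrightarrow> 0"
proof (rule SUP_tendsto_0)
  define \<eta> where "\<eta> = besov_gamma p s - 1/2"
  have \<eta>: "0 < \<eta>" "1/2 + \<eta> \<le> besov_gamma p s" using assms by (auto simp: \<eta>_def)
  have z: "wavelet_coeff \<phi> \<psi> J0 (\<lambda>_. 0) = (\<lambda>_. 0)" by (simp add: wavelet_coeff_def L2_inner_def fun_eq_iff)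
  have "(\<lambda>_. 0) \<in> besov_ball \<phi> \<psi> J0 p q s c \<inter> left_continuous_versions"
    using assms by (auto simp: besov_ball_def L2_unit_zero z besov_norm_def besov_level_def left_continuous_versions_def)
  then show "besov_ball \<phi> \<psi> J0 p q s c \<inter> left_continuous_versions \<noteq> {}" by blast
  fix \<delta> :: real assume "0 < \<delta>"
  have sub: "f \<in> smooth_class \<eta> c" if "f \<in> besov_ball \<phi> \<psi> J0 p q s c" for f
    by (rule besov_ball_smooth[OF assms(1,2) \<eta>(2) assms(4) that])
  show "\<exists>N. \<forall>n\<ge>N. \<forall>f\<in>besov_ball \<phi> \<psi> J0 p q s c \<inter> left_continuous_versions.
      \<bar>\<P>(\<epsilon> in noise n. approx_coeff \<phi> \<psi> J0 n f \<in> conf_coeffs \<phi> \<psi> J0 \<sigma> \<alpha> n (X n) (observations \<sigma> n f \<epsilon>)) - (1 - \<alpha>)\<bar> \<le> \<delta>"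
    using coverage_coeffs[OF \<eta>(1) less_imp_le[OF assms(4)] \<open>0 < \<delta>\<close>] sub by (meson IntD1 IntD2 IntI)
qed simp

lemma L2_norm_expansion:
  assumes J: "J0 \<le> J1" and f: "f \<in> L2_unit" and g: "g \<in> L2_unit"
    and ae: "AE x in unit_measure. g x = expansion \<phi> \<psi> J0 J1 m x"
  shows "L2_norm (\<lambda>x. f x - g x) = sqrt (L2_inner f f - (\<Sum>l=1..2 ^ Suc J1. (L2_inner f (basis l))\<^sup>2)
    + (\<Sum>l=1..2 ^ Suc J1. (L2_inner f (basis l) - m l)\<^sup>2))"
proof -
  have "L2_inner (\<lambda>x. f x - g x) (\<lambda>x. f x - g x)
      = L2_inner (\<lambda>x. f x - (\<Sum>l=1..2 ^ Suc J1. m l * basis l x)) (\<lambda>x. f x - (\<Sum>l=1..2 ^ Suc J1. m l * basis l x))"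
    unfolding L2_inner_def
  proof (rule integral_cong_AE)
    have "(\<lambda>x. f x - g x) \<in> borel_measurable unit_measure"
      by (intro L2_unit_measurable L2_unit_diff f g)
    then show "(\<lambda>x. (f x - g x) * (f x - g x)) \<in> borel_measurable unit_measure" by simp
    have "(\<lambda>x. f x - (\<Sum>l=1..2 ^ Suc J1. m l * basis l x)) \<in> borel_measurable unit_measure"
      using L2_unit_diff[OF f expansion_L2] unfolding expansion_eq by (rule L2_unit_measurable)
    then show "(\<lambda>x. (f x - (\<Sum>l=1..2 ^ Suc J1. m l * basis l x)) * (f x - (\<Sum>l=1..2 ^ Suc J1. m l * basis l x)))
        \<in> borel_measurable unit_measure" by (intro borel_measurable_times)
    show "AE x in unit_measure. (f x - g x) * (f x - g x)
        = (f x - (\<Sum>l=1..2 ^ Suc J1. m l * basis l x)) * (f x - (\<Sum>l=1..2 ^ Suc J1. m l * basis l x))"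
      using ae unfolding expansion_eq by eventually_elim simp
  qed
  also have "\<dots> = L2_inner f f - (\<Sum>l=1..2 ^ Suc J1. (L2_inner f (basis l))\<^sup>2) + (\<Sum>l=1..2 ^ Suc J1. (L2_inner f (basis l) - m l)\<^sup>2)"
    by (rule residual_eq) (use J f in auto)
  finally show ?thesis unfolding L2_norm_def by simp
qed

lemma INF_conf_funs:
  assumes J: "J0 \<le> J1" and f: "f \<in> L2_unit"
  shows "(INF g\<in>conf_funs \<phi> \<psi> J0 \<sigma> \<alpha> J1 (X J1) y. ereal (L2_norm (\<lambda>x. f x - g x)))
    = (INF m\<in>{m. (\<Sum>l\<in>{1..2 ^ Suc J1}. (m l - fitted J1 y l)\<^sup>2) \<le> radius J1 y}.
        ereal (sqrt (L2_inner f f - (\<Sum>l=1..2 ^ Suc J1. (L2_inner f (basis l))\<^sup>2)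
          + (\<Sum>l\<in>{1..2 ^ Suc J1}. (L2_inner f (basis l) - m l)\<^sup>2))))"
proof (rule antisym)
  show "(INF g\<in>conf_funs \<phi> \<psi> J0 \<sigma> \<alpha> J1 (X J1) y. ereal (L2_norm (\<lambda>x. f x - g x)))
    \<le> (INF m\<in>{m. (\<Sum>l\<in>{1..2 ^ Suc J1}. (m l - fitted J1 y l)\<^sup>2) \<le> radius J1 y}.
        ereal (sqrt (L2_inner f f - (\<Sum>l=1..2 ^ Suc J1. (L2_inner f (basis l))\<^sup>2)
          + (\<Sum>l\<in>{1..2 ^ Suc J1}. (L2_inner f (basis l) - m l)\<^sup>2))))"
  proof (rule INF_greatest)
    fix m assume "m \<in> {m. (\<Sum>l\<in>{1..2 ^ Suc J1}. (m l - fitted J1 y l)\<^sup>2) \<le> radius J1 y}"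
    then have "expansion \<phi> \<psi> J0 J1 m \<in> conf_funs \<phi> \<psi> J0 \<sigma> \<alpha> J1 (X J1) y"
      by (simp only: expansion_in_conf_funs conf_coeffs_eq)
    then show "(INF g\<in>conf_funs \<phi> \<psi> J0 \<sigma> \<alpha> J1 (X J1) y. ereal (L2_norm (\<lambda>x. f x - g x)))
      \<le> ereal (sqrt (L2_inner f f - (\<Sum>l=1..2 ^ Suc J1. (L2_inner f (basis l))\<^sup>2)
          + (\<Sum>l\<in>{1..2 ^ Suc J1}. (L2_inner f (basis l) - m l)\<^sup>2)))"
      by (intro INF_lower2[of "expansion \<phi> \<psi> J0 J1 m"])
        (simp_all only: L2_norm_expansion[OF J f expansion_L2 AE_I2[OF refl]] order_refl)
  qed
next
  show "(INF m\<in>{m. (\<Sum>l\<in>{1..2 ^ Suc J1}. (m l - fitted J1 y l)\<^sup>2) \<le> radius J1 y}.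
        ereal (sqrt (L2_inner f f - (\<Sum>l=1..2 ^ Suc J1. (L2_inner f (basis l))\<^sup>2)
          + (\<Sum>l\<in>{1..2 ^ Suc J1}. (L2_inner f (basis l) - m l)\<^sup>2))))
    \<le> (INF g\<in>conf_funs \<phi> \<psi> J0 \<sigma> \<alpha> J1 (X J1) y. ereal (L2_norm (\<lambda>x. f x - g x)))"
  proof (rule INF_greatest)
    fix g assume "g \<in> conf_funs \<phi> \<psi> J0 \<sigma> \<alpha> J1 (X J1) y"
    then obtain m where g: "g \<in> L2_unit" "AE x in unit_measure. g x = expansion \<phi> \<psi> J0 J1 m x"
      and m: "m \<in> conf_coeffs \<phi> \<psi> J0 \<sigma> \<alpha> J1 (X J1) y"
      by (auto simp: conf_funs_def)
    show "(INF m\<in>{m. (\<Sum>l\<in>{1..2 ^ Suc J1}. (m l - fitted J1 y l)\<^sup>2) \<le> radius J1 y}.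
        ereal (sqrt (L2_inner f f - (\<Sum>l=1..2 ^ Suc J1. (L2_inner f (basis l))\<^sup>2)
          + (\<Sum>l\<in>{1..2 ^ Suc J1}. (L2_inner f (basis l) - m l)\<^sup>2)))) \<le> ereal (L2_norm (\<lambda>x. f x - g x))"
      unfolding L2_norm_expansion[OF J f g] using m unfolding conf_coeffs_eq by (intro INF_lower)
  qed
qed

text \<open>The squared residual is O(2^(-2\<eta>r) / n), and the first factor eventually falls
  below \<delta>^2 / (2 c^2).\<close>

lemma residual_negligible:
  assumes "0 < \<eta>" "0 \<le> c" "0 < \<delta>"
  shows "\<exists>J. \<forall>J1\<ge>J. \<forall>f\<in>smooth_class \<eta> c. J0 \<le> J1 \<longrightarrow>
    L2_inner f f - (\<Sum>l=1..2 ^ Suc J1. (L2_inner f (basis l))\<^sup>2) \<le> (\<delta> / sqrt (real (sample_size J1)))\<^sup>2"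
proof -
  let ?q = "(2::real) powr - (2 * \<eta>)"
  have q: "0 < ?q" "?q < 1" using geometric_ratio[of "2 * \<eta>"] assms by auto
  have "(\<lambda>r. 2 * c\<^sup>2 * ?q ^ Suc r) \<longlonglongrightarrow> 2 * c\<^sup>2 * 0"
    by (intro tendsto_mult tendsto_const LIMSEQ_Suc[OF LIMSEQ_power_zero]) (use q in simp)
  then have "\<forall>\<^sub>F r in sequentially. 2 * c\<^sup>2 * ?q ^ Suc r < \<delta>\<^sup>2"
    by (rule order_tendstoD(2)) (use assms in simp)
  then obtain J where J: "\<And>r. r \<ge> J \<Longrightarrow> 2 * c\<^sup>2 * ?q ^ Suc r < \<delta>\<^sup>2" by (auto simp: eventually_sequentially)
  show ?thesis
  proof (intro exI[of _ J] allI impI ballI)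
    fix J1 f assume J1: "J \<le> J1" "J0 \<le> J1" and f: "f \<in> smooth_class \<eta> c"
    have "(2::real) powr - (1 + 2 * \<eta>) = ?q / 2"
      by (simp add: powr_diff powr_minus_divide)
    then have p: "(2 powr - (1 + 2 * \<eta>)) ^ Suc J1 = ?q ^ Suc J1 / 2 ^ Suc J1" by (simp only: power_divide)
    have "L2_inner f f - (\<Sum>l=1..2 ^ Suc J1. (L2_inner f (basis l))\<^sup>2) \<le> 2 * c\<^sup>2 * (2 powr - (1 + 2 * \<eta>)) ^ Suc J1"
      using J1(2) by (intro residual_tail f assms) auto
    also have "\<dots> = 2 * c\<^sup>2 * ?q ^ Suc J1 / 2 ^ Suc J1" unfolding p by simp
    also have "\<dots> \<le> \<delta>\<^sup>2 / 2 ^ Suc J1"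
      using J[OF J1(1)] by (intro divide_right_mono less_imp_le) auto
    also have "\<dots> = (\<delta> / sqrt (real (sample_size J1)))\<^sup>2"
      by (simp add: power_divide sample_size_def)
    finally show "L2_inner f f - (\<Sum>l=1..2 ^ Suc J1. (L2_inner f (basis l))\<^sup>2) \<le> (\<delta> / sqrt (real (sample_size J1)))\<^sup>2" .
  qed
qed

text \<open>If the coefficients of f lie in the confidence set, their expansion is an admissible g
  whose distance from f is the residual alone.\<close>

lemma enlarged_coverage:
  assumes J: "J0 \<le> J1" and \<delta>: "0 < \<delta>" and f: "f \<in> besov_union \<phi> \<psi> J0 \<eta> c" "f \<in> L2_unit"
    and res: "L2_inner f f - (\<Sum>l=1..2 ^ Suc J1. (L2_inner f (basis l))\<^sup>2) \<le> (\<delta> / sqrt (real (sample_size J1)))\<^sup>2"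
  shows "\<P>(\<epsilon> in noise J1. approx_coeff \<phi> \<psi> J0 J1 f \<in> conf_coeffs \<phi> \<psi> J0 \<sigma> \<alpha> J1 (X J1) (observations \<sigma> J1 f \<epsilon>))
    \<le> \<P>(\<epsilon> in noise J1. f \<in> enlarged_conf_funs \<phi> \<psi> J0 \<sigma> \<alpha> \<eta> c \<delta> J1 (X J1) (observations \<sigma> J1 f \<epsilon>))"
proof -
  define d where "d = \<delta> / sqrt (real (sample_size J1))"
  define e where "e = L2_inner f f - (\<Sum>l=1..2 ^ Suc J1. (L2_inner f (basis l))\<^sup>2)"
  have d: "0 \<le> d" using \<delta> by (simp add: d_def)
  have "0 \<le> L2_inner (\<lambda>x. f x - (\<Sum>l=1..2 ^ Suc J1. L2_inner f (basis l) * basis l x))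
      (\<lambda>x. f x - (\<Sum>l=1..2 ^ Suc J1. L2_inner f (basis l) * basis l x))"
    by (rule L2_inner_self_nonneg)
  also have "\<dots> = e" using residual_eq[of "Suc J1" f "\<lambda>l. L2_inner f (basis l)"] J f by (simp add: e_def)
  finally have e: "0 \<le> e" "e \<le> d\<^sup>2" using res by (auto simp: e_def d_def)
  \<comment> \<open>The infimum turns into an inequality between measurable functions of the data;
    monotonicity of the measure requires this event to be measurable.\<close>
  have iff: "f \<in> enlarged_conf_funs \<phi> \<psi> J0 \<sigma> \<alpha> \<eta> c \<delta> J1 (X J1) y \<longleftrightarrow> 0 \<le> radius J1 y \<and>
      L2_set (\<lambda>l. L2_inner f (basis l) - fitted J1 y l) {1..2 ^ Suc J1} \<le> sqrt (radius J1 y) + sqrt (d\<^sup>2 - e)" for y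
    unfolding enlarged_conf_funs_def mem_Collect_eq INF_conf_funs[OF J f(2)] d_def[symmetric] e_def[symmetric]
      INF_distance_ball[OF finite_atLeastAtMost d e]
    using f(1) by simp
  interpret prob_space "noise J1" unfolding noise_eq by (rule prob_space_gauss_product)
  show ?thesis
  proof (rule finite_measure_mono)
    show "{\<epsilon>\<in>space (noise J1). f \<in> enlarged_conf_funs \<phi> \<psi> J0 \<sigma> \<alpha> \<eta> c \<delta> J1 (X J1) (observations \<sigma> J1 f \<epsilon>)} \<in> sets (noise J1)"
      unfolding iff by (rule distance_event(2)[OF J])
    show "{\<epsilon>\<in>space (noise J1). approx_coeff \<phi> \<psi> J0 J1 f \<in> conf_coeffs \<phi> \<psi> J0 \<sigma> \<alpha> J1 (X J1) (observations \<sigma> J1 f \<epsilon>)}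
      \<subseteq> {\<epsilon>\<in>space (noise J1). f \<in> enlarged_conf_funs \<phi> \<psi> J0 \<sigma> \<alpha> \<eta> c \<delta> J1 (X J1) (observations \<sigma> J1 f \<epsilon>)}"
      unfolding iff approx_in_conf_coeffs[OF J f(2)]
    proof (intro subsetI CollectI conjI; elim CollectE conjE)
      fix \<epsilon>
      assume le: "(\<Sum>l\<in>{1..2 ^ Suc J1}. (L2_inner f (basis l) - fitted J1 (observations \<sigma> J1 f \<epsilon>) l)\<^sup>2)
        \<le> radius J1 (observations \<sigma> J1 f \<epsilon>)"
      show "0 \<le> radius J1 (observations \<sigma> J1 f \<epsilon>)" by (rule order_trans[OF _ le]) (simp add: sum_nonneg)
      have "L2_set (\<lambda>l. L2_inner f (basis l) - fitted J1 (observations \<sigma> J1 f \<epsilon>) l) {1..2 ^ Suc J1}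
          \<le> sqrt (radius J1 (observations \<sigma> J1 f \<epsilon>))"
        unfolding L2_set_def by (rule real_sqrt_le_mono[OF le])
      moreover have "0 \<le> sqrt (d\<^sup>2 - e)" using e by simp
      ultimately show "L2_set (\<lambda>l. L2_inner f (basis l) - fitted J1 (observations \<sigma> J1 f \<epsilon>) l) {1..2 ^ Suc J1}
          \<le> sqrt (radius J1 (observations \<sigma> J1 f \<epsilon>)) + sqrt (d\<^sup>2 - e)" by linarith
    qed
  qed
qed

lemma enlarged_liminf:
  assumes "0 < \<eta>" "0 < c" "0 < \<delta>"
  shows "liminf (\<lambda>J1. INF f\<in>besov_union \<phi> \<psi> J0 \<eta> c \<inter> left_continuous_versions.
      ereal (\<P>(\<epsilon> in noise J1. f \<in> enlarged_conf_funs \<phi> \<psi> J0 \<sigma> \<alpha> \<eta> c \<delta> J1 (X J1) (observations \<sigma> J1 f \<epsilon>))))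
    \<ge> ereal (1 - \<alpha>)"
proof (rule ereal_le_epsilon2)
  fix \<kappa> :: real assume \<kappa>: "0 < \<kappa>"
  obtain A where A: "\<And>J1. J1 \<ge> A \<Longrightarrow> J0 \<le> J1 \<and> (\<forall>f\<in>smooth_class \<eta> c \<inter> left_continuous_versions.
    \<bar>\<P>(\<epsilon> in noise J1. approx_coeff \<phi> \<psi> J0 J1 f \<in> conf_coeffs \<phi> \<psi> J0 \<sigma> \<alpha> J1 (X J1) (observations \<sigma> J1 f \<epsilon>)) - (1 - \<alpha>)\<bar> \<le> \<kappa>)"
    using coverage_coeffs[OF assms(1) less_imp_le[OF assms(2)] \<kappa>] by blast
  obtain B where B: "\<And>J1 f. J1 \<ge> B \<Longrightarrow> f \<in> smooth_class \<eta> c \<Longrightarrow> J0 \<le> J1 \<Longrightarrow>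
    L2_inner f f - (\<Sum>l=1..2 ^ Suc J1. (L2_inner f (basis l))\<^sup>2) \<le> (\<delta> / sqrt (real (sample_size J1)))\<^sup>2"
    using residual_negligible[OF assms(1) less_imp_le[OF assms(2)] assms(3)] by blast
  have "ereal (1 - \<alpha> - \<kappa>) \<le> liminf (\<lambda>J1. INF f\<in>besov_union \<phi> \<psi> J0 \<eta> c \<inter> left_continuous_versions.
      ereal (\<P>(\<epsilon> in noise J1. f \<in> enlarged_conf_funs \<phi> \<psi> J0 \<sigma> \<alpha> \<eta> c \<delta> J1 (X J1) (observations \<sigma> J1 f \<epsilon>))))"
  proof (rule Liminf_bounded, unfold eventually_sequentially, intro exI[of _ "max A B"] allI impI INF_greatest)
    fix J1 f assume J1: "max A B \<le> J1" and f: "f \<in> besov_union \<phi> \<psi> J0 \<eta> c \<inter> left_continuous_versions"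
    have J: "J0 \<le> J1" using A[of J1] J1 by simp
    have sm: "f \<in> smooth_class \<eta> c" using f assms(2) by (auto intro: besov_union_smooth)
    then have fL: "f \<in> L2_unit" by (simp add: smooth_class_def)
    have "\<bar>\<P>(\<epsilon> in noise J1. approx_coeff \<phi> \<psi> J0 J1 f \<in> conf_coeffs \<phi> \<psi> J0 \<sigma> \<alpha> J1 (X J1) (observations \<sigma> J1 f \<epsilon>)) - (1 - \<alpha>)\<bar> \<le> \<kappa>"
      using A[of J1] J1 sm f by simp
    moreover have "\<P>(\<epsilon> in noise J1. approx_coeff \<phi> \<psi> J0 J1 f \<in> conf_coeffs \<phi> \<psi> J0 \<sigma> \<alpha> J1 (X J1) (observations \<sigma> J1 f \<epsilon>))
      \<le> \<P>(\<epsilon> in noise J1. f \<in> enlarged_conf_funs \<phi> \<psi> J0 \<sigma> \<alpha> \<eta> c \<delta> J1 (X J1) (observations \<sigma> J1 f \<epsilon>))"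
      using f J1 by (intro enlarged_coverage J assms(3) fL B sm) auto
    ultimately show "ereal (1 - \<alpha> - \<kappa>)
      \<le> ereal (\<P>(\<epsilon> in noise J1. f \<in> enlarged_conf_funs \<phi> \<psi> J0 \<sigma> \<alpha> \<eta> c \<delta> J1 (X J1) (observations \<sigma> J1 f \<epsilon>)))"
      by simp
  qed
  from add_right_mono[OF this, of "ereal \<kappa>"]
  show "ereal (1 - \<alpha>) \<le> liminf (\<lambda>J1. INF f\<in>besov_union \<phi> \<psi> J0 \<eta> c \<inter> left_continuous_versions.
      ereal (\<P>(\<epsilon> in noise J1. f \<in> enlarged_conf_funs \<phi> \<psi> J0 \<sigma> \<alpha> \<eta> c \<delta> J1 (X J1) (observations \<sigma> J1 f \<epsilon>)))) + ereal \<kappa>"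
    by simp
qed

end

theorem theorem3p3:
  fixes \<phi> \<psi> :: "real \<Rightarrow> real" and J0 :: nat and \<sigma> \<alpha> :: real
    and X :: "nat \<Rightarrow> (nat \<Rightarrow> real) \<Rightarrow> modulator"
  assumes wavelets: "wavelet_system \<phi> \<psi> J0"
    and sigma: "\<sigma> > 0"
    and alpha: "0 < \<alpha>" "\<alpha> < 1"
    and X: "\<And>J1. J0 \<le> J1 \<Longrightarrow> monotone_estimator \<phi> \<psi> J0 \<sigma> J1 (X J1)"
  shows "(\<forall>p q s c. 1 \<le> p \<and> 1 \<le> q \<and> besov_gamma p s > 1/2 \<and> c > 0 \<longrightarrow>
            (\<lambda>J1. SUP f\<in>besov_ball \<phi> \<psi> J0 p q s c \<inter> left_continuous_versions.
               \<bar>\<P>(\<epsilon> in noise J1. approx_coeff \<phi> \<psi> J0 J1 f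
                    \<in> conf_coeffs \<phi> \<psi> J0 \<sigma> \<alpha> J1 (X J1) (observations \<sigma> J1 f \<epsilon>))
                - (1 - \<alpha>)\<bar>) \<longlonglongrightarrow> 0)
       \<and> (\<forall>p q s c. 1 \<le> p \<and> 1 \<le> q \<and> besov_gamma p s > 1/2 \<and> c > 0 \<longrightarrow>
            (\<lambda>J1. SUP f\<in>besov_ball \<phi> \<psi> J0 p q s c \<inter> left_continuous_versions.
               \<bar>\<P>(\<epsilon> in noise J1. expansion \<phi> \<psi> J0 J1 (approx_coeff \<phi> \<psi> J0 J1 f)
                    \<in> conf_funs \<phi> \<psi> J0 \<sigma> \<alpha> J1 (X J1) (observations \<sigma> J1 f \<epsilon>))
                - (1 - \<alpha>)\<bar>) \<longlonglongrightarrow> 0)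
       \<and> (\<forall>\<eta> c \<delta>. \<eta> > 0 \<and> c > 0 \<and> \<delta> > 0 \<longrightarrow>
            liminf (\<lambda>J1. INF f\<in>besov_union \<phi> \<psi> J0 \<eta> c \<inter> left_continuous_versions.
               ereal (\<P>(\<epsilon> in noise J1. f
                    \<in> enlarged_conf_funs \<phi> \<psi> J0 \<sigma> \<alpha> \<eta> c \<delta> J1 (X J1) (observations \<sigma> J1 f \<epsilon>))))
            \<ge> ereal (1 - \<alpha>))"
proof -
  interpret wavelet_regression \<phi> \<psi> J0 \<sigma> \<alpha> X
    using wavelets sigma alpha X by unfold_locales
  show ?thesis
    unfolding expansion_in_conf_funs
    by (intro conjI allI impI; elim conjE; intro besov_coverage enlarged_liminf)
qed

end
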